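(* Let $(\mathcal X,\mathcal E)$ be a $\mathbb Z^d$-periodic connected graph, $F$ an admissible cost function of superlinear growth (as in the context), and $\mathcal I\subset\mathbb R$ a bounded open interval. Let $\boldsymbol m^\varepsilon:\mathcal I\to\mathbb R_+^{\mathcal X_\varepsilon}$ be curves such that $$\sup_{\varepsilon>0}\mathcal A^{\mathcal I}_\varepsilon(\boldsymbol m^\varepsilon)<\infty\quad\text{and}\quad\sup_{\varepsilon>0}\boldsymbol m^\varepsilon(\mathcal I\times\mathcal X_\varepsilon)<\infty.$$ Then there exists a curve $(\mu_t)_{t\in\mathcal I}\in W^{1,1}_{\rm KR}(\mathcal I;\mathcal M_+(\mathbb T^d))$ such that, writing $\boldsymbol\mu(dx,dt)=\mu_t(dx)\,dt$ and up to extracting a subsequence ($\varepsilon\to0$), (i) $\iota_\varepsilon\boldsymbol m^\varepsilon\to\boldsymbol\mu$ weakly in $\mathcal M_+(\mathcal I\times\mathbb T^d)$; (ii) $\|\iota_\varepsilon m^\varepsilon_t-\mu_t\|_{\mathrm{KR}(\mathbb T^d)}\to0$ uniformly for $t\in\mathcal I$; (iii) $t\mapsto\mu_t(\mathbb T^d)$ is constant.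
   Context: **Graph.** $\mathcal X=\mathbb Z^d\times V$ with $V$ a finite nonempty set; for $x=(z,v)$ write $x_{\mathsf z}=z$. The edge set $\mathcal E\subseteq\mathcal X\times\mathcal X$ is symmetric and $\mathbb Z^d$-periodic (invariant under the shifts $(z,v)\mapsto(\bar z+z,v)$ applied to both endpoints); $(\mathcal X,\mathcal E)$ is connected, locally finite, of bounded degree; $x\sim y$ means $(x,y)\in\mathcal E$. $R_0=\max_{(x,y)\in\mathcal E}|x_{\mathsf z}-y_{\mathsf z}|_{\infty}$. $\mathcal E^Q=\{(x,y)\in\mathcal E:x_{\mathsf z}=0\}$. $\mathbb R_+=[0,\infty)$; $\mathbb R_a^{\mathcal E}$: antisymmetric functions $J:\mathcal E\to\mathbb R$; $\operatorname{div}J(x)=\sum_{y\sim x}J(x,y)$. **Admissible cost.** $F:\mathbb R_+^{\mathcal X}\times\mathbb R_a^{\mathcal E}\to\mathbb R\cup\{+\infty\}$ satisfies: (a) convex and lower semicontinuous; (b) local: there is $R_1<\infty$ such that $F(m,J)=F(m',J')$ whenever $m=m'$ on $\{|x_{\mathsf z}|_\infty\le R_1\}$ and $J=J'$ on $\{(x,y)\in\mathcal E:|x_{\mathsf z}|_\infty,|y_{\mathsf z}|_\infty\le R_1\}$; (c) there are $c>0$, $C<\infty$ with $F(m,J)\ge c\sum_{(x,y)\in\mathcal E^Q}|J(x,y)|-C\big(1+\sum_{|x_{\mathsf z}|_\infty\le R}m(x)\big)$, $R=\max\{R_0,R_1\}$; (d) there are a $\mathbb Z^d$-periodic $m^\circ\in\mathbb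 R_+^{\mathcal X}$ and a $\mathbb Z^d$-periodic divergence-free $J^\circ\in\mathbb R_a^{\mathcal E}$ with $(m^\circ,J^\circ)\in\mathsf D(F)^\circ$, where $\mathsf D(F)=\{F<\infty\}$ and the interior is taken in the finite-dimensional Euclidean space of the finitely many parameters on which $F$ depends. **Superlinear growth.** There are $\theta:[0,\infty)\to[0,\infty)$ with $\lim_{t\to\infty}\theta(t)/t=\infty$ and $C\in\mathbb R$ such that $F(m,J)\ge(m_0+1)\,\theta\big(\frac{J_0}{m_0+1}\big)-C(m_0+1)$ for all $(m,J)$, where $m_0=\sum_{|x_{\mathsf z}|_\infty\le R}m(x)$ and $J_0=\sum_{(x,y)\in\mathcal E^Q}|J(x,y)|$. **Rescaled graph and energies.** Throughout $\varepsilon>0$ with $1/\varepsilon\in\mathbb N$, $\varepsilon R_0<\frac12$. $\mathbb Z^d_\varepsilon=(\mathbb Z/\frac1\varepsilon\mathbb Z)^d$, $\mathbb T^d_\varepsilon=\varepsilon\mathbb Z^d_\varepsilon\subset\mathbb T^d=\mathbb R^d/\mathbb Z^d$, $\mathcal X_\varepsilon=\mathbb T^d_\varepsilon\times V$; $T^{\bar z}_\varepsilon(z,v)=([\varepsilon(\bar z+z)],v)$ for $(z,v)\in\mathcal X$, $\bar z\in\mathbb Z^d_\varepsilon$; $\mathcal E_\varepsilon=\{(T^0_\varepsilon x,T^0_\varepsilon y):(x,y)\in\mathcal E\}$; $x_{\mathsf z}=z$ for $x=([\varepsilon z],v)\in\mathcal X_\varepsilon$. $\tau^{\bar z}_\varepsilon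 m(x)=m(T^{\bar z}_\varepsilon x)$, $\tau^{\bar z}_\varepsilon J(x,y)=J(T^{\bar z}_\varepsilon x,T^{\bar z}_\varepsilon y)$, and $$\mathcal F_\varepsilon(m,J)=\sum_{z\in\mathbb Z^d_\varepsilon}\varepsilon^dF\Big(\frac{\tau^z_\varepsilon m}{\varepsilon^d},\frac{\tau^z_\varepsilon J}{\varepsilon^{d-1}}\Big),\quad(m,J)\in\mathbb R_+^{\mathcal X_\varepsilon}\times\mathbb R_a^{\mathcal E_\varepsilon}.$$ $(\boldsymbol m,\boldsymbol J)\in\mathcal{CE}^{\mathcal I}_\varepsilon$: $\boldsymbol m:\mathcal I\to\mathbb R_+^{\mathcal X_\varepsilon}$ continuous, $\boldsymbol J:\mathcal I\to\mathbb R_a^{\mathcal E_\varepsilon}$ Borel, $\partial_tm_t+\operatorname{div}J_t=0$ in the sense of distributions. For continuous $\boldsymbol m$ with $\boldsymbol m(\mathcal I\times\mathcal X_\varepsilon):=\int_{\mathcal I}\sum_{x}m_t(x)\,dt<\infty$ (all curves in the claim are of this type), $\mathcal A^{\mathcal I}_\varepsilon(\boldsymbol m)=\inf\{\int_{\mathcal I}\mathcal F_\varepsilon(m_t,J_t)\,dt:(\boldsymbol m,\boldsymbol J)\in\mathcal{CE}^{\mathcal I}_\varepsilon\}$, $\inf\emptyset=+\infty$. **Embedding.** $Q^z_\varepsilon=\varepsilon z+[0,\varepsilon)^d\subseteq\mathbb T^d$; $\iota_\varepsilon m=\varepsilon^{-d}\sum_{x\in\mathcal X_\varepsilon}m(x)\,\mathscr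 L^d|_{Q^{x_{\mathsf z}}_\varepsilon}$; $\iota_\varepsilon\boldsymbol m$ is the measure $(\iota_\varepsilon m_t)(dx)\,dt$. **Spaces.** $\mathcal M_+(A)$: finite nonnegative Radon measures on $A$; weak convergence is tested against $C_b(A)$. For a finite signed measure $\mu$ on $\mathbb T^d$, $\|\mu\|_{\mathrm{KR}(\mathbb T^d)}=\sup\{\int\psi\,d\mu:\psi\in C(\mathbb T^d),\|\psi\|_\infty\le1,\operatorname{Lip}(\psi)\le1\}$. $W^{1,1}_{\rm KR}(\mathcal I;\mathcal M_+(\mathbb T^d))$ is the set of curves $(\mu_t)_{t\in\mathcal I}$ in the Banach-space-valued Sobolev space $W^{1,1}(\mathcal I;(C^1(\mathbb T^d))^* )$ with $\mu_t\in\mathcal M_+(\mathbb T^d)$ for a.e. $t$ (identified with its continuous representative).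
   Formalization: The space W^{1,1}(I;(C^1(T^d))^* ) is taken in the weak* sense (weak* measurable curve and derivative with integrable dual norm), since with Bochner measurability the claim fails, e.g. for a limit Dirac mass moving at constant speed. *)

theory Defs
  imports "HOL-Analysis.Analysis"
begin

section \<open>The torus\<close>

definition torus_rel :: "real ^ 'd \<Rightarrow> real ^ 'd \<Rightarrow> bool" where
  "torus_rel x y \<longleftrightarrow> (\<forall>i. x $ i - y $ i \<in> \<int>)"

lemma equivp_torus_rel: "equivp (torus_rel :: real ^ 'd \<Rightarrow> real ^ 'd \<Rightarrow> bool)"
proof (rule equivpI)
  show "reflp (torus_rel :: real ^ 'd \<Rightarrow> real ^ 'd \<Rightarrow> bool)"
    by (auto simp: reflp_def torus_rel_def)
  show "symp (torus_rel :: real ^ 'd \<Rightarrow> real ^ 'd \<Rightarrow> bool)"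
    by (auto simp: symp_def torus_rel_def) (metis Ints_minus minus_diff_eq)
  show "transp (torus_rel :: real ^ 'd \<Rightarrow> real ^ 'd \<Rightarrow> bool)"
    unfolding transp_def torus_rel_def
    by (metis Ints_add diff_add_cancel add_diff_eq)
qed

quotient_type (overloaded) 'd torus = "real ^ 'd::finite" / "torus_rel :: real ^ 'd \<Rightarrow> real ^ 'd \<Rightarrow> bool"
  morphisms rep_torus proj
  by (rule equivp_torus_rel)

lemma proj_eq_iff: "proj x = proj y \<longleftrightarrow> torus_rel x y"
  using torus.abs_eq_iff by blast

lemma proj_rep [simp]: "proj (rep_torus p) = p"
  by (rule Quotient_abs_rep[OF Quotient_torus])

lemma proj_add_left:
  "proj x = proj y \<Longrightarrow> proj (x + h) = proj (y + h)"
  by (simp add: proj_eq_iff torus_rel_def)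

instantiation torus :: (finite) metric_space
begin

text \<open>The quotient (flat) metric: the Euclidean distance between the two fibres.\<close>

definition dist_torus :: "'a torus \<Rightarrow> 'a torus \<Rightarrow> real" where
  "dist_torus p q = Inf {dist x y | x y. proj x = p \<and> proj y = q}"

definition uniformity_torus :: "('a torus \<times> 'a torus) filter" where
  "uniformity_torus = (INF e\<in>{0 <..}. principal {(x, y). dist x y < e})"

definition open_torus :: "'a torus set \<Rightarrow> bool" where
  "open_torus S = (\<forall>x\<in>S. \<forall>\<^sub>F (x', y) in uniformity. x' = x \<longrightarrow> y \<in> S)"

lemma dist_torus_bdd: "bdd_below {dist x y | x y. proj x = p \<and> proj y = q}"
  by (rule bdd_belowI[of _ 0]) auto

lemma dist_torus_ne: "{dist x y | x y. proj x = p \<and> proj y = (q::'a torus)} \<noteq> {}"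
  by (auto intro: proj_rep)

lemma dist_torus_lower: "dist (proj x) (proj y) \<le> dist x y"
  unfolding dist_torus_def by (rule cInf_lower[OF _ dist_torus_bdd]) auto

lemma dist_torus_approx:
  assumes "dist p (q::'a torus) < e"
  obtains x y where "proj x = p" "proj y = q" "dist x y < e"
  using assms unfolding dist_torus_def
  by (subst (asm) cInf_less_iff[OF dist_torus_ne dist_torus_bdd]) auto

instance
proof
  fix p q r :: "'a torus"
  show "dist p q = 0 \<longleftrightarrow> p = q"
  proof
    assume "p = q"
    then have "dist p q \<le> 0"
      using dist_torus_lower[of "rep_torus p" "rep_torus p"] by simp
    moreover have "0 \<le> dist p q"
      unfolding dist_torus_def by (rule cInf_greatest[OF dist_torus_ne]) auto
    ultimately show "dist p q = 0" by simp
  next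
    assume d0: "dist p q = 0"
    show "p = q"
    proof (rule ccontr)
      assume "p \<noteq> q"
      define a where "a = rep_torus p"
      define b where "b = rep_torus q"
      have "\<not> torus_rel a b"
        using \<open>p \<noteq> q\<close> proj_eq_iff[of a b] by (simp add: a_def b_def)
      then obtain i where i: "a $ i - b $ i \<notin> \<int>"
        by (auto simp: torus_rel_def)
      define s where "s = a $ i - b $ i"
      define e where "e = min (frac s) (1 - frac s)"
      have "0 < e"
        using i frac_lt_1[of s] by (simp add: e_def s_def frac_gt_0_iff)
      then obtain x y where xy: "proj x = p" "proj y = q" "dist x y < e"
        using dist_torus_approx[of p q e] d0 by auto
      have "torus_rel x a" "torus_rel b y"
        using xy by (simp_all add: a_def b_def flip: proj_eq_iff)
      then have "(x $ i - a $ i) + (b $ i - y $ i) \<in> \<int>"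
        by (auto simp: torus_rel_def intro: Ints_add)
      then obtain k where k: "(x $ i - a $ i) + (b $ i - y $ i) = of_int k"
        by (auto elim: Ints_cases)
      have "\<bar>(x - y) $ i\<bar> < e"
        using component_le_norm_cart[of "x - y" i] xy(3) by (simp add: dist_norm)
      then have "\<bar>s + of_int k\<bar> < e"
        using k by (simp add: s_def algebra_simps)
      then have "\<bar>frac s + of_int (\<lfloor>s\<rfloor> + k)\<bar> < e"
        by (simp add: frac_def algebra_simps)
      moreover have "e \<le> \<bar>frac s + of_int m\<bar>" for m :: int
      proof (cases "m \<ge> 0")
        case True
        then have "real_of_int m \<ge> 0" by simp
        then show ?thesis using frac_ge_0[of s] by (auto simp: e_def)
      next
        case False
        then have "real_of_int m \<le> - 1" by linarith
        then show ?thesis using frac_lt_1[of s] by (auto simp: e_def)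
      qed
      ultimately show False by (meson not_less)
    qed
  qed
  show "dist p q \<le> dist p r + dist q r"
  proof (rule field_le_epsilon)
    fix e :: real assume "0 < e"
    obtain x z where xz: "proj x = p" "proj z = r" "dist x z < dist p r + e / 2"
      using dist_torus_approx[of p r "dist p r + e / 2"] \<open>0 < e\<close> by auto
    obtain y w where yw: "proj y = q" "proj w = r" "dist y w < dist q r + e / 2"
      using dist_torus_approx[of q r "dist q r + e / 2"] \<open>0 < e\<close> by auto
    have "proj (y + (z - w)) = q"
      using xz(2) yw(1,2) proj_eq_iff[of z w] proj_eq_iff[of "y + (z - w)" y]
      by (simp add: torus_rel_def)
    then have "dist p q \<le> dist x (y + (z - w))"
      using dist_torus_lower[of x "y + (z - w)"] xz(1) by simp
    also have "\<dots> \<le> dist x z + dist z (y + (z - w))"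
      by (rule dist_triangle)
    also have "dist z (y + (z - w)) = dist y w"
      by (simp add: dist_norm norm_minus_commute)
    finally show "dist p q \<le> dist p r + dist q r + e"
      using xz(3) yw(3) by simp
  qed
qed (simp_all add: uniformity_torus_def open_torus_def)

end

lemma continuous_on_proj: "continuous_on A proj"
  unfolding continuous_on_iff using dist_torus_lower le_less_trans by blast

text \<open>Lebesgue (Haar) measure of the torus, pushed forward from the unit cube.\<close>

definition torus_lebesgue :: "'d::finite torus measure" where
  "torus_lebesgue = distr (restrict_space lborel {y :: real ^ 'd. \<forall>i. 0 \<le> y $ i \<and> y $ i < 1}) borel proj"


section \<open>The Banach space of continuously differentiable functions on the torus\<close>

definition gradient :: "(real ^ 'd \<Rightarrow> real) \<Rightarrow> real ^ 'd \<Rightarrow> real ^ 'd::finite" where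
  "gradient f x = (\<chi> i. frechet_derivative f (at x) (axis i 1))"

definition C1_functions :: "('d::finite torus \<Rightarrow> real) set" where
  "C1_functions = {\<psi>. (\<forall>x. (\<lambda>x. \<psi> (proj x)) differentiable at x) \<and>
     continuous_on UNIV (gradient (\<lambda>x. \<psi> (proj x)))}"

lemma gradient_add:
  assumes "f differentiable at x" "g differentiable at x"
  shows "gradient (\<lambda>y. f y + g y) x = gradient f x + gradient g x"
proof -
  have "frechet_derivative (\<lambda>y. f y + g y) (at x) =
      (\<lambda>h. frechet_derivative f (at x) h + frechet_derivative g (at x) h)"
    using assms by (intro frechet_derivative_at[symmetric] has_derivative_add)
      (simp_all flip: frechet_derivative_works)
  then show ?thesis by (simp add: gradient_def vec_eq_iff)
qed

lemma gradient_cmul: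
  assumes "f differentiable at x"
  shows "gradient (\<lambda>y. c * f y) x = c *\<^sub>R gradient f x"
proof -
  have "frechet_derivative (\<lambda>y. c * f y) (at x) = (\<lambda>h. c * frechet_derivative f (at x) h)"
    using assms by (intro frechet_derivative_at[symmetric] has_derivative_mult_right)
      (simp flip: frechet_derivative_works)
  then show ?thesis by (simp add: gradient_def vec_eq_iff)
qed

lemma gradient_const: "gradient (\<lambda>y. c) x = 0"
  by (simp add: gradient_def vec_eq_iff frechet_derivative_const)

lemma C1_functions_cmul: "\<psi> \<in> C1_functions \<Longrightarrow> (\<lambda>p. c * \<psi> p) \<in> C1_functions"
proof -
  assume *: "\<psi> \<in> C1_functions"
  then have "gradient (\<lambda>x. c * \<psi> (proj x)) = (\<lambda>x. c *\<^sub>R gradient (\<lambda>x. \<psi> (proj x)) x)"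
    by (intro ext gradient_cmul) (simp add: C1_functions_def)
  with * show ?thesis
    by (auto simp: C1_functions_def intro!: continuous_intros derivative_intros)
qed

lemma C1_functions_add:
  "\<psi> \<in> C1_functions \<Longrightarrow> \<eta> \<in> C1_functions \<Longrightarrow> (\<lambda>p. \<psi> p + \<eta> p) \<in> C1_functions"
proof -
  assume *: "\<psi> \<in> C1_functions" "\<eta> \<in> C1_functions"
  then have "gradient (\<lambda>x. \<psi> (proj x) + \<eta> (proj x)) =
      (\<lambda>x. gradient (\<lambda>x. \<psi> (proj x)) x + gradient (\<lambda>x. \<eta> (proj x)) x)"
    by (intro ext gradient_add) (simp_all add: C1_functions_def)
  with * show ?thesis
    by (auto simp: C1_functions_def intro!: continuous_intros derivative_intros)
qed

lemma C1_functions_const: "(\<lambda>p :: 'd::finite torus. c) \<in> C1_functions"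
proof -
  have "gradient (\<lambda>x :: real ^ 'd. c) = (\<lambda>x. 0)" by (intro ext gradient_const)
  then show ?thesis by (simp add: C1_functions_def)
qed

typedef (overloaded) 'd C1 = "C1_functions :: ('d::finite torus \<Rightarrow> real) set"
  morphisms apply_C1 Abs_C1
  using C1_functions_const by blast

setup_lifting type_definition_C1

lemma C1_eqI: "(\<And>p. apply_C1 f p = apply_C1 g p) \<Longrightarrow> f = g"
  by transfer auto

lemma C1_differentiable: "(\<lambda>x. apply_C1 f (proj x)) differentiable at x"
  using apply_C1[of f] by (simp add: C1_functions_def)

lemma C1_continuous_gradient: "continuous_on UNIV (gradient (\<lambda>x. apply_C1 f (proj x)))"
  using apply_C1[of f] by (simp add: C1_functions_def)

lemma proj_cube:
  fixes x :: "real ^ 'd::finite"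
  obtains y where "proj y = proj x" "y \<in> cbox 0 1"
proof
  let ?y = "(\<chi> i. frac (x $ i)) :: real ^ 'd"
  show "proj ?y = proj x"
    by (simp add: proj_eq_iff torus_rel_def frac_def)
  show "?y \<in> cbox 0 1"
    by (simp add: mem_box_cart frac_lt_1 less_imp_le)
qed

lemma gradient_periodic:
  assumes "proj x = proj y" "(\<lambda>x. \<psi> (proj x)) differentiable at y"
  shows "gradient (\<lambda>x. \<psi> (proj x)) x = gradient (\<lambda>x. \<psi> (proj x)) y"
proof -
  let ?f = "\<lambda>x. \<psi> (proj x)"
  have D: "(?f has_derivative frechet_derivative ?f (at y)) (at (x + (y - x)))"
    using assms(2) by (simp flip: frechet_derivative_works)
  have "((\<lambda>u. u + (y - x)) has_derivative (\<lambda>h. h)) (at x)"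
    by (auto intro!: derivative_eq_intros)
  from has_derivative_compose[OF this D]
  have "((\<lambda>u. ?f (u + (y - x))) has_derivative frechet_derivative ?f (at y)) (at x)" .
  moreover have "proj (u + (y - x)) = proj u" for u
  proof -
    have "torus_rel y x" using assms(1) proj_eq_iff by metis
    then show ?thesis by (simp add: proj_eq_iff torus_rel_def)
  qed
  ultimately have "(?f has_derivative frechet_derivative ?f (at y)) (at x)"
    by simp
  then have "frechet_derivative ?f (at y) = frechet_derivative ?f (at x)"
    by (rule frechet_derivative_at)
  then show ?thesis by (simp add: gradient_def)
qed

lemma C1_bounded: "bounded (range (apply_C1 (f :: 'd::finite C1)))"
proof -
  let ?g = "\<lambda>x :: real ^ 'd. apply_C1 f (proj x)"
  have "continuous_on (cbox 0 1) ?g"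
    by (intro continuous_at_imp_continuous_on ballI differentiable_imp_continuous_within
        C1_differentiable)
  then have "bounded (?g ` cbox 0 1)"
    by (intro compact_imp_bounded compact_continuous_image compact_cbox)
  moreover have "apply_C1 f p \<in> ?g ` cbox 0 1" for p
  proof -
    obtain y where "proj y = proj (rep_torus p)" "y \<in> cbox 0 1" by (rule proj_cube)
    then show ?thesis by (auto intro!: image_eqI[of _ _ y])
  qed
  then have "range (apply_C1 f) \<subseteq> ?g ` cbox 0 1" by blast
  ultimately show ?thesis by (rule bounded_subset)
qed

lemma C1_gradient_bounded: "bounded (range (gradient (\<lambda>x. apply_C1 (f :: 'd::finite C1) (proj x))))"
proof -
  let ?G = "gradient (\<lambda>x. apply_C1 f (proj x))"
  have "bounded (?G ` cbox 0 1)"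
    by (intro compact_imp_bounded compact_continuous_image compact_cbox
        continuous_on_subset[OF C1_continuous_gradient]) simp
  moreover have "?G x \<in> ?G ` cbox 0 1" for x
  proof -
    obtain y where y: "proj y = proj x" "y \<in> cbox 0 1" by (rule proj_cube)
    have "?G y = ?G x"
      by (rule gradient_periodic[OF y(1) C1_differentiable])
    then show ?thesis using y(2) by (metis image_eqI)
  qed
  then have "range ?G \<subseteq> ?G ` cbox 0 1" by blast
  ultimately show ?thesis by (rule bounded_subset)
qed

instantiation C1 :: (finite) real_normed_vector
begin

lift_definition zero_C1 :: "'a C1" is "\<lambda>p. 0"
  by (rule C1_functions_const)

lift_definition plus_C1 :: "'a C1 \<Rightarrow> 'a C1 \<Rightarrow> 'a C1" is "\<lambda>f g p. f p + g p"
  by (rule C1_functions_add)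

lift_definition scaleR_C1 :: "real \<Rightarrow> 'a C1 \<Rightarrow> 'a C1" is "\<lambda>c f p. c * f p"
  by (rule C1_functions_cmul)

lift_definition uminus_C1 :: "'a C1 \<Rightarrow> 'a C1" is "\<lambda>f p. - f p"
  using C1_functions_cmul[of _ "- 1"] by simp

lift_definition minus_C1 :: "'a C1 \<Rightarrow> 'a C1 \<Rightarrow> 'a C1" is "\<lambda>f g p. f p - g p"
  using C1_functions_add C1_functions_cmul[of _ "- 1"] by force

definition norm_C1 :: "'a C1 \<Rightarrow> real" where
  "norm_C1 f = (SUP p. \<bar>apply_C1 f p\<bar>) + (SUP x. norm (gradient (\<lambda>x. apply_C1 f (proj x)) x))"

definition dist_C1 :: "'a C1 \<Rightarrow> 'a C1 \<Rightarrow> real" where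
  "dist_C1 f g = norm (f - g)"

definition sgn_C1 :: "'a C1 \<Rightarrow> 'a C1" where
  "sgn_C1 f = inverse (norm f) *\<^sub>R f"

definition uniformity_C1 :: "('a C1 \<times> 'a C1) filter" where
  "uniformity_C1 = (INF e\<in>{0 <..}. principal {(x, y). dist x y < e})"

definition open_C1 :: "'a C1 set \<Rightarrow> bool" where
  "open_C1 S = (\<forall>x\<in>S. \<forall>\<^sub>F (x', y) in uniformity. x' = x \<longrightarrow> y \<in> S)"

lemma C1_abs_bdd: "bdd_above (range (\<lambda>p. \<bar>apply_C1 f p\<bar>))"
  using C1_bounded[of f] by (auto simp: bounded_iff bdd_above_def)

lemma C1_grad_bdd: "bdd_above (range (\<lambda>x. norm (gradient (\<lambda>x. apply_C1 f (proj x)) x)))"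
  using C1_gradient_bounded[of f] by (auto simp: bounded_iff bdd_above_def)

lemma C1_abs_le: "\<bar>apply_C1 f p\<bar> \<le> (SUP p. \<bar>apply_C1 f p\<bar>)"
  by (rule cSUP_upper[OF _ C1_abs_bdd]) simp

lemma C1_grad_le:
  "norm (gradient (\<lambda>x. apply_C1 f (proj x)) x) \<le> (SUP x. norm (gradient (\<lambda>x. apply_C1 f (proj x)) x))"
  by (rule cSUP_upper[OF _ C1_grad_bdd]) simp

lemma abs_apply_C1_le_norm: "\<bar>apply_C1 f p\<bar> \<le> norm f"
  using C1_abs_le[of f p] C1_grad_le[of f 0] norm_ge_zero[of "gradient (\<lambda>x. apply_C1 f (proj x)) 0"]
  unfolding norm_C1_def by linarith

instance
proof
  fix a b c :: "'a C1" and s t :: real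
  show "a + b + c = a + (b + c)" by transfer (simp add: add.assoc)
  show "a + b = b + a" by transfer (simp add: add.commute)
  show "0 + a = a" by transfer simp
  show "- a + a = 0" by transfer simp
  show "a - b = a + - b" by transfer simp
  show "s *\<^sub>R (a + b) = s *\<^sub>R a + s *\<^sub>R b" by transfer (simp add: algebra_simps)
  show "(s + t) *\<^sub>R a = s *\<^sub>R a + t *\<^sub>R a" by transfer (simp add: algebra_simps)
  show "s *\<^sub>R t *\<^sub>R a = (s * t) *\<^sub>R a" by transfer (simp add: algebra_simps)
  show "1 *\<^sub>R a = a" by transfer simp
  show "dist a b = norm (a - b)" by (rule dist_C1_def)
  show "sgn a = inverse (norm a) *\<^sub>R a" by (rule sgn_C1_def)
  show "uniformity = (INF e\<in>{0 <..}. principal {(x, y). dist x (y::'a C1) < e})"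
    by (rule uniformity_C1_def)
  show "open U = (\<forall>x\<in>U. \<forall>\<^sub>F (x', y) in uniformity. x' = x \<longrightarrow> y \<in> U)" for U :: "'a C1 set"
    by (rule open_C1_def)
  show "(norm a = 0) = (a = 0)"
  proof
    assume "norm a = 0"
    then have "apply_C1 a p = 0" for p using abs_apply_C1_le_norm[of a p] by simp
    then show "a = 0" by (intro C1_eqI) (simp add: zero_C1.rep_eq)
  next
    assume "a = 0"
    moreover have "gradient (\<lambda>x. apply_C1 0 (proj x)) x = (0 :: real ^ 'a)" for x
      using gradient_const[of 0 x] by (simp add: zero_C1.rep_eq comp_def)
    ultimately show "norm a = 0" by (simp add: norm_C1_def zero_C1.rep_eq)
  qed
  show "norm (a + b) \<le> norm a + norm b"
  proof -
    have "(SUP p. \<bar>apply_C1 (a + b) p\<bar>) \<le> (SUP p. \<bar>apply_C1 a p\<bar>) + (SUP p. \<bar>apply_C1 b p\<bar>)"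
      by (rule cSUP_least, simp)
        (simp add: plus_C1.rep_eq abs_triangle_ineq[THEN order_trans] add_mono C1_abs_le)
    moreover have "gradient (\<lambda>x. apply_C1 (a + b) (proj x)) x =
        gradient (\<lambda>x. apply_C1 a (proj x)) x + gradient (\<lambda>x. apply_C1 b (proj x)) x" for x
      using gradient_add[OF C1_differentiable[of a x] C1_differentiable[of b x]]
      by (simp add: plus_C1.rep_eq comp_def)
    then have "(SUP x. norm (gradient (\<lambda>x. apply_C1 (a + b) (proj x)) x)) \<le>
        (SUP x. norm (gradient (\<lambda>x. apply_C1 a (proj x)) x)) + (SUP x. norm (gradient (\<lambda>x. apply_C1 b (proj x)) x))"
      by (intro cSUP_least)
        (simp_all add: norm_triangle_ineq[THEN order_trans] add_mono C1_grad_le)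
    ultimately show ?thesis unfolding norm_C1_def by linarith
  qed
  show "norm (s *\<^sub>R a) = \<bar>s\<bar> * norm a"
  proof -
    have sup: "(SUP p. \<bar>s\<bar> * h p) = \<bar>s\<bar> * (SUP p. h p)" if "bdd_above (range h)"
      for h :: "'z \<Rightarrow> real"
    proof -
      have "mono (\<lambda>r. \<bar>s\<bar> * r)" by (simp add: mono_def mult_left_mono)
      moreover have "continuous (at_left (Sup (range h))) (\<lambda>r. \<bar>s\<bar> * r)"
        by (intro continuous_intros)
      ultimately have "\<bar>s\<bar> * Sup (range h) = (SUP r\<in>range h. \<bar>s\<bar> * r)"
        using that by (intro continuous_at_Sup_mono) auto
      then show ?thesis by (simp add: image_comp comp_def)
    qed
    have "gradient (\<lambda>x. apply_C1 (s *\<^sub>R a) (proj x)) x = s *\<^sub>R gradient (\<lambda>x. apply_C1 a (proj x)) x" for x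
      using gradient_cmul[OF C1_differentiable[of a x], of s]
      by (simp add: scaleR_C1.rep_eq comp_def)
    then show ?thesis
      unfolding norm_C1_def
      by (simp add: scaleR_C1.rep_eq abs_mult sup[OF C1_abs_bdd] sup[OF C1_grad_bdd] distrib_left)
  qed
qed

end


section \<open>Curves of measures\<close>

text \<open>\<open>finite_measures S\<close> is \<open>M\<^sub>+(S)\<close>. On the Polish spaces used below every finite Borel
  measure is Radon.\<close>

definition finite_measures :: "'a::topological_space set \<Rightarrow> 'a measure set" where
  "finite_measures S = {M. sets M = sets (restrict_space borel S) \<and> finite_measure M}"

definition weakly_converges_on ::
    "'a::topological_space set \<Rightarrow> (nat \<Rightarrow> 'a measure) \<Rightarrow> 'a measure \<Rightarrow> bool" where
  "weakly_converges_on S M L \<longleftrightarrow> (\<forall>n. M n \<in> finite_measures S) \<and> L \<in> finite_measures S \<and>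
     (\<forall>f :: 'a \<Rightarrow> real. continuous_on S f \<and> bounded (f ` S) \<longrightarrow>
        (\<lambda>n. \<integral>x. f x \<partial>M n) \<longlonglongrightarrow> (\<integral>x. f x \<partial>L))"

text \<open>The measure \<open>\<mu>\<^sub>t(dx) dt\<close> on \<open>I \<times> X\<close>. The lemma after it shows that the formula really gives
  the value on measurable sets whenever \<open>t \<mapsto> \<mu>\<^sub>t\<close> is a measurable kernel.\<close>

definition spacetime_measure ::
    "real set \<Rightarrow> (real \<Rightarrow> 'a::topological_space measure) \<Rightarrow> (real \<times> 'a) measure" where
  "spacetime_measure I \<mu> = measure_of (I \<times> UNIV) (sets (restrict_space borel (I \<times> UNIV)))
     (\<lambda>A. \<integral>\<^sup>+t. emeasure (\<mu> t) {x. (t, x) \<in> A} \<partial>restrict_space lborel I)"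

lemma sets_spacetime_measure [simp]:
  "sets (spacetime_measure I \<mu>) = sets (restrict_space borel (I \<times> UNIV))"
  unfolding spacetime_measure_def
  by (metis (no_types, lifting) sets.sigma_sets_eq sets.space_closed sets_measure_of
      space_borel space_restrict_space inf_top_right)

lemma emeasure_spacetime_measure:
  fixes \<mu> :: "real \<Rightarrow> 'a::topological_space measure"
  assumes A: "A \<in> sets (restrict_space borel (I \<times> UNIV))"
    and sets: "\<And>t. t \<in> I \<Longrightarrow> sets (\<mu> t) = sets borel"
    and meas: "\<And>B. B \<in> sets (restrict_space borel (I \<times> UNIV)) \<Longrightarrow>
      (\<lambda>t. emeasure (\<mu> t) {x. (t, x) \<in> B}) \<in> borel_measurable (restrict_space lborel I)"
  shows "emeasure (spacetime_measure I \<mu>) A =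
    (\<integral>\<^sup>+t. emeasure (\<mu> t) {x. (t, x) \<in> A} \<partial>restrict_space lborel I)"
proof (rule emeasure_measure_of[OF spacetime_measure_def])
  show "sets (restrict_space borel (I \<times> UNIV)) \<subseteq> Pow (I \<times> (UNIV :: 'a set))"
    by (auto simp: sets_restrict_space)
  show "A \<in> sets (spacetime_measure I \<mu>)" using A by simp
  have slice: "{x. (t, x) \<in> B} \<in> sets (\<mu> t)"
    if B: "B \<in> sets (restrict_space borel (I \<times> UNIV))" and t: "t \<in> I" for B t
  proof -
    obtain B' where B': "B' \<in> sets borel" "B = (I \<times> UNIV) \<inter> B'"
      using B by (auto simp: sets_restrict_space)
    have "(\<lambda>x :: 'a. (t, x)) \<in> borel_measurable borel"
      by (intro borel_measurable_continuous_onI continuous_intros)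
    from measurable_sets[OF this B'(1)] have "{x. (t, x) \<in> B'} \<in> sets borel"
      by (simp add: vimage_def)
    with B'(2) t sets show ?thesis by simp
  qed
  show "positive (sets (spacetime_measure I \<mu>))
      (\<lambda>A. \<integral>\<^sup>+t. emeasure (\<mu> t) {x. (t, x) \<in> A} \<partial>restrict_space lborel I)"
    by (simp add: positive_def)
  show "countably_additive (sets (spacetime_measure I \<mu>))
      (\<lambda>A. \<integral>\<^sup>+t. emeasure (\<mu> t) {x. (t, x) \<in> A} \<partial>restrict_space lborel I)"
  proof (rule countably_additiveI)
    fix B :: "nat \<Rightarrow> (real \<times> 'a) set"
    assume B: "range B \<subseteq> sets (spacetime_measure I \<mu>)" "disjoint_family B"
    have "(\<Sum>i. \<integral>\<^sup>+t. emeasure (\<mu> t) {x. (t, x) \<in> B i} \<partial>restrict_space lborel I) =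
        (\<integral>\<^sup>+t. (\<Sum>i. emeasure (\<mu> t) {x. (t, x) \<in> B i}) \<partial>restrict_space lborel I)"
      using B(1) by (intro nn_integral_suminf[symmetric] meas) auto
    also have "\<dots> = (\<integral>\<^sup>+t. emeasure (\<mu> t) {x. (t, x) \<in> (\<Union>i. B i)} \<partial>restrict_space lborel I)"
    proof (rule nn_integral_cong)
      fix t assume "t \<in> space (restrict_space lborel I)"
      then have t: "t \<in> I" by (simp add: space_restrict_space)
      have "(\<Sum>i. emeasure (\<mu> t) {x. (t, x) \<in> B i}) = emeasure (\<mu> t) (\<Union>i. {x. (t, x) \<in> B i})"
        using B slice[OF _ t] by (intro suminf_emeasure) (auto simp: disjoint_family_on_def)
      also have "(\<Union>i. {x. (t, x) \<in> B i}) = {x. (t, x) \<in> (\<Union>i. B i)}" by auto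
      finally show "(\<Sum>i. emeasure (\<mu> t) {x. (t, x) \<in> B i}) =
        emeasure (\<mu> t) {x. (t, x) \<in> (\<Union>i. B i)}" .
    qed
    finally show "(\<Sum>i. \<integral>\<^sup>+t. emeasure (\<mu> t) {x. (t, x) \<in> B i} \<partial>restrict_space lborel I) =
      (\<integral>\<^sup>+t. emeasure (\<mu> t) {x. (t, x) \<in> (\<Union>i. B i)} \<partial>restrict_space lborel I)" .
  qed
qed

text \<open>The norm \<open>\<parallel>\<mu> - \<nu>\<parallel>\<close> in \<open>KR(T\<^sup>d)\<close>, for finite nonnegative \<open>\<mu>\<close> and \<open>\<nu>\<close>.\<close>

definition KR_dist :: "'d::finite torus measure \<Rightarrow> 'd torus measure \<Rightarrow> real" where
  "KR_dist \<mu> \<nu> = (SUP \<psi>\<in>{\<psi> :: 'd torus \<Rightarrow> real. continuous_on UNIV \<psi> \<and>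
     (\<forall>p. \<bar>\<psi> p\<bar> \<le> 1) \<and> 1-lipschitz_on UNIV \<psi>}. (\<integral>p. \<psi> p \<partial>\<mu>) - (\<integral>p. \<psi> p \<partial>\<nu>))"

definition test_functions :: "real set \<Rightarrow> (real \<Rightarrow> real) set" where
  "test_functions I = {\<phi>. (\<forall>n t. (deriv ^^ n) \<phi> differentiable at t) \<and>
     (\<exists>K. compact K \<and> K \<subseteq> I \<and> (\<forall>t. t \<notin> K \<longrightarrow> \<phi> t = 0))}"

definition locally_integrable :: "real set \<Rightarrow> (real \<Rightarrow> real) \<Rightarrow> bool" where
  "locally_integrable I f \<longleftrightarrow> (\<forall>K. compact K \<and> K \<subseteq> I \<longrightarrow> set_integrable lborel K f)"

text \<open>\<open>f' = g\<close> on \<open>I\<close> in the sense of distributions.\<close>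

definition weak_derivative :: "real set \<Rightarrow> (real \<Rightarrow> real) \<Rightarrow> (real \<Rightarrow> real) \<Rightarrow> bool" where
  "weak_derivative I f g \<longleftrightarrow> locally_integrable I f \<and> locally_integrable I g \<and>
     (\<forall>\<phi>\<in>test_functions I.
        (LINT t:I|lborel. deriv \<phi> t * f t) = - (LINT t:I|lborel. \<phi> t * g t))"

text \<open>\<open>L\<^sup>1\<close> and \<open>W\<^sup>1\<^sup>,\<^sup>1\<close> of an interval with values in the dual of a separable normed space,
  with measurability and integrals understood in the weak* sense. (For the nonseparable dual
  of \<open>C\<^sup>1\<close> of the torus, strong Bochner measurability of the derivative would exclude even a
  point mass moving at constant speed.)\<close>

definition dual_L1 :: "real set \<Rightarrow> (real \<Rightarrow> 'a::real_normed_vector \<Rightarrow>\<^sub>L real) \<Rightarrow> bool" where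
  "dual_L1 I u \<longleftrightarrow>
     (\<forall>\<psi>. (\<lambda>t. blinfun_apply (u t) \<psi>) \<in> borel_measurable (restrict_space lborel I)) \<and>
     (\<integral>\<^sup>+t. ennreal (norm (u t)) \<partial>restrict_space lborel I) < \<infinity>"

definition dual_W11 :: "real set \<Rightarrow> (real \<Rightarrow> 'a::real_normed_vector \<Rightarrow>\<^sub>L real) \<Rightarrow> bool" where
  "dual_W11 I u \<longleftrightarrow> dual_L1 I u \<and> (\<exists>g. dual_L1 I g \<and>
     (\<forall>\<psi>. weak_derivative I (\<lambda>t. blinfun_apply (u t) \<psi>) (\<lambda>t. blinfun_apply (g t) \<psi>)))"

definition measure_functional :: "'d::finite torus measure \<Rightarrow> 'd C1 \<Rightarrow>\<^sub>L real" where
  "measure_functional \<mu> = Blinfun (\<lambda>\<psi>. \<integral>p. apply_C1 \<psi> p \<partial>\<mu>)"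

text \<open>The continuous representative of such a curve lies in \<open>M\<^sub>+\<close> at every time, since \<open>M\<^sub>+\<close>-balls
  are closed in the dual of \<open>C\<^sup>1\<close>.\<close>

definition W11_KR :: "real set \<Rightarrow> (real \<Rightarrow> 'd::finite torus measure) set" where
  "W11_KR I = {\<mu>. (\<forall>t\<in>I. \<mu> t \<in> finite_measures UNIV) \<and>
     continuous_on I (\<lambda>t. measure_functional (\<mu> t)) \<and>
     dual_W11 I (\<lambda>t. measure_functional (\<mu> t))}"


section \<open>Periodic graphs and cost functions\<close>

type_synonym ('d, 'v) vertex = "(int ^ 'd) \<times> 'v"

definition sup_norm :: "int ^ 'd::finite \<Rightarrow> int" where
  "sup_norm z = (MAX i. \<bar>z $ i\<bar>)"

definition shift :: "int ^ 'd::finite \<Rightarrow> ('d, 'v) vertex \<Rightarrow> ('d, 'v) vertex" where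
  "shift z x = (z + fst x, snd x)"

definition periodic_graph :: "(('d::finite, 'v::finite) vertex \<times> ('d, 'v) vertex) set \<Rightarrow> bool" where
  "periodic_graph E \<longleftrightarrow> sym E \<and>
     (\<forall>z x y. (x, y) \<in> E \<longrightarrow> (shift z x, shift z y) \<in> E) \<and>
     (\<forall>x y. (x, y) \<in> E\<^sup>*) \<and>
     (\<forall>x. finite {y. (x, y) \<in> E}) \<and> (\<exists>D. \<forall>x. card {y. (x, y) \<in> E} \<le> D)"

definition R0 :: "(('d::finite, 'v) vertex \<times> ('d, 'v) vertex) set \<Rightarrow> int" where
  "R0 E = Max ((\<lambda>(x, y). sup_norm (fst x - fst y)) ` E)"

definition EQ :: "(('d::finite, 'v) vertex \<times> ('d, 'v) vertex) set \<Rightarrow> (('d, 'v) vertex \<times> ('d, 'v) vertex) set" where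
  "EQ E = {(x, y) \<in> E. fst x = 0}"

text \<open>Antisymmetric functions on \<open>E\<close>, represented by their extension by zero.\<close>

definition flows :: "('a \<times> 'a) set \<Rightarrow> ('a \<times> 'a \<Rightarrow> real) set" where
  "flows E = {J. (\<forall>x y. J (y, x) = - J (x, y)) \<and> (\<forall>e. e \<notin> E \<longrightarrow> J e = 0)}"

definition divergence :: "('a \<times> 'a) set \<Rightarrow> ('a \<times> 'a \<Rightarrow> real) \<Rightarrow> 'a \<Rightarrow> real" where
  "divergence E J x = (\<Sum>y | (x, y) \<in> E. J (x, y))"

definition states :: "('a \<times> 'a) set \<Rightarrow> (('a \<Rightarrow> real) \<times> ('a \<times> 'a \<Rightarrow> real)) set" where
  "states E = {m. \<forall>x. 0 \<le> m x} \<times> flows E"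

type_synonym ('d, 'v) cost =
  "(('d::finite, 'v) vertex \<Rightarrow> real) \<times> (('d, 'v) vertex \<times> ('d, 'v) vertex \<Rightarrow> real) \<Rightarrow> ereal"

definition local_mass :: "real \<Rightarrow> (('d::finite, 'v::finite) vertex \<Rightarrow> real) \<Rightarrow> real" where
  "local_mass R m = (\<Sum>x | real_of_int (sup_norm (fst x)) \<le> R. m x)"

definition local_flow ::
    "(('d::finite, 'v) vertex \<times> ('d, 'v) vertex) set \<Rightarrow> (('d, 'v) vertex \<times> ('d, 'v) vertex \<Rightarrow> real) \<Rightarrow> real" where
  "local_flow E J = (\<Sum>e\<in>EQ E. \<bar>J e\<bar>)"

text \<open>Truncation to the finitely many parameters on which a cost of range \<open>R\<close> depends. The range
  of \<open>cut R\<close> on \<open>UNIV \<times> flows E\<close> is a finite-dimensional space, whose Euclidean topology is the one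
  inherited from the product topology.\<close>

definition cut :: "real \<Rightarrow>
    (('d::finite, 'v) vertex \<Rightarrow> real) \<times> (('d, 'v) vertex \<times> ('d, 'v) vertex \<Rightarrow> real) \<Rightarrow>
    (('d, 'v) vertex \<Rightarrow> real) \<times> (('d, 'v) vertex \<times> ('d, 'v) vertex \<Rightarrow> real)" where
  "cut R = (\<lambda>(m, J). (\<lambda>x. if real_of_int (sup_norm (fst x)) \<le> R then m x else 0,
     \<lambda>(x, y). if real_of_int (sup_norm (fst x)) \<le> R \<and> real_of_int (sup_norm (fst y)) \<le> R then J (x, y) else 0))"

definition in_domain_interior ::
    "(('d::finite, 'v) vertex \<times> ('d, 'v) vertex) set \<Rightarrow> real \<Rightarrow> ('d, 'v) cost \<Rightarrow>
     (('d, 'v) vertex \<Rightarrow> real) \<times> (('d, 'v) vertex \<times> ('d, 'v) vertex \<Rightarrow> real) \<Rightarrow> bool" where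
  "in_domain_interior E R F p \<longleftrightarrow>
     cut R p \<in> top_of_set (cut R ` (UNIV \<times> flows E)) interior_of (cut R ` {q \<in> states E. F q < \<infinity>})"

text \<open>The locality radius \<open>R\<^sub>1\<close> is a parameter because the growth conditions refer to it.\<close>

definition admissible_cost ::
    "(('d::finite, 'v::finite) vertex \<times> ('d, 'v) vertex) set \<Rightarrow> real \<Rightarrow> ('d, 'v) cost \<Rightarrow> bool" where
  "admissible_cost E R1 F \<longleftrightarrow>
     (\<forall>p\<in>states E. F p \<noteq> - \<infinity>) \<and>
     \<comment> \<open>convexity\<close>
     (\<forall>(m, J)\<in>states E. \<forall>(m', J')\<in>states E. \<forall>t\<in>{0..1}.
        F (\<lambda>x. t * m x + (1 - t) * m' x, \<lambda>e. t * J e + (1 - t) * J' e)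
          \<le> ereal t * F (m, J) + ereal (1 - t) * F (m', J')) \<and>
     \<comment> \<open>lower semicontinuity\<close>
     (\<forall>p\<in>states E. F p \<le> Liminf (at p within states E) F) \<and>
     \<comment> \<open>locality\<close>
     (\<forall>(m, J)\<in>states E. \<forall>(m', J')\<in>states E.
        (\<forall>x. real_of_int (sup_norm (fst x)) \<le> R1 \<longrightarrow> m x = m' x) \<and>
        (\<forall>(x, y)\<in>E. real_of_int (sup_norm (fst x)) \<le> R1 \<and> real_of_int (sup_norm (fst y)) \<le> R1 \<longrightarrow> J (x, y) = J' (x, y))
        \<longrightarrow> F (m, J) = F (m', J')) \<and>
     \<comment> \<open>linear growth\<close>
     (\<exists>c C. 0 < c \<and> (\<forall>(m, J)\<in>states E.
        ereal (c * local_flow E J - C * (1 + local_mass (max (real_of_int (R0 E)) R1) m)) \<le> F (m, J))) \<and>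
     \<comment> \<open>nonempty interior of the domain\<close>
     (\<exists>m J. (m, J) \<in> states E \<and>
        (\<forall>z x. m (shift z x) = m x) \<and> (\<forall>z x y. J (shift z x, shift z y) = J (x, y)) \<and>
        (\<forall>x. divergence E J x = 0) \<and> in_domain_interior E R1 F (m, J))"

definition superlinear_growth ::
    "(('d::finite, 'v::finite) vertex \<times> ('d, 'v) vertex) set \<Rightarrow> real \<Rightarrow> ('d, 'v) cost \<Rightarrow> bool" where
  "superlinear_growth E R1 F \<longleftrightarrow>
     (\<exists>(\<theta> :: real \<Rightarrow> real) C. (\<forall>t\<ge>0. 0 \<le> \<theta> t) \<and> filterlim (\<lambda>t. \<theta> t / t) at_top at_top \<and>
        (\<forall>(m, J)\<in>states E. let m0 = local_mass (max (real_of_int (R0 E)) R1) m; J0 = local_flow E J in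
           ereal ((m0 + 1) * \<theta> (J0 / (m0 + 1)) - C * (m0 + 1)) \<le> F (m, J)))"


section \<open>Rescaled graph and energies\<close>

definition scales :: "(('d::finite, 'v) vertex \<times> ('d, 'v) vertex) set \<Rightarrow> real set" where
  "scales E = {\<epsilon>. 0 < \<epsilon> \<and> 1 / \<epsilon> \<in> \<nat> \<and> \<epsilon> * real_of_int (R0 E) < 1 / 2}"

text \<open>The discrete torus \<open>(\<int>/(1/\<epsilon>)\<int>)\<^sup>d\<close> is represented by residues in \<open>{0, \<dots>, 1/\<epsilon> - 1}\<close>, and the
  vertex \<open>([\<epsilon>z], v)\<close> of the rescaled graph by \<open>(z, v)\<close> with \<open>z\<close> such a residue vector.\<close>

definition Z_eps :: "real \<Rightarrow> (int ^ 'd::finite) set" where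
  "Z_eps \<epsilon> = {z. \<forall>i. z $ i \<in> {0..<\<lfloor>1 / \<epsilon>\<rfloor>}}"

definition X_eps :: "real \<Rightarrow> ('d::finite, 'v) vertex set" where
  "X_eps \<epsilon> = Z_eps \<epsilon> \<times> UNIV"

definition T_eps :: "real \<Rightarrow> int ^ 'd::finite \<Rightarrow> ('d, 'v) vertex \<Rightarrow> ('d, 'v) vertex" where
  "T_eps \<epsilon> z' = (\<lambda>(z, v). (\<chi> i. (z' $ i + z $ i) mod \<lfloor>1 / \<epsilon>\<rfloor>, v))"

definition E_eps :: "(('d::finite, 'v) vertex \<times> ('d, 'v) vertex) set \<Rightarrow> real \<Rightarrow>
    (('d, 'v) vertex \<times> ('d, 'v) vertex) set" where
  "E_eps E \<epsilon> = {(T_eps \<epsilon> 0 x, T_eps \<epsilon> 0 y) | x y. (x, y) \<in> E}"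

definition tau_mass :: "real \<Rightarrow> int ^ 'd::finite \<Rightarrow> (('d, 'v) vertex \<Rightarrow> real) \<Rightarrow>
    ('d, 'v) vertex \<Rightarrow> real" where
  "tau_mass \<epsilon> z m x = m (T_eps \<epsilon> z x)"

text \<open>A pair outside \<open>E\<close> may be sent into the rescaled edge set, so the extension by zero is explicit.\<close>

definition tau_flow :: "(('d::finite, 'v) vertex \<times> ('d, 'v) vertex) set \<Rightarrow> real \<Rightarrow> int ^ 'd \<Rightarrow>
    (('d, 'v) vertex \<times> ('d, 'v) vertex \<Rightarrow> real) \<Rightarrow> ('d, 'v) vertex \<times> ('d, 'v) vertex \<Rightarrow> real" where
  "tau_flow E \<epsilon> z J = (\<lambda>(x, y). if (x, y) \<in> E then J (T_eps \<epsilon> z x, T_eps \<epsilon> z y) else 0)"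

definition F_eps :: "(('d::finite, 'v) vertex \<times> ('d, 'v) vertex) set \<Rightarrow> ('d, 'v) cost \<Rightarrow> real \<Rightarrow>
    (('d, 'v) vertex \<Rightarrow> real) \<Rightarrow> (('d, 'v) vertex \<times> ('d, 'v) vertex \<Rightarrow> real) \<Rightarrow> ereal" where
  "F_eps E F \<epsilon> m J = (\<Sum>z\<in>Z_eps \<epsilon>. ereal (\<epsilon> ^ CARD('d)) *
     F (\<lambda>x. tau_mass \<epsilon> z m x / \<epsilon> ^ CARD('d), \<lambda>e. tau_flow E \<epsilon> z J e / \<epsilon> ^ (CARD('d) - 1)))"

definition mass_curve :: "real \<Rightarrow> real set \<Rightarrow> (real \<Rightarrow> ('d::finite, 'v) vertex \<Rightarrow> real) \<Rightarrow> bool" where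
  "mass_curve \<epsilon> I m \<longleftrightarrow>
     (\<forall>x\<in>X_eps \<epsilon>. (\<forall>t\<in>I. 0 \<le> m t x) \<and> continuous_on I (\<lambda>t. m t x))"

definition continuity_equation ::
    "(('d::finite, 'v) vertex \<times> ('d, 'v) vertex) set \<Rightarrow> real \<Rightarrow> real set \<Rightarrow>
     (real \<Rightarrow> ('d, 'v) vertex \<Rightarrow> real) \<Rightarrow>
     (real \<Rightarrow> ('d, 'v) vertex \<times> ('d, 'v) vertex \<Rightarrow> real) \<Rightarrow> bool" where
  "continuity_equation E \<epsilon> I m J \<longleftrightarrow> mass_curve \<epsilon> I m \<and>
     (\<forall>t\<in>I. J t \<in> flows (E_eps E \<epsilon>)) \<and>
     (\<forall>e. (\<lambda>t. J t e) \<in> borel_measurable (restrict_space borel I)) \<and>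
     (\<forall>x\<in>X_eps \<epsilon>. weak_derivative I (\<lambda>t. m t x) (\<lambda>t. - divergence (E_eps E \<epsilon>) (J t) x))"

text \<open>Integral of an extended-real function as positive minus negative part. The negative part of
  the energies below has finite integral by the growth condition on the cost.\<close>

definition ereal_integral :: "'a measure \<Rightarrow> ('a \<Rightarrow> ereal) \<Rightarrow> ereal" where
  "ereal_integral M f =
     enn2ereal (\<integral>\<^sup>+x. e2ennreal (f x) \<partial>M) - enn2ereal (\<integral>\<^sup>+x. e2ennreal (- f x) \<partial>M)"

definition action :: "(('d::finite, 'v) vertex \<times> ('d, 'v) vertex) set \<Rightarrow> ('d, 'v) cost \<Rightarrow> real \<Rightarrow>
    real set \<Rightarrow> (real \<Rightarrow> ('d, 'v) vertex \<Rightarrow> real) \<Rightarrow> ereal" where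
  "action E F \<epsilon> I m = (INF J\<in>{J. continuity_equation E \<epsilon> I m J}.
     ereal_integral (restrict_space lborel I) (\<lambda>t. F_eps E F \<epsilon> (m t) (J t)))"

definition total_mass :: "real \<Rightarrow> real set \<Rightarrow> (real \<Rightarrow> ('d::finite, 'v::finite) vertex \<Rightarrow> real) \<Rightarrow> ennreal"
  where "total_mass \<epsilon> I m = (\<integral>\<^sup>+t. ennreal (\<Sum>x\<in>X_eps \<epsilon>. m t x) \<partial>restrict_space lborel I)"

definition cell :: "real \<Rightarrow> int ^ 'd::finite \<Rightarrow> 'd torus set" where
  "cell \<epsilon> z = proj ` {y. \<forall>i. \<epsilon> * real_of_int (z $ i) \<le> y $ i \<and> y $ i < \<epsilon> * real_of_int (z $ i) + \<epsilon>}"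

definition iota_eps :: "real \<Rightarrow> (('d::finite, 'v::finite) vertex \<Rightarrow> real) \<Rightarrow> 'd torus measure" where
  "iota_eps \<epsilon> m = density torus_lebesgue
     (\<lambda>p. ennreal ((\<Sum>x\<in>X_eps \<epsilon>. m x * indicator (cell \<epsilon> (fst x)) p) / \<epsilon> ^ CARD('d)))"

end

theory Submission
  imports Defs "HOL-Probability.Probability"
begin

text \<open>
  Superlinear growth turns the action bound into equi-integrability of the rescaled total flow
  \<open>t \<mapsto> \<epsilon> \<Sum> \<bar>J\<^sub>t(x, y)\<bar>\<close>. Testing the continuity equation with the cell means of a
  Lipschitz function \<open>\<psi>\<close>, whose increments along an edge are at most \<open>\<epsilon> d R\<^sub>0 Lip(\<psi>)\<close>, shows
  that \<open>t \<mapsto> \<integral> \<psi> d\<iota>\<^sub>\<epsilon> m\<^sub>t\<close> has a derivative bounded by \<open>Lip(\<psi>)\<close> times this flow. Hence the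
  embedded curves are equicontinuous in the Kantorovich--Rubinstein norm, uniformly in \<open>\<epsilon>\<close>, with
  constant mass, and Arzela--Ascoli combined with weak compactness of bounded measures gives a
  uniform limit. A weak \<open>L\<^sup>1\<close> limit \<open>v\<close> of the flows dominates the derivative of the limit curve.
  That derivative is first found for each test function separately, as a density bounded by
  \<open>\<parallel>\<psi>\<parallel> v\<close>; separability of \<open>C\<^sup>1\<close> makes the choice linear in the test function for almost every
  time.
\<close>

section \<open>Weak derivatives of continuous functions on an interval\<close>

text \<open>For every slope K, superlinear growth gives a lower bound K |J| - C (mass + 1) for the
  cost, with C depending on K. Summed over the cells and integrated over a set S of times, it bounds
  K times the flow through S by a constant free of K plus a multiple of |S| that depends on K.
  Choosing K large before choosing |S| small yields equi-integrability; one fixed K would yield a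
  bound in L^1 only, whose weak limits may have atoms in time and would destroy the continuity of
  the limit curve. Testing with constants shows that mass is conserved, which turns the bound on the
  time-integrated mass into a bound at every time. Compactness is reduced throughout to Helly
  selection on the real line: directly for the densities in time, and by coding points as reals for
  measures on the torus. The continuity equation is available in the sense of distributions only, so
  increments between two times have to be extracted with explicit smooth test functions.\<close>

lemma smooth_coinduct:
  fixes f :: "real \<Rightarrow> real"
  assumes "f \<in> C" and "\<And>g t. g \<in> C \<Longrightarrow> g differentiable at t" and "\<And>g. g \<in> C \<Longrightarrow> deriv g \<in> C"
  shows "(deriv ^^ n) f differentiable at t"
proof -
  have "(deriv ^^ n) f \<in> C" by (induction n) (auto intro: assms)
  then show ?thesis by (rule assms)
qed

text \<open>A family closed under differentiation, so that smoothness follows by coinduction.\<close>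

definition bump :: "real poly \<Rightarrow> nat \<Rightarrow> real \<Rightarrow> real" where
  "bump p m x = (if 0 < x \<and> x < 1
     then poly p x * inverse (x * (1 - x)) ^ m * exp (- inverse (x * (1 - x))) else 0)"

section \<open>Smoothness of the bump family\<close>

lemma power_le_fact_exp: "0 \<le> z \<Longrightarrow> z ^ k \<le> fact k * exp (z :: real)"
proof -
  assume "0 \<le> z"
  \<comment> \<open>Only the k-th term of the exponential series is kept; the others are
    nonnegative.\<close>
  then have "sum (\<lambda>n. z ^ n /\<^sub>R fact n) {k} \<le> exp z"
    unfolding exp_def by (intro sum_le_suminf summable_exp_generic) (auto simp: field_simps)
  then show ?thesis by (simp add: field_simps)
qed

text \<open>Meant for the two endpoints of the bump, where its defining formula changes and the
  rules of differentiation do not apply. The bound at y = x also forces f x = 0.\<close>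

lemma has_derivative_zero_quadratic:
  fixes f :: "real \<Rightarrow> real"
  assumes "\<And>y. \<bar>f y\<bar> \<le> B * (y - x)\<^sup>2"
  shows "(f has_real_derivative 0) (at x)"
proof -
  have "f x = 0" using assms[of x] by simp
  have "((\<lambda>y. (f y - f x) / (y - x)) \<longlongrightarrow> 0) (at x)"
  proof (rule Lim_null_comparison)
    show "\<forall>\<^sub>F y in at x. norm ((f y - f x) / (y - x)) \<le> B * \<bar>y - x\<bar>"
      unfolding eventually_at_filter
    proof (intro always_eventually allI impI)
      fix y assume "y \<noteq> x"
      then have "\<bar>f y\<bar> / \<bar>y - x\<bar> \<le> B * \<bar>y - x\<bar>"
        using assms[of y] by (simp add: divide_le_eq power2_eq_square abs_mult_self_eq mult.assoc)
      then show "norm ((f y - f x) / (y - x)) \<le> B * \<bar>y - x\<bar>"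
        using \<open>f x = 0\<close> by simp
    qed
    show "((\<lambda>y. B * \<bar>y - x\<bar>) \<longlongrightarrow> 0) (at x)"
      by (auto intro!: tendsto_eq_intros)
  qed
  then show ?thesis by (simp add: has_field_derivative_iff)
qed

text \<open>With w = x (1 - x), the factor exp (-1/w) beats the pole of order m with two powers of w
  to spare, and on the unit interval w is at most x and at most 1 - x.\<close>

lemma bump_quadratic:
  obtains B where "\<And>x. \<bar>bump p m x\<bar> \<le> B * x\<^sup>2" "\<And>x. \<bar>bump p m x\<bar> \<le> B * (x - 1)\<^sup>2"
proof -
  have "bounded (poly p ` {0..1})"
    by (intro compact_imp_bounded compact_continuous_image continuous_intros) auto
  then obtain A where A: "\<And>x. x \<in> {0..1} \<Longrightarrow> \<bar>poly p x\<bar> \<le> A"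
    unfolding bounded_iff by (metis image_eqI real_norm_def)
  have A0: "0 \<le> A" using A[of 0] by auto
  \<comment> \<open>The factorial comes from the series bound on exp (1/w) at the power m +
    2.\<close>
  define B where "B = A * fact (m + 2)"
  have B0: "0 \<le> B" using A0 by (simp add: B_def)
  have w: "\<bar>bump p m x\<bar> \<le> B * (x * (1 - x))\<^sup>2" if x: "0 < x" "x < 1" for x
  proof -
    define w where "w = x * (1 - x)"
    have w0: "0 < w" using x by (simp add: w_def)
    have "inverse w ^ (m + 2) \<le> fact (m + 2) * exp (inverse w)"
      using w0 by (intro power_le_fact_exp) simp
    then have "inverse w ^ m * exp (- inverse w) \<le> fact (m + 2) * w\<^sup>2"
      using w0 by (simp add: exp_minus field_simps power2_eq_square)
    then have "\<bar>poly p x\<bar> * (inverse w ^ m * exp (- inverse w)) \<le> A * (fact (m + 2) * w\<^sup>2)"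
      using A[of x] x A0 w0 by - (rule mult_mono, auto)
    then show ?thesis
      using x w0 by (simp add: bump_def abs_mult B_def w_def[symmetric] mult.assoc)
  qed
  show ?thesis
  proof (rule that[of B])
    fix x
    show "\<bar>bump p m x\<bar> \<le> B * x\<^sup>2"
    proof (cases "0 < x \<and> x < 1")
      case True
      have "(x * (1 - x))\<^sup>2 \<le> x\<^sup>2"
        using True by (intro power_mono) (auto intro: mult_left_le)
      then show ?thesis using w[of x] True mult_left_mono[OF _ B0] order_trans by blast
    qed (use B0 in \<open>auto simp: bump_def\<close>)
    show "\<bar>bump p m x\<bar> \<le> B * (x - 1)\<^sup>2"
    proof (cases "0 < x \<and> x < 1")
      case True
      have "(x * (1 - x))\<^sup>2 \<le> (1 - x)\<^sup>2"
        using True by (intro power_mono) (auto intro: mult_left_le_one_le)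
      then show ?thesis
        using w[of x] True mult_left_mono[OF _ B0] order_trans by (metis power2_commute)
    qed (use B0 in \<open>auto simp: bump_def\<close>)
  qed
qed

text \<open>The numerator of the derivative over the denominator w^(m + 2), where
  \<open>[:0, 1, -1:]\<close> is w = x (1 - x) and \<open>[:1, -2:]\<close> is its derivative. The
  three terms come from differentiating p, the power of 1/w, and the exponential.\<close>

definition bump_next :: "real poly \<Rightarrow> nat \<Rightarrow> real poly" where
  "bump_next p m = pderiv p * [:0, 1, -1:]\<^sup>2 - smult (real m) (p * [:1, -2:] * [:0, 1, -1:]) + p * [:1, -2:]"

lemma DERIV_bump: "(bump p m has_real_derivative bump (bump_next p m) (m + 2) x) (at x)"
proof -
  obtain B where B: "\<And>x. \<bar>bump p m x\<bar> \<le> B * x\<^sup>2" "\<And>x. \<bar>bump p m x\<bar> \<le> B * (x - 1)\<^sup>2"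
    using bump_quadratic[of p m] by metis
  consider "0 < x" "x < 1" | "x = 0" | "x = 1" | "x \<notin> {0..1}" by fastforce
  then show ?thesis
  proof cases
    case 1
    define f where "f = (\<lambda>x. poly p x * inverse (x * (1 - x)) ^ m * exp (- inverse (x * (1 - x))))"
    have w: "x * (1 - x) \<noteq> 0" using 1 by auto
    define w where "w = x * (1 - x)"
    have w0: "w \<noteq> 0" using w by (simp add: w_def)
    \<comment> \<open>The truncated exponent m - 1 at m = 0 is harmless, since it only occurs with
      the factor m.\<close>
    have pw: "inverse w ^ (m - 1) * real m = real m * inverse w ^ m * w"
      using w0 by (cases m) (auto simp: field_simps)
    have "(f has_real_derivative
       (poly (pderiv p) x * inverse w ^ m
        + poly p x * (real m * inverse w ^ (m - 1) * (- (inverse w * (1 - 2 * x) * inverse w)))) * exp (- inverse w)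
        + poly p x * inverse w ^ m * (exp (- inverse w) * (inverse w * (1 - 2 * x) * inverse w))) (at x)"
      unfolding f_def w_def
      apply (rule derivative_eq_intros poly_DERIV refl w)+
      apply (simp add: algebra_simps)
      done
    moreover have "(poly (pderiv p) x * inverse w ^ m
        + poly p x * (real m * inverse w ^ (m - 1) * (- (inverse w * (1 - 2 * x) * inverse w)))) * exp (- inverse w)
        + poly p x * inverse w ^ m * (exp (- inverse w) * (inverse w * (1 - 2 * x) * inverse w))
      = bump (bump_next p m) (m + 2) x"
    proof -
      have e: "poly [:0, 1, -1:] x = w" "poly [:1, -2:] x = 1 - 2 * x"
        by (simp_all add: w_def algebra_simps)
      have "bump (bump_next p m) (m + 2) x =
         (poly (pderiv p) x * w\<^sup>2 - real m * (poly p x * (1 - 2 * x) * w) + poly p x * (1 - 2 * x))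
           * inverse w ^ (m + 2) * exp (- inverse w)"
        using 1 by (simp add: bump_def bump_next_def w_def[symmetric] e[simplified] poly_power algebra_simps power2_eq_square flip: e)
      moreover have "poly p x * (real m * inverse w ^ (m - 1) * (- (inverse w * (1 - 2 * x) * inverse w)))
          = poly p x * (real m * inverse w ^ m * w * (- (inverse w * (1 - 2 * x) * inverse w)))"
        using pw w0 by (auto simp: mult_ac)
      moreover have "w * inverse w = 1" using w0 by simp
      \<comment> \<open>With powers and exponential abstracted to variables, what remains is a
        polynomial identity modulo w v = 1.\<close>
      moreover have "w * v = 1 \<Longrightarrow> (A * V + P * (M * V * w * - (v * c * v))) * e + P * V * (e * (v * c * v))
          = (A * (w * w) - M * (P * c * w) + P * c) * (V * (v * v)) * e" for w v A V P M c e :: real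
        by algebra
      ultimately show ?thesis
        unfolding power_add power2_eq_square by (simp only:)
    qed
    ultimately have "(f has_real_derivative bump (bump_next p m) (m + 2) x) (at x)" by simp
    then show ?thesis
      by (rule has_field_derivative_transform_within_open[where S = "{0<..<1}"])
        (use 1 in \<open>auto simp: f_def bump_def\<close>)
  next
    case 2
    with B(1) show ?thesis
      using has_derivative_zero_quadratic[of "bump p m" B 0] by (simp add: bump_def)
  next
    case 3
    with B(2) show ?thesis
      using has_derivative_zero_quadratic[of "bump p m" B 1] by (simp add: bump_def)
  next
    case 4
    have "((\<lambda>x. 0) has_real_derivative 0) (at x)" by simp
    then have "(bump p m has_real_derivative 0) (at x)"
      by (rule has_field_derivative_transform_within_open[where S = "- {0..1}"])
        (use 4 in \<open>auto simp: bump_def\<close>)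
    then show ?thesis using 4 by (auto simp: bump_def)
  qed
qed

section \<open>The antiderivative of the bump\<close>

definition bump_integral :: "real \<Rightarrow> real" where
  "bump_integral x = integral {-1..x} (bump 1 0)"

definition bump_mass :: real where "bump_mass = bump_integral 1"

lemma continuous_bump: "continuous_on A (bump p m)"
  by (intro continuous_at_imp_continuous_on ballI DERIV_isCont[OF DERIV_bump])

lemma bump_1_nonneg: "0 \<le> bump 1 0 x"
  by (simp add: bump_def)

lemma bump_integral_le_0: "x \<le> 0 \<Longrightarrow> bump_integral x = 0"
proof -
  assume "x \<le> 0"
  then have "integral {-1..x} (bump 1 0) = integral {-1..x} (\<lambda>x. 0)"
    by (intro integral_cong) (auto simp: bump_def)
  then show ?thesis by (simp add: bump_integral_def)
qed

lemma DERIV_bump_integral: "(bump_integral has_real_derivative bump 1 0 x) (at x)"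
proof (cases "x < 0")
  case True
  have "((\<lambda>x. 0) has_real_derivative 0) (at x)" by simp
  then have "(bump_integral has_real_derivative 0) (at x)"
    using True by (intro has_field_derivative_transform_within_open[of "\<lambda>x. 0" 0 x "{..<0}" bump_integral]) (auto simp: bump_integral_le_0)
  then show ?thesis using True by (simp add: bump_def)
next
  case False
  \<comment> \<open>Integration starts at -1 and not at 0, so that x = 0 is an interior point of the
    interval.\<close>
  have "((\<lambda>y. integral {-1..y} (bump 1 0)) has_real_derivative bump 1 0 x) (at x within {-1..x + 1})"
    using False by (intro integral_has_real_derivative continuous_bump) auto
  moreover have "at x within {-1..x + 1} = at x"
    using False by (intro at_within_Icc_at) auto
  ultimately show ?thesis by (simp add: bump_integral_def[abs_def])
qed

lemma bump_integral_mono: "x \<le> y \<Longrightarrow> bump_integral x \<le> bump_integral y"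
  by (rule DERIV_nonneg_imp_nondecreasing) (auto intro: DERIV_bump_integral bump_1_nonneg)

lemma bump_integral_ge_1: "1 \<le> x \<Longrightarrow> bump_integral x = bump_mass"
proof -
  assume x: "1 \<le> x"
  have "integral {1..x} (bump 1 0) = integral {1..x} (\<lambda>x. 0)"
    by (intro integral_cong) (auto simp: bump_def)
  moreover have "integral {-1..1} (bump 1 0) + integral {1..x} (bump 1 0) = integral {-1..x} (bump 1 0)"
    using x by (intro Henstock_Kurzweil_Integration.integral_combine integrable_continuous_real continuous_bump) auto
  ultimately show ?thesis by (simp add: bump_integral_def bump_mass_def)
qed

text \<open>The bump is not normalised; positivity of its mass allows the mass to be cancelled in
  the end.\<close>

lemma bump_mass_pos: "0 < bump_mass"
proof -
  have "bump_integral 0 < bump_integral 1"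
  proof (rule DERIV_pos_imp_increasing_open[where f = bump_integral])
    fix x :: real assume "0 < x" "x < 1"
    then show "\<exists>y. (bump_integral has_real_derivative y) (at x) \<and> 0 < y"
      using DERIV_bump_integral[of x] by (auto simp: bump_def)
  qed (auto intro: continuous_at_imp_continuous_on DERIV_isCont[OF DERIV_bump_integral])
  then show ?thesis by (simp add: bump_integral_le_0 bump_mass_def)
qed

lemma bump_integral_bounds: "0 \<le> bump_integral x" "bump_integral x \<le> bump_mass"
  using bump_integral_mono[of 0 x] bump_integral_mono[of x 1] bump_integral_le_0[of x]
    bump_integral_le_0[of 0] bump_integral_ge_1[of x] bump_mass_pos
  by (cases "x \<le> 0"; cases "x \<le> 1"; auto simp: bump_mass_def)+

lemma has_integral_bump: "has_bochner_integral lborel (bump 1 0) (bump_mass)"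
proof -
  have "(bump 1 0 has_integral bump_mass) {-1..1}"
    unfolding bump_mass_def bump_integral_def
    by (intro integrable_integral integrable_continuous_real continuous_bump)
  then have "(bump 1 0 has_integral bump_mass) UNIV"
    by (rule has_integral_on_superset) (auto simp: bump_def)
  moreover have "bump 1 0 \<in> borel_measurable borel"
    by (intro borel_measurable_continuous_onI continuous_bump)
  moreover have "0 \<le> bump_mass" using bump_mass_pos by simp
  ultimately have "(\<integral>\<^sup>+x. bump 1 0 x \<partial>lborel) = bump_mass"
    by (intro nn_integral_has_integral_lborel) (auto simp: bump_1_nonneg)
  then show ?thesis
    using \<open>bump 1 0 \<in> borel_measurable borel\<close> bump_mass_pos
    by (intro has_bochner_integral_nn_integral) (auto simp: bump_1_nonneg)
qed

section \<open>Smooth approximations of time intervals: up to the factor \<open>bump_mass\<close>,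
  plateaus tend to indicators\<close>

definition plateau :: "real \<Rightarrow> real \<Rightarrow> real \<Rightarrow> real \<Rightarrow> real" where
  "plateau k s t r = bump_integral (k * (r - s)) - bump_integral (k * (r - t))"

lemma DERIV_plateau:
  "(plateau k s t has_real_derivative k * bump 1 0 (k * (r - s)) - k * bump 1 0 (k * (r - t))) (at r)"
proof -
  have *: "((\<lambda>r. bump_integral (k * (r - s))) has_real_derivative k * bump 1 0 (k * (r - s))) (at r)" for s
    by (rule DERIV_chain3[of bump_integral "bump 1 0", THEN DERIV_cong])
      (auto intro!: DERIV_bump_integral derivative_eq_intros)
  show ?thesis unfolding plateau_def[abs_def] by (intro DERIV_diff *)
qed

text \<open>Left of s both terms vanish; right of t + 1/k both have reached the full mass and
  cancel.\<close>

lemma plateau_outside: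
  assumes "0 < k" "s \<le> t" "r \<notin> {s..t + 1 / k}"
  shows "plateau k s t r = 0"
proof (cases "r < s")
  case True
  then show ?thesis using assms
    by (simp add: plateau_def bump_integral_le_0 mult_nonneg_nonpos)
next
  case False
  then have "t + 1 / k < r" using assms by auto
  then have "1 \<le> k * (r - t)"
    using assms by (simp add: field_simps)
  moreover have "k * (r - t) \<le> k * (r - s)" using assms by (intro mult_left_mono) auto
  ultimately have "1 \<le> k * (r - t)" "1 \<le> k * (r - s)" by auto
  then show ?thesis by (simp add: plateau_def bump_integral_ge_1)
qed

lemma plateau_test_function:
  assumes "0 < k" "s \<le> t" "{s..t + 1 / k} \<subseteq> I"
  shows "plateau k s t \<in> test_functions I"
proof -
  \<comment> \<open>From the first derivative on, a plateau is a difference of two rescaled bumps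
    with a common factor. Such differences are closed under differentiation, and the plateau itself
    is adjoined to them.\<close>
  define C where "C = insert (plateau k s t)
    {(\<lambda>r. A * bump p m (k * (r - s)) - A * bump p m (k * (r - t))) | A p m. True}"
  have D: "((\<lambda>r. A * bump p m (k * (r - s)) - A * bump p m (k * (r - t))) has_real_derivative
    (A * k) * bump (bump_next p m) (m + 2) (k * (r - s)) - (A * k) * bump (bump_next p m) (m + 2) (k * (r - t))) (at r)"
    for A p m r
  proof -
    have "((\<lambda>r. A * bump p m (k * (r - s))) has_real_derivative A * (bump (bump_next p m) (m + 2) (k * (r - s)) * k)) (at r)" for s
      by (rule DERIV_cmult, rule DERIV_chain2[OF DERIV_bump]) (auto intro!: derivative_eq_intros)
    from DERIV_diff[OF this this] show ?thesis by (simp add: mult_ac)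
  qed
  have "(deriv ^^ n) (plateau k s t) differentiable at r" for n r
  proof (rule smooth_coinduct[where C = C])
    show "plateau k s t \<in> C" by (simp add: C_def)
    fix g assume g: "g \<in> C"
    show "g differentiable at t" for t
      using g unfolding C_def
      by (elim insertE CollectE exE conjE; hypsubst)
        (rule real_differentiable_def[THEN iffD2, OF exI, OF DERIV_plateau]
          real_differentiable_def[THEN iffD2, OF exI, OF D])+
    show "deriv g \<in> C"
    proof (cases "g = plateau k s t")
      case True
      have "deriv g = (\<lambda>r. k * bump 1 0 (k * (r - s)) - k * bump 1 0 (k * (r - t)))"
        unfolding True by (intro ext DERIV_imp_deriv DERIV_plateau)
      then show ?thesis unfolding C_def by blast
    next
      case False
      then obtain A p m where "g = (\<lambda>r. A * bump p m (k * (r - s)) - A * bump p m (k * (r - t)))"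
        using g by (auto simp: C_def)
      then have "deriv g = (\<lambda>r. (A * k) * bump (bump_next p m) (m + 2) (k * (r - s))
          - (A * k) * bump (bump_next p m) (m + 2) (k * (r - t)))"
        by (intro ext DERIV_imp_deriv) (simp only: D)
      then show ?thesis unfolding C_def by blast
    qed
  qed
  moreover have "plateau k s t r = 0" if "r \<notin> {s..t + 1 / k}" for r
    by (rule plateau_outside[OF assms(1,2) that])
  ultimately show ?thesis
    unfolding test_functions_def using assms(3) by (auto intro!: exI[of _ "{s..t + 1 / k}"])
qed

text \<open>Tested with steeper and steeper plateaus, the left side concentrates at s and t, where
  continuity of f evaluates it, while the right side converges to the integral of g over the
  half-open interval by domination.\<close>

lemma weak_derivative_imp_integral:
  fixes f g :: "real \<Rightarrow> real"
  assumes I: "I = {a<..<b}" and f: "continuous_on I f" and wd: "weak_derivative I f g"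
    and st: "s \<in> I" "t \<in> I" "s \<le> t"
  shows "f t - f s = (LINT r:{s<..t}|lborel. g r)"
proof -
  define Z where "Z = bump_mass"
  \<comment> \<open>Plateaus spill over to the right of t by 1/k. Half the distance to b is kept as
    room for this, and k starts at 1/\<delta>, so that all supports lie in one compact part of
    I.\<close>
  define \<delta> where "\<delta> = (b - t) / 2"
  have \<delta>: "0 < \<delta>" "{s..t + \<delta>} \<subseteq> I" "t + \<delta> < b" using st I by (auto simp: \<delta>_def field_simps)
  define k where "k n = 1 / \<delta> + real n" for n
  have k0: "0 < k n" for n using \<delta> by (simp add: k_def add_pos_nonneg)
  have kd: "1 / k n \<le> \<delta>" for n
    using \<delta>(1) k0[of n] by (simp add: k_def field_simps)
  have klim: "filterlim k at_top sequentially"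
    unfolding k_def by (rule filterlim_tendsto_add_at_top[OF tendsto_const filterlim_real_sequentially])
  have kinv: "(\<lambda>n. 1 / k n) \<longlonglongrightarrow> 0"
    using tendsto_inverse_0_at_top[OF klim] by (simp add: inverse_eq_divide)
  have tf: "plateau (k n) s t \<in> test_functions I" for n
  proof (rule plateau_test_function[OF k0 st(3)])
    have "{s..t + 1 / k n} \<subseteq> {s..t + \<delta>}" using kd[of n] by auto
    then show "{s..t + 1 / k n} \<subseteq> I" using \<delta> by blast
  qed
  have gint: "set_integrable lborel {s..t + \<delta>} g"
    using wd \<delta> by (auto simp: weak_derivative_def locally_integrable_def)
  have eq: "(LINT r:I|lborel. deriv (plateau (k n) s t) r * f r) = - (LINT r:I|lborel. plateau (k n) s t r * g r)" for n
    using wd tf[of n] by (auto simp: weak_derivative_def)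
  have bm: "bump 1 0 \<in> borel_measurable borel"
    by (intro borel_measurable_continuous_onI continuous_bump)
  have bi: "bump_integral \<in> borel_measurable borel"
    by (intro borel_measurable_continuous_onI continuous_at_imp_continuous_on ballI
        DERIV_isCont[OF DERIV_bump_integral])
  have fm: "(\<lambda>r. indicator I r * f r) \<in> borel_measurable borel"
    using borel_measurable_continuous_on_indicator[OF _ f] I by simp
  \<comment> \<open>The substitution r = u + x/k turns the shrinking bump at u into a fixed one in
    x, with f evaluated ever closer to u from the right.\<close>
  have lim1: "(\<lambda>n. LINT r|lborel. k n * bump 1 0 (k n * (r - u)) * (indicator I r * f r)) \<longlonglongrightarrow> Z * f u"
    and int1: "integrable lborel (\<lambda>r. k n * bump 1 0 (k n * (r - u)) * (indicator I r * f r))"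
    if u: "u \<in> {s..t}" for u n
  proof -
    have sub: "{u..u + \<delta>} \<subseteq> I" using u \<delta> by auto
    then have "bounded (f ` {u..u + \<delta>})"
      by (intro compact_imp_bounded compact_continuous_image continuous_on_subset[OF f]) auto
    then obtain B where B: "\<bar>f r\<bar> \<le> B" if "r \<in> {u..u + \<delta>}" for r
      unfolding bounded_iff by (metis image_eqI real_norm_def)
    have in_u: "u + x / k n \<in> {u..u + \<delta>}" if "0 \<le> x" "x \<le> 1" for x n
    proof -
      have "x / k n \<le> 1 / k n" using that k0[of n] by (simp add: divide_right_mono)
      then show ?thesis using that k0[of n] kd[of n] by (auto intro: order_trans)
    qed
    have bnd: "norm (bump 1 0 x * (indicator I (u + x / k n) * f (u + x / k n))) \<le> B * bump 1 0 x" for x n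
    proof (cases "0 < x \<and> x < 1")
      case True
      then show ?thesis
        using B[OF in_u[of x n]] in_u[of x n] sub bump_1_nonneg[of x]
          mult_left_mono[of "\<bar>f (u + x / k n)\<bar>" B "bump 1 0 x"]
        by (simp add: abs_mult indicator_def mult.commute)
    qed (auto simp: bump_def)
    have iB: "integrable lborel (\<lambda>x. B * bump 1 0 x)"
      using has_integral_bump by (simp add: has_bochner_integral_iff)
    have meas: "(\<lambda>x. bump 1 0 x * (indicator I (u + x / k n) * f (u + x / k n))) \<in> borel_measurable lborel" for n
    proof -
      have "(\<lambda>x. (\<lambda>r. indicator I r * f r) (u + x / k n)) \<in> borel_measurable borel"
        by (rule measurable_compose[OF _ fm]) simp
      then show ?thesis using bm by simp
    qed
    have conv: "(\<lambda>n. bump 1 0 x * (indicator I (u + x / k n) * f (u + x / k n))) \<longlonglongrightarrow> bump 1 0 x * f u" for x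
    proof (cases "0 < x \<and> x < 1")
      case True
      have "(\<lambda>n. u + x / k n) \<longlonglongrightarrow> u"
        using tendsto_add[OF tendsto_const[of u] tendsto_mult[OF tendsto_const[of x] kinv]] by simp
      moreover have uI: "u \<in> I" using sub \<delta>(1) by auto
      moreover have xI: "u + x / k n \<in> I" for n
        using subsetD[OF sub in_u[of x n]] True by linarith
      ultimately have "(\<lambda>n. f (u + x / k n)) \<longlonglongrightarrow> f u"
        by (intro continuous_on_tendsto_compose[OF f]) auto
      then have "(\<lambda>n. bump 1 0 x * f (u + x / k n)) \<longlonglongrightarrow> bump 1 0 x * f u" by (intro tendsto_intros)
      moreover have "indicator I (u + x / k n) = (1::real)" for n using xI[of n] by simp
      ultimately show ?thesis by simp
    qed (auto simp: bump_def)
    have int: "integrable lborel (\<lambda>x. bump 1 0 x * (indicator I (u + x / k n) * f (u + x / k n)))" for n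
      by (rule Bochner_Integration.integrable_bound[OF iB meas], rule AE_I2, rule order_trans[OF bnd], simp)
    have shift: "k n * bump 1 0 (k n * ((u + 1 / k n * x) - u)) * (indicator I (u + 1 / k n * x) * f (u + 1 / k n * x))
      = k n * (bump 1 0 x * (indicator I (u + x / k n) * f (u + x / k n)))" for x n
      using k0[of n] by simp
    have "(\<lambda>n. LINT x|lborel. bump 1 0 x * (indicator I (u + x / k n) * f (u + x / k n)))
        \<longlonglongrightarrow> (LINT x|lborel. bump 1 0 x * f u)"
      by (rule integral_dominated_convergence[where w = "\<lambda>x. B * bump 1 0 x"])
        (use iB bm meas conv bnd in \<open>simp_all del: real_norm_def\<close>)
    moreover have "(LINT x|lborel. bump 1 0 x * f u) = Z * f u"
      using has_integral_bump by (simp add: has_bochner_integral_iff Z_def)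
    moreover have "(LINT r|lborel. k n * bump 1 0 (k n * (r - u)) * (indicator I r * f r)) =
       (LINT x|lborel. bump 1 0 x * (indicator I (u + x / k n) * f (u + x / k n)))" for n
      using k0[of n] lborel_integral_real_affine[where c = "1 / k n" and t = u and
          f = "\<lambda>r. k n * bump 1 0 (k n * (r - u)) * (indicator I r * f r)"]
      unfolding shift by simp
    ultimately show "(\<lambda>n. LINT r|lborel. k n * bump 1 0 (k n * (r - u)) * (indicator I r * f r)) \<longlonglongrightarrow> Z * f u"
      by (simp only:)
    show "integrable lborel (\<lambda>r. k n * bump 1 0 (k n * (r - u)) * (indicator I r * f r))"
    proof (subst lborel_integrable_real_affine_iff[where c = "1 / k n" and t = u, symmetric])
      show "1 / k n \<noteq> 0" using k0[of n] by simp
      show "integrable lborel (\<lambda>x. k n * bump 1 0 (k n * (u + 1 / k n * x - u)) * (indicator I (u + 1 / k n * x) * f (u + 1 / k n * x)))"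
        unfolding shift using int[of n] by simp
    qed
  qed
  have "(LINT r:I|lborel. deriv (plateau (k n) s t) r * f r) =
    (LINT r|lborel. k n * bump 1 0 (k n * (r - s)) * (indicator I r * f r))
    - (LINT r|lborel. k n * bump 1 0 (k n * (r - t)) * (indicator I r * f r))" for n
  proof -
    have "(LINT r:I|lborel. deriv (plateau (k n) s t) r * f r) =
      (LINT r|lborel. k n * bump 1 0 (k n * (r - s)) * (indicator I r * f r)
        - k n * bump 1 0 (k n * (r - t)) * (indicator I r * f r))"
      unfolding set_lebesgue_integral_def DERIV_imp_deriv[OF DERIV_plateau]
      by (simp add: algebra_simps)
    also have "\<dots> = (LINT r|lborel. k n * bump 1 0 (k n * (r - s)) * (indicator I r * f r))
      - (LINT r|lborel. k n * bump 1 0 (k n * (r - t)) * (indicator I r * f r))"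
      by (rule Bochner_Integration.integral_diff; rule int1; use st in simp)
    finally show ?thesis .
  qed
  then have L: "(\<lambda>n. LINT r:I|lborel. deriv (plateau (k n) s t) r * f r) \<longlonglongrightarrow> Z * f s - Z * f t"
    using tendsto_diff[OF lim1[of s] lim1[of t]] st by simp
  have "(\<lambda>n. LINT r|lborel. plateau (k n) s t r * (indicator {s..t + \<delta>} r * g r)) \<longlonglongrightarrow>
      (LINT r|lborel. Z * (indicator {s<..t} r * g r))"
  proof (rule integral_dominated_convergence[where w = "\<lambda>r. Z * \<bar>indicator {s..t + \<delta>} r * g r\<bar>"])
    have gm: "(\<lambda>r. indicator {s..t + \<delta>} r * g r) \<in> borel_measurable lborel"
      using gint by (simp add: set_integrable_def borel_measurable_integrable)
    \<comment> \<open>Local integrability gives measurability of g only after a cut-off to a compact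
      part of I.\<close>
    have "(\<lambda>r. Z * (indicator {s<..t} r * (indicator {s..t + \<delta>} r * g r))) \<in> borel_measurable lborel"
      using gm by measurable
    moreover have "indicator {s<..t} r * (indicator {s..t + \<delta>} r * g r) = indicator {s<..t} r * g r" for r
      using \<delta>(1) by (auto simp: indicator_def)
    ultimately show "(\<lambda>r. Z * (indicator {s<..t} r * g r)) \<in> borel_measurable lborel"
      by (simp only:)
    show "(\<lambda>r. plateau (k n) s t r * (indicator {s..t + \<delta>} r * g r)) \<in> borel_measurable lborel" for n
    proof -
      have "plateau (k n) s t \<in> borel_measurable borel"
        unfolding plateau_def[abs_def] using bi by measurable
      then show ?thesis using gm by measurable
    qed
    show "integrable lborel (\<lambda>r. Z * \<bar>indicator {s..t + \<delta>} r * g r\<bar>)"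
      using gint by (simp add: set_integrable_def)
    show "AE r in lborel. norm (plateau (k n) s t r * (indicator {s..t + \<delta>} r * g r)) \<le> Z * \<bar>indicator {s..t + \<delta>} r * g r\<bar>" for n
    proof (intro AE_I2)
      fix r
      have "\<bar>plateau (k n) s t r\<bar> \<le> Z"
        using bump_integral_bounds[of "k n * (r - s)"] bump_integral_bounds[of "k n * (r - t)"]
        by (simp add: plateau_def Z_def)
      then show "norm (plateau (k n) s t r * (indicator {s..t + \<delta>} r * g r)) \<le> Z * \<bar>indicator {s..t + \<delta>} r * g r\<bar>"
        by (simp add: abs_mult mult_right_mono)
    qed
    \<comment> \<open>At r = u the antiderivative is still zero, so the limiting step is strict
      there; this is why the interval is open at s and closed at t.\<close>
    have H: "(\<lambda>n. bump_integral (k n * (r - u))) \<longlonglongrightarrow> (if u < r then Z else 0)" for r u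
    proof (cases "u < r")
      case True
      have "filterlim (\<lambda>n. (r - u) * k n) at_top sequentially"
        using klim True by (intro filterlim_tendsto_pos_mult_at_top[OF tendsto_const]) auto
      then have "\<forall>\<^sub>F n in sequentially. 1 \<le> (r - u) * k n"
        by (auto simp: filterlim_at_top)
      then have "\<forall>\<^sub>F n in sequentially. bump_integral (k n * (r - u)) = Z"
        by eventually_elim (simp add: bump_integral_ge_1 Z_def mult.commute)
      then show ?thesis using True by (simp add: tendsto_eventually)
    next
      case False
      then have "bump_integral (k n * (r - u)) = 0" for n
        using k0[of n] by (intro bump_integral_le_0) (simp add: mult_nonneg_nonpos)
      then show ?thesis using False by simp
    qed
    show "AE r in lborel. (\<lambda>n. plateau (k n) s t r * (indicator {s..t + \<delta>} r * g r)) \<longlonglongrightarrow> Z * (indicator {s<..t} r * g r)"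
    proof (intro AE_I2)
      fix r
      have "(\<lambda>n. plateau (k n) s t r * (indicator {s..t + \<delta>} r * g r)) \<longlonglongrightarrow>
        ((if s < r then Z else 0) - (if t < r then Z else 0)) * (indicator {s..t + \<delta>} r * g r)"
        unfolding plateau_def by (intro tendsto_intros H)
      moreover have "((if s < r then Z else 0) - (if t < r then Z else 0)) * (indicator {s..t + \<delta>} r * g r) = Z * (indicator {s<..t} r * g r)"
        using st \<delta>(1) by (auto simp: indicator_def)
      ultimately show "(\<lambda>n. plateau (k n) s t r * (indicator {s..t + \<delta>} r * g r)) \<longlonglongrightarrow> Z * (indicator {s<..t} r * g r)"
        by simp
    qed
  qed
  moreover have "(LINT r|lborel. plateau (k n) s t r * (indicator {s..t + \<delta>} r * g r)) = (LINT r:I|lborel. plateau (k n) s t r * g r)" for n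
    unfolding set_lebesgue_integral_def
  proof (rule Bochner_Integration.integral_cong[OF refl])
    fix r
    have "plateau (k n) s t r = 0" if "r \<notin> {s..t + \<delta>}"
      using that kd[of n] by (intro plateau_outside[OF k0 st(3)]) auto
    then show "plateau (k n) s t r * (indicator {s..t + \<delta>} r * g r) = indicator I r *\<^sub>R (plateau (k n) s t r * g r)"
      using \<delta>(2) by (cases "r \<in> {s..t + \<delta>}") (auto simp: indicator_def)
  qed
  ultimately have "(\<lambda>n. LINT r:I|lborel. plateau (k n) s t r * g r) \<longlonglongrightarrow> Z * (LINT r:{s<..t}|lborel. g r)"
    by (simp add: set_lebesgue_integral_def)
  from LIMSEQ_unique[OF L tendsto_minus[OF this, folded eq]]
  have "Z * f s - Z * f t = - (Z * (LINT r:{s<..t}|lborel. g r))" .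
  then have "Z * (f t - f s) = Z * (LINT r:{s<..t}|lborel. g r)" by (simp add: algebra_simps)
  then show ?thesis using bump_mass_pos by (simp add: Z_def)
qed

section \<open>Cells of the torus and the embedding\<close>

lemma compact_torus: "compact (UNIV :: 'd::finite torus set)"
proof -
  have "(UNIV :: 'd torus set) \<subseteq> proj ` cbox 0 1"
  proof
    fix p :: "'d torus"
    obtain y where "proj y = proj (rep_torus p)" "y \<in> cbox 0 1" by (rule proj_cube)
    then show "p \<in> proj ` cbox 0 1" by (auto intro!: image_eqI[of _ _ y])
  qed
  then have "(UNIV :: 'd torus set) = proj ` cbox 0 1" by auto
  then show ?thesis
    using compact_continuous_image[OF continuous_on_proj compact_cbox, of "0 :: real ^ 'd" 1] by simp
qed

lemma bounded_continuous_torus: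
  fixes \<psi> :: "'d::finite torus \<Rightarrow> real"
  shows "continuous_on UNIV \<psi> \<Longrightarrow> bounded (range \<psi>)"
  by (intro compact_imp_bounded compact_continuous_image compact_torus)

lemma measurable_proj [measurable]: "proj \<in> borel_measurable borel"
  by (intro borel_measurable_continuous_onI continuous_on_proj)

text \<open>Half-open, so that \<open>hbox 0 1\<close> meets every class of the torus exactly once
  and the cells do not overlap.\<close>

definition hbox :: "real ^ 'd \<Rightarrow> real ^ 'd \<Rightarrow> (real ^ 'd::finite) set" where
  "hbox a b = {y. \<forall>i. a $ i \<le> y $ i \<and> y $ i < b $ i}"

text \<open>An exhaustion by compact boxes, needed because continuous maps send compact sets to
  closed sets but give no such control over half-open ones.\<close>

lemma hbox_eq_Union: "hbox a b = (\<Union>k. cbox a (\<chi> i. b $ i - 1 / real (Suc k)))"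
proof (intro equalityI subsetI)
  fix y assume y: "y \<in> hbox a b"
  have "\<forall>i. \<exists>k. 1 / real (Suc k) < b $ i - y $ i"
  proof
    fix i
    show "\<exists>k. 1 / real (Suc k) < b $ i - y $ i"
      using y reals_Archimedean[of "b $ i - y $ i"] by (simp add: hbox_def inverse_eq_divide)
  qed
  then obtain k where k: "\<And>i. 1 / real (Suc (k i)) < b $ i - y $ i" by metis
  define K where "K = Max (range k)"
  have "1 / real (Suc K) \<le> 1 / real (Suc (k i))" for i
    by (intro divide_left_mono) (auto simp: K_def)
  then have "y $ i \<le> b $ i - 1 / real (Suc K)" for i using k[of i] by (smt (verit))
  then show "y \<in> (\<Union>k. cbox a (\<chi> i. b $ i - 1 / real (Suc k)))"
    using y by (auto simp: hbox_def mem_box_cart intro!: exI[of _ K])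
next
  fix y assume "y \<in> (\<Union>k. cbox a (\<chi> i. b $ i - 1 / real (Suc k)))"
  then obtain k where k: "\<And>i. a $ i \<le> y $ i" "\<And>i. y $ i \<le> b $ i - 1 / real (Suc k)"
    by (auto simp: mem_box_cart)
  have "0 < 1 / real (Suc k)" by simp
  then have "y $ i < b $ i" for i using k(2)[of i] by linarith
  then show "y \<in> hbox a b" using k(1) by (simp add: hbox_def)
qed

lemma sets_hbox [measurable]: "hbox a b \<in> sets borel"
  by (simp add: hbox_eq_Union)

text \<open>Continuous images of Borel sets need not be Borel; here the image is a countable union
  of compact sets.\<close>

lemma sets_proj_hbox:
  assumes "closed S"
  shows "proj ` (S \<inter> hbox a b) \<in> sets borel"
proof -
  have "proj ` (S \<inter> hbox a b) = (\<Union>k. proj ` (S \<inter> cbox a (\<chi> i. b $ i - 1 / real (Suc k))))"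
    by (auto simp: hbox_eq_Union)
  moreover have "closed (proj ` (S \<inter> cbox a (\<chi> i. b $ i - 1 / real (Suc k))))" for k
    by (rule compact_imp_closed[OF compact_continuous_image[OF continuous_on_proj closed_Int_compact[OF assms compact_cbox]]])
  ultimately show ?thesis by auto
qed

section \<open>The fundamental domain and a Borel section of the projection\<close>

lemma proj_inj_on_hbox:
  assumes "x \<in> hbox 0 1" "y \<in> hbox 0 1" "proj x = proj y"
  shows "x = y"
proof -
  have "x $ i = y $ i" for i
  proof -
    have "x $ i - y $ i \<in> \<int>" using assms(3) by (simp add: proj_eq_iff torus_rel_def)
    then obtain k where k: "x $ i - y $ i = of_int k" by (auto elim: Ints_cases)
    have "\<bar>x $ i - y $ i\<bar> < 1" using assms(1,2) by (auto simp: hbox_def abs_less_iff) (smt (verit))+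
    then have "k = 0" using k by linarith
    then show ?thesis using k by simp
  qed
  then show ?thesis by (simp add: vec_eq_iff)
qed

text \<open>A Borel choice of representatives, in contrast to \<open>rep_torus\<close>, which is an
  arbitrary one. Fractional parts move it into the fundamental domain.\<close>

definition torus_section :: "'d::finite torus \<Rightarrow> real ^ 'd" where
  "torus_section p = (\<chi> i. frac (rep_torus p $ i))"

lemma proj_torus_section [simp]: "proj (torus_section p) = p"
proof -
  have "proj (torus_section p) = proj (rep_torus p)"
    unfolding proj_eq_iff torus_rel_def by (simp add: frac_def torus_section_def)
  then show ?thesis by simp
qed

lemma torus_section_in_hbox: "torus_section p \<in> hbox 0 1"
  by (simp add: hbox_def torus_section_def frac_lt_1)

lemma torus_section_proj: "y \<in> hbox 0 1 \<Longrightarrow> torus_section (proj y) = y"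
  by (rule proj_inj_on_hbox) (simp_all add: torus_section_in_hbox)

text \<open>The preimage of an open set is the complement of the projection of a closed set cut to
  the fundamental domain, and such projections are Borel.\<close>

lemma measurable_torus_section [measurable]: "torus_section \<in> borel_measurable borel"
proof (rule borel_measurableI)
  fix S :: "(real ^ 'a) set" assume "open S"
  have "torus_section -` S = - (proj ` (- S \<inter> hbox 0 1))"
  proof (intro equalityI subsetI)
    fix p assume "p \<in> torus_section -` S"
    then show "p \<in> - (proj ` (- S \<inter> hbox 0 1))" by (auto simp: torus_section_proj)
  next
    fix p assume *: "p \<in> - (proj ` (- S \<inter> hbox 0 1))"
    show "p \<in> torus_section -` S"
    proof (rule ccontr)
      assume "p \<notin> torus_section -` S"
      then have "torus_section p \<in> - S \<inter> hbox 0 1" using torus_section_in_hbox by auto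
      then have "proj (torus_section p) \<in> proj ` (- S \<inter> hbox 0 1)" by (rule imageI)
      with * show False by simp
    qed
  qed
  moreover have "proj ` (- S \<inter> hbox 0 1) \<in> sets borel"
    using \<open>open S\<close> by (intro sets_proj_hbox) auto
  ultimately show "torus_section -` S \<inter> space borel \<in> sets borel" by simp
qed

section \<open>Lebesgue measure of half-open cubes and of the torus\<close>

lemma emeasure_hbox:
  assumes "0 \<le> \<epsilon>"
  shows "emeasure lborel (hbox 0 (\<chi> i. \<epsilon>) :: (real ^ 'd::finite) set) = ennreal (\<epsilon> ^ CARD('d))"
proof -
  let ?v = "(\<chi> i. \<epsilon>) :: real ^ 'd"
  have b: "?v \<bullet> b = \<epsilon>" if "b \<in> Basis" for b
    using that by (auto simp: Basis_vec_def inner_axis)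
  have p: "(\<Prod>b\<in>Basis. (?v - 0) \<bullet> b) = \<epsilon> ^ CARD('d)" by (simp add: b)
  have "box 0 ?v \<subseteq> hbox 0 ?v" "hbox 0 ?v \<subseteq> cbox 0 ?v"
    by (auto simp: hbox_def mem_box_cart less_imp_le)
  then have "emeasure lborel (box 0 ?v) \<le> emeasure lborel (hbox 0 ?v)"
    "emeasure lborel (hbox 0 ?v) \<le> emeasure lborel (cbox 0 ?v)"
    by (auto intro!: emeasure_mono)
  moreover have "emeasure lborel (box 0 ?v) = ennreal (\<epsilon> ^ CARD('d))"
    using p b assms by (subst emeasure_lborel_box_eq) simp
  moreover have "emeasure lborel (cbox 0 ?v) = ennreal (\<epsilon> ^ CARD('d))"
    using p b assms by (subst emeasure_lborel_cbox_eq) simp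
  ultimately show ?thesis by simp
qed

lemma measure_hbox:
  "0 \<le> \<epsilon> \<Longrightarrow> measure lborel (hbox 0 (\<chi> i. \<epsilon>) :: (real ^ 'd::finite) set) = \<epsilon> ^ CARD('d)"
  by (simp add: measure_def emeasure_hbox)

lemma sets_torus_lebesgue [simp, measurable_cong]: "sets torus_lebesgue = sets borel"
  by (simp add: torus_lebesgue_def)

lemma torus_lebesgue_eq: "torus_lebesgue = distr (restrict_space lborel (hbox 0 1)) borel proj"
  by (simp add: torus_lebesgue_def hbox_def)

lemma measurable_proj_hbox [measurable]: "proj \<in> measurable (restrict_space lborel (hbox 0 1)) borel"
  by (rule measurable_restrict_space1) simp

lemma finite_torus_lebesgue: "finite_measure torus_lebesgue"
proof (rule finite_measureI)
  have "emeasure torus_lebesgue (UNIV :: 'a torus set) = emeasure lborel (hbox 0 1 :: (real ^ 'a) set)"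
    unfolding torus_lebesgue_eq
    by (subst emeasure_distr) (auto simp: space_restrict_space emeasure_restrict_space)
  also have "hbox 0 1 = (hbox 0 (\<chi> i. 1) :: (real ^ 'a) set)" by (simp add: hbox_def)
  finally have "emeasure torus_lebesgue (UNIV :: 'a torus set) = 1" by (simp add: emeasure_hbox)
  then show "emeasure torus_lebesgue (space (torus_lebesgue :: 'a torus measure)) \<noteq> \<infinity>"
    by (simp add: torus_lebesgue_def)
qed

section \<open>Cells of the rescaled torus and means over them\<close>

definition corner :: "real \<Rightarrow> int ^ 'd::finite \<Rightarrow> real ^ 'd" where
  "corner \<epsilon> z = (\<chi> i. \<epsilon> * real_of_int (z $ i))"

lemma cell_eq: "cell \<epsilon> z = proj ` hbox (corner \<epsilon> z) (corner \<epsilon> z + (\<chi> i. \<epsilon>))"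
  by (simp add: cell_def hbox_def corner_def)

lemma sets_cell [measurable]: "cell \<epsilon> z \<in> sets borel"
  using sets_proj_hbox[of UNIV] by (simp add: cell_eq)

definition inverse_nat :: "real \<Rightarrow> bool" where
  "inverse_nat \<epsilon> \<longleftrightarrow> 0 < \<epsilon> \<and> 1 / \<epsilon> \<in> \<nat>"

lemma inverse_nat_floor: "inverse_nat \<epsilon> \<Longrightarrow> \<epsilon> * real_of_int \<lfloor>1 / \<epsilon>\<rfloor> = 1"
  by (auto simp: inverse_nat_def elim!: Nats_cases) (simp add: field_simps)

lemma Z_eps_subset: "Z_eps \<epsilon> \<subseteq> (\<lambda>f. \<chi> i. f i) ` (PiE (UNIV :: 'd::finite set) (\<lambda>_. {0..<\<lfloor>1 / \<epsilon>\<rfloor>}))"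
proof
  fix z :: "int ^ 'd" assume "z \<in> Z_eps \<epsilon>"
  then have "(\<lambda>i. z $ i) \<in> PiE UNIV (\<lambda>_. {0..<\<lfloor>1 / \<epsilon>\<rfloor>})" by (auto simp: Z_eps_def)
  moreover have "z = (\<chi> i. z $ i)" by simp
  ultimately show "z \<in> (\<lambda>f. \<chi> i. f i) ` (PiE UNIV (\<lambda>_. {0..<\<lfloor>1 / \<epsilon>\<rfloor>}))" by blast
qed

lemma finite_Z_eps: "finite (Z_eps \<epsilon> :: (int ^ 'd::finite) set)"
  by (rule finite_subset[OF Z_eps_subset]) (intro finite_imageI finite_PiE, auto)

lemma finite_X_eps [simp]: "finite (X_eps \<epsilon> :: ('d::finite, 'v::finite) vertex set)"
  by (simp add: X_eps_def finite_Z_eps)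

text \<open>Since 1/\<epsilon> is an integer, a residue is at most 1/\<epsilon> - 1 and its cell
  ends at 1 at the latest: no cell wraps around.\<close>

lemma hbox_cell_subset:
  assumes "inverse_nat \<epsilon>" "z \<in> Z_eps \<epsilon>"
  shows "hbox (corner \<epsilon> z) (corner \<epsilon> z + (\<chi> i. \<epsilon>)) \<subseteq> hbox 0 1"
proof
  fix y assume y: "y \<in> hbox (corner \<epsilon> z) (corner \<epsilon> z + (\<chi> i. \<epsilon>))"
  have e: "0 < \<epsilon>" using assms(1) by (simp add: inverse_nat_def)
  have "0 \<le> y $ i \<and> y $ i < 1" for i
  proof -
    have "z $ i \<in> {0..<\<lfloor>1 / \<epsilon>\<rfloor>}" using assms(2) by (simp add: Z_eps_def)
    then have z: "0 \<le> z $ i" "z $ i + 1 \<le> \<lfloor>1 / \<epsilon>\<rfloor>" by auto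
    have "real_of_int (z $ i + 1) \<le> real_of_int \<lfloor>1 / \<epsilon>\<rfloor>" using z(2) by (simp only: of_int_le_iff)
    then have "\<epsilon> * real_of_int (z $ i + 1) \<le> 1"
      using inverse_nat_floor[OF assms(1)] e mult_left_mono[of "real_of_int (z $ i + 1)" "real_of_int \<lfloor>1 / \<epsilon>\<rfloor>" \<epsilon>] by simp
    moreover have "0 \<le> \<epsilon> * real_of_int (z $ i)" using e z(1) by simp
    ultimately show ?thesis using y by (auto simp: hbox_def corner_def distrib_left dest!: spec[of _ i])
  qed
  then show "y \<in> hbox 0 1" by (simp add: hbox_def)
qed

text \<open>The mean over the cell of z, written as an integral over the box at the origin, so that
  means over two cells can be compared point by point.\<close>

definition cell_mean :: "real \<Rightarrow> ('d::finite torus \<Rightarrow> real) \<Rightarrow> int ^ 'd \<Rightarrow> real" where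
  "cell_mean \<epsilon> \<psi> z = (\<integral>w. indicator (hbox 0 (\<chi> i. \<epsilon>)) w * \<psi> (proj (corner \<epsilon> z + w)) \<partial>lborel) / \<epsilon> ^ CARD('d)"

lemma integrable_indicator_bounded:
  fixes h :: "'a \<Rightarrow> real"
  assumes "A \<in> sets M" "emeasure M A < \<infinity>" "h \<in> borel_measurable M" "\<And>x. x \<in> A \<Longrightarrow> \<bar>h x\<bar> \<le> B"
  shows "integrable M (\<lambda>x. indicator A x * h x)"
proof (rule Bochner_Integration.integrable_bound)
  show "integrable M (\<lambda>x. B * indicator A x)" using assms by (intro integrable_mult_right integrable_real_indicator)
  show "(\<lambda>x. indicator A x * h x) \<in> borel_measurable M" using assms by measurable
  have "\<bar>h x\<bar> \<le> \<bar>B\<bar>" if "x \<in> A" for x using assms(4)[OF that] by linarith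
  then show "AE x in M. norm (indicator A x * h x) \<le> norm (B * indicator A x)"
    by (auto simp: indicator_def)
qed

lemma integrable_cell_mean:
  fixes \<psi> :: "'d::finite torus \<Rightarrow> real"
  assumes "\<psi> \<in> borel_measurable borel" "\<And>p. \<bar>\<psi> p\<bar> \<le> D" "0 < \<epsilon>"
  shows "integrable lborel (\<lambda>w. indicator (hbox 0 (\<chi> i. \<epsilon>)) w * \<psi> (proj (c + w)))"
proof (rule integrable_indicator_bounded)
  have "(\<lambda>w. proj (c + w)) \<in> borel_measurable borel" by (rule measurable_compose[OF _ measurable_proj]) simp
  from measurable_compose[OF this assms(1)] show "(\<lambda>w. \<psi> (proj (c + w))) \<in> borel_measurable lborel" by simp
qed (use assms in \<open>auto simp: emeasure_hbox\<close>)

text \<open>Unfolding the torus onto the fundamental domain turns each cell into a single half-open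
  box. The weight of x is then its mass divided by the volume of the box, which the mean
  absorbs.\<close>

lemma integral_iota_eps:
  fixes m :: "('d::finite, 'v::finite) vertex \<Rightarrow> real" and \<psi> :: "'d torus \<Rightarrow> real"
  assumes \<epsilon>: "inverse_nat \<epsilon>" and m: "\<And>x. x \<in> X_eps \<epsilon> \<Longrightarrow> 0 \<le> m x"
    and \<psi>: "\<psi> \<in> borel_measurable borel" "\<And>p. \<bar>\<psi> p\<bar> \<le> D"
  shows "(\<integral>p. \<psi> p \<partial>iota_eps \<epsilon> m) = (\<Sum>x\<in>X_eps \<epsilon>. m x * cell_mean \<epsilon> \<psi> (fst x))"
proof -
  have e: "0 < \<epsilon>" using \<epsilon> by (simp add: inverse_nat_def)
  let ?d = "CARD('d)"
  define h where "h p = (\<Sum>x\<in>X_eps \<epsilon>. m x * indicator (cell \<epsilon> (fst x)) p) / \<epsilon> ^ ?d" for p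
  have hm[measurable]: "h \<in> borel_measurable borel" unfolding h_def by measurable
  have h0: "0 \<le> h p" for p unfolding h_def using m e by (intro divide_nonneg_pos sum_nonneg) auto
  note \<psi>(1)[measurable]
  define Hb where "Hb z = hbox (corner \<epsilon> z) (corner \<epsilon> z + (\<chi> i. \<epsilon>))" for z :: "int ^ 'd"
  have Hb_meas[measurable]: "Hb z \<in> sets borel" for z by (simp add: Hb_def)
  have shift: "(\<integral>y. indicator (Hb z) y * \<psi> (proj y) \<partial>lborel) = (\<integral>w. indicator (hbox 0 (\<chi> i. \<epsilon>)) w * \<psi> (proj (corner \<epsilon> z + w)) \<partial>lborel)"
    and Hb_int: "integrable lborel (\<lambda>y. indicator (Hb z) y * \<psi> (proj y))" for z
  proof -
    have meas: "(\<lambda>y. indicator (Hb z) y * \<psi> (proj y)) \<in> borel_measurable borel" by measurable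
    have ind: "indicator (Hb z) (corner \<epsilon> z + w) = (indicator (hbox 0 (\<chi> i. \<epsilon>)) w :: real)" for w
      by (auto simp: indicator_def Hb_def hbox_def)
    have "(\<integral>y. indicator (Hb z) y * \<psi> (proj y) \<partial>lborel) = (\<integral>y. indicator (Hb z) y * \<psi> (proj y) \<partial>distr lborel borel ((+) (corner \<epsilon> z)))"
      by (simp add: lborel_distr_plus)
    also have "\<dots> = (\<integral>w. indicator (Hb z) (corner \<epsilon> z + w) * \<psi> (proj (corner \<epsilon> z + w)) \<partial>lborel)"
      by (rule integral_distr) (use meas in simp_all)
    finally show "(\<integral>y. indicator (Hb z) y * \<psi> (proj y) \<partial>lborel) = (\<integral>w. indicator (hbox 0 (\<chi> i. \<epsilon>)) w * \<psi> (proj (corner \<epsilon> z + w)) \<partial>lborel)"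
      by (simp add: ind)
    have "integrable (distr lborel borel ((+) (corner \<epsilon> z))) (\<lambda>y. indicator (Hb z) y * \<psi> (proj y))"
      using integrable_cell_mean[OF \<psi> e, of "corner \<epsilon> z"] meas
      by (subst integrable_distr_eq) (simp_all add: ind)
    then show "integrable lborel (\<lambda>y. indicator (Hb z) y * \<psi> (proj y))" by (simp add: lborel_distr_plus)
  qed
  \<comment> \<open>The box of a residue lies in the fundamental domain, where the projection is
    injective; hence a point of the domain projects into the cell only if it lies in the
    box.\<close>
  have cellH: "indicator (hbox 0 1) y * indicator (cell \<epsilon> z) (proj y) = (indicator (Hb z) y :: real)"
    if z: "z \<in> Z_eps \<epsilon>" for y z
  proof -
    have sub: "Hb z \<subseteq> hbox 0 1" unfolding Hb_def by (rule hbox_cell_subset[OF \<epsilon> z])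
    have "y \<in> Hb z" if "y \<in> hbox 0 1" "proj y \<in> cell \<epsilon> z"
    proof -
      obtain y' where y': "y' \<in> Hb z" "proj y = proj y'" using \<open>proj y \<in> cell \<epsilon> z\<close> by (auto simp: cell_eq Hb_def)
      then have "y = y'" using proj_inj_on_hbox that(1) sub by blast
      then show ?thesis using y' by simp
    qed
    moreover have "proj y \<in> cell \<epsilon> z" if "y \<in> Hb z" using that by (auto simp: cell_eq Hb_def)
    ultimately show ?thesis using sub by (auto simp: indicator_def)
  qed
  have "(\<integral>p. \<psi> p \<partial>iota_eps \<epsilon> m) = (\<integral>p. h p *\<^sub>R \<psi> p \<partial>torus_lebesgue)"
    unfolding iota_eps_def h_def[symmetric] using h0 by (intro integral_density) auto
  also have "\<dots> = (\<integral>y. h (proj y) *\<^sub>R \<psi> (proj y) \<partial>restrict_space lborel (hbox 0 1))"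
    unfolding torus_lebesgue_eq by (rule integral_distr) measurable
  also have "\<dots> = (\<integral>y. indicator (hbox 0 1) y *\<^sub>R (h (proj y) *\<^sub>R \<psi> (proj y)) \<partial>lborel)"
    by (rule integral_restrict_space) simp
  also have "\<dots> = (\<integral>y. (\<Sum>x\<in>X_eps \<epsilon>. m x / \<epsilon> ^ ?d * (indicator (Hb (fst x)) y * \<psi> (proj y))) \<partial>lborel)"
  proof (rule Bochner_Integration.integral_cong[OF refl])
    fix y
    have "indicator (hbox 0 1) y *\<^sub>R (h (proj y) *\<^sub>R \<psi> (proj y))
      = (\<Sum>x\<in>X_eps \<epsilon>. m x / \<epsilon> ^ ?d * (indicator (hbox 0 1) y * indicator (cell \<epsilon> (fst x)) (proj y) * \<psi> (proj y)))"
      unfolding h_def real_scaleR_def sum_divide_distrib sum_distrib_left sum_distrib_right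
      by (rule sum.cong) (simp_all add: mult_ac)
    also have "\<dots> = (\<Sum>x\<in>X_eps \<epsilon>. m x / \<epsilon> ^ ?d * (indicator (Hb (fst x)) y * \<psi> (proj y)))"
      by (intro sum.cong refl) (subst cellH, auto simp: X_eps_def)
    finally show "indicator (hbox 0 1) y *\<^sub>R (h (proj y) *\<^sub>R \<psi> (proj y)) = (\<Sum>x\<in>X_eps \<epsilon>. m x / \<epsilon> ^ ?d * (indicator (Hb (fst x)) y * \<psi> (proj y)))" .
  qed
  also have "\<dots> = (\<Sum>x\<in>X_eps \<epsilon>. m x / \<epsilon> ^ ?d * (\<integral>y. indicator (Hb (fst x)) y * \<psi> (proj y) \<partial>lborel))"
    using Hb_int by (subst Bochner_Integration.integral_sum) (auto intro!: integrable_mult_right)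
  also have "\<dots> = (\<Sum>x\<in>X_eps \<epsilon>. m x * cell_mean \<epsilon> \<psi> (fst x))"
    by (simp add: shift cell_mean_def)
  finally show ?thesis .
qed

lemma sets_iota_eps [simp]: "sets (iota_eps \<epsilon> m) = sets borel"
  by (simp add: iota_eps_def)

lemma finite_iota_eps:
  fixes m :: "('d::finite, 'v::finite) vertex \<Rightarrow> real"
  assumes "0 < \<epsilon>" and m: "\<And>x. x \<in> X_eps \<epsilon> \<Longrightarrow> 0 \<le> m x"
  shows "finite_measure (iota_eps \<epsilon> m)"
proof (rule finite_measureI)
  define h where "h p = (\<Sum>x\<in>X_eps \<epsilon>. m x * indicator (cell \<epsilon> (fst x)) p) / \<epsilon> ^ CARD('d)" for p
  define K where "K = (\<Sum>x\<in>X_eps \<epsilon>. m x) / \<epsilon> ^ CARD('d)"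
  have hm: "h \<in> borel_measurable borel" unfolding h_def by measurable
  have hK: "h p \<le> K" for p
    unfolding h_def K_def using assms by (intro divide_right_mono sum_mono) (auto simp: indicator_def)
  have "emeasure (iota_eps \<epsilon> m) UNIV = (\<integral>\<^sup>+p. ennreal (h p) \<partial>torus_lebesgue)"
    unfolding iota_eps_def h_def[symmetric] using hm
    by (subst emeasure_density) (auto intro!: nn_integral_cong)
  also have "\<dots> \<le> (\<integral>\<^sup>+p. ennreal K \<partial>(torus_lebesgue :: 'd torus measure))"
    by (intro nn_integral_mono ennreal_leI hK)
  also have "\<dots> < \<infinity>"
    using finite_measure.emeasure_finite[OF finite_torus_lebesgue, where ?'a1 = 'd]
    by (simp add: ennreal_mult_less_top less_top)
  finally show "emeasure (iota_eps \<epsilon> m) (space (iota_eps \<epsilon> m)) \<noteq> \<infinity>"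
    using sets_eq_imp_space_eq[OF sets_iota_eps[of \<epsilon> m]] by simp
qed

lemma cell_mean_const: "0 < \<epsilon> \<Longrightarrow> cell_mean \<epsilon> (\<lambda>p. c) z = (c::real)"
  by (simp add: cell_mean_def measure_hbox)

text \<open>Both means are integrals over the same box in w, so only the distance of corresponding
  points matters.\<close>

lemma cell_mean_diff:
  fixes \<psi> :: "'d::finite torus \<Rightarrow> real"
  assumes \<epsilon>: "0 < \<epsilon>" and \<psi>: "L-lipschitz_on UNIV \<psi>"
    and d: "\<And>w. dist (proj (corner \<epsilon> z + w)) (proj (corner \<epsilon> z' + w)) \<le> \<delta>"
  shows "\<bar>cell_mean \<epsilon> \<psi> z - cell_mean \<epsilon> \<psi> z'\<bar> \<le> L * \<delta>"
proof -
  let ?H = "hbox 0 (\<chi> i. \<epsilon>) :: (real ^ 'd) set"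
  have cont: "continuous_on UNIV \<psi>" by (rule lipschitz_on_continuous_on[OF \<psi>])
  then obtain D where D: "\<And>p. \<bar>\<psi> p\<bar> \<le> D"
    using bounded_continuous_torus[OF cont] by (auto simp: bounded_iff)
  have meas: "\<psi> \<in> borel_measurable borel" by (rule borel_measurable_continuous_onI[OF cont])
  note int = integrable_cell_mean[OF meas D \<epsilon>]
  have L: "0 \<le> L" using lipschitz_on_nonneg[OF \<psi>] .
  have iH: "integrable lborel (\<lambda>w. L * \<delta> * indicator ?H w)"
    using \<epsilon> by (intro integrable_mult_right integrable_real_indicator) (auto simp: emeasure_hbox)
  have "\<bar>(\<integral>w. indicator ?H w * \<psi> (proj (corner \<epsilon> z + w)) \<partial>lborel) - (\<integral>w. indicator ?H w * \<psi> (proj (corner \<epsilon> z' + w)) \<partial>lborel)\<bar>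
    = \<bar>\<integral>w. indicator ?H w * \<psi> (proj (corner \<epsilon> z + w)) - indicator ?H w * \<psi> (proj (corner \<epsilon> z' + w)) \<partial>lborel\<bar>"
    by (simp add: Bochner_Integration.integral_diff[OF int int])
  also have "\<dots> \<le> (\<integral>w. \<bar>indicator ?H w * \<psi> (proj (corner \<epsilon> z + w)) - indicator ?H w * \<psi> (proj (corner \<epsilon> z' + w))\<bar> \<partial>lborel)"
    by (rule integral_abs_bound)
  also have "\<dots> \<le> (\<integral>w. L * \<delta> * indicator ?H w \<partial>lborel)"
  proof (rule integral_mono[OF _ iH])
    show "integrable lborel (\<lambda>w. \<bar>indicator ?H w * \<psi> (proj (corner \<epsilon> z + w)) - indicator ?H w * \<psi> (proj (corner \<epsilon> z' + w))\<bar>)"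
      by (intro integrable_abs Bochner_Integration.integrable_diff int)
    fix w
    have "\<bar>\<psi> (proj (corner \<epsilon> z + w)) - \<psi> (proj (corner \<epsilon> z' + w))\<bar> \<le> L * dist (proj (corner \<epsilon> z + w)) (proj (corner \<epsilon> z' + w))"
      using lipschitz_onD[OF \<psi>] by (simp add: dist_real_def)
    also have "\<dots> \<le> L * \<delta>" by (intro mult_left_mono d L)
    finally show "\<bar>indicator ?H w * \<psi> (proj (corner \<epsilon> z + w)) - indicator ?H w * \<psi> (proj (corner \<epsilon> z' + w))\<bar> \<le> L * \<delta> * indicator ?H w"
      by (simp add: indicator_def)
  qed
  also have "\<dots> = L * \<delta> * \<epsilon> ^ CARD('d)" using \<epsilon> by (simp add: measure_hbox)
  finally show ?thesis
    using \<epsilon> by (simp add: cell_mean_def divide_le_eq flip: diff_divide_distrib)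
qed

section \<open>Weak compactness of measures and of integrable functions\<close>

text \<open>The Cantor set argument. At the first differing place i the sums differ by 2/3^(i + 1),
  and all later places together contribute at most 1/3^(i + 1). The remaining gap of 1/3^(i + 1) is
  at least 1/3^N; in base two it would close.\<close>

lemma ternary_digits_unique:
  fixes d d' :: "nat \<Rightarrow> real"
  assumes d: "\<And>j. d j \<in> {0, 1}" "\<And>j. d' j \<in> {0, 1}"
    and close: "\<bar>(\<Sum>j. d j * (2 / 3 * (1 / 3) ^ j)) - (\<Sum>j. d' j * (2 / 3 * (1 / 3) ^ j))\<bar> < (1 / 3) ^ N"
    and "j < N"
  shows "d j = d' j"
proof (rule ccontr)
  assume neq: "d j \<noteq> d' j"
  define i where "i = (LEAST i. d i \<noteq> d' i)"
  have i: "d i \<noteq> d' i" "i \<le> j" and less_i: "k < i \<Longrightarrow> d k = d' k" for k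
    using LeastI[of "\<lambda>i. d i \<noteq> d' i" j] Least_le[of "\<lambda>i. d i \<noteq> d' i" j] neq not_less_Least[of k "\<lambda>i. d i \<noteq> d' i"]
    by (auto simp: i_def)
  define a where "a k = 2 / 3 * (1 / 3 :: real) ^ k" for k
  define e where "e k = (d k - d' k) * a k" for k
  have a0: "0 < a k" for k by (simp add: a_def)
  have sa: "summable a" unfolding a_def by (intro summable_mult summable_geometric) simp
  have sm: "summable (\<lambda>k. x k * a k)" if "\<And>k. \<bar>x k\<bar> \<le> 1" for x
  proof (rule summable_comparison_test[OF _ sa], intro exI[of _ 0] allI impI)
    show "norm (x k * a k) \<le> a k" for k
      using mult_right_mono[OF that[of k], of "a k"] a0[of k] by (simp add: abs_mult)
  qed
  have d1: "\<bar>d k\<bar> \<le> 1" "\<bar>d' k\<bar> \<le> 1" "\<bar>d k - d' k\<bar> \<le> 1" for k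
    using d(1)[of k] d(2)[of k] by auto
  have se: "summable e" unfolding e_def by (rule sm) (rule d1)
  have ea: "\<bar>e k\<bar> \<le> a k" for k
    using d1(3)[of k] a0[of k] by (simp add: e_def abs_mult mult_left_le_one_le)
  have "(\<Sum>k. e k) = (\<Sum>k. d k * a k) - (\<Sum>k. d' k * a k)"
    using sm[OF d1(1)] sm[OF d1(2)] by (simp add: suminf_diff e_def left_diff_distrib)
  then have 1: "\<bar>\<Sum>k. e k\<bar> < (1 / 3) ^ N" using close by (simp add: a_def)
  have 2: "(\<Sum>k. e k) = (\<Sum>k. e (k + Suc i)) + (\<Sum>k<Suc i. e k)"
    by (rule suminf_split_initial_segment[OF se])
  have 3: "(\<Sum>k<Suc i. e k) = e i" by (simp add: e_def less_i)
  have 4: "\<bar>e i\<bar> = a i" using i(1) d(1)[of i] d(2)[of i] a0[of i] by (auto simp: e_def abs_mult)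
  have sai: "summable (\<lambda>k. a (k + Suc i))" by (rule summable_ignore_initial_segment[OF sa])
  have se_i: "summable (\<lambda>k. \<bar>e (k + Suc i)\<bar>)"
    by (rule summable_comparison_test[OF _ sai]) (use ea in auto)
  have "\<bar>\<Sum>k. e (k + Suc i)\<bar> \<le> (\<Sum>k. \<bar>e (k + Suc i)\<bar>)"
    using summable_rabs[OF se_i] .
  also have "\<dots> \<le> (\<Sum>k. a (k + Suc i))"
    by (rule suminf_le[OF ea se_i sai])
  also have "\<dots> = (\<Sum>k. 2 / 3 * (1 / 3) ^ Suc i * (1 / 3 :: real) ^ k)"
    by (simp add: a_def power_add mult_ac)
  also have "\<dots> = (1 / 3) ^ Suc i"
    by (subst suminf_mult) (simp_all add: suminf_geometric)
  finally have 5: "\<bar>\<Sum>k. e (k + Suc i)\<bar> \<le> (1 / 3) ^ Suc i" .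
  have "(1 / 3 :: real) ^ N \<le> (1 / 3) ^ Suc i"
    using i(2) \<open>j < N\<close> by (intro power_decreasing) auto
  moreover have "a i = 2 * (1 / 3) ^ Suc i" by (simp add: a_def)
  ultimately show False using 1 2 3 4 5 by linarith
qed

text \<open>A point is coded by ternary digits recording which balls of a countable family contain
  it. The code is merely Borel, but its inverse on the codes of K is uniformly continuous: close
  codes share many digits, hence a common small ball. Continuity of the decoding map is what weak
  convergence requires.\<close>

lemma compact_coding:
  fixes K :: "'a::euclidean_space set"
  assumes "compact K"
  obtains s :: "'a \<Rightarrow> real" and f :: "real \<Rightarrow> 'a"
  where "s \<in> borel_measurable borel" "\<And>y. s y \<in> {0..1}" "continuous_on UNIV f" "\<And>y. y \<in> K \<Longrightarrow> f (s y) = y"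
proof (cases "K = {}")
  case True
  show ?thesis by (rule that[of "\<lambda>_. 0" "\<lambda>_. 0"]) (use True in auto)
next
  case False
  define \<rho> where "\<rho> k = 1 / real (Suc k)" for k
  have "\<exists>C. finite C \<and> C \<subseteq> K \<and> K \<subseteq> (\<Union>c\<in>C. ball c (\<rho> k))" for k
  proof -
    have "K \<subseteq> (\<Union>c\<in>K. ball c (\<rho> k))" by (auto simp: \<rho>_def)
    then show ?thesis
      by (rule compactE_image[OF assms open_ball]) auto
  qed
  then obtain C where C: "\<And>k. finite (C k)" "\<And>k. C k \<subseteq> K" "\<And>k. K \<subseteq> (\<Union>c\<in>C k. ball c (\<rho> k))"
    by metis
  define W where "W = (\<Union>k. (\<lambda>c. ball c (\<rho> k)) ` C k)"
  have cW: "countable W" unfolding W_def by (intro countable_UN) (auto intro: countable_finite C(1))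
  define U where "U = from_nat_into W"
  have W_ne: "W \<noteq> {}" using False C(3) by (fastforce simp: W_def)
  have U_open: "open (U j)" for j
    using from_nat_into[OF W_ne, of j] by (auto simp: U_def W_def)
  define d where "d y j = (indicator (U j) y :: real)" for y j
  define s where "s y = (\<Sum>j. d y j * (2 / 3 * (1 / 3) ^ j))" for y
  have d01: "d y j \<in> {0, 1}" for y j by (auto simp: d_def indicator_def)
  have sg: "summable (\<lambda>j. 2 / 3 * (1 / 3 :: real) ^ j)" by (intro summable_mult summable_geometric) simp
  have sd: "summable (\<lambda>j. d y j * (2 / 3 * (1 / 3) ^ j))" for y
    by (rule summable_comparison_test[OF _ sg]) (auto simp: d_def indicator_def)
  have s_meas: "s \<in> borel_measurable borel"
    unfolding s_def d_def using U_open by (intro borel_measurable_suminf borel_measurable_times borel_measurable_indicator) auto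
  have s01: "s y \<in> {0..1}" for y
  proof -
    have "0 \<le> s y" unfolding s_def by (intro suminf_nonneg[OF sd]) (auto simp: d_def)
    moreover have "s y \<le> (\<Sum>j. 2 / 3 * (1 / 3 :: real) ^ j)"
      unfolding s_def by (intro suminf_le[OF _ sd sg]) (auto simp: d_def indicator_def)
    moreover have "(\<Sum>j. 2 / 3 * (1 / 3 :: real) ^ j) = 1"
      by (subst suminf_mult) (simp_all add: suminf_geometric)
    ultimately show ?thesis by simp
  qed
  have key: "\<exists>\<delta>>0. \<forall>y\<in>K. \<forall>y'\<in>K. \<bar>s y - s y'\<bar> < \<delta> \<longrightarrow> dist y y' < e" if "0 < e" for e
  proof -
    obtain k where k: "inverse (real (Suc k)) < e / 2"
      using reals_Archimedean[of "e / 2"] \<open>0 < e\<close> by auto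
    have "\<exists>j. U j = ball c (\<rho> k)" if "c \<in> C k" for c
      unfolding U_def by (rule from_nat_into_surj[OF cW]) (use that in \<open>auto simp: W_def\<close>)
    then obtain J where J: "\<And>c. c \<in> C k \<Longrightarrow> U (J c) = ball c (\<rho> k)" by metis
    \<comment> \<open>The first N digits decide membership in every ball of the k-th net, one of
      which contains y.\<close>
    define N where "N = Suc (Max (J ` C k))"
    show ?thesis
    proof (intro exI[of _ "(1 / 3) ^ N"] conjI ballI impI)
      fix y y' assume y: "y \<in> K" "y' \<in> K" and close: "\<bar>s y - s y'\<bar> < (1 / 3) ^ N"
      obtain c where c: "c \<in> C k" "y \<in> ball c (\<rho> k)" using C(3)[of k] y(1) by auto
      have "J c < N" unfolding N_def using c(1) C(1) by (auto intro: le_imp_less_Suc)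
      then have "d y (J c) = d y' (J c)"
        using close unfolding s_def by (intro ternary_digits_unique[where N = N and j = "J c" and d = "d y" and d' = "d y'"] d01)
      then have "y' \<in> ball c (\<rho> k)" using c J[OF c(1)] by (auto simp: d_def indicator_def split: if_splits)
      then have "dist y y' < \<rho> k + \<rho> k"
        using c(2) dist_triangle[of y y' c] by (simp add: dist_commute)
      also have "\<dots> < e" using k by (simp add: \<rho>_def inverse_eq_divide)
      finally show "dist y y' < e" .
    qed simp
  qed
  have inj: "inj_on s K"
  proof (rule inj_onI)
    fix y y' assume y: "y \<in> K" "y' \<in> K" "s y = s y'"
    then have "dist y y' < e" if "0 < e" for e using key[OF that] by auto
    from this[of "dist y y'"] show "y = y'" by (cases "y = y'") auto
  qed
  define f0 where "f0 = inv_into K s"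
  have f0: "f0 (s y) = y" if "y \<in> K" for y using that inj by (simp add: f0_def)
  have "uniformly_continuous_on (s ` K) f0"
    unfolding uniformly_continuous_on_def
  proof (intro allI impI)
    fix e :: real assume "0 < e"
    from key[OF this] obtain \<delta> where "0 < \<delta>" "\<forall>y\<in>K. \<forall>y'\<in>K. \<bar>s y - s y'\<bar> < \<delta> \<longrightarrow> dist y y' < e" by auto
    then show "\<exists>d>0. \<forall>x\<in>s ` K. \<forall>x'\<in>s ` K. dist x' x < d \<longrightarrow> dist (f0 x') (f0 x) < e"
      by (auto simp: f0 dist_real_def intro!: exI[of _ \<delta>])
  qed
  \<comment> \<open>The set of codes need not be closed, as s is not continuous. Uniform continuity
    extends the decoding to its closure, and Tietze extends it from there to the line.\<close>
  then obtain f1 where f1: "uniformly_continuous_on (closure (s ` K)) f1" "\<And>x. x \<in> s ` K \<Longrightarrow> f0 x = f1 x"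
    by (rule uniformly_continuous_on_extension_on_closure) blast
  obtain f where f: "continuous_on UNIV f" "\<And>x. x \<in> closure (s ` K) \<Longrightarrow> f x = f1 x"
    by (rule Tietze_unbounded[OF uniformly_continuous_imp_continuous[OF f1(1)], of UNIV]) auto
  have "f (s y) = y" if "y \<in> K" for y
  proof -
    have "s y \<in> s ` K" using that by simp
    moreover from this have "s y \<in> closure (s ` K)" by (rule subsetD[OF closure_subset])
    ultimately show ?thesis using f(2)[of "s y"] f1(2)[of "s y"] f0[OF that] by simp
  qed
  then show ?thesis by (rule that[OF s_meas s01 f(1)])
qed

lemma integral_bounded_finite_measure:
  fixes h :: "'a \<Rightarrow> real"
  assumes "finite_measure N" "h \<in> borel_measurable N" "\<And>x. \<bar>h x\<bar> \<le> B"
  shows "integrable N h" "\<bar>\<integral>x. h x \<partial>N\<bar> \<le> B * measure N (space N)"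
proof -
  interpret finite_measure N by fact
  show i: "integrable N h" using assms by (intro integrable_const_bound[of h B]) auto
  have "\<bar>\<integral>x. h x \<partial>N\<bar> \<le> (\<integral>x. \<bar>h x\<bar> \<partial>N)" by (rule integral_abs_bound)
  also have "\<dots> \<le> (\<integral>x. B \<partial>N)" using assms i by (intro integral_mono) auto
  finally show "\<bar>\<integral>x. h x \<partial>N\<bar> \<le> B * measure N (space N)" by (simp add: mult.commute)
qed

text \<open>Coding the points by reals reduces Prokhorov's theorem to the one on the real line.\<close>

lemma weak_compactness_coded:
  fixes \<nu> :: "nat \<Rightarrow> 'a::metric_space measure" and \<sigma> :: "'a \<Rightarrow> real" and g :: "real \<Rightarrow> 'a"
  assumes \<nu>: "\<And>n. sets (\<nu> n) = sets borel" "\<And>n. finite_measure (\<nu> n)" "\<And>n. measure (\<nu> n) UNIV \<le> B"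
    and \<sigma>: "\<sigma> \<in> borel_measurable borel" "\<And>p. \<sigma> p \<in> {0..1}"
    and g: "continuous_on UNIV g" "\<And>p. g (\<sigma> p) = p"
  obtains r :: "nat \<Rightarrow> nat" and \<mu> where "strict_mono r" "sets \<mu> = sets borel" "finite_measure \<mu>"
    "\<And>\<psi> :: 'a \<Rightarrow> real. continuous_on UNIV \<psi> \<Longrightarrow> bounded (range \<psi>) \<Longrightarrow> (\<lambda>n. \<integral>p. \<psi> p \<partial>\<nu> (r n)) \<longlonglongrightarrow> (\<integral>p. \<psi> p \<partial>\<mu>)"
proof -
  define M where "M n = measure (\<nu> n) UNIV" for n
  have sp: "space (\<nu> n) = UNIV" for n using sets_eq_imp_space_eq[OF \<nu>(1)] by simp
  have M0: "0 \<le> M n" for n by (simp add: M_def)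
  have emM: "emeasure (\<nu> n) UNIV = ennreal (M n)" for n
    unfolding M_def using \<nu>(2)[of n] by (simp add: finite_measure.emeasure_eq_measure)
  note \<nu>(1)[measurable_cong] \<sigma>(1)[measurable]
  have \<sigma>m: "\<sigma> \<in> measurable (\<nu> n) borel" for n by measurable
  \<comment> \<open>For zero mass any law on the unit interval will do, because its integrals are
    multiplied by M n = 0 later.\<close>
  define P where "P n = (if M n = 0 then return borel 0
    else distr (density (\<nu> n) (\<lambda>_. ennreal (1 / M n))) borel \<sigma>)" for n
  have setsP[measurable_cong, simp]: "sets (P n) = sets borel" for n by (simp add: P_def)
  have P_Icc: "emeasure (P n) A = 1" if A: "A \<in> sets borel" "{0..1} \<subseteq> A" for n A
  proof (cases "M n = 0")
    case False
    have "\<sigma> -` A \<inter> UNIV = UNIV" using subsetD[OF A(2) \<sigma>(2)] by auto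
    then have "emeasure (P n) A = ennreal (1 / M n) * ennreal (M n)"
      using False A by (simp add: P_def emeasure_distr emeasure_density_const sp emM \<sigma>m)
    also have "\<dots> = 1" using False M0[of n] by (simp flip: ennreal_mult' add: ennreal_1[symmetric] del: ennreal_1)
    finally show ?thesis .
  qed (use A in \<open>auto simp: P_def indicator_def\<close>)
  have rd: "real_distribution (P n)" for n
  proof -
    have "prob_space (P n)"
      by (rule prob_spaceI) (use P_Icc[of UNIV n] sets_eq_imp_space_eq[OF setsP[of n]] in simp)
    then show ?thesis by (simp add: real_distribution_def real_distribution_axioms_def)
  qed
  have tight: "tight P"
    unfolding tight_def
  proof (intro conjI allI impI rd)
    fix \<epsilon> :: real assume "0 < \<epsilon>"
    \<comment> \<open>All laws live on the unit interval; the left end -1 keeps the point 0 inside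
      the half-open interval.\<close>
    have "measure (P n) {-1<..1} = 1" for n
      by (subst measure_def, subst P_Icc) auto
    then show "\<exists>a b. a < b \<and> (\<forall>n. 1 - \<epsilon> < measure (P n) {a<..b})"
      using \<open>0 < \<epsilon>\<close> by (intro exI[of _ "-1"] exI[of _ 1]) auto
  qed
  have "bounded (range M)"
    unfolding bounded_iff using \<nu>(3) M0 by (auto intro!: exI[of _ B] simp: M_def)
  then obtain c r1 where r1: "strict_mono (r1 :: nat \<Rightarrow> nat)" "(M \<circ> r1) \<longlonglongrightarrow> c"
    using bounded_imp_convergent_subsequence by blast
  from tight_imp_convergent_subsubsequence[OF tight r1(1)] obtain r2 Q where
    r2: "strict_mono (r2 :: nat \<Rightarrow> nat)" "real_distribution Q" "weak_conv_m (P \<circ> r1 \<circ> r2) Q" by auto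
  define r where "r = r1 \<circ> r2"
  have c0: "0 \<le> c" using r1(2) M0 by (intro LIMSEQ_le_const[of "M \<circ> r1" c 0]) auto
  interpret Q: real_distribution Q by fact
  have gm[measurable]: "g \<in> borel_measurable borel" by (rule borel_measurable_continuous_onI[OF g(1)])
  \<comment> \<open>The limit law is decoded by g and rescaled by the limit of the masses. Test
    functions reach the line through g and therefore stay continuous there, although \<sigma> is
    only Borel.\<close>
  define \<mu> where "\<mu> = density (distr Q borel g) (\<lambda>_. ennreal c)"
  show thesis
  proof (rule that[of r \<mu>])
    show "strict_mono r" unfolding r_def using r1 r2 by (simp add: strict_mono_o)
    show "sets \<mu> = sets borel" by (simp add: \<mu>_def)
    show "finite_measure \<mu>"
    proof (rule finite_measureI)
      have "emeasure \<mu> UNIV = ennreal c * 1"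
        using Q.emeasure_space_1 by (simp add: \<mu>_def emeasure_density_const emeasure_distr)
      then show "emeasure \<mu> (space \<mu>) \<noteq> \<infinity>" by (simp add: \<mu>_def)
    qed
    fix \<psi> :: "'a \<Rightarrow> real" assume \<psi>: "continuous_on UNIV \<psi>" "bounded (range \<psi>)"
    have \<psi>m[measurable]: "\<psi> \<in> borel_measurable borel" by (rule borel_measurable_continuous_onI[OF \<psi>(1)])
    obtain D where D: "\<And>p. \<bar>\<psi> p\<bar> \<le> D" using \<psi>(2) by (auto simp: bounded_iff)
    have contg: "continuous_on UNIV (\<lambda>x. \<psi> (g x))"
      by (rule continuous_on_compose2[OF \<psi>(1) g(1)]) auto
    have "(\<lambda>n. \<integral>x. \<psi> (g x) \<partial>(P \<circ> r1 \<circ> r2) n) \<longlonglongrightarrow> (\<integral>x. \<psi> (g x) \<partial>Q)"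
    proof (rule weak_conv_imp_integral_bdd_continuous_conv[OF _ r2(2,3)])
      show "real_distribution ((P \<circ> r1 \<circ> r2) n)" for n using rd by simp
      show "isCont (\<lambda>x. \<psi> (g x)) x" for x using contg by (simp add: continuous_on_eq_continuous_at)
      show "norm (\<psi> (g x)) \<le> D" for x using D by simp
    qed
    then have "(\<lambda>n. (M \<circ> r1) (r2 n) * (\<integral>x. \<psi> (g x) \<partial>(P \<circ> r1 \<circ> r2) n)) \<longlonglongrightarrow> c * (\<integral>x. \<psi> (g x) \<partial>Q)"
      using LIMSEQ_subseq_LIMSEQ[OF r1(2) r2(1)] by (intro tendsto_mult) (simp_all add: o_def)
    moreover have "M n * (\<integral>x. \<psi> (g x) \<partial>P n) = (\<integral>p. \<psi> p \<partial>\<nu> n)" for n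
    proof (cases "M n = 0")
      case True
      then show ?thesis
        using integral_bounded_finite_measure(2)[of "\<nu> n" \<psi> D] \<nu>(2) D by (simp add: sp M_def)
    next
      case False
      then have "(\<integral>x. \<psi> (g x) \<partial>P n) = (\<integral>p. \<psi> p \<partial>density (\<nu> n) (\<lambda>_. ennreal (1 / M n)))"
        by (simp add: P_def integral_distr g(2))
      also have "\<dots> = (\<integral>p. (1 / M n) *\<^sub>R \<psi> p \<partial>\<nu> n)"
        using M0[of n] by (intro integral_density) auto
      finally show ?thesis using False by simp
    qed
    moreover have "(\<integral>p. \<psi> p \<partial>\<mu>) = c * (\<integral>x. \<psi> (g x) \<partial>Q)"
    proof -
      have "(\<integral>p. \<psi> p \<partial>\<mu>) = (\<integral>p. c *\<^sub>R \<psi> p \<partial>distr Q borel g)"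
        unfolding \<mu>_def using c0 by (intro integral_density) auto
      also have "\<dots> = c * (\<integral>x. \<psi> (g x) \<partial>Q)" by (simp add: integral_distr)
      finally show ?thesis .
    qed
    ultimately show "(\<lambda>n. \<integral>p. \<psi> p \<partial>\<nu> (r n)) \<longlonglongrightarrow> (\<integral>p. \<psi> p \<partial>\<mu>)"
      by (simp add: r_def o_def)
  qed
qed

text \<open>Lipschitz functions increasing to the indicator of an open set. The whole space is
  treated separately because \<open>infdist\<close> to the empty set is 0 by convention.\<close>

definition open_approx :: "'a::metric_space set \<Rightarrow> nat \<Rightarrow> 'a \<Rightarrow> real" where
  "open_approx U k x = (if U = UNIV then 1 else min 1 (real k * infdist x (- U)))"

lemma open_approx_bounds: "0 \<le> open_approx U k x" "open_approx U k x \<le> 1"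
  by (auto simp: open_approx_def infdist_nonneg)

lemma open_approx_outside: "x \<notin> U \<Longrightarrow> open_approx U k x = 0"
  by (auto simp: open_approx_def)

lemma open_approx_lipschitz: "\<bar>open_approx U k x - open_approx U k y\<bar> \<le> real k * dist x y"
proof -
  have "\<bar>infdist x (- U) - infdist y (- U)\<bar> \<le> dist x y"
    using infdist_triangle[of x "- U" y] infdist_triangle[of y "- U" x] by (simp add: dist_commute abs_le_iff)
  then have "real k * \<bar>infdist x (- U) - infdist y (- U)\<bar> \<le> real k * dist x y"
    by (rule mult_left_mono) simp
  moreover have "\<bar>min 1 a - min 1 b\<bar> \<le> \<bar>a - b\<bar>" for a b :: real by linarith
  then have "\<bar>min 1 (real k * infdist x (- U)) - min 1 (real k * infdist y (- U))\<bar>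
      \<le> \<bar>real k * infdist x (- U) - real k * infdist y (- U)\<bar>" .
  moreover have "\<bar>real k * infdist x (- U) - real k * infdist y (- U)\<bar> = real k * \<bar>infdist x (- U) - infdist y (- U)\<bar>"
    by (simp add: abs_mult flip: right_diff_distrib)
  ultimately show ?thesis by (auto simp: open_approx_def)
qed

lemma open_approx_continuous: "continuous_on S (open_approx U k)"
proof -
  have "(real k)-lipschitz_on S (open_approx U k)"
    using open_approx_lipschitz[of U k] by (intro lipschitz_onI) (auto simp: dist_real_def)
  then show ?thesis by (rule lipschitz_on_continuous_on)
qed

lemma open_approx_tendsto:
  assumes "open U"
  shows "(\<lambda>k. open_approx U k x) \<longlonglongrightarrow> indicator U x"
proof (cases "x \<in> U \<and> U \<noteq> UNIV")
  case True
  then have pos: "0 < infdist x (- U)"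
    using assms in_closed_iff_infdist_zero[of "- U" x] infdist_nonneg[of x "- U"]
    by (auto simp: less_le)
  then obtain n where n: "1 < real n * infdist x (- U)"
    using reals_Archimedean3 by blast
  have "\<forall>\<^sub>F k in sequentially. open_approx U k x = 1"
    using eventually_ge_at_top[of n]
  proof eventually_elim
    case (elim k)
    then have "real n * infdist x (- U) \<le> real k * infdist x (- U)"
      using pos by (intro mult_right_mono) auto
    then show ?case using n by (simp add: open_approx_def min_def)
  qed
  then show ?thesis using True by (simp add: tendsto_eventually)
next
  case False
  then consider "x \<notin> U" | "U = UNIV" by blast
  then show ?thesis by cases (auto simp: open_approx_outside, simp add: open_approx_def)
qed

lemma measure_open_approx:
  fixes N :: "'a::metric_space measure"
  assumes N: "finite_measure N" "sets N = sets borel" and "open U"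
  shows "(\<lambda>k. \<integral>x. open_approx U k x \<partial>N) \<longlonglongrightarrow> measure N U"
proof -
  interpret finite_measure N by fact
  have [measurable]: "open_approx U k \<in> borel_measurable N" for k
    using borel_measurable_continuous_onI[OF open_approx_continuous] N(2) by (simp cong: measurable_cong_sets)
  have [measurable]: "U \<in> sets N" using assms by simp
  have "(\<lambda>k. \<integral>x. open_approx U k x \<partial>N) \<longlonglongrightarrow> (\<integral>x. indicator U x \<partial>N)"
    by (rule integral_dominated_convergence[where w = "\<lambda>_. 1"])
      (auto simp: open_approx_bounds open_approx_tendsto[OF \<open>open U\<close>])
  then show ?thesis by simp
qed

text \<open>The extra mass on \<open>{b<..b + 1}\<close> keeps the total masses away
  from zero, so that normalisation is harmless.\<close>

lemma weak_L1_compactness: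
  fixes u :: "nat \<Rightarrow> real \<Rightarrow> real"
  assumes I: "I = {a<..<b}" "a < b"
    and meas: "\<And>n. u n \<in> borel_measurable borel" and nonneg: "\<And>n x. 0 \<le> u n x"
    and support: "\<And>n x. x \<notin> I \<Longrightarrow> u n x = 0"
    and int: "\<And>n. integrable lborel (u n)" and bound: "\<And>n. (\<integral>x. u n x \<partial>lborel) \<le> B"
    and equi: "\<And>\<eta>. 0 < \<eta> \<Longrightarrow> \<exists>\<delta>>0. \<forall>n. \<forall>S\<in>sets borel. emeasure lborel S < ennreal \<delta> \<longrightarrow> (\<integral>x. indicator S x * u n x \<partial>lborel) \<le> \<eta>"
  obtains r :: "nat \<Rightarrow> nat" and v :: "real \<Rightarrow> real" where "strict_mono r" "v \<in> borel_measurable borel" "\<And>x. 0 \<le> v x"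
    "integrable lborel v"
    "\<And>s t. s \<in> I \<Longrightarrow> t \<in> I \<Longrightarrow> (\<lambda>n. \<integral>x. indicator {s<..t} x * u (r n) x \<partial>lborel) \<longlonglongrightarrow> (\<integral>x. indicator {s<..t} x * v x \<partial>lborel)"
proof -
  note meas[measurable]
  define w where "w n x = u n x + indicator {b<..b + 1} x" for n x
  have [measurable]: "w n \<in> borel_measurable borel" for n unfolding w_def by measurable
  have w0: "0 \<le> w n x" for n x by (simp add: w_def nonneg)
  have iw: "integrable lborel (w n)" for n
    unfolding w_def by (intro Bochner_Integration.integrable_add int integrable_real_indicator) auto
  define c where "c n = (\<integral>x. w n x \<partial>lborel)" for n
  have c_eq: "c n = (\<integral>x. u n x \<partial>lborel) + 1" for n
    unfolding c_def w_def by (subst Bochner_Integration.integral_add) (auto intro: int)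
  have c1: "1 \<le> c n" "c n \<le> B + 1" for n
    using bound[of n] integral_nonneg_AE[of "u n" lborel] nonneg by (auto simp: c_eq)
  define P where "P n = density lborel (\<lambda>x. ennreal (w n x / c n))" for n
  have [simp, measurable_cong]: "sets (P n) = sets borel" for n by (simp add: P_def)
  have iAw: "integrable lborel (\<lambda>x. indicator A x * w n x)" if "A \<in> sets borel" for A n
    using integrable_mult_indicator[OF _ iw[of n], of A] that by simp
  have emP: "emeasure (P n) A = ennreal ((\<integral>x. indicator A x * w n x \<partial>lborel) / c n)" if [measurable]: "A \<in> sets borel" for n A
  proof -
    have "emeasure (P n) A = (\<integral>\<^sup>+x. ennreal (indicator A x * w n x / c n) \<partial>lborel)"
      unfolding P_def by (subst emeasure_density) (auto intro!: nn_integral_cong simp: indicator_def)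
    also have "\<dots> = ennreal (\<integral>x. indicator A x * w n x / c n \<partial>lborel)"
      using iAw[OF that, of n] c1(1)[of n] w0 by (intro nn_integral_eq_integral) auto
    finally show ?thesis by simp
  qed
  have mP: "measure (P n) A = (\<integral>x. indicator A x * w n x \<partial>lborel) / c n" if "A \<in> sets borel" for n A
    unfolding measure_def emP[OF that] using c1(1)[of n] w0
    by (intro enn2real_ennreal) (auto intro!: divide_nonneg_pos integral_nonneg_AE)
  have rd: "real_distribution (P n)" for n
  proof -
    have "prob_space (P n)"
      by (rule prob_spaceI) (use emP[of UNIV n] c1(1)[of n] in \<open>simp add: c_def[symmetric] P_def\<close>)
    then show ?thesis by (simp add: real_distribution_def real_distribution_axioms_def)
  qed
  have tight: "tight P"
    unfolding tight_def
  proof (intro conjI allI impI rd)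
    fix \<epsilon> :: real assume "0 < \<epsilon>"
    have "measure (P n) {a<..b + 1} = 1" for n
    proof -
      have "indicator {a<..b + 1} x * w n x = w n x" for x
        using support[of x n] I by (auto simp: w_def indicator_def)
      then have "(\<integral>x. indicator {a<..b + 1} x * w n x \<partial>lborel) = c n" by (simp only: c_def)
      then show ?thesis using mP[of "{a<..b + 1}" n] c1(1)[of n] by simp
    qed
    then show "\<exists>a b. a < b \<and> (\<forall>n. 1 - \<epsilon> < measure (P n) {a<..b})"
      using \<open>0 < \<epsilon>\<close> I by (intro exI[of _ a] exI[of _ "b + 1"]) auto
  qed
  have "bounded (range c)"
    unfolding bounded_iff using c1 by (auto intro!: exI[of _ "B + 1"] simp: abs_le_iff) (metis add.inverse_inverse c1 dual_order.trans neg_le_0_iff_le zero_le_one add_increasing minus_le_iff)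
  then obtain cl r1 where r1: "strict_mono (r1 :: nat \<Rightarrow> nat)" "(c \<circ> r1) \<longlonglongrightarrow> cl"
    using bounded_imp_convergent_subsequence by blast
  from tight_imp_convergent_subsubsequence[OF tight r1(1)] obtain r2 Q where
    r2: "strict_mono (r2 :: nat \<Rightarrow> nat)" "real_distribution Q" "weak_conv_m (P \<circ> r1 \<circ> r2) Q" by auto
  define r where "r = r1 \<circ> r2"
  interpret Q: real_distribution Q by fact
  have cl1: "1 \<le> cl" using r1(2) c1 by (intro LIMSEQ_le_const[of "c \<circ> r1" cl 1]) auto
  have cr: "(\<lambda>n. c (r n)) \<longlonglongrightarrow> cl"
    using LIMSEQ_subseq_LIMSEQ[OF r1(2) r2(1)] by (simp add: o_def r_def)
  have rdr: "real_distribution ((P \<circ> r1 \<circ> r2) n)" for n using rd by simp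
  \<comment> \<open>A null set is enclosed in an open set of small measure by outer regularity;
    equi-integrability makes all P n small on that open set, and smallness on open sets survives
    weak limits.\<close>
  have ac: "absolutely_continuous lborel Q"
    unfolding absolutely_continuous_def
  proof
    fix N :: "real set" assume N: "N \<in> null_sets lborel"
    have "measure Q N \<le> \<eta>" if "0 < \<eta>" for \<eta>
    proof -
      obtain \<delta> where \<delta>: "0 < \<delta>" "\<And>n S. S \<in> sets borel \<Longrightarrow> emeasure lborel S < ennreal \<delta> \<Longrightarrow> (\<integral>x. indicator S x * u n x \<partial>lborel) \<le> \<eta> / 2"
        using equi[of "\<eta> / 2"] \<open>0 < \<eta>\<close> by auto
      \<comment> \<open>The second bound keeps the contribution of the added mass to U below
        \<eta>/2.\<close>
      define \<delta>' where "\<delta>' = min \<delta> (\<eta> / 2)"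
      have \<delta>': "0 < \<delta>'" using \<delta>(1) \<open>0 < \<eta>\<close> by (simp add: \<delta>'_def)
      obtain U where U: "open U" "N \<subseteq> U" "emeasure lborel (U - N) < ennreal \<delta>'"
        using outer_regular_lborel[OF _ \<delta>', of N] N by (auto simp: null_sets_def)
      have [measurable]: "U \<in> sets borel" using U by simp
      have eU: "emeasure lborel U < ennreal \<delta>'"
        using U(3) N emeasure_Diff_null_set[of N lborel U] by simp
      have lU: "measure lborel U \<le> \<eta> / 2"
        using eU \<delta>' enn2real_mono[of "emeasure lborel U" "ennreal \<delta>'"] by (simp add: measure_def \<delta>'_def)
      have fU: "emeasure lborel U < \<infinity>" using eU by (rule order.strict_trans) simp
      have PU: "measure (P n) U \<le> \<eta>" for n
      proof -
        have "(\<integral>x. indicator U x * w n x \<partial>lborel) = (\<integral>x. indicator U x * u n x \<partial>lborel) + (\<integral>x. indicator (U \<inter> {b<..b + 1}) x \<partial>lborel)"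
          using integrable_mult_indicator[OF _ int[of n], of U] fU
          by (subst Bochner_Integration.integral_add[symmetric])
            (auto simp: w_def distrib_left indicator_inter_arith intro!: integrable_real_indicator le_less_trans[OF emeasure_mono fU])
        also have "(\<integral>x. indicator (U \<inter> {b<..b + 1}) x \<partial>lborel) \<le> measure lborel U"
          using fU by (simp add: measure_mono_fmeasurable fmeasurableI)
        also have "(\<integral>x. indicator U x * u n x \<partial>lborel) \<le> \<eta> / 2"
          using eU \<delta>' by (intro \<delta>(2)) (auto simp: \<delta>'_def elim!: less_le_trans intro!: ennreal_leI)
        finally have *: "(\<integral>x. indicator U x * w n x \<partial>lborel) \<le> \<eta>" using lU by simp
        have "(\<integral>x. indicator U x * w n x \<partial>lborel) / c n \<le> (\<integral>x. indicator U x * w n x \<partial>lborel) / 1"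
          using c1(1)[of n] w0 by (intro divide_left_mono) (auto intro!: integral_nonneg_AE)
        then show ?thesis using * by (simp add: mP)
      qed
      \<comment> \<open>U need not be a continuity set of Q, so the bound is passed on through
        continuous functions below its indicator.\<close>
      have "(\<integral>x. open_approx U k x \<partial>Q) \<le> \<eta>" for k
      proof (rule LIMSEQ_le_const2)
        show "(\<lambda>n. \<integral>x. open_approx U k x \<partial>(P \<circ> r1 \<circ> r2) n) \<longlonglongrightarrow> (\<integral>x. open_approx U k x \<partial>Q)"
        proof (rule weak_conv_imp_integral_bdd_continuous_conv[OF rdr r2(2,3)])
          show "isCont (open_approx U k) x" for x
            using open_approx_continuous[of UNIV U k] by (simp add: continuous_on_eq_continuous_at)
          show "norm (open_approx U k x) \<le> 1" for x using open_approx_bounds[of U k x] by simp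
        qed
        have PU': "(\<integral>x. open_approx U k x \<partial>P n) \<le> measure (P n) U" for n
        proof -
          interpret real_distribution "P n" by (rule rd)
          have m: "open_approx U k \<in> borel_measurable borel"
            by (rule borel_measurable_continuous_onI[OF open_approx_continuous])
          have "(\<integral>x. open_approx U k x \<partial>P n) \<le> (\<integral>x. indicator U x \<partial>P n)"
          proof (rule integral_mono)
            show "integrable (P n) (open_approx U k)"
              using m by (intro integrable_const_bound[of _ 1]) (auto simp: open_approx_bounds)
            show "integrable (P n) (indicator U :: real \<Rightarrow> real)" by (intro integrable_real_indicator) (auto simp: less_top[symmetric])
            show "open_approx U k x \<le> indicator U x" for x
              using open_approx_bounds[of U k x] by (auto simp: indicator_def open_approx_outside)
          qed
          then show ?thesis by simp
        qed
        show "\<exists>N. \<forall>n\<ge>N. (\<integral>x. open_approx U k x \<partial>(P \<circ> r1 \<circ> r2) n) \<le> \<eta>"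
          unfolding comp_def by (intro exI[of _ 0] allI impI order_trans[OF PU' PU])
      qed
      moreover have "(\<lambda>k. \<integral>x. open_approx U k x \<partial>Q) \<longlonglongrightarrow> measure Q U"
        by (rule measure_open_approx) (auto intro: U Q.finite_measure_axioms)
      ultimately have "measure Q U \<le> \<eta>"
        by (intro LIMSEQ_le_const2) auto
      moreover have "measure Q N \<le> measure Q U" using U by (intro Q.finite_measure_mono) auto
      ultimately show ?thesis by simp
    qed
    then have "measure Q N \<le> 0" by (rule field_le_epsilon[of _ 0, simplified])
    then show "N \<in> null_sets Q"
      using N by (auto simp: null_sets_def Q.emeasure_eq_measure measure_le_0_iff)
  qed
  obtain p where p[measurable]: "p \<in> borel_measurable lborel" and pQ: "density lborel p = Q"
    using sigma_finite_measure.Radon_Nikodym[OF _ ac] by (auto simp: lborel.sigma_finite_measure_axioms)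
  have p_fin: "(\<integral>\<^sup>+x. p x \<partial>lborel) = 1"
    using Q.emeasure_space_1 emeasure_density[OF p, of UNIV] by (simp add: pQ)
  then have p_AE: "AE x in lborel. p x \<noteq> \<infinity>" by (intro nn_integral_PInf_AE) auto
  \<comment> \<open>Multiplying the density by the limit of the total masses undoes the
    normalisation.\<close>
  define v where "v x = cl * enn2real (p x)" for x
  have [measurable]: "v \<in> borel_measurable borel" unfolding v_def using p by measurable
  have v0: "0 \<le> v x" for x using cl1 by (simp add: v_def)
  have ip: "integrable lborel (\<lambda>x. enn2real (p x))"
  proof (rule integrableI_nonneg)
    have "(\<integral>\<^sup>+x. ennreal (enn2real (p x)) \<partial>lborel) = (\<integral>\<^sup>+x. p x \<partial>lborel)"
      using p_AE by (intro nn_integral_cong_AE) (auto simp: less_top)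
    then show "(\<integral>\<^sup>+x. ennreal (enn2real (p x)) \<partial>lborel) < \<infinity>" using p_fin by simp
  qed auto
  have mQ: "measure Q A = (\<integral>x. indicator A x * enn2real (p x) \<partial>lborel)" if [measurable]: "A \<in> sets borel" for A
  proof -
    have "emeasure Q A = (\<integral>\<^sup>+x. p x * indicator A x \<partial>lborel)"
      unfolding pQ[symmetric] by (subst emeasure_density) auto
    also have "\<dots> = (\<integral>\<^sup>+x. ennreal (indicator A x * enn2real (p x)) \<partial>lborel)"
      using p_AE by (intro nn_integral_cong_AE) (auto simp: less_top indicator_def)
    also have "\<dots> = ennreal (\<integral>x. indicator A x * enn2real (p x) \<partial>lborel)"
      using integrable_mult_indicator[OF _ ip, of A] by (intro nn_integral_eq_integral) auto
    finally show ?thesis by (simp add: measure_def integral_nonneg_AE)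
  qed
  show thesis
  proof (rule that[of r v])
    show "strict_mono r" unfolding r_def using r1 r2 by (simp add: strict_mono_o)
    show "integrable lborel v" unfolding v_def by (intro integrable_mult_right ip)
    fix s t assume st: "s \<in> I" "t \<in> I"
    \<comment> \<open>By absolute continuity the two endpoints carry no mass under Q, so weak
      convergence applies to the interval. The added mass lies to the right of b, hence of t, and is
      not seen.\<close>
    have "closure {s<..t} \<subseteq> {s..t}" by (intro closure_minimal) auto
    moreover have "{s<..<t} \<subseteq> interior {s<..t}" by (intro interior_maximal) auto
    ultimately have fr: "frontier {s<..t} \<subseteq> {s, t}" unfolding frontier_def by force
    have "frontier {s<..t} \<in> null_sets lborel"
      by (rule finite_imp_null_set_lborel[OF finite_subset[OF fr]]) simp
    then have "emeasure Q (frontier {s<..t}) = 0"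
      using subsetD[OF ac[unfolded absolutely_continuous_def]] by (simp add: null_setsD1)
    then have "(\<lambda>n. measure ((P \<circ> r1 \<circ> r2) n) {s<..t}) \<longlonglongrightarrow> measure Q {s<..t}"
      by (intro weak_conv_imp_continuity_set_conv[OF rdr r2(2,3)]) auto
    then have "(\<lambda>n. c (r n) * measure (P (r n)) {s<..t}) \<longlonglongrightarrow> cl * measure Q {s<..t}"
      by (intro tendsto_mult cr) (simp add: r_def)
    moreover have "c n * measure (P n) {s<..t} = (\<integral>x. indicator {s<..t} x * u n x \<partial>lborel)" for n
    proof -
      have "indicator {s<..t} x * w n x = indicator {s<..t} x * u n x" for x
        using st I by (auto simp: w_def indicator_def)
      then have "(\<integral>x. indicator {s<..t} x * w n x \<partial>lborel) = (\<integral>x. indicator {s<..t} x * u n x \<partial>lborel)"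
        by (simp only:)
      then show ?thesis using c1(1)[of n] by (simp add: mP)
    qed
    moreover have "cl * measure Q {s<..t} = (\<integral>x. indicator {s<..t} x * v x \<partial>lborel)"
      by (simp add: mQ v_def mult.left_commute)
    ultimately show "(\<lambda>n. \<integral>x. indicator {s<..t} x * u (r n) x \<partial>lborel) \<longlonglongrightarrow> (\<integral>x. indicator {s<..t} x * v x \<partial>lborel)"
      by simp
  qed (auto simp: v0)
qed

section \<open>Space-time measures\<close>

lemma measurable_continuous_on_lborel:
  "continuous_on I f \<Longrightarrow> f \<in> borel_measurable (restrict_space lborel I)" for f :: "real \<Rightarrow> real"
  using borel_measurable_continuous_on_restrict[of I f]
  by (simp cong: measurable_cong_sets add: measurable_def sets_restrict_space space_restrict_space)

text \<open>Continuity in time is asked for bounded Lipschitz functions, which is what flux bounds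
  provide. It is enough for a measurable kernel because indicators of open sets are limits of such
  functions.\<close>

locale measure_curve =
  fixes I :: "real set" and a b B :: real and \<kappa> :: "real \<Rightarrow> 'a::metric_space measure"
  assumes I: "I = {a<..<b}" "a < b"
    and sets_\<kappa>: "\<And>t. t \<in> I \<Longrightarrow> sets (\<kappa> t) = sets borel"
    and finite_\<kappa>: "\<And>t. t \<in> I \<Longrightarrow> finite_measure (\<kappa> t)"
    and bound_\<kappa>: "\<And>t. t \<in> I \<Longrightarrow> measure (\<kappa> t) UNIV \<le> B"
    and cont_\<kappa>: "\<And>\<psi> :: 'a \<Rightarrow> real. \<And>L. L-lipschitz_on UNIV \<psi> \<Longrightarrow> bounded (range \<psi>) \<Longrightarrow> continuous_on I (\<lambda>t. \<integral>x. \<psi> x \<partial>\<kappa> t)"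
begin

lemma space_\<kappa>: "t \<in> I \<Longrightarrow> space (\<kappa> t) = UNIV"
  using sets_eq_imp_space_eq[OF sets_\<kappa>] by simp

lemma measurable_\<kappa>: "t \<in> I \<Longrightarrow> measurable (\<kappa> t) N = measurable borel N"
  by (rule measurable_cong_sets[OF sets_\<kappa> refl])

lemma measurable_slice: "(\<lambda>x :: 'a. (t :: real, x)) \<in> measurable borel borel"
  by (intro borel_measurable_continuous_onI continuous_intros)

lemma sets_slice: "A \<in> sets borel \<Longrightarrow> {x :: 'a. (t :: real, x) \<in> A} \<in> sets borel"
  using measurable_sets[OF measurable_slice[of t], of A] by (simp add: vimage_def)

text \<open>The increment splits into a change of the integrand under a fixed measure, of size k |t
  - s| times the mass, and a change of the measure under a fixed integrand.\<close>

lemma continuous_integral_lipschitz: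
  fixes \<phi> :: "real \<times> 'a \<Rightarrow> real"
  assumes lip: "\<And>p q. \<bar>\<phi> p - \<phi> q\<bar> \<le> k * dist p q" and bnd: "\<And>p. \<bar>\<phi> p\<bar> \<le> D"
  shows "continuous_on I (\<lambda>t. \<integral>x. \<phi> (t, x) \<partial>\<kappa> t)"
  unfolding continuous_on_def
proof
  fix s assume s: "s \<in> I"
  have k: "0 \<le> k"
  proof (rule ccontr)
    assume "\<not> 0 \<le> k"
    then have "\<bar>\<phi> (0, undefined) - \<phi> (1, undefined)\<bar> < 0"
      using lip[of "(0, undefined)" "(1, undefined)"] by (simp add: dist_prod_def)
    then show False by simp
  qed
  have lips: "k-lipschitz_on UNIV (\<lambda>x. \<phi> (t, x))" for t
  proof (rule lipschitz_onI[OF _ k])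
    show "dist (\<phi> (t, x)) (\<phi> (t, y)) \<le> k * dist x y" for x y
      using lip[of "(t, x)" "(t, y)"] by (simp add: dist_real_def dist_prod_def)
  qed
  have bds: "bounded (range (\<lambda>x. \<phi> (t, x)))" for t
    unfolding bounded_iff using bnd by (auto intro!: exI[of _ D])
  have meas: "(\<lambda>x. \<phi> (t, x)) \<in> borel_measurable borel" for t
    by (intro borel_measurable_continuous_onI lipschitz_on_continuous_on[OF lips])
  have c: "((\<lambda>t. \<integral>x. \<phi> (s, x) \<partial>\<kappa> t) \<longlongrightarrow> (\<integral>x. \<phi> (s, x) \<partial>\<kappa> s)) (at s within I)"
    using cont_\<kappa>[OF lips bds, of s] s by (simp add: continuous_on_def)
  have d: "((\<lambda>t. (\<integral>x. \<phi> (t, x) \<partial>\<kappa> t) - (\<integral>x. \<phi> (s, x) \<partial>\<kappa> t)) \<longlongrightarrow> 0) (at s within I)"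
  proof (rule Lim_null_comparison)
    show "\<forall>\<^sub>F t in at s within I. norm ((\<integral>x. \<phi> (t, x) \<partial>\<kappa> t) - (\<integral>x. \<phi> (s, x) \<partial>\<kappa> t)) \<le> (k * \<bar>t - s\<bar>) * B"
      unfolding eventually_at_filter
    proof (intro always_eventually allI impI)
      fix t assume "t \<in> I"
      have i: "integrable (\<kappa> t) (\<lambda>x. \<phi> (u, x))" for u
        using finite_\<kappa>[OF \<open>t \<in> I\<close>] meas bnd by (intro integral_bounded_finite_measure(1)[where B = D]) (auto simp: measurable_\<kappa> \<open>t \<in> I\<close>)
      have "\<bar>\<integral>x. \<phi> (t, x) - \<phi> (s, x) \<partial>\<kappa> t\<bar> \<le> (k * \<bar>t - s\<bar>) * measure (\<kappa> t) (space (\<kappa> t))"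
      proof (rule integral_bounded_finite_measure(2)[OF finite_\<kappa>[OF \<open>t \<in> I\<close>]])
        show "(\<lambda>x. \<phi> (t, x) - \<phi> (s, x)) \<in> borel_measurable (\<kappa> t)"
          using meas by (simp add: measurable_\<kappa> \<open>t \<in> I\<close>)
        show "\<bar>\<phi> (t, x) - \<phi> (s, x)\<bar> \<le> k * \<bar>t - s\<bar>" for x
          using lip[of "(t, x)" "(s, x)"] by (simp add: dist_prod_def dist_real_def)
      qed
      also have "\<dots> \<le> (k * \<bar>t - s\<bar>) * B"
        using bound_\<kappa>[OF \<open>t \<in> I\<close>] k by (intro mult_left_mono) (auto simp: space_\<kappa> \<open>t \<in> I\<close>)
      finally show "norm ((\<integral>x. \<phi> (t, x) \<partial>\<kappa> t) - (\<integral>x. \<phi> (s, x) \<partial>\<kappa> t)) \<le> (k * \<bar>t - s\<bar>) * B"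
        using i by simp
    qed
    show "((\<lambda>t. (k * \<bar>t - s\<bar>) * B) \<longlongrightarrow> 0) (at s within I)"
      by (auto intro!: tendsto_eq_intros)
  qed
  from tendsto_add[OF d c] show "((\<lambda>t. \<integral>x. \<phi> (t, x) \<partial>\<kappa> t) \<longlongrightarrow> (\<integral>x. \<phi> (s, x) \<partial>\<kappa> s)) (at s within I)"
    by simp
qed

text \<open>Lipschitz approximations of the indicator of U in space-time reduce measurability to
  continuity in time.\<close>

lemma measurable_measure_open:
  assumes "open (U :: (real \<times> 'a) set)"
  shows "(\<lambda>t. measure (\<kappa> t) {x. (t, x) \<in> U}) \<in> borel_measurable (restrict_space lborel I)"
proof (rule borel_measurable_LIMSEQ_real)
  show "(\<lambda>t. \<integral>x. open_approx U k (t, x) \<partial>\<kappa> t) \<in> borel_measurable (restrict_space lborel I)" for k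
    by (intro measurable_continuous_on_lborel continuous_integral_lipschitz[where k = "real k" and D = 1])
      (auto simp: open_approx_lipschitz open_approx_bounds)
  fix t assume "t \<in> space (restrict_space lborel I)"
  then have t: "t \<in> I" by (simp add: space_restrict_space)
  interpret finite_measure "\<kappa> t" by (rule finite_\<kappa>[OF t])
  have m: "(\<lambda>x. open_approx U k (t, x)) \<in> borel_measurable (\<kappa> t)" for k
    unfolding measurable_\<kappa>[OF t]
    by (rule measurable_compose[OF measurable_slice borel_measurable_continuous_onI[OF open_approx_continuous]])
  have sl: "{x. (t, x) \<in> U} \<in> sets (\<kappa> t)" using sets_slice[of U t] assms sets_\<kappa>[OF t] by simp
  have "(\<lambda>k. \<integral>x. open_approx U k (t, x) \<partial>\<kappa> t) \<longlonglongrightarrow> (\<integral>x. indicator {x. (t, x) \<in> U} x \<partial>\<kappa> t)"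
  proof (rule integral_dominated_convergence[where w = "\<lambda>_. 1"])
    show "AE x in \<kappa> t. (\<lambda>k. open_approx U k (t, x)) \<longlonglongrightarrow> indicator {x. (t, x) \<in> U} x"
      using open_approx_tendsto[OF assms] by (simp add: indicator_def)
  qed (use m sl in \<open>auto simp: open_approx_bounds\<close>)
  then show "(\<lambda>k. \<integral>x. open_approx U k (t, x) \<partial>\<kappa> t) \<longlonglongrightarrow> measure (\<kappa> t) {x. (t, x) \<in> U}"
    using sl by simp
qed

text \<open>Open sets are closed under intersection and generate the Borel sets. The argument works
  in the product topology itself: without separability its Borel sets may exceed the product of the
  two Borel \<sigma>-algebras.\<close>

lemma measurable_measure:
  assumes "A \<in> sets (borel :: (real \<times> 'a) measure)"
  shows "(\<lambda>t. measure (\<kappa> t) {x. (t, x) \<in> A}) \<in> borel_measurable (restrict_space lborel I)"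
proof -
  have borel_eq: "sets (borel :: (real \<times> 'a) measure) = sigma_sets UNIV {S. open S}"
    by (simp add: borel_def)
  have cong: "(\<lambda>t. measure (\<kappa> t) {x. (t, x) \<in> A}) \<in> borel_measurable (restrict_space lborel I)"
    if "\<And>t. t \<in> I \<Longrightarrow> measure (\<kappa> t) {x. (t, x) \<in> A} = f t" "f \<in> borel_measurable (restrict_space lborel I)" for A f
    using that by (subst measurable_cong[of _ _ f]) (auto simp: space_restrict_space)
  have "Int_stable {S :: (real \<times> 'a) set. open S}" by (auto simp: Int_stable_def)
  moreover have "{S :: (real \<times> 'a) set. open S} \<subseteq> Pow UNIV" by simp
  moreover have "A \<in> sigma_sets UNIV {S. open S}" using assms borel_eq by simp
  ultimately show ?thesis
  proof (induction rule: sigma_sets_induct_disjoint)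
    case (basic A)
    then show ?case by (simp add: measurable_measure_open)
  next
    case empty
    then show ?case by simp
  next
    case (compl A)
    then have A: "A \<in> sets borel" using borel_eq by simp
    show ?case
    proof (rule cong)
      fix t assume t: "t \<in> I"
      interpret finite_measure "\<kappa> t" by (rule finite_\<kappa>[OF t])
      have "{x. (t, x) \<in> UNIV - A} = space (\<kappa> t) - {x. (t, x) \<in> A}" using space_\<kappa>[OF t] by auto
      then show "measure (\<kappa> t) {x. (t, x) \<in> UNIV - A} = measure (\<kappa> t) {x. (t, x) \<in> UNIV} - measure (\<kappa> t) {x. (t, x) \<in> A}"
        using sets_slice[OF A, of t] sets_\<kappa>[OF t] space_\<kappa>[OF t]
          finite_measure_compl[of "{x. (t, x) \<in> A}"] by (simp del: Collect_neg_eq)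
    next
      show "(\<lambda>t. measure (\<kappa> t) {x. (t, x) \<in> UNIV} - measure (\<kappa> t) {x. (t, x) \<in> A}) \<in> borel_measurable (restrict_space lborel I)"
        using compl measurable_measure_open[of UNIV] by (intro borel_measurable_diff) auto
    qed
  next
    case (union A)
    then have A: "A i \<in> sets borel" for i using borel_eq by auto
    show ?case
    proof (rule cong)
      fix t assume t: "t \<in> I"
      interpret finite_measure "\<kappa> t" by (rule finite_\<kappa>[OF t])
      have "(\<lambda>i. measure (\<kappa> t) {x. (t, x) \<in> A i}) sums measure (\<kappa> t) (\<Union>i. {x. (t, x) \<in> A i})"
        using sets_slice[OF A, of t] sets_\<kappa>[OF t] union
        by (intro finite_measure_UNION) (auto simp: disjoint_family_on_def, blast)
      moreover have "(\<Union>i. {x. (t, x) \<in> A i}) = {x. (t, x) \<in> \<Union> (range A)}" by auto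
      ultimately show "measure (\<kappa> t) {x. (t, x) \<in> \<Union> (range A)} = (\<Sum>i. measure (\<kappa> t) {x. (t, x) \<in> A i})"
        by (simp add: sums_iff)
    next
      show "(\<lambda>t. \<Sum>i. measure (\<kappa> t) {x. (t, x) \<in> A i}) \<in> borel_measurable (restrict_space lborel I)"
        using union by (intro borel_measurable_suminf) auto
    qed
  qed
qed

abbreviation "st \<equiv> spacetime_measure I \<kappa>"

lemma space_st: "space st = I \<times> UNIV"
  using sets_eq_imp_space_eq[OF sets_spacetime_measure[of I \<kappa>]] by (simp add: space_restrict_space)

lemma emeasure_\<kappa>: "t \<in> I \<Longrightarrow> emeasure (\<kappa> t) A = ennreal (measure (\<kappa> t) A)"
  using finite_measure.emeasure_eq_measure[OF finite_\<kappa>] .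

text \<open>Measurability of the slice masses is what makes the formula defining
  \<open>spacetime_measure\<close> countably additive.\<close>

lemma emeasure_st:
  assumes A: "A \<in> sets borel"
  shows "emeasure st (A \<inter> (I \<times> UNIV)) = (\<integral>\<^sup>+t. emeasure (\<kappa> t) {x. (t, x) \<in> A} \<partial>restrict_space lborel I)"
    and "(\<lambda>t. emeasure (\<kappa> t) {x. (t, x) \<in> A}) \<in> borel_measurable (restrict_space lborel I)"
proof -
  have m: "(\<lambda>t. emeasure (\<kappa> t) {x. (t, x) \<in> A}) \<in> borel_measurable (restrict_space lborel I)"
    if "A \<in> sets borel" for A
    using measurable_measure[OF that] by (subst measurable_cong[OF emeasure_\<kappa>]) (auto simp: space_restrict_space)
  show "(\<lambda>t. emeasure (\<kappa> t) {x. (t, x) \<in> A}) \<in> borel_measurable (restrict_space lborel I)"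
    by (rule m[OF A])
  have restr: "B \<in> sets (restrict_space borel (I \<times> UNIV)) \<longleftrightarrow> (\<exists>A \<in> sets borel. B = A \<inter> (I \<times> UNIV))" for B
    by (auto simp: sets_restrict_space)
  have "emeasure st (A \<inter> (I \<times> UNIV)) = (\<integral>\<^sup>+t. emeasure (\<kappa> t) {x. (t, x) \<in> A \<inter> (I \<times> UNIV)} \<partial>restrict_space lborel I)"
  proof (rule emeasure_spacetime_measure)
    show "A \<inter> (I \<times> UNIV) \<in> sets (restrict_space borel (I \<times> UNIV))" using A restr by auto
    fix B assume "B \<in> sets (restrict_space borel (I \<times> (UNIV :: 'a set)))"
    then obtain A where A: "A \<in> sets borel" "B = A \<inter> (I \<times> UNIV)" using restr by auto
    show "(\<lambda>t. emeasure (\<kappa> t) {x. (t, x) \<in> B}) \<in> borel_measurable (restrict_space lborel I)"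
      using m[OF A(1)] by (subst measurable_cong[where g = "\<lambda>t. emeasure (\<kappa> t) {x. (t, x) \<in> A}"]) (auto simp: space_restrict_space A(2))
  qed (rule sets_\<kappa>)
  also have "\<dots> = (\<integral>\<^sup>+t. emeasure (\<kappa> t) {x. (t, x) \<in> A} \<partial>restrict_space lborel I)"
    by (intro nn_integral_cong) (auto simp: space_restrict_space)
  finally show "emeasure st (A \<inter> (I \<times> UNIV)) = (\<integral>\<^sup>+t. emeasure (\<kappa> t) {x. (t, x) \<in> A} \<partial>restrict_space lborel I)" .
qed

lemma finite_st: "finite_measure st"
proof (rule finite_measureI)
  have "emeasure st (space st) = (\<integral>\<^sup>+t. emeasure (\<kappa> t) UNIV \<partial>restrict_space lborel I)"
    using emeasure_st(1)[of UNIV] by (simp add: space_st)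
  also have "\<dots> \<le> (\<integral>\<^sup>+t. ennreal B \<partial>restrict_space lborel I)"
    by (intro nn_integral_mono) (auto simp: space_restrict_space emeasure_\<kappa> bound_\<kappa> intro!: ennreal_leI)
  also have "\<dots> = ennreal B * emeasure lborel I"
    using I by (simp add: emeasure_restrict_space space_restrict_space)
  also have "\<dots> < \<infinity>" using I by (simp add: ennreal_mult_less_top)
  finally show "emeasure st (space st) \<noteq> \<infinity>" by simp
qed

lemma st_finite_measures: "st \<in> finite_measures (I \<times> UNIV)"
  using finite_st by (simp add: finite_measures_def)

lemma measurable_st:
  assumes "f \<in> borel_measurable borel"
  shows "f \<in> borel_measurable st"
  unfolding measurable_cong_sets[OF sets_spacetime_measure refl]
  by (rule measurable_restrict_space1[OF assms])

text \<open>Tonelli for a disintegrated measure. Measurability in time is proved in the same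
  induction, since each step integrates the inner integrals of the previous ones.\<close>

lemma nn_integral_st:
  assumes "f \<in> borel_measurable borel"
  shows "(\<lambda>t. \<integral>\<^sup>+x. f (t, x) \<partial>\<kappa> t) \<in> borel_measurable (restrict_space lborel I) \<and>
    (\<integral>\<^sup>+p. f p \<partial>st) = (\<integral>\<^sup>+t. \<integral>\<^sup>+x. f (t, x) \<partial>\<kappa> t \<partial>restrict_space lborel I)"
  using assms
proof (induction rule: borel_measurable_induct)
  case (cong f g)
  then have "f = g" by auto
  then show ?case using cong by simp
next
  case (set A)
  have 1: "(\<integral>\<^sup>+x. indicator A (t, x) \<partial>\<kappa> t) = emeasure (\<kappa> t) {x. (t, x) \<in> A}" if "t \<in> I" for t
  proof -
    have "(\<integral>\<^sup>+x. indicator A (t, x) \<partial>\<kappa> t) = (\<integral>\<^sup>+x. indicator {x. (t, x) \<in> A} x \<partial>\<kappa> t)"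
      by (intro nn_integral_cong) (simp add: indicator_def)
    then show ?thesis using sets_slice[OF set, of t] sets_\<kappa>[OF that] by simp
  qed
  have 2: "(\<integral>\<^sup>+p. indicator A p \<partial>st) = emeasure st (A \<inter> (I \<times> UNIV))"
  proof -
    have "(\<integral>\<^sup>+p. indicator A p \<partial>st) = (\<integral>\<^sup>+p. indicator (A \<inter> (I \<times> UNIV)) p \<partial>st)"
      by (intro nn_integral_cong) (auto simp: space_st indicator_def)
    moreover have "A \<inter> (I \<times> UNIV) \<in> sets st" using set by (auto simp: sets_restrict_space)
    ultimately show ?thesis by simp
  qed
  have "(\<integral>\<^sup>+t. \<integral>\<^sup>+x. indicator A (t, x) \<partial>\<kappa> t \<partial>restrict_space lborel I) = (\<integral>\<^sup>+t. emeasure (\<kappa> t) {x. (t, x) \<in> A} \<partial>restrict_space lborel I)"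
    by (intro nn_integral_cong 1) (simp add: space_restrict_space)
  moreover have "(\<lambda>t. \<integral>\<^sup>+x. indicator A (t, x) \<partial>\<kappa> t) \<in> borel_measurable (restrict_space lborel I)"
    using emeasure_st(2)[OF set] by (subst measurable_cong[OF 1]) (simp_all add: space_restrict_space)
  ultimately show ?case using 2 emeasure_st(1)[OF set] by simp
next
  case (mult u c)
  have 1: "(\<integral>\<^sup>+x. c * u (t, x) \<partial>\<kappa> t) = c * (\<integral>\<^sup>+x. u (t, x) \<partial>\<kappa> t)" if "t \<in> I" for t
    using measurable_compose[OF measurable_slice mult.hyps(2)] that
    by (intro nn_integral_cmult) (simp add: measurable_\<kappa>)
  have "(\<lambda>t. \<integral>\<^sup>+x. c * u (t, x) \<partial>\<kappa> t) \<in> borel_measurable (restrict_space lborel I)"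
  proof -
    have "(\<lambda>t. c * \<integral>\<^sup>+x. u (t, x) \<partial>\<kappa> t) \<in> borel_measurable (restrict_space lborel I)"
      using mult.IH[THEN conjunct1] by measurable
    then show ?thesis by (subst measurable_cong[OF 1]) (simp_all add: space_restrict_space)
  qed
  moreover have "(\<integral>\<^sup>+t. \<integral>\<^sup>+x. c * u (t, x) \<partial>\<kappa> t \<partial>restrict_space lborel I) = (\<integral>\<^sup>+t. c * \<integral>\<^sup>+x. u (t, x) \<partial>\<kappa> t \<partial>restrict_space lborel I)"
    by (intro nn_integral_cong 1) (simp add: space_restrict_space)
  moreover have "(\<integral>\<^sup>+p. c * u p \<partial>st) = c * (\<integral>\<^sup>+p. u p \<partial>st)"
    by (rule nn_integral_cmult[OF measurable_st[OF mult.hyps(2)]])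
  moreover have "(\<integral>\<^sup>+t. c * \<integral>\<^sup>+x. u (t, x) \<partial>\<kappa> t \<partial>restrict_space lborel I) = c * (\<integral>\<^sup>+t. \<integral>\<^sup>+x. u (t, x) \<partial>\<kappa> t \<partial>restrict_space lborel I)"
    using mult.IH by (intro nn_integral_cmult) simp
  ultimately show ?case using mult.IH by - (elim conjE, intro conjI, assumption, metis)
next
  case (add u v)
  have 1: "(\<integral>\<^sup>+x. v (t, x) + u (t, x) \<partial>\<kappa> t) = (\<integral>\<^sup>+x. v (t, x) \<partial>\<kappa> t) + (\<integral>\<^sup>+x. u (t, x) \<partial>\<kappa> t)" if "t \<in> I" for t
    using measurable_compose[OF measurable_slice add.hyps(1)] measurable_compose[OF measurable_slice add.hyps(3)] that
    by (intro nn_integral_add) (simp_all add: measurable_\<kappa>)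
  have "(\<lambda>t. \<integral>\<^sup>+x. v (t, x) + u (t, x) \<partial>\<kappa> t) \<in> borel_measurable (restrict_space lborel I)"
  proof -
    have "(\<lambda>t. (\<integral>\<^sup>+x. v (t, x) \<partial>\<kappa> t) + (\<integral>\<^sup>+x. u (t, x) \<partial>\<kappa> t)) \<in> borel_measurable (restrict_space lborel I)"
      using add.IH[THEN conjunct1] by measurable
    then show ?thesis by (subst measurable_cong[OF 1]) (simp_all add: space_restrict_space)
  qed
  moreover have "(\<integral>\<^sup>+t. \<integral>\<^sup>+x. v (t, x) + u (t, x) \<partial>\<kappa> t \<partial>restrict_space lborel I) = (\<integral>\<^sup>+t. (\<integral>\<^sup>+x. v (t, x) \<partial>\<kappa> t) + (\<integral>\<^sup>+x. u (t, x) \<partial>\<kappa> t) \<partial>restrict_space lborel I)"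
    by (intro nn_integral_cong 1) (simp add: space_restrict_space)
  moreover have "(\<integral>\<^sup>+p. v p + u p \<partial>st) = (\<integral>\<^sup>+p. v p \<partial>st) + (\<integral>\<^sup>+p. u p \<partial>st)"
    by (rule nn_integral_add[OF measurable_st[OF add.hyps(3)] measurable_st[OF add.hyps(1)]])
  moreover have "(\<integral>\<^sup>+t. (\<integral>\<^sup>+x. v (t, x) \<partial>\<kappa> t) + (\<integral>\<^sup>+x. u (t, x) \<partial>\<kappa> t) \<partial>restrict_space lborel I)
      = (\<integral>\<^sup>+t. \<integral>\<^sup>+x. v (t, x) \<partial>\<kappa> t \<partial>restrict_space lborel I) + (\<integral>\<^sup>+t. \<integral>\<^sup>+x. u (t, x) \<partial>\<kappa> t \<partial>restrict_space lborel I)"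
    using add.IH by (intro nn_integral_add) simp_all
  ultimately show ?case using add.IH by - (elim conjE, intro conjI, assumption, metis)
next
  case (seq U)
  have inc: "incseq (\<lambda>i x. U i (t, x))" for t using seq.hyps(3) by (auto simp: incseq_def le_fun_def)
  have 1: "(\<integral>\<^sup>+x. (SUP i. U i) (t, x) \<partial>\<kappa> t) = (SUP i. \<integral>\<^sup>+x. U i (t, x) \<partial>\<kappa> t)" if "t \<in> I" for t
    using nn_integral_monotone_convergence_SUP[OF inc[of t], of "\<kappa> t"] measurable_compose[OF measurable_slice seq.hyps(1)] that
    by (simp add: measurable_\<kappa> SUP_apply image_comp)
  have "(\<lambda>t. \<integral>\<^sup>+x. (SUP i. U i) (t, x) \<partial>\<kappa> t) \<in> borel_measurable (restrict_space lborel I)"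
    using seq.IH by (subst measurable_cong[OF 1]) (simp_all add: space_restrict_space borel_measurable_SUP)
  moreover have "(\<integral>\<^sup>+t. \<integral>\<^sup>+x. (SUP i. U i) (t, x) \<partial>\<kappa> t \<partial>restrict_space lborel I) = (\<integral>\<^sup>+t. (SUP i. \<integral>\<^sup>+x. U i (t, x) \<partial>\<kappa> t) \<partial>restrict_space lborel I)"
    by (intro nn_integral_cong 1) (simp add: space_restrict_space)
  moreover have "\<dots> = (SUP i. \<integral>\<^sup>+t. \<integral>\<^sup>+x. U i (t, x) \<partial>\<kappa> t \<partial>restrict_space lborel I)"
  proof (rule nn_integral_monotone_convergence_SUP)
    show "incseq (\<lambda>i t. \<integral>\<^sup>+x. U i (t, x) \<partial>\<kappa> t)"
      by (intro incseq_SucI le_funI nn_integral_mono le_funD[OF incseq_SucD[OF inc]])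
    show "(\<lambda>t. \<integral>\<^sup>+x. U i (t, x) \<partial>\<kappa> t) \<in> borel_measurable (restrict_space lborel I)" for i
      using seq.IH by simp
  qed
  moreover have "(\<integral>\<^sup>+p. (SUP i. U i) p \<partial>st) = (SUP i. \<integral>\<^sup>+p. U i p \<partial>st)"
    using nn_integral_monotone_convergence_SUP[OF seq.hyps(3), of st] measurable_st[OF seq.hyps(1)] by (simp add: SUP_apply image_comp)
  moreover have "(SUP i. \<integral>\<^sup>+p. U i p \<partial>st) = (SUP i. \<integral>\<^sup>+t. \<integral>\<^sup>+x. U i (t, x) \<partial>\<kappa> t \<partial>restrict_space lborel I)"
    using seq.IH by (intro SUP_cong) auto
  ultimately show ?case by - (intro conjI, assumption, metis)
qed

text \<open>Adding the constant |D| makes the integrand nonnegative. It contributes |D| times the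
  total mass on both sides and is cancelled afterwards.\<close>

lemma integral_st:
  assumes f: "continuous_on (I \<times> UNIV) f" and bnd: "\<And>p. p \<in> I \<times> UNIV \<Longrightarrow> \<bar>f p\<bar> \<le> (D::real)"
  shows "(\<lambda>t. \<integral>x. f (t, x) \<partial>\<kappa> t) \<in> borel_measurable (restrict_space lborel I)"
    and "(\<integral>p. f p \<partial>st) = (\<integral>t. (\<integral>x. f (t, x) \<partial>\<kappa> t) \<partial>restrict_space lborel I)"
proof -
  \<comment> \<open>The extension by zero is Borel on the whole space, because the strip is
    open.\<close>
  define g where "g p = indicator (I \<times> UNIV) p * f p" for p
  have "open (I \<times> (UNIV :: 'a set))" using I by (intro open_Times) auto
  then have gm: "g \<in> borel_measurable borel"
    unfolding g_def using borel_measurable_continuous_on_indicator[OF _ f] by simp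
  have gb: "\<bar>g p\<bar> \<le> \<bar>D\<bar>" for p using bnd[of p] by (auto simp: g_def indicator_def)
  have eq: "g (t, x) = f (t, x)" if "t \<in> I" for t x using that by (simp add: g_def)
  have gs: "(\<lambda>x. g (t, x)) \<in> borel_measurable (\<kappa> t)" if "t \<in> I" for t
    using measurable_compose[OF measurable_slice gm] that by (simp add: measurable_\<kappa>)
  define h where "h t = (\<integral>x. g (t, x) \<partial>\<kappa> t)" for t
  have gi: "integrable (\<kappa> t) (\<lambda>x. g (t, x))" if "t \<in> I" for t
    using finite_\<kappa>[OF that] gs[OF that] gb by (rule integral_bounded_finite_measure)
  define M where "M t = measure (\<kappa> t) UNIV" for t
  have Mm: "M \<in> borel_measurable (restrict_space lborel I)"
    using measurable_measure[of UNIV] by (simp add: M_def[abs_def])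
  have nnh: "(\<integral>\<^sup>+x. ennreal (g (t, x) + \<bar>D\<bar>) \<partial>\<kappa> t) = ennreal (h t + \<bar>D\<bar> * M t)"
    and h0: "0 \<le> h t + \<bar>D\<bar> * M t" if t: "t \<in> I" for t
  proof -
    interpret finite_measure "\<kappa> t" by (rule finite_\<kappa>[OF t])
    have nonneg: "0 \<le> g p + \<bar>D\<bar>" for p using gb[of p] by linarith
    have i: "integrable (\<kappa> t) (\<lambda>x. g (t, x) + \<bar>D\<bar>)" using gi[OF t] by simp
    have e: "(\<integral>x. g (t, x) + \<bar>D\<bar> \<partial>\<kappa> t) = h t + \<bar>D\<bar> * M t"
      using gi[OF t] space_\<kappa>[OF t] by (simp add: h_def M_def)
    show "(\<integral>\<^sup>+x. ennreal (g (t, x) + \<bar>D\<bar>) \<partial>\<kappa> t) = ennreal (h t + \<bar>D\<bar> * M t)"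
      using nn_integral_eq_integral[OF i] nonneg e by simp
    show "0 \<le> h t + \<bar>D\<bar> * M t" using integral_nonneg_AE[of "\<lambda>x. g (t, x) + \<bar>D\<bar>" "\<kappa> t"] nonneg e by simp
  qed
  have m: "(\<lambda>p. ennreal (g p + \<bar>D\<bar>)) \<in> borel_measurable borel" using gm by measurable
  from nn_integral_st[OF m]
  have hm': "(\<lambda>t. \<integral>\<^sup>+x. ennreal (g (t, x) + \<bar>D\<bar>) \<partial>\<kappa> t) \<in> borel_measurable (restrict_space lborel I)"
    and sti: "(\<integral>\<^sup>+p. ennreal (g p + \<bar>D\<bar>) \<partial>st) = (\<integral>\<^sup>+t. \<integral>\<^sup>+x. ennreal (g (t, x) + \<bar>D\<bar>) \<partial>\<kappa> t \<partial>restrict_space lborel I)" by auto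
  have "(\<lambda>t. enn2real (\<integral>\<^sup>+x. ennreal (g (t, x) + \<bar>D\<bar>) \<partial>\<kappa> t) - \<bar>D\<bar> * M t) \<in> borel_measurable (restrict_space lborel I)"
    using hm' Mm by measurable
  then have hm: "h \<in> borel_measurable (restrict_space lborel I)"
    by (subst measurable_cong[where g = "\<lambda>t. enn2real (\<integral>\<^sup>+x. ennreal (g (t, x) + \<bar>D\<bar>) \<partial>\<kappa> t) - \<bar>D\<bar> * M t"])
      (simp_all add: space_restrict_space nnh h0)
  show "(\<lambda>t. \<integral>x. f (t, x) \<partial>\<kappa> t) \<in> borel_measurable (restrict_space lborel I)"
    using hm by (subst measurable_cong[where g = h]) (simp_all add: space_restrict_space h_def eq)
  interpret R: finite_measure "restrict_space lborel I"
    using I by (intro finite_measureI) (simp add: emeasure_restrict_space space_restrict_space)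
  interpret S: finite_measure st by (rule finite_st)
  have Mi: "integrable (restrict_space lborel I) M"
    using Mm bound_\<kappa> by (intro R.integrable_const_bound[of _ B]) (auto simp: space_restrict_space M_def)
  have hi: "integrable (restrict_space lborel I) h"
  proof (rule Bochner_Integration.integrable_bound[OF integrable_mult_right[OF Mi, of "\<bar>D\<bar>"] hm], rule AE_I2)
    fix t assume "t \<in> space (restrict_space lborel I)"
    then have t: "t \<in> I" by (simp add: space_restrict_space)
    show "norm (h t) \<le> norm (\<bar>D\<bar> * M t)"
      using integral_bounded_finite_measure(2)[OF finite_\<kappa>[OF t] gs[OF t], of "\<bar>D\<bar>"] gb
      by (simp add: h_def M_def space_\<kappa>[OF t])
  qed
  have gi': "integrable st g"
    using measurable_st[OF gm] gb by (intro S.integrable_const_bound[of _ "\<bar>D\<bar>"]) auto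
  have nn: "0 \<le> g p + \<bar>D\<bar>" for p using gb[of p] by linarith
  have gD: "integrable st (\<lambda>p. g p + \<bar>D\<bar>)"
    by (rule Bochner_Integration.integrable_add[OF gi' S.integrable_const])
  have hD: "integrable (restrict_space lborel I) (\<lambda>t. h t + \<bar>D\<bar> * M t)"
    by (rule Bochner_Integration.integrable_add[OF hi integrable_mult_right[OF Mi]])
  have h0': "AE t in restrict_space lborel I. 0 \<le> h t + \<bar>D\<bar> * M t"
    by (rule AE_I2, rule h0) (simp add: space_restrict_space)
  have "ennreal (\<integral>p. g p + \<bar>D\<bar> \<partial>st) = (\<integral>\<^sup>+p. ennreal (g p + \<bar>D\<bar>) \<partial>st)"
    by (rule nn_integral_eq_integral[OF gD AE_I2[OF nn], symmetric])
  also have "\<dots> = (\<integral>\<^sup>+t. ennreal (h t + \<bar>D\<bar> * M t) \<partial>restrict_space lborel I)"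
    unfolding sti by (intro nn_integral_cong nnh) (simp add: space_restrict_space)
  also have "\<dots> = ennreal (\<integral>t. h t + \<bar>D\<bar> * M t \<partial>restrict_space lborel I)"
    by (rule nn_integral_eq_integral[OF hD h0'])
  finally have 1: "(\<integral>p. g p + \<bar>D\<bar> \<partial>st) = (\<integral>t. h t + \<bar>D\<bar> * M t \<partial>restrict_space lborel I)"
    using integral_nonneg_AE[OF h0'] integral_nonneg_AE[OF AE_I2[OF nn], of st]
    by (simp only: ennreal_inj)
  have "ennreal (measure st (space st)) = (\<integral>\<^sup>+t. emeasure (\<kappa> t) UNIV \<partial>restrict_space lborel I)"
    using emeasure_st(1)[of UNIV] by (simp add: space_st flip: S.emeasure_eq_measure)
  also have "\<dots> = (\<integral>\<^sup>+t. ennreal (M t) \<partial>restrict_space lborel I)"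
    by (intro nn_integral_cong) (simp add: space_restrict_space M_def emeasure_\<kappa>)
  also have "\<dots> = ennreal (\<integral>t. M t \<partial>restrict_space lborel I)"
    by (rule nn_integral_eq_integral[OF Mi]) (simp add: M_def)
  finally have 2: "measure st (space st) = (\<integral>t. M t \<partial>restrict_space lborel I)"
    using Bochner_Integration.integral_nonneg[of "restrict_space lborel I" M] by (simp add: M_def)
  have "(\<integral>p. g p \<partial>st) = (\<integral>t. h t \<partial>restrict_space lborel I)"
    using 1 2 Bochner_Integration.integral_add[OF gi' S.integrable_const, of "\<bar>D\<bar>"]
      Bochner_Integration.integral_add[OF hi integrable_mult_right[OF Mi], of "\<bar>D\<bar>"]
    by (simp add: mult.commute)
  moreover have "(\<integral>p. g p \<partial>st) = (\<integral>p. f p \<partial>st)"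
    by (intro Bochner_Integration.integral_cong refl) (auto simp: space_st g_def)
  moreover have "(\<integral>t. h t \<partial>restrict_space lborel I) = (\<integral>t. (\<integral>x. f (t, x) \<partial>\<kappa> t) \<partial>restrict_space lborel I)"
    by (intro Bochner_Integration.integral_cong refl) (simp add: space_restrict_space h_def eq)
  ultimately show "(\<integral>p. f p \<partial>st) = (\<integral>t. (\<integral>x. f (t, x) \<partial>\<kappa> t) \<partial>restrict_space lborel I)" by simp
qed

end

section \<open>Functionals on continuously differentiable functions\<close>

lemma frechet_derivative_eq_gradient:
  fixes f :: "real ^ 'd::finite \<Rightarrow> real"
  assumes "f differentiable at x"
  shows "frechet_derivative f (at x) h = gradient f x \<bullet> h"
proof -
  interpret linear "frechet_derivative f (at x)" by (rule linear_frechet_derivative[OF assms])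
  have "frechet_derivative f (at x) h = frechet_derivative f (at x) (\<Sum>i\<in>UNIV. h $ i *\<^sub>R axis i 1)"
    by (simp add: basis_expansion flip: scalar_mult_eq_scaleR)
  also have "\<dots> = gradient f x \<bullet> h"
    by (simp add: sum scale gradient_def inner_vec_def mult.commute)
  finally show ?thesis .
qed

lemma norm_gradient_C1_le: "norm (gradient (\<lambda>x. apply_C1 f (proj x)) x) \<le> norm f"
  using C1_grad_le[of f x] C1_abs_le[of f undefined] unfolding norm_C1_def by linarith

text \<open>On the covering space this is the mean value inequality. The quotient distance is an
  infimum over representatives, so it is approached by near-optimal ones with a slack e.\<close>

lemma C1_lipschitz: "(norm f)-lipschitz_on UNIV (apply_C1 (f :: 'd::finite C1))"
proof (rule lipschitz_onI)
  fix p q :: "'d torus"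
  let ?f = "\<lambda>x. apply_C1 f (proj x)"
  have le: "\<bar>?f x - ?f y\<bar> \<le> norm f * dist x y" for x y
  proof -
    have "norm (?f x - ?f y) \<le> norm f * norm (x - y)"
    proof (rule differentiable_bound[of UNIV ?f "\<lambda>x. frechet_derivative ?f (at x)"])
      fix z
      show "(?f has_derivative frechet_derivative ?f (at z)) (at z within UNIV)"
        using C1_differentiable[of f z] by (simp flip: frechet_derivative_works)
      show "onorm (frechet_derivative ?f (at z)) \<le> norm f"
      proof (rule onorm_le)
        fix h
        have "\<bar>gradient ?f z \<bullet> h\<bar> \<le> norm (gradient ?f z) * norm h" by (rule Cauchy_Schwarz_ineq2)
        also have "\<dots> \<le> norm f * norm h" by (intro mult_right_mono norm_gradient_C1_le) simp
        finally show "norm (frechet_derivative ?f (at z) h) \<le> norm f * norm h"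
          by (simp add: frechet_derivative_eq_gradient[OF C1_differentiable])
      qed
    qed auto
    then show ?thesis by (simp add: dist_norm)
  qed
  show "dist (apply_C1 f p) (apply_C1 f q) \<le> norm f * dist p q"
  proof (rule field_le_epsilon)
    fix e :: real assume "0 < e"
    \<comment> \<open>The added 1 avoids division by zero for f = 0.\<close>
    define \<delta> where "\<delta> = e / (norm f + 1)"
    have nf: "0 < norm f + 1" by (simp add: add_nonneg_pos)
    have "0 < \<delta>" using \<open>0 < e\<close> nf by (simp add: \<delta>_def)
    then obtain x y where xy: "proj x = p" "proj y = q" "dist x y < dist p q + \<delta>"
      using dist_torus_approx[of p q "dist p q + \<delta>"] by auto
    have "\<bar>apply_C1 f p - apply_C1 f q\<bar> \<le> norm f * dist x y" using le[of x y] xy by simp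
    also have "\<dots> \<le> norm f * (dist p q + \<delta>)" using xy by (intro mult_left_mono) auto
    also have "\<dots> \<le> norm f * dist p q + e"
      using nf \<open>0 < \<delta>\<close> by (simp add: distrib_left) (simp add: \<delta>_def field_simps \<open>0 < e\<close> less_imp_le)
    finally show "dist (apply_C1 f p) (apply_C1 f q) \<le> norm f * dist p q + e" by (simp add: dist_real_def)
  qed
qed simp

lemma apply_C1_measurable [measurable]: "apply_C1 f \<in> borel_measurable borel"
  by (intro borel_measurable_continuous_onI lipschitz_on_continuous_on[OF C1_lipschitz])

text \<open>\<open>Blinfun\<close> is meaningful on bounded linear maps only; the total mass
  supplies the bound.\<close>

lemma measure_functional_apply:
  assumes "finite_measure \<mu>" "sets \<mu> = sets borel"
  shows "blinfun_apply (measure_functional \<mu>) \<psi> = (\<integral>p. apply_C1 \<psi> p \<partial>\<mu>)"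
proof -
  interpret finite_measure \<mu> by fact
  have i: "integrable \<mu> (apply_C1 f)" for f
    using apply_C1_measurable[of f] abs_apply_C1_le_norm[of f] assms(2)
    by (intro integrable_const_bound[of _ "norm f"]) (auto cong: measurable_cong_sets)
  have "bounded_linear (\<lambda>\<psi>. \<integral>p. apply_C1 \<psi> p \<partial>\<mu>)"
  proof (rule bounded_linear_intro)
    show "(\<integral>p. apply_C1 (f + g) p \<partial>\<mu>) = (\<integral>p. apply_C1 f p \<partial>\<mu>) + (\<integral>p. apply_C1 g p \<partial>\<mu>)" for f g
      using i by (simp add: plus_C1.rep_eq)
    show "(\<integral>p. apply_C1 (c *\<^sub>R f) p \<partial>\<mu>) = c *\<^sub>R (\<integral>p. apply_C1 f p \<partial>\<mu>)" for c f
      by (simp add: scaleR_C1.rep_eq)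
    show "norm (\<integral>p. apply_C1 f p \<partial>\<mu>) \<le> norm f * measure \<mu> (space \<mu>)" for f
    proof -
      have "\<bar>\<integral>p. apply_C1 f p \<partial>\<mu>\<bar> \<le> (\<integral>p. \<bar>apply_C1 f p\<bar> \<partial>\<mu>)" by (rule integral_abs_bound)
      also have "\<dots> \<le> (\<integral>p. norm f \<partial>\<mu>)" using i by (intro integral_mono) (auto simp: abs_apply_C1_le_norm)
      finally show ?thesis by (simp add: mult.commute)
    qed
  qed
  then show ?thesis by (simp add: measure_functional_def bounded_linear_Blinfun_apply)
qed

section \<open>Separability of the space of C1 functions\<close>

lemma gradient_C1_diff:
  "gradient (\<lambda>x. apply_C1 (f - g) (proj x)) x =
    gradient (\<lambda>x. apply_C1 f (proj x)) x - gradient (\<lambda>x. apply_C1 g (proj x)) x"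
proof -
  have "(\<lambda>x. apply_C1 (f - g) (proj x)) = (\<lambda>x. apply_C1 f (proj x) + (- 1) * apply_C1 g (proj x))"
    by (simp add: minus_C1.rep_eq)
  then show ?thesis
    using gradient_add[OF C1_differentiable[of f x], of "\<lambda>x. (- 1) * apply_C1 g (proj x)"]
      gradient_cmul[OF C1_differentiable[of g x], of "- 1"]
    by (simp add: C1_differentiable)
qed

lemma norm_C1_diff_le:
  fixes f g :: "'d::finite C1"
  assumes "\<And>x. x \<in> cbox 0 1 \<Longrightarrow> \<bar>apply_C1 f (proj x) - apply_C1 g (proj x)\<bar> \<le> A"
    and "\<And>x. x \<in> cbox 0 1 \<Longrightarrow> norm (gradient (\<lambda>x. apply_C1 f (proj x)) x - gradient (\<lambda>x. apply_C1 g (proj x)) x) \<le> B"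
  shows "norm (f - g) \<le> A + B"
proof -
  have "(SUP p. \<bar>apply_C1 (f - g) p\<bar>) \<le> A"
  proof (rule cSUP_least)
    fix p :: "'d torus"
    obtain y where "proj y = proj (rep_torus p)" "y \<in> cbox 0 1" by (rule proj_cube)
    then show "\<bar>apply_C1 (f - g) p\<bar> \<le> A" using assms(1)[of y] by (simp add: minus_C1.rep_eq)
  qed simp
  moreover have "(SUP x. norm (gradient (\<lambda>x. apply_C1 (f - g) (proj x)) x)) \<le> B"
  proof (rule cSUP_least)
    fix x :: "real ^ 'd"
    obtain y where y: "proj y = proj x" "y \<in> cbox 0 1" by (rule proj_cube)
    have "gradient (\<lambda>x. apply_C1 (f - g) (proj x)) x = gradient (\<lambda>x. apply_C1 (f - g) (proj x)) y"
      by (rule gradient_periodic[OF y(1)[symmetric] C1_differentiable])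
    then show "norm (gradient (\<lambda>x. apply_C1 (f - g) (proj x)) x) \<le> B"
      using assms(2)[OF y(2)] by (simp add: gradient_C1_diff)
  qed simp
  ultimately show ?thesis unfolding norm_C1_def by linarith
qed

lemma floor_eq_imp_close:
  fixes x y c :: real
  assumes "\<lfloor>c * x\<rfloor> = \<lfloor>c * y\<rfloor>" "0 < c"
  shows "\<bar>x - y\<bar> \<le> 1 / c"
proof -
  have "\<bar>c * x - c * y\<bar> \<le> 1" using assms(1) by linarith
  then have "c * \<bar>x - y\<bar> \<le> 1" using assms(2) by (simp add: abs_mult flip: right_diff_distrib)
  then show ?thesis using assms(2) by (simp add: field_simps)
qed

text \<open>Functions are sorted by a common modulus of continuity for values and gradients and by
  their rounded data on a finite net. Two functions in one class with the same data are close, so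
  one representative for each occurring data set gives a countable dense set, without any explicit
  approximants.\<close>

lemma C1_separable:
  obtains D :: "'d::finite C1 set" where "countable D" "\<And>f e. 0 < e \<Longrightarrow> \<exists>g\<in>D. norm (f - g) < e"
proof -
  define Q where "Q = (cbox 0 1 :: (real ^ 'd) set)"
  define v where "v f x = apply_C1 f (proj x)" for f :: "'d C1" and x
  define G where "G f = gradient (\<lambda>x. apply_C1 f (proj x))" for f :: "'d C1"
  have cQ: "compact Q" by (simp add: Q_def)
  have "\<exists>A. finite A \<and> A \<subseteq> Q \<and> Q \<subseteq> (\<Union>c\<in>A. ball c (1 / real (Suc N)))" for N
  proof -
    have "Q \<subseteq> (\<Union>c\<in>Q. ball c (1 / real (Suc N)))" by auto
    then show ?thesis by (rule compactE_image[OF cQ open_ball]) auto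
  qed
  then obtain A where A: "\<And>N. finite (A N)" "\<And>N. A N \<subseteq> Q" "\<And>N. Q \<subseteq> (\<Union>c\<in>A N. ball c (1 / real (Suc N)))"
    by metis
  \<comment> \<open>By compactness of the cube, values and gradients are uniformly continuous there,
    so for given m every f belongs to some class.\<close>
  define K where "K m N = {f. \<forall>x\<in>Q. \<forall>y\<in>Q. dist x y < 1 / real (Suc N) \<longrightarrow>
    \<bar>v f x - v f y\<bar> \<le> 1 / real (Suc m) \<and> norm (G f x - G f y) \<le> 1 / real (Suc m)}" for m N
  define data where "data m N f = restrict (\<lambda>a. (\<lfloor>real (Suc m) * v f a\<rfloor>, \<lambda>i. \<lfloor>real (Suc m) * G f a $ i\<rfloor>)) (A N)" for m N f
  have cnt: "countable (data m N ` K m N)" for m N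
  proof (rule countable_subset)
    show "data m N ` K m N \<subseteq> PiE (A N) (\<lambda>_. UNIV)" by (auto simp: data_def)
    show "countable (PiE (A N) (\<lambda>_. UNIV :: (int \<times> ('d \<Rightarrow> int)) set))" by (intro countable_PiE A) simp
  qed
  define D where "D = (\<Union>m N. inv_into (K m N) (data m N) ` data m N ` K m N)"
  show thesis
  proof (rule that[of D])
    have "countable (inv_into (K m N) (data m N) ` data m N ` K m N)" for m N
      by (rule countable_image[OF cnt])
    then show "countable D" unfolding D_def by (intro countable_UN) simp_all
    fix f :: "'d C1" and e :: real assume "0 < e"
    \<comment> \<open>This is 3 + (2 + d): values lose one rounding and two moduli, gradients lose
      two moduli and one rounding for each of the d coordinates.\<close>
    define C where "C = 5 + real CARD('d)"
    obtain m where m: "C / real (Suc m) < e"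
    proof -
      obtain m where "inverse (real (Suc m)) < e / C"
        using reals_Archimedean[of "e / C"] \<open>0 < e\<close> by (auto simp: C_def)
      then have "C / real (Suc m) < e" by (simp add: C_def field_simps)
      then show thesis by (rule that)
    qed
    define \<eta> where "\<eta> = 1 / real (Suc m)"
    have "0 < \<eta>" by (simp add: \<eta>_def)
    have "uniformly_continuous_on Q (v f)"
      unfolding v_def Q_def using C1_differentiable[of f]
      by (intro compact_uniformly_continuous continuous_at_imp_continuous_on ballI differentiable_imp_continuous_within compact_cbox)
    then obtain d1 where d1: "0 < d1" "\<And>x y. x \<in> Q \<Longrightarrow> y \<in> Q \<Longrightarrow> dist x y < d1 \<Longrightarrow> dist (v f x) (v f y) < \<eta>"
      using \<open>0 < \<eta>\<close> unfolding uniformly_continuous_on_def by (metis dist_commute)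
    have "uniformly_continuous_on Q (G f)"
      unfolding G_def Q_def
      by (intro compact_uniformly_continuous continuous_on_subset[OF C1_continuous_gradient] compact_cbox) simp
    then obtain d2 where d2: "0 < d2" "\<And>x y. x \<in> Q \<Longrightarrow> y \<in> Q \<Longrightarrow> dist x y < d2 \<Longrightarrow> dist (G f x) (G f y) < \<eta>"
      using \<open>0 < \<eta>\<close> unfolding uniformly_continuous_on_def by (metis dist_commute)
    obtain N where N: "inverse (real (Suc N)) < min d1 d2"
      using reals_Archimedean[of "min d1 d2"] d1(1) d2(1) by auto
    have fK: "f \<in> K m N"
    proof -
      have "\<bar>v f x - v f y\<bar> \<le> \<eta> \<and> norm (G f x - G f y) \<le> \<eta>" if "x \<in> Q" "y \<in> Q" "dist x y < 1 / real (Suc N)" for x y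
        using d1(2)[OF that(1,2)] d2(2)[OF that(1,2)] that(3) N
        by (simp add: dist_real_def dist_norm inverse_eq_divide)
      then show ?thesis by (auto simp: K_def \<eta>_def)
    qed
    define g where "g = inv_into (K m N) (data m N) (data m N f)"
    have gK: "g \<in> K m N" and dg: "data m N g = data m N f"
      unfolding g_def using fK by (auto intro: inv_into_into f_inv_into_f)
    have "g \<in> D" unfolding D_def g_def using fK by blast
    have close: "\<bar>v f x - v g x\<bar> \<le> 3 * \<eta> \<and> norm (G f x - G g x) \<le> (2 + real CARD('d)) * \<eta>" if x: "x \<in> Q" for x
    proof -
      obtain a where a: "a \<in> A N" "dist x a < 1 / real (Suc N)" using A(3)[of N] x by (auto simp: dist_commute)
      have aQ: "a \<in> Q" using a A(2) by auto
      have da: "data m N g a = data m N f a" using dg by simp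
      have fl: "\<lfloor>real (Suc m) * v f a\<rfloor> = \<lfloor>real (Suc m) * v g a\<rfloor>"
        "\<lfloor>real (Suc m) * G f a $ i\<rfloor> = \<lfloor>real (Suc m) * G g a $ i\<rfloor>" for i
        using da a(1) by (simp_all add: data_def) metis
      have gi: "\<bar>(G f a - G g a) $ i\<bar> \<le> \<eta>" for i
        unfolding \<eta>_def vector_minus_component by (rule floor_eq_imp_close[OF fl(2)]) simp
      have "norm (G f a - G g a) \<le> (\<Sum>i\<in>UNIV. \<bar>(G f a - G g a) $ i\<bar>)" by (rule norm_le_l1_cart)
      also have "\<dots> \<le> (\<Sum>i\<in>(UNIV :: 'd set). \<eta>)" by (intro sum_mono gi)
      finally have "norm (G f a - G g a) \<le> real CARD('d) * \<eta>" by simp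
      moreover have "\<bar>v f a - v g a\<bar> \<le> \<eta>" unfolding \<eta>_def by (rule floor_eq_imp_close[OF fl(1)]) simp
      moreover have "\<bar>v f x - v f a\<bar> \<le> \<eta>" "norm (G f x - G f a) \<le> \<eta>" "\<bar>v g x - v g a\<bar> \<le> \<eta>" "norm (G g x - G g a) \<le> \<eta>"
        using fK gK x aQ a(2) by (auto simp: K_def \<eta>_def)
      moreover have "norm (G f x - G g x) \<le> norm (G f x - G f a) + norm (G f a - G g a) + norm (G g x - G g a)"
        using norm_triangle_ineq[of "G f x - G f a" "G f a - G g a"]
          norm_triangle_ineq4[of "G f x - G f a + (G f a - G g a)" "G g x - G g a"] by (simp add: algebra_simps)
      ultimately show ?thesis by (simp add: distrib_right)
    qed
    have "norm (f - g) \<le> 3 * \<eta> + (2 + real CARD('d)) * \<eta>"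
      by (rule norm_C1_diff_le) (use close in \<open>auto simp: v_def G_def Q_def\<close>)
    also have "\<dots> = C * \<eta>" by (simp add: C_def algebra_simps)
    also have "\<dots> < e" using m by (simp add: \<eta>_def)
    finally show "\<exists>g\<in>D. norm (f - g) < e" using \<open>g \<in> D\<close> by blast
  qed
qed

text \<open>The Borel section sends the torus into the closed cube, which is coded by reals;
  decoding followed by \<open>proj\<close> is continuous and inverts this.\<close>

lemma torus_weak_compactness:
  fixes \<nu> :: "nat \<Rightarrow> 'd::finite torus measure"
  assumes \<nu>: "\<And>n. sets (\<nu> n) = sets borel" "\<And>n. finite_measure (\<nu> n)" "\<And>n. measure (\<nu> n) UNIV \<le> B"
  obtains r :: "nat \<Rightarrow> nat" and \<mu> where "strict_mono r" "sets \<mu> = sets borel" "finite_measure \<mu>"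
    "\<And>\<psi> :: 'd torus \<Rightarrow> real. continuous_on UNIV \<psi> \<Longrightarrow> (\<lambda>n. \<integral>p. \<psi> p \<partial>\<nu> (r n)) \<longlonglongrightarrow> (\<integral>p. \<psi> p \<partial>\<mu>)"
proof -
  obtain s :: "real ^ 'd \<Rightarrow> real" and f where
    s: "s \<in> borel_measurable borel" "\<And>y. s y \<in> {0..1}" and
    f: "continuous_on UNIV f" "\<And>y. y \<in> cbox 0 1 \<Longrightarrow> f (s y) = y"
    by (rule compact_coding[OF compact_cbox, of "0 :: real ^ 'd" 1]) blast
  have sub: "hbox 0 1 \<subseteq> (cbox 0 1 :: (real ^ 'd) set)"
    by (auto simp: hbox_def mem_box_cart less_imp_le)
  have \<sigma>: "(\<lambda>p. s (torus_section p)) \<in> borel_measurable borel"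
    by (rule measurable_compose[OF measurable_torus_section s(1)])
  have g: "continuous_on UNIV (\<lambda>x. proj (f x))"
    by (rule continuous_on_compose2[OF continuous_on_proj f(1)]) auto
  have gs: "proj (f (s (torus_section p))) = p" for p :: "'d torus"
    using f(2)[of "torus_section p"] torus_section_in_hbox[of p] sub by auto
  obtain r \<mu> where r: "strict_mono (r :: nat \<Rightarrow> nat)" and \<mu>: "sets \<mu> = sets borel" "finite_measure \<mu>"
    and lim: "\<And>\<psi> :: 'd torus \<Rightarrow> real. continuous_on UNIV \<psi> \<Longrightarrow> bounded (range \<psi>) \<Longrightarrow> (\<lambda>n. \<integral>p. \<psi> p \<partial>\<nu> (r n)) \<longlonglongrightarrow> (\<integral>p. \<psi> p \<partial>\<mu>)"
    using weak_compactness_coded[of \<nu> B "\<lambda>p. s (torus_section p)" "\<lambda>x. proj (f x)", OF \<nu> \<sigma> s(2) g gs] by blast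
  show thesis by (rule that[OF r \<mu> lim[OF _ bounded_continuous_torus]])
qed

text \<open>The positive and the negative part of d on I are densities of finite measures that agree
  on all half-lines, hence are equal, and equal measures have almost everywhere equal
  densities.\<close>

lemma AE_zero_if_interval_integrals_zero:
  fixes d :: "real \<Rightarrow> real"
  assumes I: "I = {a<..<b}" "a < b" and d: "integrable lborel d"
    and zero: "\<And>s t. s \<in> I \<Longrightarrow> t \<in> I \<Longrightarrow> (\<integral>x. indicator {s<..t} x * d x \<partial>lborel) = 0"
  shows "AE x in lborel. x \<in> I \<longrightarrow> d x = 0"
proof -
  have [measurable]: "d \<in> borel_measurable borel" using borel_measurable_integrable[OF d] by simp
  have [measurable]: "I \<in> sets borel" using I by simp
  define p where "p x = indicator I x * max 0 (d x)" for x
  define q where "q x = indicator I x * max 0 (- d x)" for x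
  have [measurable]: "p \<in> borel_measurable borel" "q \<in> borel_measurable borel" unfolding p_def q_def by measurable
  have p0: "0 \<le> p x" "0 \<le> q x" for x by (auto simp: p_def q_def)
  have pq_le: "\<bar>p x\<bar> \<le> \<bar>d x\<bar>" "\<bar>q x\<bar> \<le> \<bar>d x\<bar>" for x by (auto simp: p_def q_def indicator_def)
  have ip: "integrable lborel p" and iq: "integrable lborel q"
    by (rule Bochner_Integration.integrable_bound[OF d]; use pq_le in simp)+
  have pq: "p x - q x = indicator I x * d x" for x by (auto simp: p_def q_def indicator_def)
  have eq: "(\<integral>y. indicator {x<..} y * p y \<partial>lborel) = (\<integral>y. indicator {x<..} y * q y \<partial>lborel)" for x
  proof (cases "x < b")
    case True
    \<comment> \<open>The hypothesis speaks of endpoints in I only, so the ends of I are approached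
      from inside, and the shift by 3 keeps both endpoints in I from the start. The case s n > t n
      is allowed, as the interval is then empty.\<close>
    define h where "h n = (b - a) / real (n + 3)" for n
    have h: "0 < h n" "h n < b - a" for n
      using I(2) by (simp_all add: h_def divide_less_eq)
    have h_lim: "h \<longlonglongrightarrow> 0"
      unfolding h_def
      by (rule LIMSEQ_ignore_initial_segment[OF lim_const_over_n])
    define s where "s n = max x (a + h n)" for n
    define t where "t n = b - h n" for n
    have st: "s n \<in> I" "t n \<in> I" for n using h[of n] True I by (auto simp: s_def t_def)
    have s_lim: "s \<longlonglongrightarrow> max x a" unfolding s_def using tendsto_add[OF tendsto_const[of a] h_lim]
      by (intro tendsto_max tendsto_const) simp
    have t_lim: "t \<longlonglongrightarrow> b" unfolding t_def using tendsto_diff[OF tendsto_const[of b] h_lim] by simp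
    have "(\<lambda>n. \<integral>y. indicator {s n<..t n} y * d y \<partial>lborel) \<longlonglongrightarrow> (\<integral>y. indicator {x<..} y * (indicator I y * d y) \<partial>lborel)"
    proof (rule integral_dominated_convergence[where w = "\<lambda>y. \<bar>d y\<bar>"])
      show "AE y in lborel. (\<lambda>n. indicator {s n<..t n} y * d y) \<longlonglongrightarrow> indicator {x<..} y * (indicator I y * d y)"
      proof (intro AE_I2)
        fix y
        show "(\<lambda>n. indicator {s n<..t n} y * d y) \<longlonglongrightarrow> indicator {x<..} y * (indicator I y * d y)"
        proof (cases "max x a < y \<and> y < b")
          case True
          then have "\<forall>\<^sub>F n in sequentially. s n < y" "\<forall>\<^sub>F n in sequentially. y < t n"
            using order_tendstoD(2)[OF s_lim, of y] order_tendstoD(1)[OF t_lim, of y] by auto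
          then have "\<forall>\<^sub>F n in sequentially. indicator {s n<..t n} y * d y = indicator {x<..} y * (indicator I y * d y)"
            by eventually_elim (use True I in auto)
          then show ?thesis by (rule tendsto_eventually)
        next
          case False
          have "y \<notin> {s n<..t n}" for n using False h[of n] by (auto simp: s_def t_def)
          moreover have "y \<notin> {x<..} \<inter> I" using False I by auto
          ultimately have "indicator {s n<..t n} y * d y = 0" "indicator {x<..} y * (indicator I y * d y) = 0" for n
            by (auto simp: indicator_def)
          then show ?thesis by (simp only: tendsto_const)
        qed
      qed
    qed (use d in \<open>auto simp: indicator_def\<close>)
    then have "(\<integral>y. indicator {x<..} y * (indicator I y * d y) \<partial>lborel) = 0"
      using st by (simp add: zero LIMSEQ_const_iff)
    moreover have "(\<integral>y. indicator {x<..} y * (indicator I y * d y) \<partial>lborel) = (\<integral>y. indicator {x<..} y * p y - indicator {x<..} y * q y \<partial>lborel)"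
      by (simp flip: pq right_diff_distrib)
    moreover have "\<dots> = (\<integral>y. indicator {x<..} y * p y \<partial>lborel) - (\<integral>y. indicator {x<..} y * q y \<partial>lborel)"
      using integrable_mult_indicator[OF _ ip, of "{x<..}"] integrable_mult_indicator[OF _ iq, of "{x<..}"]
      by (intro Bochner_Integration.integral_diff) auto
    ultimately show ?thesis by simp
  next
    case False
    then have "indicator {x<..} y * p y = 0" "indicator {x<..} y * q y = 0" for y
      using I by (auto simp: p_def q_def indicator_def)
    then show ?thesis by (simp only:)
  qed
  have em: "emeasure (density lborel (\<lambda>x. ennreal (w x))) {x<..} = ennreal (\<integral>y. indicator {x<..} y * w y \<partial>lborel)"
    if [measurable]: "w \<in> borel_measurable borel" and "integrable lborel w" "\<And>x. 0 \<le> w x" for w :: "real \<Rightarrow> real" and x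
  proof -
    have "emeasure (density lborel (\<lambda>x. ennreal (w x))) {x<..} = (\<integral>\<^sup>+y. ennreal (indicator {x<..} y * w y) \<partial>lborel)"
      by (subst emeasure_density) (auto intro!: nn_integral_cong simp: indicator_def)
    also have "\<dots> = ennreal (\<integral>y. indicator {x<..} y * w y \<partial>lborel)"
      using integrable_mult_indicator[OF _ that(2), of "{x<..}"] that(3) by (intro nn_integral_eq_integral) auto
    finally show ?thesis .
  qed
  have "density lborel (\<lambda>x. ennreal (p x)) = density lborel (\<lambda>x. ennreal (q x))"
    by (rule measure_eqI_lessThan) (simp_all add: em ip iq p0 eq)
  then have "AE x in lborel. ennreal (p x) = ennreal (q x)"
    by (intro sigma_finite_measure.density_unique[OF lborel.sigma_finite_measure_axioms]) auto
  then show ?thesis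
  proof eventually_elim
    case (elim x)
    then have "p x = q x" using p0 by simp
    then show ?case using pq[of x] by (auto simp: indicator_def)
  qed
qed

text \<open>One operation generates the rational span: with q = -1 it produces 0 and differences,
  and from these all rational combinations.\<close>

lemma countable_rat_span:
  fixes D :: "'a::real_vector set"
  assumes "countable D"
  obtains S where "countable S" "D \<subseteq> S" "\<And>\<psi> \<xi> q. \<psi> \<in> S \<Longrightarrow> \<xi> \<in> S \<Longrightarrow> q \<in> \<rat> \<Longrightarrow> \<psi> + q *\<^sub>R \<xi> \<in> S"
proof -
  define step where "step A = A \<union> (\<lambda>(\<psi>, \<xi>, q). \<psi> + q *\<^sub>R \<xi>) ` (A \<times> A \<times> \<rat>)" for A :: "'a set"
  define S where "S n = (step ^^ n) D" for n
  have c: "countable (S n)" for n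
  proof (induction n)
    case 0
    then show ?case using assms by (simp add: S_def)
  next
    case (Suc n)
    have "S (Suc n) = step (S n)" by (simp add: S_def)
    then show ?case using Suc by (auto simp: step_def countable_rat intro!: countable_Un countable_image countable_SIGMA)
  qed
  have mono: "S n \<subseteq> S k" if "n \<le> k" for n k
    using that by (induction k rule: dec_induct) (auto simp: S_def step_def)
  show thesis
  proof (rule that[of "\<Union>n. S n"])
    show "countable (\<Union>n. S n)" using c by simp
    show "D \<subseteq> (\<Union>n. S n)" by (auto simp: S_def intro!: exI[of _ 0])
    fix \<psi> \<xi> q assume *: "\<psi> \<in> (\<Union>n. S n)" "\<xi> \<in> (\<Union>n. S n)" "q \<in> (\<rat> :: real set)"
    then obtain i j where "\<psi> \<in> S i" "\<xi> \<in> S j" by auto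
    then have "\<psi> \<in> S (max i j)" "\<xi> \<in> S (max i j)" using mono[of i "max i j"] mono[of j "max i j"] by auto
    then have "\<psi> + q *\<^sub>R \<xi> \<in> S (Suc (max i j))" using *(3) by (force simp: S_def step_def)
    then show "\<psi> + q *\<^sub>R \<xi> \<in> (\<Union>n. S n)" by blast
  qed
qed

text \<open>Densities that are linear and bounded almost everywhere, with an exceptional set depending on
  the vectors involved, are simultaneously linear and bounded off a single null set on a countable
  dense \<open>\<rat>\<close>-subspace; the functional is then extended by continuity.\<close>

lemma AE_linear_selection:
  fixes \<gamma> :: "'a::real_normed_vector \<Rightarrow> real \<Rightarrow> real" and v :: "real \<Rightarrow> real"
    and D :: "'a set"
  assumes D: "countable D" "\<And>\<psi> e. 0 < e \<Longrightarrow> \<exists>\<xi>\<in>D. norm (\<psi> - \<xi>) < e"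
    and meas: "\<And>\<psi>. \<gamma> \<psi> \<in> borel_measurable borel" and v0: "\<And>x. 0 \<le> v x"
    and bound: "\<And>\<psi>. AE x in lborel. \<bar>\<gamma> \<psi> x\<bar> \<le> norm \<psi> * v x"
    and linear: "\<And>\<psi> \<xi> c. AE x in lborel. \<gamma> (\<psi> + c *\<^sub>R \<xi>) x = \<gamma> \<psi> x + c * \<gamma> \<xi> x"
  obtains g :: "real \<Rightarrow> 'a \<Rightarrow>\<^sub>L real" where "\<And>\<psi>. (\<lambda>x. blinfun_apply (g x) \<psi>) \<in> borel_measurable borel"
    "\<And>x. norm (g x) \<le> v x" "\<And>\<psi>. AE x in lborel. blinfun_apply (g x) \<psi> = \<gamma> \<psi> x"
proof -
  obtain S :: "'a set" where S: "countable S" "D \<subseteq> S" "\<And>\<psi> \<xi> q. \<psi> \<in> S \<Longrightarrow> \<xi> \<in> S \<Longrightarrow> q \<in> \<rat> \<Longrightarrow> \<psi> + q *\<^sub>R \<xi> \<in> S"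
    by (rule countable_rat_span[OF D(1)]) blast
  have "AE x in lborel. (\<forall>\<psi>\<in>S. \<bar>\<gamma> \<psi> x\<bar> \<le> norm \<psi> * v x) \<and> (\<forall>\<psi>\<in>S. \<forall>\<xi>\<in>S. \<forall>q\<in>\<rat>. \<gamma> (\<psi> + q *\<^sub>R \<xi>) x = \<gamma> \<psi> x + q * \<gamma> \<xi> x)"
  proof -
    have "countable (\<rat> :: real set)" by (rule countable_rat)
    with S(1) show ?thesis by (simp add: AE_ball_countable AE_conj_iff bound linear)
  qed
  then obtain N where "\<And>x. x \<in> space lborel - N \<Longrightarrow> (\<forall>\<psi>\<in>S. \<bar>\<gamma> \<psi> x\<bar> \<le> norm \<psi> * v x) \<and> (\<forall>\<psi>\<in>S. \<forall>\<xi>\<in>S. \<forall>q\<in>\<rat>. \<gamma> (\<psi> + q *\<^sub>R \<xi>) x = \<gamma> \<psi> x + q * \<gamma> \<xi> x)"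
    "N \<in> null_sets lborel" by (rule AE_E3) blast
  then have N: "N \<in> null_sets lborel"
    "\<And>x. x \<notin> N \<Longrightarrow> (\<forall>\<psi>\<in>S. \<bar>\<gamma> \<psi> x\<bar> \<le> norm \<psi> * v x) \<and> (\<forall>\<psi>\<in>S. \<forall>\<xi>\<in>S. \<forall>q\<in>\<rat>. \<gamma> (\<psi> + q *\<^sub>R \<xi>) x = \<gamma> \<psi> x + q * \<gamma> \<xi> x)"
    by simp_all
  have "\<forall>\<psi>. \<forall>n. \<exists>\<xi>\<in>S. norm (\<psi> - \<xi>) < 1 / real (Suc n)"
    using D(2) S(2) by (meson subsetD zero_less_divide_1_iff of_nat_0_less_iff zero_less_Suc)
  then obtain \<sigma> where \<sigma>: "\<And>\<psi> n. \<sigma> \<psi> n \<in> S" "\<And>\<psi> n. norm (\<psi> - \<sigma> \<psi> n) < 1 / real (Suc n)" by metis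
  have \<sigma>_lim: "\<sigma> \<psi> \<longlonglongrightarrow> \<psi>" for \<psi>
  proof (rule LIMSEQ_I)
    fix r :: real assume "0 < r"
    then obtain k where k: "inverse (real (Suc k)) < r" using reals_Archimedean by blast
    have "norm (\<sigma> \<psi> n - \<psi>) < r" if "k \<le> n" for n
    proof -
      have "1 / real (Suc n) \<le> 1 / real (Suc k)" using that by (intro divide_left_mono) auto
      then show ?thesis using \<sigma>(2)[of \<psi> n] k by (simp add: norm_minus_commute inverse_eq_divide)
    qed
    then show "\<exists>no. \<forall>n\<ge>no. norm (\<sigma> \<psi> n - \<psi>) < r" by blast
  qed
  \<comment> \<open>One approximating sequence is fixed for each vector, so that measurability in x
    passes to the limit. Off N the values form a Cauchy sequence, so that \<open>lim\<close> is a
    true limit.\<close>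
  define G where "G x \<psi> = (if x \<in> N then 0 else lim (\<lambda>n. \<gamma> (\<sigma> \<psi> n) x))" for x \<psi>
  have diff: "\<bar>\<gamma> \<psi> x - \<gamma> \<xi> x\<bar> \<le> norm (\<psi> - \<xi>) * v x" if "x \<notin> N" "\<psi> \<in> S" "\<xi> \<in> S" for x \<psi> \<xi>
  proof -
    have "\<psi> + (- 1) *\<^sub>R \<xi> \<in> S" using that by (intro S) auto
    moreover have "\<gamma> (\<psi> + (- 1) *\<^sub>R \<xi>) x = \<gamma> \<psi> x + (- 1) * \<gamma> \<xi> x" using N(2)[OF that(1)] that(2,3) Rats_minus_iff[of 1] by (metis Rats_1)
    ultimately show ?thesis using N(2)[OF that(1)] by fastforce
  qed
  have conv: "(\<lambda>n. \<gamma> (\<sigma> \<psi> n) x) \<longlonglongrightarrow> G x \<psi>" if x: "x \<notin> N" for x \<psi>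
  proof -
    have "Cauchy (\<lambda>n. \<gamma> (\<sigma> \<psi> n) x)"
    proof (rule metric_CauchyI)
      fix e :: real assume "0 < e"
      then have "0 < e / (v x + 1)" using v0[of x] by simp
      then obtain M where M: "\<And>m n. M \<le> m \<Longrightarrow> M \<le> n \<Longrightarrow> dist (\<sigma> \<psi> m) (\<sigma> \<psi> n) < e / (v x + 1)"
        using LIMSEQ_imp_Cauchy[OF \<sigma>_lim[of \<psi>]] unfolding Cauchy_def by metis
      have "dist (\<gamma> (\<sigma> \<psi> m) x) (\<gamma> (\<sigma> \<psi> n) x) < e" if "M \<le> m" "M \<le> n" for m n
      proof -
        have "\<bar>\<gamma> (\<sigma> \<psi> m) x - \<gamma> (\<sigma> \<psi> n) x\<bar> \<le> norm (\<sigma> \<psi> m - \<sigma> \<psi> n) * v x" by (rule diff[OF x \<sigma>(1) \<sigma>(1)])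
        also have "\<dots> \<le> norm (\<sigma> \<psi> m - \<sigma> \<psi> n) * (v x + 1)" by (intro mult_left_mono) auto
        also have "\<dots> < e" using M[OF that] v0[of x] by (simp add: dist_norm pos_less_divide_eq add_nonneg_pos)
        finally show ?thesis by (simp add: dist_real_def)
      qed
      then show "\<exists>M. \<forall>m\<ge>M. \<forall>n\<ge>M. dist (\<gamma> (\<sigma> \<psi> m) x) (\<gamma> (\<sigma> \<psi> n) x) < e" by blast
    qed
    then show ?thesis using x by (simp add: G_def Cauchy_convergent_iff convergent_LIMSEQ_iff)
  qed
  \<comment> \<open>The limit is independent of the approximating sequence. Sums and multiples of
    approximants may therefore serve as approximants of sums and multiples.\<close>
  have conv': "(\<lambda>n. \<gamma> (\<tau> n) x) \<longlonglongrightarrow> G x \<psi>" if x: "x \<notin> N" and \<tau>: "\<And>n. \<tau> n \<in> S" "\<tau> \<longlonglongrightarrow> \<psi>" for x \<psi> \<tau>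
  proof -
    have "(\<lambda>n. \<gamma> (\<tau> n) x - \<gamma> (\<sigma> \<psi> n) x) \<longlonglongrightarrow> 0"
    proof (rule Lim_null_comparison)
      show "\<forall>\<^sub>F n in sequentially. norm (\<gamma> (\<tau> n) x - \<gamma> (\<sigma> \<psi> n) x) \<le> norm (\<tau> n - \<sigma> \<psi> n) * v x"
        using diff[OF x \<tau>(1) \<sigma>(1)] by (intro always_eventually allI) simp
      have "(\<lambda>n. norm (\<tau> n - \<sigma> \<psi> n) * v x) \<longlonglongrightarrow> norm (\<psi> - \<psi>) * v x"
        by (intro tendsto_intros \<tau>(2) \<sigma>_lim)
      then show "(\<lambda>n. norm (\<tau> n - \<sigma> \<psi> n) * v x) \<longlonglongrightarrow> 0" by simp
    qed
    from tendsto_add[OF this conv[OF x, of \<psi>]] show ?thesis by simp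
  qed
  have lin: "bounded_linear (G x)" and bd: "\<bar>G x \<psi>\<bar> \<le> norm \<psi> * v x" if x: "x \<notin> N" for x \<psi>
  proof -
    have bd: "\<bar>G x \<psi>\<bar> \<le> norm \<psi> * v x" for \<psi>
    proof (rule LIMSEQ_le)
      show "(\<lambda>n. \<bar>\<gamma> (\<sigma> \<psi> n) x\<bar>) \<longlonglongrightarrow> \<bar>G x \<psi>\<bar>" by (intro tendsto_rabs conv x)
      show "(\<lambda>n. norm (\<sigma> \<psi> n) * v x) \<longlonglongrightarrow> norm \<psi> * v x" by (intro tendsto_intros \<sigma>_lim)
      show "\<exists>n. \<forall>k\<ge>n. \<bar>\<gamma> (\<sigma> \<psi> k) x\<bar> \<le> norm (\<sigma> \<psi> k) * v x" using N(2)[OF x] \<sigma>(1) by blast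
    qed
    then show "\<bar>G x \<psi>\<bar> \<le> norm \<psi> * v x" .
    show "bounded_linear (G x)"
    proof (rule bounded_linear_intro)
      fix \<psi> \<xi>
      have "\<sigma> \<psi> n + 1 *\<^sub>R \<sigma> \<xi> n \<in> S" for n by (intro S \<sigma>) auto
      moreover have "(\<lambda>n. \<sigma> \<psi> n + 1 *\<^sub>R \<sigma> \<xi> n) \<longlonglongrightarrow> \<psi> + 1 *\<^sub>R \<xi>" by (intro tendsto_intros \<sigma>_lim)
      ultimately have "(\<lambda>n. \<gamma> (\<sigma> \<psi> n + 1 *\<^sub>R \<sigma> \<xi> n) x) \<longlonglongrightarrow> G x (\<psi> + 1 *\<^sub>R \<xi>)" by (rule conv'[OF x])
      moreover have "\<gamma> (\<sigma> \<psi> n + 1 *\<^sub>R \<sigma> \<xi> n) x = \<gamma> (\<sigma> \<psi> n) x + 1 * \<gamma> (\<sigma> \<xi> n) x" for n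
        using N(2)[OF x] \<sigma>(1) Rats_1 by blast
      ultimately have "(\<lambda>n. \<gamma> (\<sigma> \<psi> n) x + \<gamma> (\<sigma> \<xi> n) x) \<longlonglongrightarrow> G x (\<psi> + \<xi>)" by simp
      then show "G x (\<psi> + \<xi>) = G x \<psi> + G x \<xi>"
        using LIMSEQ_unique tendsto_add[OF conv[OF x, of \<psi>] conv[OF x, of \<xi>]] by blast
    next
      fix c :: real and \<psi>
      \<comment> \<open>On S only rational multiples are linear, so the scalar is approximated
        together with the vector.\<close>
      have "\<forall>n. \<exists>q\<in>\<rat>. c < q \<and> q < c + inverse (real (Suc n))"
        by (intro allI Rats_dense_in_real) simp
      then obtain q where q': "\<And>n. q n \<in> \<rat>" "\<And>n. c < q n" "\<And>n. q n < c + inverse (real (Suc n))" by metis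
      have "q \<longlonglongrightarrow> c"
        by (rule tendsto_sandwich[OF _ _ tendsto_const LIMSEQ_inverse_real_of_nat_add])
          (use q' in \<open>auto intro!: always_eventually less_imp_le\<close>)
      note q = q'(1) this
      have S0: "\<psi> + (- 1) *\<^sub>R \<psi> \<in> S" if "\<psi> \<in> S" for \<psi> using that by (intro S) auto
      then have zS: "0 \<in> S" using S0[OF \<sigma>(1)] by simp
      have g0: "\<gamma> 0 x = 0" using N(2)[OF x] zS by fastforce
      have "0 + q n *\<^sub>R \<sigma> \<psi> n \<in> S" for n by (intro S \<sigma> zS q)
      moreover have "(\<lambda>n. 0 + q n *\<^sub>R \<sigma> \<psi> n) \<longlonglongrightarrow> 0 + c *\<^sub>R \<psi>" by (intro tendsto_intros \<sigma>_lim q)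
      ultimately have "(\<lambda>n. \<gamma> (0 + q n *\<^sub>R \<sigma> \<psi> n) x) \<longlonglongrightarrow> G x (0 + c *\<^sub>R \<psi>)" by (rule conv'[OF x])
      moreover have "\<gamma> (0 + q n *\<^sub>R \<sigma> \<psi> n) x = \<gamma> 0 x + q n * \<gamma> (\<sigma> \<psi> n) x" for n
        using N(2)[OF x] \<sigma>(1) zS q(1) by blast
      ultimately have "(\<lambda>n. q n * \<gamma> (\<sigma> \<psi> n) x) \<longlonglongrightarrow> G x (c *\<^sub>R \<psi>)" by (simp add: g0)
      then show "G x (c *\<^sub>R \<psi>) = c *\<^sub>R G x \<psi>"
        using LIMSEQ_unique tendsto_mult[OF q(2) conv[OF x, of \<psi>]] by (simp add: LIMSEQ_unique)
    qed (use bd in auto)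
  qed
  define g where "g x = (if x \<in> N then 0 else Blinfun (G x))" for x
  have gG: "blinfun_apply (g x) \<psi> = G x \<psi>" for x \<psi>
    using lin by (auto simp: g_def G_def bounded_linear_Blinfun_apply)
  have Nm[measurable]: "N \<in> sets borel" using N(1) by auto
  note meas[measurable]
  show thesis
  proof (rule that[of g])
    fix \<psi>
    show "(\<lambda>x. blinfun_apply (g x) \<psi>) \<in> borel_measurable borel"
    proof (rule borel_measurable_LIMSEQ_real)
      show "(\<lambda>x. indicator (- N) x * \<gamma> (\<sigma> \<psi> n) x) \<in> borel_measurable borel" for n by measurable
      show "(\<lambda>n. indicator (- N) x * \<gamma> (\<sigma> \<psi> n) x) \<longlonglongrightarrow> blinfun_apply (g x) \<psi>" for x
        using conv[of x \<psi>] by (cases "x \<in> N") (auto simp: gG G_def)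
    qed
    show "AE x in lborel. blinfun_apply (g x) \<psi> = \<gamma> \<psi> x"
    proof -
      \<comment> \<open>The vector need not lie in S, so bound and linearity are invoked once more
        for it and its approximants. The further null set may depend on the vector, as the claim is
        made for each vector separately.\<close>
      have "AE x in lborel. \<forall>n. \<bar>\<gamma> (\<psi> + (- 1) *\<^sub>R \<sigma> \<psi> n) x\<bar> \<le> norm (\<psi> + (- 1) *\<^sub>R \<sigma> \<psi> n) * v x \<and>
          \<gamma> (\<psi> + (- 1) *\<^sub>R \<sigma> \<psi> n) x = \<gamma> \<psi> x + (- 1) * \<gamma> (\<sigma> \<psi> n) x"
        unfolding AE_all_countable AE_conj_iff using bound linear by blast
      moreover have "AE x in lborel. x \<notin> N" using N(1) by (rule AE_not_in)
      ultimately show ?thesis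
      proof eventually_elim
        case (elim x)
        have "(\<lambda>n. \<gamma> \<psi> x - \<gamma> (\<sigma> \<psi> n) x) \<longlonglongrightarrow> 0"
        proof (rule Lim_null_comparison)
          have "\<bar>\<gamma> \<psi> x - \<gamma> (\<sigma> \<psi> n) x\<bar> \<le> norm (\<psi> - \<sigma> \<psi> n) * v x" for n
            using elim(1)[rule_format, of n] by (metis diff_conv_add_uminus mult_minus1 scaleR_minus1_left)
          then show "\<forall>\<^sub>F n in sequentially. norm (\<gamma> \<psi> x - \<gamma> (\<sigma> \<psi> n) x) \<le> norm (\<psi> - \<sigma> \<psi> n) * v x"
            by (intro always_eventually allI) simp
          have "(\<lambda>n. norm (\<psi> - \<sigma> \<psi> n) * v x) \<longlonglongrightarrow> norm (\<psi> - \<psi>) * v x" by (intro tendsto_intros \<sigma>_lim)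
          then show "(\<lambda>n. norm (\<psi> - \<sigma> \<psi> n) * v x) \<longlonglongrightarrow> 0" by simp
        qed
        moreover have "(\<lambda>n. \<gamma> \<psi> x - \<gamma> (\<sigma> \<psi> n) x) \<longlonglongrightarrow> \<gamma> \<psi> x - G x \<psi>"
          by (intro tendsto_intros conv elim)
        ultimately have "\<gamma> \<psi> x - G x \<psi> = 0" using LIMSEQ_unique by blast
        then show ?case by (simp add: gG)
      qed
    qed
  next
    fix x
    show "norm (g x) \<le> v x"
    proof (rule norm_blinfun_bound[OF v0])
      fix \<psi>
      show "norm (blinfun_apply (g x) \<psi>) \<le> v x * norm \<psi>"
        using bd[of x \<psi>] v0[of x] by (cases "x \<in> N") (auto simp: gG G_def mult.commute)
    qed
  qed
qed

text \<open>Integration by parts as Fubini on the triangle s < x <= r <= t: the increment of f is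
  written as an integral of g and the order of integration is exchanged.\<close>

lemma weak_derivative_of_integral:
  fixes f g :: "real \<Rightarrow> real"
  assumes I: "I = {a<..<b}" and f: "continuous_on I f" and g: "integrable lborel g"
    and fg: "\<And>s t. s \<in> I \<Longrightarrow> t \<in> I \<Longrightarrow> s \<le> t \<Longrightarrow> f t - f s = (\<integral>x. indicator {s<..t} x * g x \<partial>lborel)"
  shows "weak_derivative I f g"
  unfolding weak_derivative_def
proof (intro conjI ballI)
  have gm[measurable]: "g \<in> borel_measurable borel" using borel_measurable_integrable[OF g] by simp
  show "locally_integrable I f"
    unfolding locally_integrable_def
    using borel_integrable_compact[OF _ continuous_on_subset[OF f]] by (auto simp: set_integrable_def)
  show "locally_integrable I g"
    unfolding locally_integrable_def set_integrable_def
    using integrable_mult_indicator[OF _ g] by (simp add: borel_compact)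
  fix \<phi> assume "\<phi> \<in> test_functions I"
  then obtain K where smooth: "\<And>n t. (deriv ^^ n) \<phi> differentiable at t"
    and K: "compact K" "K \<subseteq> I" "\<And>t. t \<notin> K \<Longrightarrow> \<phi> t = 0"
    by (auto simp: test_functions_def)
  have D: "(\<phi> has_real_derivative deriv \<phi> t) (at t)" for t
    using smooth[of 0 t] by (simp add: DERIV_deriv_iff_real_differentiable)
  have cd: "continuous_on UNIV (deriv \<phi>)"
    using smooth[of 1] by (intro continuous_at_imp_continuous_on ballI differentiable_imp_continuous_within) simp
  have [measurable]: "deriv \<phi> \<in> borel_measurable borel" by (rule borel_measurable_continuous_onI[OF cd])
  have deriv0: "deriv \<phi> t = 0" if "t \<notin> K" for t
  proof -
    have "(\<phi> has_real_derivative 0) (at t)"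
      by (rule has_field_derivative_transform_within_open[of "\<lambda>_. 0" 0 t "- K"])
        (use that K compact_imp_closed in auto)
    then show ?thesis by (rule DERIV_imp_deriv)
  qed
  show "(LINT t:I|lborel. deriv \<phi> t * f t) = - (LINT t:I|lborel. \<phi> t * g t)"
  proof (cases "K = {}")
    case True
    then show ?thesis using K deriv0 by (simp add: set_lebesgue_integral_def)
  next
    case False
    obtain k1 where k1: "k1 \<in> K" "\<And>k. k \<in> K \<Longrightarrow> k1 \<le> k" using compact_attains_inf[OF K(1) False] by blast
    obtain k2 where k2: "k2 \<in> K" "\<And>k. k \<in> K \<Longrightarrow> k \<le> k2" using compact_attains_sup[OF K(1) False] by blast
    \<comment> \<open>Both s and t lie strictly between K and the ends of I, so that \<phi> vanishes
      at them.\<close>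
    define s where "s = (a + k1) / 2"
    define t where "t = (k2 + b) / 2"
    have kI: "a < k1" "k2 < b" "k1 \<le> k2" using k1 k2 K(2) I by auto
    have st: "s \<in> I" "t \<in> I" "s < k1" "k2 < t" "s \<le> t" using kI I by (auto simp: s_def t_def)
    have out: "x \<notin> K" if "x \<notin> {s<..<t}" for x using that k1(2)[of x] k2(2)[of x] st by force
    have bnd: "bounded (deriv \<phi> ` {s..t})"
      by (intro compact_imp_bounded compact_continuous_image continuous_on_subset[OF cd]) auto
    then obtain C where C: "\<And>x. x \<in> {s..t} \<Longrightarrow> \<bar>deriv \<phi> x\<bar> \<le> C"
      unfolding bounded_iff by (metis image_eqI real_norm_def)
    \<comment> \<open>The integrand on the triangle; the cut-off in r makes it integrable over the
      plane.\<close>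
    define P where "P r x = deriv \<phi> r * indicator {s<..t} r * (indicator {s<..r} x * g x)" for r x
    have Pm: "(\<lambda>(r, x). P r x) \<in> borel_measurable (lborel \<Otimes>\<^sub>M lborel)"
    proof -
      have eq: "P r x = deriv \<phi> r * indicator {s<..t} r * ((if s < x \<and> x \<le> r then 1 else 0) * g x)" for r x
        by (simp add: P_def indicator_def)
      show ?thesis unfolding eq by measurable
    qed
    have Pb: "\<bar>P r x\<bar> \<le> C * indicator {s<..t} r * \<bar>g x\<bar>" for r x
      using C[of r] by (auto simp: P_def abs_mult indicator_def intro!: mult_mono)
    have Pint: "integrable (lborel \<Otimes>\<^sub>M lborel) (\<lambda>(r, x). P r x)"
    proof (rule Bochner_Integration.integrable_bound)
      have "integrable (lborel \<Otimes>\<^sub>M lborel) (\<lambda>(r, x). (C * indicator {s<..t} r) * \<bar>g x\<bar>)"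
      proof (rule lborel_pair.Fubini_integrable)
        show "(\<lambda>(r, x). (C * indicator {s<..t} r) * \<bar>g x\<bar>) \<in> borel_measurable (lborel \<Otimes>\<^sub>M lborel)" by measurable
        have "integrable lborel (\<lambda>r. \<bar>C\<bar> * indicator {s<..t} r * (\<integral>x. \<bar>g x\<bar> \<partial>lborel))"
          using st(5) by (intro integrable_mult_left integrable_mult_right integrable_real_indicator) auto
        then show "integrable lborel (\<lambda>r. \<integral>x. norm (case (r, x) of (r, x) \<Rightarrow> (C * indicator {s<..t} r) * \<bar>g x\<bar>) \<partial>lborel)"
          by (simp add: abs_mult)
        show "AE r in lborel. integrable lborel (\<lambda>x. case (r, x) of (r, x) \<Rightarrow> (C * indicator {s<..t} r) * \<bar>g x\<bar>)"
          using g by simp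
      qed
      then show "integrable (lborel \<Otimes>\<^sub>M lborel) (\<lambda>(r, x). (C * indicator {s<..t} r) * \<bar>g x\<bar>)" .
      show "AE p in lborel \<Otimes>\<^sub>M lborel. norm (case p of (r, x) \<Rightarrow> P r x) \<le> norm (case p of (r, x) \<Rightarrow> (C * indicator {s<..t} r) * \<bar>g x\<bar>)"
        using Pb by (auto intro!: AE_I2 order_trans[OF Pb])
    qed (rule Pm)
    have ftc: "(\<integral>r. indicator {x<..t} r * deriv \<phi> r \<partial>lborel) = \<phi> t - \<phi> x" if "x \<le> t" for x
    proof -
      have "(\<integral>r. deriv \<phi> r * indicator {x..t} r \<partial>lborel) = \<phi> t - \<phi> x"
        by (rule integral_FTC_Icc_real[OF that D]) (use cd in \<open>simp add: continuous_on_eq_continuous_at\<close>)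
      moreover have "(\<integral>r. deriv \<phi> r * indicator {x..t} r \<partial>lborel) = (\<integral>r. indicator {x<..t} r * deriv \<phi> r \<partial>lborel)"
      proof (rule integral_cong_AE)
        have "AE r in lborel. r \<noteq> x" by (rule AE_lborel_singleton)
        then show "AE r in lborel. deriv \<phi> r * indicator {x..t} r = indicator {x<..t} r * deriv \<phi> r"
          by eventually_elim (auto simp: indicator_def)
      qed auto
      ultimately show ?thesis by simp
    qed
    have \<phi>0: "\<phi> s = 0" "\<phi> t = 0" using K(3) out[of s] out[of t] by auto
    have "(LINT r:I|lborel. deriv \<phi> r * f r) = (\<integral>r. (\<integral>x. P r x \<partial>lborel) + f s * (indicator {s<..t} r * deriv \<phi> r) \<partial>lborel)"
      unfolding set_lebesgue_integral_def
    proof (rule Bochner_Integration.integral_cong[OF refl])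
      fix r
      show "indicator I r *\<^sub>R (deriv \<phi> r * f r) = (\<integral>x. P r x \<partial>lborel) + f s * (indicator {s<..t} r * deriv \<phi> r)"
      proof (cases "r \<in> {s<..<t}")
        case True
        then have rI: "r \<in> I" using st I by auto
        then have "(\<integral>x. P r x \<partial>lborel) = deriv \<phi> r * (f r - f s)"
          using fg[of s r] st True by (simp add: P_def)
        then show ?thesis using True rI by (simp add: algebra_simps)
      next
        case False
        then have "deriv \<phi> r = 0" by (intro deriv0 out)
        then show ?thesis by (simp add: P_def)
      qed
    qed
    also have "\<dots> = (\<integral>r. \<integral>x. P r x \<partial>lborel \<partial>lborel) + f s * (\<integral>r. indicator {s<..t} r * deriv \<phi> r \<partial>lborel)"
    proof (subst Bochner_Integration.integral_add)
      show "integrable lborel (\<lambda>r. \<integral>x. P r x \<partial>lborel)"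
        using lborel_pair.integrable_fst'[OF Pint] by simp
      have "integrable lborel (\<lambda>r. indicator {s<..t} r * deriv \<phi> r)"
        by (rule integrable_indicator_bounded[where B = C])
          (use C st(5) in auto)
      then show "integrable lborel (\<lambda>r. f s * (indicator {s<..t} r * deriv \<phi> r))" by (rule integrable_mult_right)
    qed simp
    also have "(\<integral>r. indicator {s<..t} r * deriv \<phi> r \<partial>lborel) = 0" using ftc[OF st(5)] \<phi>0 by simp
    also have "(\<integral>r. \<integral>x. P r x \<partial>lborel \<partial>lborel) = (\<integral>x. \<integral>r. P r x \<partial>lborel \<partial>lborel)"
      using lborel_pair.Fubini_integral[OF Pint] by simp
    also have "\<dots> = (\<integral>x. - (indicator I x * (\<phi> x * g x)) \<partial>lborel)"
    proof (rule Bochner_Integration.integral_cong[OF refl])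
      fix x
      show "(\<integral>r. P r x \<partial>lborel) = - (indicator I x * (\<phi> x * g x))"
      proof (cases "x \<in> {s<..<t}")
        case True
        then have xI: "x \<in> I" using st I by auto
        \<comment> \<open>The triangle contains its diagonal, which the half-open interval omits;
          for fixed x this is the single point r = x.\<close>
        have "P r x = g x * (indicator {x<..t} r * deriv \<phi> r) + g x * (indicator {x} r * deriv \<phi> r)" for r
          using True by (auto simp: P_def indicator_def)
        then have "(\<integral>r. P r x \<partial>lborel) = (\<integral>r. g x * (indicator {x<..t} r * deriv \<phi> r) + g x * (indicator {x} r * deriv \<phi> r) \<partial>lborel)"
          by (simp only:)
        also have "\<dots> = (\<integral>r. g x * (indicator {x<..t} r * deriv \<phi> r) \<partial>lborel)"
        proof (rule integral_cong_AE)
          show "AE r in lborel. g x * (indicator {x<..t} r * deriv \<phi> r) + g x * (indicator {x} r * deriv \<phi> r) = g x * (indicator {x<..t} r * deriv \<phi> r)"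
            using AE_lborel_singleton[of x] by eventually_elim simp
        qed measurable
        finally have "(\<integral>r. P r x \<partial>lborel) = (\<integral>r. g x * (indicator {x<..t} r * deriv \<phi> r) \<partial>lborel)" .
        then show ?thesis using ftc[of x] True xI \<phi>0 by simp
      next
        case False
        then have "\<phi> x = 0" by (intro K(3) out)
        have "P r x = 0" if "r \<in> {s<..<t}" for r using False that by (auto simp: P_def indicator_def)
        moreover have "P r x = 0" if "r \<notin> {s<..<t}" for r using deriv0[OF out[OF that]] by (simp add: P_def)
        ultimately have "P r x = 0" for r by blast
        then show ?thesis using \<open>\<phi> x = 0\<close> by simp
      qed
    qed
    finally show ?thesis by (simp add: set_lebesgue_integral_def)
  qed
qed

section \<open>Limits of curves with equi-integrable fluxes\<close>

text \<open>The infimal convolution of \<psi> with k times the distance. At slope k = 2 B/\<delta>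
  points farther away than \<delta> cannot compete, since \<psi> varies by at most 2 B; nearer ones
  lower the value by less than \<eta>.\<close>

lemma lipschitz_uniform_approx:
  fixes \<psi> :: "'a::metric_space \<Rightarrow> real"
  assumes "compact (UNIV :: 'a set)" "continuous_on UNIV \<psi>" "0 < \<eta>"
  obtains \<phi> L where "L-lipschitz_on UNIV \<phi>" "\<And>p. \<bar>\<psi> p - \<phi> p\<bar> \<le> \<eta>"
proof -
  have "bounded (range \<psi>)" using assms by (intro compact_imp_bounded compact_continuous_image)
  then obtain B where B: "\<And>p. \<bar>\<psi> p\<bar> \<le> B" by (auto simp: bounded_iff)
  then have B0: "0 \<le> B" using abs_ge_zero order_trans by blast
  obtain \<delta> where \<delta>: "0 < \<delta>" "\<And>p q. dist p q < \<delta> \<Longrightarrow> dist (\<psi> p) (\<psi> q) < \<eta>"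
    using compact_uniformly_continuous[OF assms(2,1)] assms(3) unfolding uniformly_continuous_on_def by (metis UNIV_I)
  define k where "k = 2 * B / \<delta>"
  have k0: "0 \<le> k" using \<delta>(1) B0 by (simp add: k_def)
  define \<phi> where "\<phi> p = (INF q. \<psi> q + k * dist p q)" for p
  have bdd: "bdd_below (range (\<lambda>q. \<psi> q + k * dist p q))" for p
  proof (rule bdd_belowI2)
    fix q
    have "0 \<le> k * dist p q" using k0 by simp
    then show "- B \<le> \<psi> q + k * dist p q" using B[of q] by linarith
  qed
  have le: "\<phi> p \<le> \<psi> q + k * dist p q" for p q unfolding \<phi>_def by (rule cINF_lower[OF bdd]) simp
  show thesis
  proof (rule that[of k \<phi>])
    have *: "\<phi> p \<le> \<phi> p' + k * dist p p'" for p p'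
    proof -
      have "\<phi> p - k * dist p p' \<le> \<phi> p'"
        unfolding \<phi>_def[of p']
      proof (rule cINF_greatest)
        fix q
        have "k * dist p q \<le> k * (dist p p' + dist p' q)" using k0 by (intro mult_left_mono dist_triangle) auto
        then show "\<phi> p - k * dist p p' \<le> \<psi> q + k * dist p' q" using le[of p q] by (simp add: distrib_left)
      qed simp
      then show ?thesis by linarith
    qed
    show "k-lipschitz_on UNIV \<phi>"
    proof (rule lipschitz_onI[OF _ k0])
      show "dist (\<phi> p) (\<phi> p') \<le> k * dist p p'" for p p'
        using *[of p p'] *[of p' p] by (simp add: dist_real_def abs_le_iff dist_commute[of p' p])
    qed
    fix p
    have "\<psi> p - \<eta> \<le> \<phi> p"
      unfolding \<phi>_def
    proof (rule cINF_greatest)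
      fix q
      show "\<psi> p - \<eta> \<le> \<psi> q + k * dist p q"
      proof (cases "dist p q < \<delta>")
        case True
        have "0 \<le> k * dist p q" using k0 by simp
        then show ?thesis using \<delta>(2)[OF True] by (simp add: dist_real_def abs_less_iff)
      next
        case False
        then have "k * \<delta> \<le> k * dist p q" using k0 by (intro mult_left_mono) auto
        then have "2 * B \<le> k * dist p q" using \<delta>(1) by (simp add: k_def)
        then show ?thesis using B[of p] B[of q] assms(3) by linarith
      qed
    qed simp
    moreover have "\<phi> p \<le> \<psi> p" using le[of p p] by simp
    ultimately show "\<bar>\<psi> p - \<phi> p\<bar> \<le> \<eta>" by simp
  qed
qed

text \<open>Rounded values on a finite \<eta>-net of the space take finitely many patterns, and a
  pattern determines a function of K up to 3 \<eta>: one \<eta> for rounding and one for each of the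
  two Lipschitz moduli.\<close>

lemma finite_net_lipschitz:
  fixes K :: "('a::metric_space \<Rightarrow> real) set"
  assumes "compact (UNIV :: 'a set)" and "0 < \<eta>"
    and K: "K = {\<psi>. (\<forall>p. \<bar>\<psi> p\<bar> \<le> 1) \<and> 1-lipschitz_on UNIV \<psi>}"
  obtains G where "finite G" "G \<subseteq> K" "\<And>\<psi>. \<psi> \<in> K \<Longrightarrow> \<exists>g\<in>G. \<forall>p. \<bar>\<psi> p - g p\<bar> \<le> 3 * \<eta>"
proof -
  have "(UNIV :: 'a set) \<subseteq> (\<Union>c\<in>UNIV. ball c \<eta>)" using assms(2) by auto
  then obtain A where A: "finite A" "(UNIV :: 'a set) \<subseteq> (\<Union>c\<in>A. ball c \<eta>)"
    using compactE_image[OF assms(1), of UNIV "\<lambda>c. ball c \<eta>"] by auto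
  define data where "data \<psi> = restrict (\<lambda>a. \<lfloor>1 / \<eta> * \<psi> a\<rfloor>) A" for \<psi> :: "'a \<Rightarrow> real"
  have "data ` K \<subseteq> PiE A (\<lambda>_. {\<lfloor>1 / \<eta> * (- 1)\<rfloor>..\<lfloor>1 / \<eta> * 1\<rfloor>})"
  proof
    fix d assume "d \<in> data ` K"
    then obtain \<psi> where \<psi>: "\<psi> \<in> K" "d = data \<psi>" by auto
    have "- 1 \<le> \<psi> a" "\<psi> a \<le> 1" for a using \<psi>(1) by (auto simp: K abs_le_iff)
    then have "\<lfloor>1 / \<eta> * (- 1)\<rfloor> \<le> \<lfloor>1 / \<eta> * \<psi> a\<rfloor>" "\<lfloor>1 / \<eta> * \<psi> a\<rfloor> \<le> \<lfloor>1 / \<eta> * 1\<rfloor>" for a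
      using assms(2) by (intro floor_mono mult_left_mono; simp)+
    then show "d \<in> PiE A (\<lambda>_. {\<lfloor>1 / \<eta> * (- 1)\<rfloor>..\<lfloor>1 / \<eta> * 1\<rfloor>})"
      unfolding \<psi>(2) data_def by (intro PiE_I) (simp_all only: restrict_apply' restrict_apply atLeastAtMost_iff if_False if_True simp_thms)
  qed
  then have fin: "finite (data ` K)" by (rule finite_subset) (intro finite_PiE A, simp)
  show thesis
  proof (rule that[of "inv_into K data ` data ` K"])
    show "finite (inv_into K data ` data ` K)" using fin by simp
    show "inv_into K data ` data ` K \<subseteq> K" by (auto intro: inv_into_into)
    fix \<psi> assume \<psi>: "\<psi> \<in> K"
    define g where "g = inv_into K data (data \<psi>)"
    have g: "g \<in> K" "data g = data \<psi>" using \<psi> by (simp_all add: g_def inv_into_into f_inv_into_f)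
    have lip: "\<bar>f p - f q\<bar> \<le> dist p q" if "f \<in> K" for f p q
      using that lipschitz_onD[of 1 UNIV f p q] by (simp add: K dist_real_def)
    have "\<bar>\<psi> p - g p\<bar> \<le> 3 * \<eta>" for p
    proof -
      have "p \<in> (\<Union>c\<in>A. ball c \<eta>)" using A(2) by blast
      then obtain c where c: "c \<in> A" "dist c p < \<eta>" by auto
      have "\<lfloor>1 / \<eta> * \<psi> c\<rfloor> = \<lfloor>1 / \<eta> * g c\<rfloor>"
        using g(2) c(1) unfolding data_def by (metis restrict_apply')
      then have "\<bar>\<psi> c - g c\<bar> \<le> 1 / (1 / \<eta>)" using assms(2) by (intro floor_eq_imp_close) auto
      then show ?thesis using lip[OF \<psi>, of c p] lip[OF g(1), of c p] c(2) by simp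
    qed
    then show "\<exists>g\<in>inv_into K data ` data ` K. \<forall>p. \<bar>\<psi> p - g p\<bar> \<le> 3 * \<eta>"
      using \<psi> by (intro bexI[of _ g]) (auto simp: g_def)
  qed
qed

text \<open>The abstract setting left once the graph is forgotten: u n bounds the total flux at each
  time, and against an L-Lipschitz function the curve has increments with density at most L u
  n.\<close>

locale flux_curves =
  fixes I :: "real set" and a b M B :: real
    and \<nu> :: "nat \<Rightarrow> real \<Rightarrow> 'd::finite torus measure" and u :: "nat \<Rightarrow> real \<Rightarrow> real"
  assumes I: "I = {a<..<b}" "a < b"
    and sets_\<nu>: "\<And>n t. t \<in> I \<Longrightarrow> sets (\<nu> n t) = sets borel"
    and finite_\<nu>: "\<And>n t. t \<in> I \<Longrightarrow> finite_measure (\<nu> n t)"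
    and mass_\<nu>: "\<And>n t. t \<in> I \<Longrightarrow> measure (\<nu> n t) UNIV \<le> M"
    and u_meas: "\<And>n. u n \<in> borel_measurable borel" and u_nonneg: "\<And>n x. 0 \<le> u n x"
    and u_support: "\<And>n x. x \<notin> I \<Longrightarrow> u n x = 0"
    and u_int: "\<And>n. integrable lborel (u n)" and u_bound: "\<And>n. (\<integral>x. u n x \<partial>lborel) \<le> B"
    and u_equi: "\<And>\<eta>. 0 < \<eta> \<Longrightarrow> \<exists>\<delta>>0. \<forall>n. \<forall>S\<in>sets borel. emeasure lborel S < ennreal \<delta> \<longrightarrow> (\<integral>x. indicator S x * u n x \<partial>lborel) \<le> \<eta>"
    and flux: "\<And>n L (\<psi> :: 'd torus \<Rightarrow> real). L-lipschitz_on UNIV \<psi> \<Longrightarrow> \<exists>h\<in>borel_measurable borel. (\<forall>x. \<bar>h x\<bar> \<le> L * u n x) \<and>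
      (\<forall>s\<in>I. \<forall>t\<in>I. s \<le> t \<longrightarrow> (\<integral>p. \<psi> p \<partial>\<nu> n t) - (\<integral>p. \<psi> p \<partial>\<nu> n s) = (\<integral>x. indicator {s<..t} x * h x \<partial>lborel))"
begin

lemma subsequence: "flux_curves I a b M B (\<lambda>n. \<nu> (r n)) (\<lambda>n. u (r n))"
proof (intro flux_curves.intro)
  fix \<eta> :: real assume "0 < \<eta>"
  from u_equi[OF this] obtain \<delta> where "0 < \<delta>"
    "\<forall>n. \<forall>S\<in>sets borel. emeasure lborel S < ennreal \<delta> \<longrightarrow> (\<integral>x. indicator S x * u n x \<partial>lborel) \<le> \<eta>" by blast
  then show "\<exists>\<delta>>0. \<forall>n. \<forall>S\<in>sets borel. emeasure lborel S < ennreal \<delta> \<longrightarrow> (\<integral>x. indicator S x * u (r n) x \<partial>lborel) \<le> \<eta>"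
    by blast
qed (fact I sets_\<nu> finite_\<nu> mass_\<nu> u_meas u_nonneg u_support u_int u_bound flux)+

lemma int_indicator_u: "A \<in> sets borel \<Longrightarrow> integrable lborel (\<lambda>x. indicator A x * u n x)"
  using integrable_mult_indicator[OF _ u_int, of A] by simp

lemma increment_le:
  fixes \<psi> :: "'d torus \<Rightarrow> real"
  assumes \<psi>: "L-lipschitz_on UNIV \<psi>" and st: "s \<in> I" "t \<in> I" "s \<le> t"
  shows "\<bar>(\<integral>p. \<psi> p \<partial>\<nu> n t) - (\<integral>p. \<psi> p \<partial>\<nu> n s)\<bar> \<le> L * (\<integral>x. indicator {s<..t} x * u n x \<partial>lborel)"
proof -
  obtain h where h: "h \<in> borel_measurable borel" "\<And>x. \<bar>h x\<bar> \<le> L * u n x"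
    and eq: "(\<integral>p. \<psi> p \<partial>\<nu> n t) - (\<integral>p. \<psi> p \<partial>\<nu> n s) = (\<integral>x. indicator {s<..t} x * h x \<partial>lborel)"
    using flux[OF \<psi>, of n] st by blast
  have "\<bar>\<integral>x. indicator {s<..t} x * h x \<partial>lborel\<bar> \<le> (\<integral>x. \<bar>indicator {s<..t} x * h x\<bar> \<partial>lborel)" by (rule integral_abs_bound)
  also have "\<dots> \<le> (\<integral>x. L * (indicator {s<..t} x * u n x) \<partial>lborel)"
  proof (rule integral_mono')
    show "integrable lborel (\<lambda>x. L * (indicator {s<..t} x * u n x))" by (intro integrable_mult_right int_indicator_u) simp
    show "\<bar>indicator {s<..t} x * h x\<bar> \<le> L * (indicator {s<..t} x * u n x)" for x
      using h(2)[of x] by (simp add: indicator_def)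
    show "0 \<le> L * (indicator {s<..t} x * u n x)" for x
      using lipschitz_on_nonneg[OF \<psi>] u_nonneg[of n x] by simp
  qed
  finally show ?thesis using eq by simp
qed

lemma small_interval:
  assumes "0 < \<eta>"
  obtains \<delta> where "0 < \<delta>" "\<And>n s t. s \<le> t \<Longrightarrow> t - s < \<delta> \<Longrightarrow> (\<integral>x. indicator {s<..t} x * u n x \<partial>lborel) \<le> \<eta>"
proof -
  obtain \<delta> where \<delta>: "0 < \<delta>" "\<And>n S. S \<in> sets borel \<Longrightarrow> emeasure lborel S < ennreal \<delta> \<Longrightarrow> (\<integral>x. indicator S x * u n x \<partial>lborel) \<le> \<eta>"
    using u_equi[OF assms] by blast
  show thesis
  proof (rule that[OF \<delta>(1)])
    fix n s t assume "s \<le> t" "t - s < \<delta>"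
    then show "(\<integral>x. indicator {s<..t} x * u n x \<partial>lborel) \<le> \<eta>"
      by (intro \<delta>(2)) (simp_all add: ennreal_lessI \<delta>(1))
  qed
qed

text \<open>One \<delta> serves all n, which makes the convergence uniform in time, and all test
  functions up to the factor L, which makes the limit curve continuous in the dual norm.\<close>

lemma equicontinuous:
  assumes "0 < \<eta>"
  obtains \<delta> where "0 < \<delta>" "\<And>n L (\<psi> :: 'd torus \<Rightarrow> real) s t. L-lipschitz_on UNIV \<psi> \<Longrightarrow> s \<in> I \<Longrightarrow> t \<in> I \<Longrightarrow> \<bar>t - s\<bar> < \<delta> \<Longrightarrow>
    \<bar>(\<integral>p. \<psi> p \<partial>\<nu> n t) - (\<integral>p. \<psi> p \<partial>\<nu> n s)\<bar> \<le> L * \<eta>"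
proof -
  obtain \<delta> where \<delta>: "0 < \<delta>" "\<And>n s t. s \<le> t \<Longrightarrow> t - s < \<delta> \<Longrightarrow> (\<integral>x. indicator {s<..t} x * u n x \<partial>lborel) \<le> \<eta>"
    by (rule small_interval[OF assms]) blast
  show thesis
  proof (rule that[OF \<delta>(1)])
    fix n L \<psi> s t assume \<psi>: "L-lipschitz_on UNIV (\<psi> :: 'd torus \<Rightarrow> real)" and st: "s \<in> I" "t \<in> I" "\<bar>t - s\<bar> < \<delta>"
    have *: "\<bar>(\<integral>p. \<psi> p \<partial>\<nu> n t) - (\<integral>p. \<psi> p \<partial>\<nu> n s)\<bar> \<le> L * \<eta>" if "s \<in> I" "t \<in> I" "s \<le> t" "t - s < \<delta>" for s t
      using increment_le[OF \<psi> that(1-3), of n] mult_left_mono[OF \<delta>(2)[OF that(3,4), of n] lipschitz_on_nonneg[OF \<psi>]] by linarith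
    show "\<bar>(\<integral>p. \<psi> p \<partial>\<nu> n t) - (\<integral>p. \<psi> p \<partial>\<nu> n s)\<bar> \<le> L * \<eta>"
    proof (cases "s \<le> t")
      case True
      then show ?thesis using *[of s t] st by simp
    next
      case False
      then show ?thesis using *[of t s] st by (simp add: abs_minus_commute)
    qed
  qed
qed

lemma continuous_integral:
  fixes \<psi> :: "'d torus \<Rightarrow> real"
  assumes \<psi>: "L-lipschitz_on UNIV \<psi>"
  shows "continuous_on I (\<lambda>t. \<integral>p. \<psi> p \<partial>\<nu> n t)"
  unfolding continuous_on_iff
proof (intro ballI allI impI)
  fix s and e :: real assume s: "s \<in> I" and "0 < e"
  \<comment> \<open>The added 1 admits L = 0 and makes L \<eta> strictly smaller than e.\<close>
  define \<eta> where "\<eta> = e / (L + 1)"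
  have L: "0 \<le> L" by (rule lipschitz_on_nonneg[OF \<psi>])
  have "0 < \<eta>" using L \<open>0 < e\<close> by (simp add: \<eta>_def add_nonneg_pos)
  then obtain \<delta> where \<delta>: "0 < \<delta>" "\<And>n L (\<psi> :: 'd torus \<Rightarrow> real) s t. L-lipschitz_on UNIV \<psi> \<Longrightarrow> s \<in> I \<Longrightarrow> t \<in> I \<Longrightarrow> \<bar>t - s\<bar> < \<delta> \<Longrightarrow>
    \<bar>(\<integral>p. \<psi> p \<partial>\<nu> n t) - (\<integral>p. \<psi> p \<partial>\<nu> n s)\<bar> \<le> L * \<eta>" by (rule equicontinuous) blast
  have "L * \<eta> < e" using L \<open>0 < e\<close> by (simp add: \<eta>_def field_simps)
  then show "\<exists>d>0. \<forall>t\<in>I. dist t s < d \<longrightarrow> dist (\<integral>p. \<psi> p \<partial>\<nu> n t) (\<integral>p. \<psi> p \<partial>\<nu> n s) < e"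
    using \<delta>(1) \<delta>(2)[OF \<psi> s] by (intro exI[of _ \<delta>]) (auto simp: dist_real_def intro: le_less_trans)
qed

end

text \<open>Convergence is recorded against Lipschitz functions, the class that equicontinuity
  carries from rational times to all times. Continuous test functions follow by density.\<close>

locale flux_limit = flux_curves I a b M B \<nu> u
  for I a b M B and \<nu> :: "nat \<Rightarrow> real \<Rightarrow> 'd::finite torus measure" and u +
  fixes v :: "real \<Rightarrow> real" and \<mu> :: "real \<Rightarrow> 'd torus measure"
  assumes v_meas: "v \<in> borel_measurable borel" and v_nonneg: "\<And>x. 0 \<le> v x" and v_int: "integrable lborel v"
    and u_lim: "\<And>s t. s \<in> I \<Longrightarrow> t \<in> I \<Longrightarrow> (\<lambda>n. \<integral>x. indicator {s<..t} x * u n x \<partial>lborel) \<longlonglongrightarrow> (\<integral>x. indicator {s<..t} x * v x \<partial>lborel)"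
    and sets_\<mu>: "\<And>t. t \<in> I \<Longrightarrow> sets (\<mu> t) = sets borel"
    and finite_\<mu>: "\<And>t. t \<in> I \<Longrightarrow> finite_measure (\<mu> t)"
    and lim_lipschitz: "\<And>L (\<psi> :: 'd torus \<Rightarrow> real) t. L-lipschitz_on UNIV \<psi> \<Longrightarrow> t \<in> I \<Longrightarrow> (\<lambda>n. \<integral>p. \<psi> p \<partial>\<nu> n t) \<longlonglongrightarrow> (\<integral>p. \<psi> p \<partial>\<mu> t)"

context flux_curves
begin

text \<open>A diagonal sequence converges weakly at all rational times of I, and equicontinuity
  makes the integrals at every other time Cauchy along the same sequence. A further subsequence at
  that time only serves to exhibit the limit measure.\<close>

lemma exists_limit:
  obtains r :: "nat \<Rightarrow> nat" and v \<mu> where "strict_mono r" "flux_limit I a b M B (\<lambda>n. \<nu> (r n)) (\<lambda>n. u (r n)) v \<mu>"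
proof -
  obtain r0 :: "nat \<Rightarrow> nat" and v where r0: "strict_mono r0" and v: "v \<in> borel_measurable borel" "\<And>x. 0 \<le> v x" "integrable lborel v"
    and vlim: "\<And>s t. s \<in> I \<Longrightarrow> t \<in> I \<Longrightarrow> (\<lambda>n. \<integral>x. indicator {s<..t} x * u (r0 n) x \<partial>lborel) \<longlonglongrightarrow> (\<integral>x. indicator {s<..t} x * v x \<partial>lborel)"
    by (rule weak_L1_compactness[OF I u_meas u_nonneg u_support u_int u_bound u_equi]) (assumption, assumption, (rule that; assumption))
  define Q where "Q = \<rat> \<inter> I"
  have Q_dense: "\<exists>q\<in>Q. \<bar>t - q\<bar> < \<delta>" if "t \<in> I" "0 < \<delta>" for t \<delta>
  proof -
    have "max a (t - \<delta>) < t" using that I by auto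
    then obtain q where "q \<in> \<rat>" "max a (t - \<delta>) < q" "q < t" using Rats_dense_in_real by blast
    then show ?thesis using that I by (intro bexI[of _ q]) (auto simp: Q_def)
  qed
  have "(a + b) / 2 \<in> I" using I by auto
  then have Q_ne: "Q \<noteq> {}" using Q_dense[of "(a + b) / 2" 1] by auto
  have Q_c: "countable Q" unfolding Q_def using countable_rat by (intro countable_Int1)
  define q where "q = from_nat_into Q"
  have qQ: "q k \<in> Q" for k unfolding q_def by (rule from_nat_into[OF Q_ne])
  then have qI: "q k \<in> I" for k by (auto simp: Q_def)
  have q_surj: "\<exists>k. q k = x" if "x \<in> Q" for x unfolding q_def by (rule from_nat_into_surj[OF Q_c that])
  \<comment> \<open>A property inherited by subsequences, as the diagonal argument requires.\<close>
  define P where "P k s \<longleftrightarrow> (\<forall>\<psi> :: 'd torus \<Rightarrow> real. continuous_on UNIV \<psi> \<longrightarrow> convergent (\<lambda>n. \<integral>p. \<psi> p \<partial>\<nu> (r0 (s n)) (q k)))" for k :: nat and s :: "nat \<Rightarrow> nat"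
  interpret subseqs P
  proof
    fix k and s :: "nat \<Rightarrow> nat" assume "strict_mono s"
    obtain r :: "nat \<Rightarrow> nat" and \<mu> where r: "strict_mono r"
      and lim: "\<And>\<psi> :: 'd torus \<Rightarrow> real. continuous_on UNIV \<psi> \<Longrightarrow> (\<lambda>n. \<integral>p. \<psi> p \<partial>\<nu> (r0 (s (r n))) (q k)) \<longlonglongrightarrow> (\<integral>p. \<psi> p \<partial>\<mu>)"
      by (rule torus_weak_compactness[of "\<lambda>n. \<nu> (r0 (s n)) (q k)" M, OF sets_\<nu>[OF qI] finite_\<nu>[OF qI] mass_\<nu>[OF qI]])
        (rule that; assumption)
    have "P k (s \<circ> r)"
      unfolding P_def comp_def by (intro allI impI, rule convergentI, rule lim)
    then show "\<exists>r'. strict_mono r' \<and> P k (s \<circ> r')" using r by blast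
  qed
  have conv_q: "convergent (\<lambda>n. \<integral>p. \<psi> p \<partial>\<nu> (r0 (diagseq n)) (q k))" if \<psi>: "continuous_on UNIV \<psi>" for \<psi> :: "'d torus \<Rightarrow> real" and k
  proof -
    \<comment> \<open>Only from index k + 1 on is the diagonal sequence known to be a subsequence of
      the k-th extraction; convergence ignores the initial segment.\<close>
    have "P k (diagseq \<circ> ((+) (Suc k)))"
    proof (rule diagseq_holds)
      fix r s :: "nat \<Rightarrow> nat" and n assume *: "strict_mono r" "P n s"
      show "P n (s \<circ> r)"
        unfolding P_def
      proof (intro allI impI)
        fix \<psi> :: "'d torus \<Rightarrow> real" assume "continuous_on UNIV \<psi>"
        then have "convergent (\<lambda>n'. \<integral>p. \<psi> p \<partial>\<nu> (r0 (s n')) (q n))" using *(2) by (simp add: P_def)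
        from convergent_subseq_convergent[OF this *(1)]
        show "convergent (\<lambda>n'. \<integral>p. \<psi> p \<partial>\<nu> (r0 ((s \<circ> r) n')) (q n))" by (simp add: o_def)
      qed
    qed
    then have "convergent (\<lambda>n. (\<lambda>n. \<integral>p. \<psi> p \<partial>\<nu> (r0 (diagseq n)) (q k)) (n + Suc k))"
      using \<psi> by (simp add: P_def o_def add.commute)
    then show ?thesis by (rule iffD1[OF convergent_ignore_initial_segment])
  qed
  define r where "r = r0 \<circ> diagseq"
  have r: "strict_mono r" unfolding r_def by (intro strict_mono_o r0 subseq_diagseq)
  have conv: "convergent (\<lambda>n. \<integral>p. \<psi> p \<partial>\<nu> (r n) t)" if \<psi>: "L-lipschitz_on UNIV \<psi>" and t: "t \<in> I" for L and \<psi> :: "'d torus \<Rightarrow> real" and t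
  proof -
    have L: "0 \<le> L" by (rule lipschitz_on_nonneg[OF \<psi>])
    have "Cauchy (\<lambda>n. \<integral>p. \<psi> p \<partial>\<nu> (r n) t)"
    proof (rule metric_CauchyI)
      fix e :: real assume "0 < e"
      define \<eta> where "\<eta> = e / (3 * (L + 1))"
      have \<eta>: "0 < \<eta>" "L * \<eta> < e / 3" using L \<open>0 < e\<close> by (simp_all add: \<eta>_def field_simps add_nonneg_pos)
      obtain \<delta> where \<delta>: "0 < \<delta>" "\<And>n L (\<psi> :: 'd torus \<Rightarrow> real) s t. L-lipschitz_on UNIV \<psi> \<Longrightarrow> s \<in> I \<Longrightarrow> t \<in> I \<Longrightarrow> \<bar>t - s\<bar> < \<delta> \<Longrightarrow>
        \<bar>(\<integral>p. \<psi> p \<partial>\<nu> n t) - (\<integral>p. \<psi> p \<partial>\<nu> n s)\<bar> \<le> L * \<eta>" by (rule equicontinuous[OF \<eta>(1)]) blast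
      obtain x where x: "x \<in> Q" "\<bar>t - x\<bar> < \<delta>" using Q_dense[OF t \<delta>(1)] by blast
      obtain k where k: "q k = x" using q_surj[OF x(1)] by blast
      have near: "\<bar>(\<integral>p. \<psi> p \<partial>\<nu> n t) - (\<integral>p. \<psi> p \<partial>\<nu> n (q k))\<bar> < e / 3" for n
        using \<delta>(2)[OF \<psi> qI[of k] t, of n] x(2) k \<eta>(2) by simp
      have "Cauchy (\<lambda>n. \<integral>p. \<psi> p \<partial>\<nu> (r n) (q k))"
        using conv_q[OF lipschitz_on_continuous_on[OF \<psi>], of k] by (simp add: r_def Cauchy_convergent_iff)
      then obtain N where N: "\<And>m n. N \<le> m \<Longrightarrow> N \<le> n \<Longrightarrow> dist (\<integral>p. \<psi> p \<partial>\<nu> (r m) (q k)) (\<integral>p. \<psi> p \<partial>\<nu> (r n) (q k)) < e / 3"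
        unfolding Cauchy_def using \<open>0 < e\<close> by (metis zero_less_divide_iff zero_less_numeral)
      have "dist (\<integral>p. \<psi> p \<partial>\<nu> (r m) t) (\<integral>p. \<psi> p \<partial>\<nu> (r n) t) < e" if "N \<le> m" "N \<le> n" for m n
        using N[OF that] near[of "r m"] near[of "r n"] unfolding dist_real_def by linarith
      then show "\<exists>N. \<forall>m\<ge>N. \<forall>n\<ge>N. dist (\<integral>p. \<psi> p \<partial>\<nu> (r m) t) (\<integral>p. \<psi> p \<partial>\<nu> (r n) t) < e" by blast
    qed
    then show ?thesis by (simp add: Cauchy_convergent_iff)
  qed
  have "\<forall>t\<in>I. \<exists>\<mu>. sets \<mu> = sets borel \<and> finite_measure \<mu> \<and>
    (\<forall>L. \<forall>\<psi> :: 'd torus \<Rightarrow> real. L-lipschitz_on UNIV \<psi> \<longrightarrow> (\<lambda>n. \<integral>p. \<psi> p \<partial>\<nu> (r n) t) \<longlonglongrightarrow> (\<integral>p. \<psi> p \<partial>\<mu>))"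
  proof
    fix t assume t: "t \<in> I"
    obtain r' \<mu> where r': "strict_mono (r' :: nat \<Rightarrow> nat)" and \<mu>: "sets \<mu> = sets borel" "finite_measure \<mu>"
      and lim: "\<And>\<psi> :: 'd torus \<Rightarrow> real. continuous_on UNIV \<psi> \<Longrightarrow> (\<lambda>n. \<integral>p. \<psi> p \<partial>\<nu> (r (r' n)) t) \<longlonglongrightarrow> (\<integral>p. \<psi> p \<partial>\<mu>)"
      by (rule torus_weak_compactness[of "\<lambda>n. \<nu> (r n) t" M, OF sets_\<nu>[OF t] finite_\<nu>[OF t] mass_\<nu>[OF t]])
        (rule that; assumption)
    have "(\<lambda>n. \<integral>p. \<psi> p \<partial>\<nu> (r n) t) \<longlonglongrightarrow> (\<integral>p. \<psi> p \<partial>\<mu>)" if \<psi>: "L-lipschitz_on UNIV \<psi>" for L and \<psi> :: "'d torus \<Rightarrow> real"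
    proof -
      obtain l where l: "(\<lambda>n. \<integral>p. \<psi> p \<partial>\<nu> (r n) t) \<longlonglongrightarrow> l" using conv[OF \<psi> t] by (auto simp: convergent_def)
      from LIMSEQ_subseq_LIMSEQ[OF l r'] lim[OF lipschitz_on_continuous_on[OF \<psi>]]
      have "l = (\<integral>p. \<psi> p \<partial>\<mu>)" by (intro LIMSEQ_unique) (auto simp: o_def)
      then show ?thesis using l by simp
    qed
    then show "\<exists>\<mu>. sets \<mu> = sets borel \<and> finite_measure \<mu> \<and>
      (\<forall>L. \<forall>\<psi> :: 'd torus \<Rightarrow> real. L-lipschitz_on UNIV \<psi> \<longrightarrow> (\<lambda>n. \<integral>p. \<psi> p \<partial>\<nu> (r n) t) \<longlonglongrightarrow> (\<integral>p. \<psi> p \<partial>\<mu>))" using \<mu> by blast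
  qed
  then obtain \<mu> where \<mu>: "\<forall>t\<in>I. sets (\<mu> t) = sets borel \<and> finite_measure (\<mu> t) \<and>
    (\<forall>L. \<forall>\<psi> :: 'd torus \<Rightarrow> real. L-lipschitz_on UNIV \<psi> \<longrightarrow> (\<lambda>n. \<integral>p. \<psi> p \<partial>\<nu> (r n) t) \<longlonglongrightarrow> (\<integral>p. \<psi> p \<partial>\<mu> t))"
    by (rule bchoice[THEN exE])
  have "flux_limit I a b M B (\<lambda>n. \<nu> (r n)) (\<lambda>n. u (r n)) v \<mu>"
  proof (intro flux_limit.intro subsequence flux_limit_axioms.intro)
    show "(\<lambda>n. \<integral>x. indicator {s<..t} x * u (r n) x \<partial>lborel) \<longlonglongrightarrow> (\<integral>x. indicator {s<..t} x * v x \<partial>lborel)" if "s \<in> I" "t \<in> I" for s t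
      using LIMSEQ_subseq_LIMSEQ[OF vlim[OF that] subseq_diagseq] by (simp add: r_def o_def)
  qed (use v \<mu> in auto)
  then show thesis by (rule that[OF r])
qed

end

context flux_limit
begin

section \<open>Uniform convergence and regularity of the limit curve\<close>

lemma space_\<nu>: "t \<in> I \<Longrightarrow> space (\<nu> n t) = UNIV"
  using sets_eq_imp_space_eq[OF sets_\<nu>] by simp

lemma space_\<mu>: "t \<in> I \<Longrightarrow> space (\<mu> t) = UNIV"
  using sets_eq_imp_space_eq[OF sets_\<mu>] by simp

lemma measurable_\<nu>: "t \<in> I \<Longrightarrow> measurable (\<nu> n t) N = measurable borel N"
  by (rule measurable_cong_sets[OF sets_\<nu> refl])

lemma measurable_\<mu>: "t \<in> I \<Longrightarrow> measurable (\<mu> t) N = measurable borel N"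
  by (rule measurable_cong_sets[OF sets_\<mu> refl])

text \<open>The constant 1 is 0-Lipschitz, so its increments are at most 0 times the flux.\<close>

lemma mass_constant: "s \<in> I \<Longrightarrow> t \<in> I \<Longrightarrow> measure (\<nu> n t) UNIV = measure (\<nu> n s) UNIV"
proof -
  have *: "measure (\<nu> n t) UNIV = measure (\<nu> n s) UNIV" if "s \<in> I" "t \<in> I" "s \<le> t" for s t
  proof -
    have "0-lipschitz_on UNIV (\<lambda>_ :: 'd torus. 1 :: real)" by (intro lipschitz_onI) auto
    from increment_le[OF this that, of n] show ?thesis using that by (simp add: space_\<nu>)
  qed
  assume "s \<in> I" "t \<in> I"
  then show ?thesis using *[of s t] *[of t s] by (cases "s \<le> t") auto
qed

lemma mass_\<mu>_lim: "t \<in> I \<Longrightarrow> (\<lambda>n. measure (\<nu> n t) UNIV) \<longlonglongrightarrow> measure (\<mu> t) UNIV"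
proof -
  assume t: "t \<in> I"
  have "0-lipschitz_on UNIV (\<lambda>_ :: 'd torus. 1 :: real)" by (intro lipschitz_onI) auto
  from lim_lipschitz[OF this t] show ?thesis using t by (simp add: space_\<nu> space_\<mu>)
qed

lemma mass_\<mu>: "t \<in> I \<Longrightarrow> measure (\<mu> t) UNIV \<le> M"
  by (rule LIMSEQ_le_const2[OF mass_\<mu>_lim]) (auto intro: mass_\<nu>)

lemma mass_\<mu>_constant: "s \<in> I \<Longrightarrow> t \<in> I \<Longrightarrow> measure (\<mu> t) UNIV = measure (\<mu> s) UNIV"
  using mass_\<mu>_lim[of t] mass_\<mu>_lim[of s] mass_constant[of s t] by (simp add: LIMSEQ_unique)

lemma M_nonneg: "0 \<le> M"
proof -
  have "(a + b) / 2 \<in> I" using I by auto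
  from mass_\<mu>[OF this] show ?thesis using measure_nonneg order_trans by blast
qed

lemma integrable_continuous:
  fixes \<psi> :: "'d torus \<Rightarrow> real"
  assumes "continuous_on UNIV \<psi>" "t \<in> I"
  shows "integrable (\<nu> n t) \<psi>" "integrable (\<mu> t) \<psi>"
proof -
  obtain D where D: "\<And>p. \<bar>\<psi> p\<bar> \<le> D" using bounded_continuous_torus[OF assms(1)] by (auto simp: bounded_iff)
  have m: "\<psi> \<in> borel_measurable borel" by (rule borel_measurable_continuous_onI[OF assms(1)])
  show "integrable (\<nu> n t) \<psi>"
    using m by (intro integral_bounded_finite_measure(1)[OF finite_\<nu>[OF assms(2)] _ D]) (simp add: measurable_\<nu> assms)
  show "integrable (\<mu> t) \<psi>"
    using m by (intro integral_bounded_finite_measure(1)[OF finite_\<mu>[OF assms(2)] _ D]) (simp add: measurable_\<mu> assms)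
qed

lemma integral_diff_le:
  fixes \<psi> \<phi> :: "'d torus \<Rightarrow> real"
  assumes "continuous_on UNIV \<psi>" "continuous_on UNIV \<phi>" "\<And>p. \<bar>\<psi> p - \<phi> p\<bar> \<le> \<eta>" and t: "t \<in> I"
  shows "\<bar>(\<integral>p. \<psi> p \<partial>\<nu> n t) - (\<integral>p. \<phi> p \<partial>\<nu> n t)\<bar> \<le> \<eta> * M"
    and "\<bar>(\<integral>p. \<psi> p \<partial>\<mu> t) - (\<integral>p. \<phi> p \<partial>\<mu> t)\<bar> \<le> \<eta> * M"
proof -
  have \<eta>: "0 \<le> \<eta>" using assms(3)[of undefined] abs_ge_zero order_trans by blast
  have m: "(\<lambda>p. \<psi> p - \<phi> p) \<in> borel_measurable borel"
    using assms(1,2) by (intro borel_measurable_continuous_onI continuous_on_diff)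
  have "\<bar>\<integral>p. \<psi> p - \<phi> p \<partial>\<nu> n t\<bar> \<le> \<eta> * measure (\<nu> n t) (space (\<nu> n t))"
    using m by (intro integral_bounded_finite_measure(2)[OF finite_\<nu>[OF t] _ assms(3)]) (simp add: measurable_\<nu> t)
  also have "\<dots> \<le> \<eta> * M" using \<eta> mass_\<nu>[OF t] by (simp add: space_\<nu>[OF t] mult_left_mono)
  finally show "\<bar>(\<integral>p. \<psi> p \<partial>\<nu> n t) - (\<integral>p. \<phi> p \<partial>\<nu> n t)\<bar> \<le> \<eta> * M"
    by (simp add: integrable_continuous assms)
  have "\<bar>\<integral>p. \<psi> p - \<phi> p \<partial>\<mu> t\<bar> \<le> \<eta> * measure (\<mu> t) (space (\<mu> t))"
    using m by (intro integral_bounded_finite_measure(2)[OF finite_\<mu>[OF t] _ assms(3)]) (simp add: measurable_\<mu> t)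
  also have "\<dots> \<le> \<eta> * M" using \<eta> mass_\<mu>[OF t] by (simp add: space_\<mu>[OF t] mult_left_mono)
  finally show "\<bar>(\<integral>p. \<psi> p \<partial>\<mu> t) - (\<integral>p. \<phi> p \<partial>\<mu> t)\<bar> \<le> \<eta> * M"
    by (simp add: integrable_continuous assms)
qed

text \<open>Lipschitz functions are uniformly dense and all masses are at most M, so the error of
  replacing \<psi> is uniform in n.\<close>

lemma lim_continuous:
  fixes \<psi> :: "'d torus \<Rightarrow> real"
  assumes \<psi>: "continuous_on UNIV \<psi>" and t: "t \<in> I"
  shows "(\<lambda>n. \<integral>p. \<psi> p \<partial>\<nu> n t) \<longlonglongrightarrow> (\<integral>p. \<psi> p \<partial>\<mu> t)"
proof (rule LIMSEQ_I)
  fix e :: real assume "0 < e"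
  define \<eta> where "\<eta> = e / (3 * (M + 1))"
  have \<eta>: "0 < \<eta>" "\<eta> * M < e / 3" using M_nonneg \<open>0 < e\<close> by (simp_all add: \<eta>_def field_simps add_nonneg_pos)
  obtain \<phi> :: "'d torus \<Rightarrow> real" and L where \<phi>: "L-lipschitz_on UNIV \<phi>" "\<And>p. \<bar>\<psi> p - \<phi> p\<bar> \<le> \<eta>"
    by (rule lipschitz_uniform_approx[OF compact_torus \<psi> \<eta>(1)]) blast
  note d = integral_diff_le[OF \<psi> lipschitz_on_continuous_on[OF \<phi>(1)] \<phi>(2) t]
  obtain N where N: "\<And>n. N \<le> n \<Longrightarrow> \<bar>(\<integral>p. \<phi> p \<partial>\<nu> n t) - (\<integral>p. \<phi> p \<partial>\<mu> t)\<bar> < e / 3"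
    using LIMSEQ_D[OF lim_lipschitz[OF \<phi>(1) t], of "e / 3"] \<open>0 < e\<close> by auto
  have "norm ((\<integral>p. \<psi> p \<partial>\<nu> n t) - (\<integral>p. \<psi> p \<partial>\<mu> t)) < e" if "N \<le> n" for n
    using N[OF that] d(1)[of n] d(2) \<eta>(2) unfolding real_norm_def by linarith
  then show "\<exists>N. \<forall>n\<ge>N. norm ((\<integral>p. \<psi> p \<partial>\<nu> n t) - (\<integral>p. \<psi> p \<partial>\<mu> t)) < e" by blast
qed

lemma equicontinuous_\<mu>:
  assumes "0 < \<eta>"
  obtains \<delta> where "0 < \<delta>"
    "\<And>n L (\<psi> :: 'd torus \<Rightarrow> real) s t. L-lipschitz_on UNIV \<psi> \<Longrightarrow> s \<in> I \<Longrightarrow> t \<in> I \<Longrightarrow> \<bar>t - s\<bar> < \<delta> \<Longrightarrow>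
      \<bar>(\<integral>p. \<psi> p \<partial>\<nu> n t) - (\<integral>p. \<psi> p \<partial>\<nu> n s)\<bar> \<le> L * \<eta>"
    "\<And>L (\<psi> :: 'd torus \<Rightarrow> real) s t. L-lipschitz_on UNIV \<psi> \<Longrightarrow> s \<in> I \<Longrightarrow> t \<in> I \<Longrightarrow> \<bar>t - s\<bar> < \<delta> \<Longrightarrow>
      \<bar>(\<integral>p. \<psi> p \<partial>\<mu> t) - (\<integral>p. \<psi> p \<partial>\<mu> s)\<bar> \<le> L * \<eta>"
proof -
  obtain \<delta> where \<delta>: "0 < \<delta>" "\<And>n L (\<psi> :: 'd torus \<Rightarrow> real) s t. L-lipschitz_on UNIV \<psi> \<Longrightarrow> s \<in> I \<Longrightarrow> t \<in> I \<Longrightarrow> \<bar>t - s\<bar> < \<delta> \<Longrightarrow>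
      \<bar>(\<integral>p. \<psi> p \<partial>\<nu> n t) - (\<integral>p. \<psi> p \<partial>\<nu> n s)\<bar> \<le> L * \<eta>"
    by (rule equicontinuous[OF assms]) blast
  show thesis
  proof (rule that[OF \<delta>])
    fix L and \<psi> :: "'d torus \<Rightarrow> real" and s t
    assume \<psi>: "L-lipschitz_on UNIV \<psi>" and st: "s \<in> I" "t \<in> I" "\<bar>t - s\<bar> < \<delta>"
    show "\<bar>(\<integral>p. \<psi> p \<partial>\<mu> t) - (\<integral>p. \<psi> p \<partial>\<mu> s)\<bar> \<le> L * \<eta>"
    proof (rule LIMSEQ_le_const2)
      show "(\<lambda>n. \<bar>(\<integral>p. \<psi> p \<partial>\<nu> n t) - (\<integral>p. \<psi> p \<partial>\<nu> n s)\<bar>) \<longlonglongrightarrow> \<bar>(\<integral>p. \<psi> p \<partial>\<mu> t) - (\<integral>p. \<psi> p \<partial>\<mu> s)\<bar>"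
        by (intro tendsto_rabs tendsto_diff lim_lipschitz[OF \<psi>] st)
    qed (use \<delta>(2)[OF \<psi> st] in blast)
  qed
qed

lemma continuous_integral_\<mu>:
  fixes \<psi> :: "'d torus \<Rightarrow> real"
  assumes \<psi>: "L-lipschitz_on UNIV \<psi>"
  shows "continuous_on I (\<lambda>t. \<integral>p. \<psi> p \<partial>\<mu> t)"
  unfolding continuous_on_iff
proof (intro ballI allI impI)
  fix s and e :: real assume s: "s \<in> I" and "0 < e"
  define \<eta> where "\<eta> = e / (L + 1)"
  have L: "0 \<le> L" by (rule lipschitz_on_nonneg[OF \<psi>])
  have "0 < \<eta>" using L \<open>0 < e\<close> by (simp add: \<eta>_def add_nonneg_pos)
  then obtain \<delta> where \<delta>: "0 < \<delta>" "\<And>L (\<psi> :: 'd torus \<Rightarrow> real) s t. L-lipschitz_on UNIV \<psi> \<Longrightarrow> s \<in> I \<Longrightarrow> t \<in> I \<Longrightarrow> \<bar>t - s\<bar> < \<delta> \<Longrightarrow>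
    \<bar>(\<integral>p. \<psi> p \<partial>\<mu> t) - (\<integral>p. \<psi> p \<partial>\<mu> s)\<bar> \<le> L * \<eta>" by (rule equicontinuous_\<mu>) blast
  have "L * \<eta> < e" using L \<open>0 < e\<close> by (simp add: \<eta>_def field_simps)
  then show "\<exists>d>0. \<forall>t\<in>I. dist t s < d \<longrightarrow> dist (\<integral>p. \<psi> p \<partial>\<mu> t) (\<integral>p. \<psi> p \<partial>\<mu> s) < e"
    using \<delta>(1) \<delta>(2)[OF \<psi> s] by (intro exI[of _ \<delta>]) (auto simp: dist_real_def intro: le_less_trans)
qed

text \<open>Convergence at finitely many times, \<delta>-dense in I, spreads to all times because
  the approximating curves and the limit share the same equicontinuity.\<close>

lemma uniform_lipschitz:
  fixes \<psi> :: "'d torus \<Rightarrow> real"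
  assumes \<psi>: "L-lipschitz_on UNIV \<psi>" and "0 < e"
  shows "\<forall>\<^sub>F n in sequentially. \<forall>t\<in>I. \<bar>(\<integral>p. \<psi> p \<partial>\<nu> n t) - (\<integral>p. \<psi> p \<partial>\<mu> t)\<bar> < e"
proof -
  define \<eta> where "\<eta> = e / (3 * (L + 1))"
  have L: "0 \<le> L" by (rule lipschitz_on_nonneg[OF \<psi>])
  have \<eta>: "0 < \<eta>" "L * \<eta> < e / 3" using L \<open>0 < e\<close> by (simp_all add: \<eta>_def field_simps add_nonneg_pos)
  obtain \<delta> where \<delta>: "0 < \<delta>" "\<And>n L (\<psi> :: 'd torus \<Rightarrow> real) s t. L-lipschitz_on UNIV \<psi> \<Longrightarrow> s \<in> I \<Longrightarrow> t \<in> I \<Longrightarrow> \<bar>t - s\<bar> < \<delta> \<Longrightarrow>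
      \<bar>(\<integral>p. \<psi> p \<partial>\<nu> n t) - (\<integral>p. \<psi> p \<partial>\<nu> n s)\<bar> \<le> L * \<eta>"
    "\<And>L (\<psi> :: 'd torus \<Rightarrow> real) s t. L-lipschitz_on UNIV \<psi> \<Longrightarrow> s \<in> I \<Longrightarrow> t \<in> I \<Longrightarrow> \<bar>t - s\<bar> < \<delta> \<Longrightarrow>
      \<bar>(\<integral>p. \<psi> p \<partial>\<mu> t) - (\<integral>p. \<psi> p \<partial>\<mu> s)\<bar> \<le> L * \<eta>"
    by (rule equicontinuous_\<mu>[OF \<eta>(1)]) blast
  have "{a..b} \<subseteq> (\<Union>c\<in>I. ball c \<delta>)"
  proof
    fix x assume x: "x \<in> {a..b}"
    \<comment> \<open>Compactness needs the closed interval, whereas the centres must lie in the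
      open one: points near the ends are moved inwards by at most \<delta>/2.\<close>
    define y where "y = max (a + min \<delta> (b - a) / 2) (min x (b - min \<delta> (b - a) / 2))"
    have "y \<in> I" "\<bar>y - x\<bar> < \<delta>" using x I \<delta>(1) by (auto simp: y_def max_def min_def field_simps)
    then show "x \<in> (\<Union>c\<in>I. ball c \<delta>)" by (auto simp: dist_real_def)
  qed
  then obtain F where F: "F \<subseteq> I" "finite F" "{a..b} \<subseteq> (\<Union>c\<in>F. ball c \<delta>)"
    by (rule compactE_image[OF compact_Icc open_ball]) blast
  have "\<forall>\<^sub>F n in sequentially. \<forall>c\<in>F. \<bar>(\<integral>p. \<psi> p \<partial>\<nu> n c) - (\<integral>p. \<psi> p \<partial>\<mu> c)\<bar> < e / 3"
  proof (rule eventually_ball_finite[OF F(2)], intro ballI)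
    fix c assume "c \<in> F"
    then have "(\<lambda>n. \<integral>p. \<psi> p \<partial>\<nu> n c) \<longlonglongrightarrow> (\<integral>p. \<psi> p \<partial>\<mu> c)" using F(1) by (intro lim_lipschitz[OF \<psi>]) auto
    from tendstoD[OF this, of "e / 3"] \<open>0 < e\<close>
    show "\<forall>\<^sub>F n in sequentially. \<bar>(\<integral>p. \<psi> p \<partial>\<nu> n c) - (\<integral>p. \<psi> p \<partial>\<mu> c)\<bar> < e / 3"
      unfolding dist_real_def by simp
  qed
  then show ?thesis
  proof eventually_elim
    case (elim n)
    show ?case
    proof
      fix t assume t: "t \<in> I"
      then have "t \<in> {a..b}" using I by auto
      then have "t \<in> (\<Union>c\<in>F. ball c \<delta>)" by (rule subsetD[OF F(3)])
      then obtain c where c: "c \<in> F" "\<bar>t - c\<bar> < \<delta>" by (auto simp: dist_real_def abs_minus_commute)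
      have cI: "c \<in> I" using c F(1) by auto
      show "\<bar>(\<integral>p. \<psi> p \<partial>\<nu> n t) - (\<integral>p. \<psi> p \<partial>\<mu> t)\<bar> < e"
        using \<delta>(2)[OF \<psi> cI t c(2), of n] \<delta>(3)[OF \<psi> cI t c(2)] bspec[OF elim c(1)] \<eta>(2) by linarith
    qed
  qed
qed

text \<open>A finite net of the competitors in the supremum leaves finitely many functions, each
  converging uniformly in time.\<close>

lemma KR_uniform: "uniform_limit I (\<lambda>n t. KR_dist (\<nu> n t) (\<mu> t)) (\<lambda>t. 0) sequentially"
proof (rule uniform_limitI)
  fix e :: real assume "0 < e"
  define K where "K = {\<psi> :: 'd torus \<Rightarrow> real. (\<forall>p. \<bar>\<psi> p\<bar> \<le> 1) \<and> 1-lipschitz_on UNIV \<psi>}"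
  \<comment> \<open>The net error 3 \<eta>, integrated against a mass of at most M, costs less than
    e/4 for each of the two measures; another e/4 goes to the function of the net.\<close>
  define \<eta> where "\<eta> = e / (12 * (M + 1))"
  have \<eta>: "0 < \<eta>" "12 * \<eta> * M < e" using M_nonneg \<open>0 < e\<close> by (simp_all add: \<eta>_def field_simps add_nonneg_pos)
  obtain G where G: "finite G" "G \<subseteq> K" "\<And>\<psi>. \<psi> \<in> K \<Longrightarrow> \<exists>g\<in>G. \<forall>p. \<bar>\<psi> p - g p\<bar> \<le> 3 * \<eta>"
    by (rule finite_net_lipschitz[OF compact_torus \<eta>(1) K_def]) blast
  have K_cont: "continuous_on UNIV \<psi>" if "\<psi> \<in> K" for \<psi>
    using that lipschitz_on_continuous_on by (auto simp: K_def)
  have KR: "KR_dist \<alpha> \<beta> = (SUP \<psi>\<in>K. (\<integral>p. \<psi> p \<partial>\<alpha>) - (\<integral>p. \<psi> p \<partial>\<beta>))" for \<alpha> \<beta> :: "'d torus measure"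
  proof -
    have "{\<psi> :: 'd torus \<Rightarrow> real. continuous_on UNIV \<psi> \<and> (\<forall>p. \<bar>\<psi> p\<bar> \<le> 1) \<and> 1-lipschitz_on UNIV \<psi>} = K"
      using K_cont by (auto simp: K_def)
    then show ?thesis by (simp add: KR_dist_def)
  qed
  have K0: "(\<lambda>_. 0) \<in> K" by (auto simp: K_def intro: lipschitz_onI)
  have "\<forall>\<^sub>F n in sequentially. \<forall>g\<in>G. \<forall>t\<in>I. \<bar>(\<integral>p. g p \<partial>\<nu> n t) - (\<integral>p. g p \<partial>\<mu> t)\<bar> < e / 4"
    using G(2) \<open>0 < e\<close> by (intro eventually_ball_finite[OF G(1)] ballI uniform_lipschitz[where L = 1]) (auto simp: K_def)
  then show "\<forall>\<^sub>F n in sequentially. \<forall>t\<in>I. dist (KR_dist (\<nu> n t) (\<mu> t)) 0 < e"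
  proof eventually_elim
    case (elim n)
    show ?case
    proof
      fix t assume t: "t \<in> I"
      have le: "(\<integral>p. \<psi> p \<partial>\<nu> n t) - (\<integral>p. \<psi> p \<partial>\<mu> t) \<le> 3 / 4 * e" if \<psi>: "\<psi> \<in> K" for \<psi>
      proof -
        obtain g where g: "g \<in> G" "\<And>p. \<bar>\<psi> p - g p\<bar> \<le> 3 * \<eta>" using G(3)[OF \<psi>] by blast
        have "g \<in> K" using g G by auto
        note d = integral_diff_le[OF K_cont[OF \<psi>] K_cont[OF this] g(2) t]
        have "\<bar>(\<integral>p. g p \<partial>\<nu> n t) - (\<integral>p. g p \<partial>\<mu> t)\<bar> < e / 4" using elim g(1) t by blast
        then show ?thesis using d(1)[of n] d(2) \<eta>(2) by linarith
      qed
      have "KR_dist (\<nu> n t) (\<mu> t) \<le> 3 / 4 * e"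
        unfolding KR using K0 by (intro cSUP_least le) auto
      moreover have "0 \<le> KR_dist (\<nu> n t) (\<mu> t)"
        unfolding KR using le by (intro cSUP_upper2[OF _ K0] bdd_aboveI2[where M = "3 / 4 * e"]) auto
      ultimately show "dist (KR_dist (\<nu> n t) (\<mu> t)) 0 < e" using \<open>0 < e\<close> by simp
    qed
  qed
qed

text \<open>Test functions are bounded and continuous on the open strip, without control of their
  behaviour at the ends of I. Convergence at each fixed time together with domination by |D| M on
  the bounded interval is enough.\<close>

lemma weak_convergence: "weakly_converges_on (I \<times> UNIV) (\<lambda>n. spacetime_measure I (\<nu> n)) (spacetime_measure I \<mu>)"
proof -
  have cn: "measure_curve I a b M (\<nu> n)" for n
    by (rule measure_curve.intro) (rule I sets_\<nu> finite_\<nu> mass_\<nu> continuous_integral; assumption)+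
  have c: "measure_curve I a b M \<mu>"
    by (rule measure_curve.intro) (rule I sets_\<mu> finite_\<mu> mass_\<mu> continuous_integral_\<mu>; assumption)+
  show ?thesis
    unfolding weakly_converges_on_def
  proof (intro conjI allI impI)
    show "spacetime_measure I (\<nu> n) \<in> finite_measures (I \<times> UNIV)" for n by (rule measure_curve.st_finite_measures[OF cn])
    show "spacetime_measure I \<mu> \<in> finite_measures (I \<times> UNIV)" by (rule measure_curve.st_finite_measures[OF c])
    fix f :: "real \<times> 'd torus \<Rightarrow> real" assume f: "continuous_on (I \<times> UNIV) f \<and> bounded (f ` (I \<times> UNIV))"
    then obtain D where D: "\<And>p. p \<in> I \<times> UNIV \<Longrightarrow> \<bar>f p\<bar> \<le> D" unfolding bounded_iff by auto
    note mn = measure_curve.integral_st[OF cn conjunct1[OF f] D] and m = measure_curve.integral_st[OF c conjunct1[OF f] D]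
    have ft: "continuous_on UNIV (\<lambda>x. f (t, x))" if "t \<in> I" for t
      using that by (intro continuous_on_compose2[OF conjunct1[OF f]] continuous_intros) auto
    interpret R: finite_measure "restrict_space lborel I"
      using I by (intro finite_measureI) (simp add: emeasure_restrict_space space_restrict_space)
    have "(\<lambda>n. \<integral>t. (\<integral>x. f (t, x) \<partial>\<nu> n t) \<partial>restrict_space lborel I) \<longlonglongrightarrow> (\<integral>t. (\<integral>x. f (t, x) \<partial>\<mu> t) \<partial>restrict_space lborel I)"
    proof (rule integral_dominated_convergence[where w = "\<lambda>_. \<bar>D\<bar> * M"])
      show "AE t in restrict_space lborel I. (\<lambda>n. \<integral>x. f (t, x) \<partial>\<nu> n t) \<longlonglongrightarrow> (\<integral>x. f (t, x) \<partial>\<mu> t)"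
        by (intro AE_I2 lim_continuous ft) (simp_all add: space_restrict_space)
      show "AE t in restrict_space lborel I. norm (\<integral>x. f (t, x) \<partial>\<nu> n t) \<le> \<bar>D\<bar> * M" for n
      proof (rule AE_I2)
        fix t assume "t \<in> space (restrict_space lborel I)"
        then have t: "t \<in> I" by (simp add: space_restrict_space)
        have D': "\<bar>f (t, x) - 0\<bar> \<le> \<bar>D\<bar>" for x using D[of "(t, x)"] t by auto
        show "norm (\<integral>x. f (t, x) \<partial>\<nu> n t) \<le> \<bar>D\<bar> * M"
          using integral_diff_le(1)[OF ft[OF t] continuous_on_const D' t, of n] by simp
      qed
    qed (use mn(1) m(1) in auto)
    then show "(\<lambda>n. \<integral>x. f x \<partial>spacetime_measure I (\<nu> n)) \<longlonglongrightarrow> (\<integral>x. f x \<partial>spacetime_measure I \<mu>)"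
      by (simp add: mn(2) m(2))
  qed
qed

text \<open>The functions \<open>w\<^sub>1\<close> and \<open>w\<^sub>2\<close> are weak limits of the nonnegative \<open>L u\<^sub>n \<plusminus> h\<^sub>n\<close>, so \<open>w\<^sub>1 + w\<^sub>2 = 2 L v\<close>
  bounds the weak limit \<open>w\<^sub>1 - L v\<close> of \<open>h\<^sub>n\<close> by \<open>L v\<close>.\<close>

lemma density_exists:
  fixes \<psi> :: "'d torus \<Rightarrow> real"
  assumes \<psi>: "L-lipschitz_on UNIV \<psi>"
  obtains \<gamma> where "\<gamma> \<in> borel_measurable borel" "integrable lborel \<gamma>" "\<And>x. x \<notin> I \<Longrightarrow> \<gamma> x = 0"
    "AE x in lborel. \<bar>\<gamma> x\<bar> \<le> L * v x"
    "\<And>s t. s \<in> I \<Longrightarrow> t \<in> I \<Longrightarrow> s \<le> t \<Longrightarrow> (\<integral>p. \<psi> p \<partial>\<mu> t) - (\<integral>p. \<psi> p \<partial>\<mu> s) = (\<integral>x. indicator {s<..t} x * \<gamma> x \<partial>lborel)"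
proof -
  have L: "0 \<le> L" by (rule lipschitz_on_nonneg[OF \<psi>])
  obtain h where h: "\<And>n. h n \<in> borel_measurable borel" "\<And>n x. \<bar>h n x\<bar> \<le> L * u n x"
    "\<And>n s t. s \<in> I \<Longrightarrow> t \<in> I \<Longrightarrow> s \<le> t \<Longrightarrow> (\<integral>p. \<psi> p \<partial>\<nu> n t) - (\<integral>p. \<psi> p \<partial>\<nu> n s) = (\<integral>x. indicator {s<..t} x * h n x \<partial>lborel)"
    using flux[OF \<psi>] by metis
  \<comment> \<open>The compactness result concerns nonnegative functions, so the flux bound is
    added to the signed density; \<sigma> stands for the two signs.\<close>
  have one_sided: "\<exists>w. w \<in> borel_measurable borel \<and> (\<forall>x. 0 \<le> w x) \<and> integrable lborel w \<and>
    (\<forall>s\<in>I. \<forall>t\<in>I. s \<le> t \<longrightarrow> (\<integral>x. indicator {s<..t} x * w x \<partial>lborel) = L * (\<integral>x. indicator {s<..t} x * v x \<partial>lborel) + \<sigma> * ((\<integral>p. \<psi> p \<partial>\<mu> t) - (\<integral>p. \<psi> p \<partial>\<mu> s)))"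
    if \<sigma>: "\<bar>\<sigma>\<bar> \<le> 1" for \<sigma> :: real
  proof -
    define w where "w n x = L * u n x + \<sigma> * h n x" for n x
    have \<sigma>h: "\<bar>\<sigma> * h n x\<bar> \<le> L * u n x" for n x
    proof -
      have "\<bar>\<sigma> * h n x\<bar> \<le> 1 * \<bar>h n x\<bar>" unfolding abs_mult by (intro mult_right_mono \<sigma>) simp
      then show ?thesis using h(2)[of n x] by linarith
    qed
    have wm: "w n \<in> borel_measurable borel" for n
      unfolding w_def using h(1) u_meas by (intro borel_measurable_add borel_measurable_times) auto
    have w0: "0 \<le> w n x" for n x using \<sigma>h[of n x] by (simp add: w_def abs_le_iff)
    have wle: "w n x \<le> 2 * L * u n x" for n x using \<sigma>h[of n x] by (simp add: w_def abs_le_iff)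
    have ws: "w n x = 0" if "x \<notin> I" for n x using wle[of n x] w0[of n x] u_support[OF that, of n] by simp
    have wi: "integrable lborel (w n)" for n
    proof (rule Bochner_Integration.integrable_bound)
      show "integrable lborel (\<lambda>x. 2 * L * u n x)" by (intro integrable_mult_right u_int)
      show "AE x in lborel. norm (w n x) \<le> norm (2 * L * u n x)"
        using wle w0 L u_nonneg by (intro AE_I2) (simp add: order_trans[OF _ abs_ge_self])
    qed (use wm in simp)
    have hi: "integrable lborel (\<lambda>x. indicator A x * h n x)" if "A \<in> sets borel" for n A
    proof (rule Bochner_Integration.integrable_bound)
      show "integrable lborel (\<lambda>x. L * (indicator A x * u n x))" by (intro integrable_mult_right int_indicator_u that)
      show "AE x in lborel. norm (indicator A x * h n x) \<le> norm (L * (indicator A x * u n x))"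
        using h(2)[of n] L u_nonneg by (intro AE_I2) (auto simp: indicator_def intro: order_trans)
    qed (use h(1) that in measurable)
    have wle_int: "(\<integral>x. indicator S x * w n x \<partial>lborel) \<le> 2 * L * (\<integral>x. indicator S x * u n x \<partial>lborel)" if "S \<in> sets borel" for S n
    proof -
      have "(\<integral>x. indicator S x * w n x \<partial>lborel) \<le> (\<integral>x. 2 * L * (indicator S x * u n x) \<partial>lborel)"
        using integrable_mult_indicator[OF _ wi[of n], of S] that
        by (intro integral_mono integrable_mult_right int_indicator_u that) (auto simp: indicator_def intro: order_trans[OF wle])
      then show ?thesis by simp
    qed
    have wb: "(\<integral>x. w n x \<partial>lborel) \<le> 2 * L * B" for n
      using wle_int[of UNIV n] mult_left_mono[OF u_bound[of n], of "2 * L"] L by simp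
    have we: "\<exists>\<delta>>0. \<forall>n. \<forall>S\<in>sets borel. emeasure lborel S < ennreal \<delta> \<longrightarrow> (\<integral>x. indicator S x * w n x \<partial>lborel) \<le> \<eta>" if "0 < \<eta>" for \<eta>
    proof -
      define \<eta>' where "\<eta>' = \<eta> / (2 * L + 1)"
      have \<eta>': "0 < \<eta>'" "2 * L * \<eta>' \<le> \<eta>" using L that by (simp_all add: \<eta>'_def field_simps add_nonneg_pos)
      obtain \<delta> where \<delta>: "0 < \<delta>" "\<And>n S. S \<in> sets borel \<Longrightarrow> emeasure lborel S < ennreal \<delta> \<Longrightarrow> (\<integral>x. indicator S x * u n x \<partial>lborel) \<le> \<eta>'"
        using u_equi[OF \<eta>'(1)] by blast
      have "(\<integral>x. indicator S x * w n x \<partial>lborel) \<le> \<eta>" if S: "S \<in> sets borel" "emeasure lborel S < ennreal \<delta>" for n S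
        using wle_int[OF S(1), of n] mult_left_mono[OF \<delta>(2)[OF S, of n], of "2 * L"] L \<eta>'(2) by linarith
      then show ?thesis using \<delta>(1) by blast
    qed
    obtain r :: "nat \<Rightarrow> nat" and w' where r: "strict_mono r" and w': "w' \<in> borel_measurable borel" "\<And>x. 0 \<le> w' x" "integrable lborel w'"
      and lim: "\<And>s t. s \<in> I \<Longrightarrow> t \<in> I \<Longrightarrow> (\<lambda>n. \<integral>x. indicator {s<..t} x * w (r n) x \<partial>lborel) \<longlonglongrightarrow> (\<integral>x. indicator {s<..t} x * w' x \<partial>lborel)"
      by (rule weak_L1_compactness[OF I wm w0 ws wi wb we]) (assumption, assumption, (rule that; assumption))
    have "(\<integral>x. indicator {s<..t} x * w' x \<partial>lborel) = L * (\<integral>x. indicator {s<..t} x * v x \<partial>lborel) + \<sigma> * ((\<integral>p. \<psi> p \<partial>\<mu> t) - (\<integral>p. \<psi> p \<partial>\<mu> s))"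
      if st: "s \<in> I" "t \<in> I" "s \<le> t" for s t
    proof -
      have "(\<integral>x. indicator {s<..t} x * w n x \<partial>lborel) = L * (\<integral>x. indicator {s<..t} x * u n x \<partial>lborel) + \<sigma> * ((\<integral>p. \<psi> p \<partial>\<nu> n t) - (\<integral>p. \<psi> p \<partial>\<nu> n s))" for n
      proof -
        have "(\<integral>x. indicator {s<..t} x * w n x \<partial>lborel) = (\<integral>x. L * (indicator {s<..t} x * u n x) + \<sigma> * (indicator {s<..t} x * h n x) \<partial>lborel)"
          by (simp add: w_def algebra_simps)
        also have "\<dots> = L * (\<integral>x. indicator {s<..t} x * u n x \<partial>lborel) + \<sigma> * (\<integral>x. indicator {s<..t} x * h n x \<partial>lborel)"
          using int_indicator_u[of "{s<..t}" n] hi[of "{s<..t}" n] by (subst Bochner_Integration.integral_add) auto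
        finally show ?thesis using h(3)[OF st, of n] by simp
      qed
      moreover have "(\<lambda>n. L * (\<integral>x. indicator {s<..t} x * u n x \<partial>lborel) + \<sigma> * ((\<integral>p. \<psi> p \<partial>\<nu> n t) - (\<integral>p. \<psi> p \<partial>\<nu> n s)))
        \<longlonglongrightarrow> L * (\<integral>x. indicator {s<..t} x * v x \<partial>lborel) + \<sigma> * ((\<integral>p. \<psi> p \<partial>\<mu> t) - (\<integral>p. \<psi> p \<partial>\<mu> s))"
        by (intro tendsto_intros u_lim lim_lipschitz[OF \<psi>] st)
      ultimately have "(\<lambda>n. \<integral>x. indicator {s<..t} x * w n x \<partial>lborel) \<longlonglongrightarrow> L * (\<integral>x. indicator {s<..t} x * v x \<partial>lborel) + \<sigma> * ((\<integral>p. \<psi> p \<partial>\<mu> t) - (\<integral>p. \<psi> p \<partial>\<mu> s))"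
        by simp
      from LIMSEQ_subseq_LIMSEQ[OF this r] lim[OF st(1,2)] show ?thesis
        unfolding comp_def by (rule LIMSEQ_unique[rotated])
    qed
    then show ?thesis using w' by blast
  qed
  have "\<bar>1\<bar> \<le> (1 :: real)" by simp
  from one_sided[OF this] obtain w1 where W1: "w1 \<in> borel_measurable borel \<and> (\<forall>x. 0 \<le> w1 x) \<and> integrable lborel w1 \<and>
    (\<forall>s\<in>I. \<forall>t\<in>I. s \<le> t \<longrightarrow> (\<integral>x. indicator {s<..t} x * w1 x \<partial>lborel) = L * (\<integral>x. indicator {s<..t} x * v x \<partial>lborel) + (1) * ((\<integral>p. \<psi> p \<partial>\<mu> t) - (\<integral>p. \<psi> p \<partial>\<mu> s)))"
    by (rule exE)
  have w1: "w1 \<in> borel_measurable borel" "0 \<le> w1 x" "integrable lborel w1" for x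
    using W1 by auto
  have w1_int: "(\<integral>x. indicator {s<..t} x * w1 x \<partial>lborel) = L * (\<integral>x. indicator {s<..t} x * v x \<partial>lborel) + ((\<integral>p. \<psi> p \<partial>\<mu> t) - (\<integral>p. \<psi> p \<partial>\<mu> s))"
    if "s \<in> I" "t \<in> I" "s \<le> t" for s t
    using W1[THEN conjunct2, THEN conjunct2, THEN conjunct2, rule_format, OF that] by simp
  have "\<bar>- 1\<bar> \<le> (1 :: real)" by simp
  from one_sided[OF this] obtain w2 where W2: "w2 \<in> borel_measurable borel \<and> (\<forall>x. 0 \<le> w2 x) \<and> integrable lborel w2 \<and>
    (\<forall>s\<in>I. \<forall>t\<in>I. s \<le> t \<longrightarrow> (\<integral>x. indicator {s<..t} x * w2 x \<partial>lborel) = L * (\<integral>x. indicator {s<..t} x * v x \<partial>lborel) + (- 1) * ((\<integral>p. \<psi> p \<partial>\<mu> t) - (\<integral>p. \<psi> p \<partial>\<mu> s)))"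
    by (rule exE)
  have w2: "w2 \<in> borel_measurable borel" "0 \<le> w2 x" "integrable lborel w2" for x
    using W2 by auto
  have w2_int: "(\<integral>x. indicator {s<..t} x * w2 x \<partial>lborel) = L * (\<integral>x. indicator {s<..t} x * v x \<partial>lborel) - ((\<integral>p. \<psi> p \<partial>\<mu> t) - (\<integral>p. \<psi> p \<partial>\<mu> s))"
    if "s \<in> I" "t \<in> I" "s \<le> t" for s t
    using W2[THEN conjunct2, THEN conjunct2, THEN conjunct2, rule_format, OF that] by simp
  have ind: "integrable lborel (\<lambda>x. indicator {s<..t} x * f x)" if "integrable lborel f" for f :: "real \<Rightarrow> real" and s t :: real
    using integrable_mult_indicator[OF _ that, of "{s<..t}"] by simp
  have "AE x in lborel. x \<in> I \<longrightarrow> w1 x + w2 x - 2 * L * v x = 0"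
  proof (rule AE_zero_if_interval_integrals_zero[OF I])
    show "integrable lborel (\<lambda>x. w1 x + w2 x - 2 * L * v x)"
      by (intro Bochner_Integration.integrable_diff Bochner_Integration.integrable_add integrable_mult_right w1 w2 v_int)
    fix s t assume st: "s \<in> I" "t \<in> I"
    show "(\<integral>x. indicator {s<..t} x * (w1 x + w2 x - 2 * L * v x) \<partial>lborel) = 0"
    proof (cases "s \<le> t")
      case True
      have "(\<integral>x. indicator {s<..t} x * (w1 x + w2 x - 2 * L * v x) \<partial>lborel)
        = (\<integral>x. indicator {s<..t} x * w1 x + indicator {s<..t} x * w2 x - 2 * L * (indicator {s<..t} x * v x) \<partial>lborel)"
        by (simp add: algebra_simps)
      also have "\<dots> = (\<integral>x. indicator {s<..t} x * w1 x \<partial>lborel) + (\<integral>x. indicator {s<..t} x * w2 x \<partial>lborel) - 2 * L * (\<integral>x. indicator {s<..t} x * v x \<partial>lborel)"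
        using ind[OF w1(3), of s t] ind[OF w2(3), of s t] ind[OF v_int, of s t] by simp
      finally show ?thesis using w1_int[OF st True] w2_int[OF st True] by simp
    qed simp
  qed
  \<comment> \<open>Off I nothing is known about w1, hence the cut-off.\<close>
  then have bound: "AE x in lborel. \<bar>indicator I x * (w1 x - L * v x)\<bar> \<le> L * v x"
  proof eventually_elim
    case (elim x)
    have "0 \<le> L * v x" using L v_nonneg[of x] by simp
    then show ?case using elim w1(2)[of x] w2(2)[of x] by (cases "x \<in> I") auto
  qed
  show thesis
  proof (rule that[of "\<lambda>x. indicator I x * (w1 x - L * v x)"])
    have Im: "I \<in> sets borel" using I by simp
    show "(\<lambda>x. indicator I x * (w1 x - L * v x)) \<in> borel_measurable borel"
      using w1(1) v_meas Im by measurable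
    have "integrable lborel (\<lambda>x. w1 x - L * v x)"
      by (intro Bochner_Integration.integrable_diff integrable_mult_right w1 v_int)
    from integrable_mult_indicator[OF _ this, of I] Im
    show "integrable lborel (\<lambda>x. indicator I x * (w1 x - L * v x))" by simp
    fix s t assume st: "s \<in> I" "t \<in> I" "s \<le> t"
    have "indicator {s<..t} x * (indicator I x * (w1 x - L * v x)) = indicator {s<..t} x * w1 x - L * (indicator {s<..t} x * v x)" for x
      using st I by (auto simp: indicator_def)
    then have "(\<integral>x. indicator {s<..t} x * (indicator I x * (w1 x - L * v x)) \<partial>lborel) = (\<integral>x. indicator {s<..t} x * w1 x - L * (indicator {s<..t} x * v x) \<partial>lborel)"
      by (simp only:)
    also have "\<dots> = (\<integral>x. indicator {s<..t} x * w1 x \<partial>lborel) - L * (\<integral>x. indicator {s<..t} x * v x \<partial>lborel)"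
      using ind[OF w1(3), of s t] ind[OF v_int, of s t] by simp
    finally show "(\<integral>p. \<psi> p \<partial>\<mu> t) - (\<integral>p. \<psi> p \<partial>\<mu> s) = (\<integral>x. indicator {s<..t} x * (indicator I x * (w1 x - L * v x)) \<partial>lborel)"
      using w1_int[OF st] by simp
  qed (use bound in auto)
qed

text \<open>Domination by the single integrable function v gives the derivative an integrable dual
  norm, beyond being integrable against each test function.\<close>

lemma \<mu>_in_W11_KR: "\<mu> \<in> W11_KR I"
proof -
  have mf: "blinfun_apply (measure_functional (\<mu> t)) \<psi> = (\<integral>p. apply_C1 \<psi> p \<partial>\<mu> t)" if "t \<in> I" for t \<psi>
    by (rule measure_functional_apply[OF finite_\<mu>[OF that] sets_\<mu>[OF that]])
  have f_cont: "continuous_on I (\<lambda>t. blinfun_apply (measure_functional (\<mu> t)) \<psi>)" for \<psi>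
    using continuous_integral_\<mu>[OF C1_lipschitz[of \<psi>]] by (rule continuous_on_eq) (simp add: mf)
  \<comment> \<open>Equicontinuity with L = \<open>norm \<psi>\<close> is uniform over the unit
    ball, which gives continuity in norm and not merely weak* continuity.\<close>
  have cont: "continuous_on I (\<lambda>t. measure_functional (\<mu> t))"
    unfolding continuous_on_iff
  proof (intro ballI allI impI)
    fix s and e :: real assume s: "s \<in> I" and "0 < e"
    obtain \<delta> where \<delta>: "0 < \<delta>" "\<And>L (\<psi> :: 'd torus \<Rightarrow> real) s t. L-lipschitz_on UNIV \<psi> \<Longrightarrow> s \<in> I \<Longrightarrow> t \<in> I \<Longrightarrow> \<bar>t - s\<bar> < \<delta> \<Longrightarrow>
      \<bar>(\<integral>p. \<psi> p \<partial>\<mu> t) - (\<integral>p. \<psi> p \<partial>\<mu> s)\<bar> \<le> L * (e / 2)"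
      using equicontinuous_\<mu>[of "e / 2"] \<open>0 < e\<close> by (metis half_gt_zero)
    have "dist (measure_functional (\<mu> t)) (measure_functional (\<mu> s)) < e" if t: "t \<in> I" "dist t s < \<delta>" for t
    proof -
      have "norm (measure_functional (\<mu> t) - measure_functional (\<mu> s)) \<le> e / 2"
      proof (rule norm_blinfun_bound)
        fix \<psi> :: "'d C1"
        show "norm (blinfun_apply (measure_functional (\<mu> t) - measure_functional (\<mu> s)) \<psi>) \<le> e / 2 * norm \<psi>"
          using \<delta>(2)[OF C1_lipschitz[of \<psi>] s t(1)] t by (simp add: blinfun.diff_left mf s dist_real_def mult.commute)
      qed (use \<open>0 < e\<close> in simp)
      then show ?thesis using \<open>0 < e\<close> by (simp add: dist_norm)
    qed
    then show "\<exists>d>0. \<forall>t\<in>I. dist t s < d \<longrightarrow> dist (measure_functional (\<mu> t)) (measure_functional (\<mu> s)) < e"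
      using \<delta>(1) by blast
  qed
  have Im: "I \<in> sets borel" using I by simp
  have dual: "dual_L1 I (\<lambda>t. measure_functional (\<mu> t))"
    unfolding dual_L1_def
  proof (intro conjI allI measurable_continuous_on_lborel f_cont)
    have "(\<integral>\<^sup>+t. ennreal (norm (measure_functional (\<mu> t))) \<partial>restrict_space lborel I) \<le> (\<integral>\<^sup>+t. ennreal M \<partial>restrict_space lborel I)"
    proof (intro nn_integral_mono ennreal_leI)
      fix t assume "t \<in> space (restrict_space lborel I)"
      then have t: "t \<in> I" by (simp add: space_restrict_space)
      show "norm (measure_functional (\<mu> t)) \<le> M"
      proof (rule norm_blinfun_bound[OF M_nonneg])
        fix \<psi> :: "'d C1"
        have "\<bar>apply_C1 \<psi> p - 0\<bar> \<le> norm \<psi>" for p using abs_apply_C1_le_norm by simp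
        from integral_diff_le(2)[OF lipschitz_on_continuous_on[OF C1_lipschitz] continuous_on_const this t]
        show "norm (blinfun_apply (measure_functional (\<mu> t)) \<psi>) \<le> M * norm \<psi>" by (simp add: mf[OF t] mult.commute)
      qed
    qed
    also have "\<dots> < \<infinity>" using I by (simp add: space_restrict_space emeasure_restrict_space ennreal_mult_less_top)
    finally show "(\<integral>\<^sup>+t. ennreal (norm (measure_functional (\<mu> t))) \<partial>restrict_space lborel I) < \<infinity>" .
  qed
  \<comment> \<open>All properties are bundled, so that a single choice provides a family that has
    them all.\<close>
  define is_density where "is_density \<psi> \<gamma> \<longleftrightarrow> \<gamma> \<in> borel_measurable borel \<and> integrable lborel \<gamma> \<and> (\<forall>x. x \<notin> I \<longrightarrow> \<gamma> x = 0) \<and> (AE x in lborel. \<bar>\<gamma> x\<bar> \<le> norm \<psi> * v x) \<and>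
    (\<forall>s\<in>I. \<forall>t\<in>I. s \<le> t \<longrightarrow> blinfun_apply (measure_functional (\<mu> t)) \<psi> - blinfun_apply (measure_functional (\<mu> s)) \<psi> = (\<integral>x. indicator {s<..t} x * \<gamma> x \<partial>lborel))" for \<psi> \<gamma>
  have "\<exists>\<gamma>. is_density \<psi> \<gamma>" for \<psi>
  proof -
    obtain \<gamma> where \<gamma>: "\<gamma> \<in> borel_measurable borel" "integrable lborel \<gamma>" "\<And>x. x \<notin> I \<Longrightarrow> \<gamma> x = 0"
      "AE x in lborel. \<bar>\<gamma> x\<bar> \<le> norm \<psi> * v x"
      "\<And>s t. s \<in> I \<Longrightarrow> t \<in> I \<Longrightarrow> s \<le> t \<Longrightarrow> (\<integral>p. apply_C1 \<psi> p \<partial>\<mu> t) - (\<integral>p. apply_C1 \<psi> p \<partial>\<mu> s) = (\<integral>x. indicator {s<..t} x * \<gamma> x \<partial>lborel)"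
      by (rule density_exists[OF C1_lipschitz[of \<psi>]]) (rule that; assumption)
    then show ?thesis by (intro exI[of _ \<gamma>]) (simp add: is_density_def mf)
  qed
  then obtain \<gamma> where "\<And>\<psi>. is_density \<psi> (\<gamma> \<psi>)" by metis
  then have \<gamma>: "\<gamma> \<psi> \<in> borel_measurable borel" "integrable lborel (\<gamma> \<psi>)" "x \<notin> I \<Longrightarrow> \<gamma> \<psi> x = 0"
    "AE x in lborel. \<bar>\<gamma> \<psi> x\<bar> \<le> norm \<psi> * v x"
    "s \<in> I \<Longrightarrow> t \<in> I \<Longrightarrow> s \<le> t \<Longrightarrow> blinfun_apply (measure_functional (\<mu> t)) \<psi> - blinfun_apply (measure_functional (\<mu> s)) \<psi> = (\<integral>x. indicator {s<..t} x * \<gamma> \<psi> x \<partial>lborel)"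
    for \<psi> x s t
    unfolding is_density_def by blast+
  \<comment> \<open>Increments of the curve are linear in the vector, so both sides have equal
    interval integrals; off I all densities vanish.\<close>
  have linear: "AE x in lborel. \<gamma> (\<psi> + c *\<^sub>R \<xi>) x = \<gamma> \<psi> x + c * \<gamma> \<xi> x" for \<psi> \<xi> c
  proof -
    have ind: "integrable lborel (\<lambda>x. indicator {s<..t} x * \<gamma> \<psi> x)" for \<psi> and s t :: real
      using integrable_mult_indicator[OF _ \<gamma>(2), of "{s<..t}"] by simp
    have "AE x in lborel. x \<in> I \<longrightarrow> \<gamma> (\<psi> + c *\<^sub>R \<xi>) x - \<gamma> \<psi> x - c * \<gamma> \<xi> x = 0"
    proof (rule AE_zero_if_interval_integrals_zero[OF I])
      show "integrable lborel (\<lambda>x. \<gamma> (\<psi> + c *\<^sub>R \<xi>) x - \<gamma> \<psi> x - c * \<gamma> \<xi> x)"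
        by (intro Bochner_Integration.integrable_diff integrable_mult_right \<gamma>)
      fix s t assume st: "s \<in> I" "t \<in> I"
      show "(\<integral>x. indicator {s<..t} x * (\<gamma> (\<psi> + c *\<^sub>R \<xi>) x - \<gamma> \<psi> x - c * \<gamma> \<xi> x) \<partial>lborel) = 0"
      proof (cases "s \<le> t")
        case True
        have "(\<integral>x. indicator {s<..t} x * (\<gamma> (\<psi> + c *\<^sub>R \<xi>) x - \<gamma> \<psi> x - c * \<gamma> \<xi> x) \<partial>lborel)
          = (\<integral>x. indicator {s<..t} x * \<gamma> (\<psi> + c *\<^sub>R \<xi>) x - indicator {s<..t} x * \<gamma> \<psi> x - c * (indicator {s<..t} x * \<gamma> \<xi> x) \<partial>lborel)"
          by (simp add: algebra_simps)
        also have "\<dots> = (\<integral>x. indicator {s<..t} x * \<gamma> (\<psi> + c *\<^sub>R \<xi>) x \<partial>lborel) - (\<integral>x. indicator {s<..t} x * \<gamma> \<psi> x \<partial>lborel) - c * (\<integral>x. indicator {s<..t} x * \<gamma> \<xi> x \<partial>lborel)"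
          using ind[of s t "\<psi> + c *\<^sub>R \<xi>"] ind[of s t \<psi>] ind[of s t \<xi>] by simp
        finally show ?thesis
          unfolding \<gamma>(5)[OF st True, symmetric] by (simp add: blinfun.add_right blinfun.scaleR_right algebra_simps)
      qed simp
    qed
    then show ?thesis
    proof eventually_elim
      case (elim x)
      then show ?case using \<gamma>(3)[of x] by (cases "x \<in> I") auto
    qed
  qed
  obtain D :: "'d C1 set" where D: "countable D" "\<And>f e. 0 < e \<Longrightarrow> \<exists>g\<in>D. norm (f - g) < e"
    by (rule C1_separable) blast
  obtain g :: "real \<Rightarrow> 'd C1 \<Rightarrow>\<^sub>L real" where g: "\<And>\<psi>. (\<lambda>x. blinfun_apply (g x) \<psi>) \<in> borel_measurable borel"
    "\<And>x. norm (g x) \<le> v x" "\<And>\<psi>. AE x in lborel. blinfun_apply (g x) \<psi> = \<gamma> \<psi> x"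
    by (rule AE_linear_selection[OF D \<gamma>(1) v_nonneg \<gamma>(4) linear]) (assumption, (rule that; assumption))
  have gi: "integrable lborel (\<lambda>x. blinfun_apply (g x) \<psi>)" for \<psi>
  proof (rule integrable_cong_AE_imp[OF \<gamma>(2)[of \<psi>]])
    show "AE x in lborel. \<gamma> \<psi> x = blinfun_apply (g x) \<psi>" using g(3)[of \<psi>] by eventually_elim simp
  qed (use g(1) in simp)
  have dual_g: "dual_L1 I g"
    unfolding dual_L1_def
  proof (intro conjI allI)
    show "(\<lambda>t. blinfun_apply (g t) \<psi>) \<in> borel_measurable (restrict_space lborel I)" for \<psi>
      using g(1)[of \<psi>] by (intro measurable_restrict_space1) simp
    have "(\<integral>\<^sup>+t. ennreal (norm (g t)) \<partial>restrict_space lborel I) \<le> (\<integral>\<^sup>+t. ennreal (v t) \<partial>restrict_space lborel I)"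
      by (intro nn_integral_mono ennreal_leI g)
    also have "\<dots> = (\<integral>\<^sup>+t. ennreal (v t) * indicator I t \<partial>lborel)"
      using Im by (intro nn_integral_restrict_space) simp
    also have "\<dots> \<le> (\<integral>\<^sup>+t. ennreal (v t) \<partial>lborel)" by (intro nn_integral_mono) (simp add: indicator_def)
    also have "\<dots> < \<infinity>" using v_int v_nonneg by (simp add: nn_integral_eq_integral)
    finally show "(\<integral>\<^sup>+t. ennreal (norm (g t)) \<partial>restrict_space lborel I) < \<infinity>" .
  qed
  have wd: "weak_derivative I (\<lambda>t. blinfun_apply (measure_functional (\<mu> t)) \<psi>) (\<lambda>t. blinfun_apply (g t) \<psi>)" for \<psi>
  proof (rule weak_derivative_of_integral[OF I(1) f_cont gi])
    fix s t assume st: "s \<in> I" "t \<in> I" "s \<le> t"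
    have "(\<integral>x. indicator {s<..t} x * \<gamma> \<psi> x \<partial>lborel) = (\<integral>x. indicator {s<..t} x * blinfun_apply (g x) \<psi> \<partial>lborel)"
    proof (rule integral_cong_AE)
      show "AE x in lborel. indicator {s<..t} x * \<gamma> \<psi> x = indicator {s<..t} x * blinfun_apply (g x) \<psi>"
        using g(3)[of \<psi>] by eventually_elim simp
    qed (use \<gamma>(1)[of \<psi>] g(1)[of \<psi>] in measurable)
    then show "blinfun_apply (measure_functional (\<mu> t)) \<psi> - blinfun_apply (measure_functional (\<mu> s)) \<psi> = (\<integral>x. indicator {s<..t} x * blinfun_apply (g x) \<psi> \<partial>lborel)"
      using \<gamma>(5)[OF st] by simp
  qed
  have "\<mu> t \<in> finite_measures UNIV" if "t \<in> I" for t
    using sets_\<mu>[OF that] finite_\<mu>[OF that] by (simp add: finite_measures_def)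
  then show ?thesis
    unfolding W11_KR_def dual_W11_def using cont dual dual_g wd by blast
qed

end

section \<open>The rescaled graph\<close>

lemma abs_component_le_sup_norm: "\<bar>z $ i\<bar> \<le> sup_norm (z :: int ^ 'd::finite)"
  unfolding sup_norm_def by (rule Max_ge) auto

lemma finite_EQ:
  fixes E :: "(('d::finite, 'v::finite) vertex \<times> ('d, 'v) vertex) set"
  assumes "periodic_graph E"
  shows "finite (EQ E)"
proof -
  have "EQ E \<subseteq> (\<Union>v. (\<lambda>y. ((0, v), y)) ` {y. ((0, v), y) \<in> E})"
  proof
    fix p assume "p \<in> EQ E"
    then obtain v y where "p = ((0, v), y)" "((0, v), y) \<in> E" by (cases p) (auto simp: EQ_def)
    then show "p \<in> (\<Union>v. (\<lambda>y. ((0, v), y)) ` {y. ((0, v), y) \<in> E})" by blast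
  qed
  moreover have "finite {y. (x, y) \<in> E}" for x using assms unfolding periodic_graph_def by blast
  then have "finite (\<Union>v. (\<lambda>y. ((0 :: int ^ 'd, v), y)) ` {y. ((0, v), y) \<in> E})" by simp
  ultimately show ?thesis by (rule finite_subset)
qed

lemma edge_from_EQ:
  assumes "periodic_graph E" "(x, y) \<in> E"
  shows "((0, snd x), (fst y - fst x, snd y)) \<in> EQ E"
proof -
  have "(Defs.shift (- fst x) x, Defs.shift (- fst x) y) \<in> E"
    using assms unfolding periodic_graph_def by blast
  then show ?thesis by (simp add: EQ_def Defs.shift_def)
qed

text \<open>E is infinite, so \<open>Max\<close> needs justification: by translation the set of its
  values is already attained on the finite set \<open>EQ E\<close>.\<close>

lemma sup_norm_edge_le_R0:
  fixes E :: "(('d::finite, 'v::finite) vertex \<times> ('d, 'v) vertex) set"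
  assumes "periodic_graph E" "(x, y) \<in> E"
  shows "sup_norm (fst x - fst y) \<le> R0 E"
proof -
  let ?f = "\<lambda>(x :: ('d, 'v) vertex, y :: ('d, 'v) vertex). sup_norm (fst x - fst y)"
  have "?f ` E \<subseteq> ?f ` EQ E"
  proof
    fix k assume "k \<in> ?f ` E"
    then obtain x y where xy: "(x, y) \<in> E" "k = sup_norm (fst x - fst y)" by auto
    show "k \<in> ?f ` EQ E"
      by (rule image_eqI[OF _ edge_from_EQ[OF assms(1) xy(1)]]) (simp add: xy(2))
  qed
  then have "finite (?f ` E)" by (rule finite_subset) (intro finite_imageI finite_EQ assms(1))
  then show ?thesis unfolding R0_def using assms(2) by (intro Max_ge) force+
qed

section \<open>Energy and divergence on the rescaled graph\<close>

locale rescaled_graph =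
  fixes E :: "(('d::finite, 'v::finite) vertex \<times> ('d, 'v) vertex) set" and \<epsilon> :: real
  assumes graph: "periodic_graph E" and scale: "inverse_nat \<epsilon>"
begin

abbreviation "N \<equiv> \<lfloor>1 / \<epsilon>\<rfloor>"

lemma eps_pos: "0 < \<epsilon>" using scale by (simp add: inverse_nat_def)

lemma eps_N: "\<epsilon> * real_of_int N = 1" by (rule inverse_nat_floor[OF scale])

lemma N_pos: "0 < N"
  using eps_N eps_pos by (metis of_int_0_less_iff zero_less_mult_pos zero_less_one)

lemma mod_in_Z_eps: "(\<chi> i. f i mod N) \<in> Z_eps \<epsilon>"
  using N_pos by (simp add: Z_eps_def)

lemma T_eps_in_X_eps: "T_eps \<epsilon> z x \<in> X_eps \<epsilon>"
  by (cases x) (simp add: T_eps_def X_eps_def mod_in_Z_eps)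

lemma E_eps_subset: "E_eps E \<epsilon> \<subseteq> X_eps \<epsilon> \<times> X_eps \<epsilon>"
  using T_eps_in_X_eps by (auto simp: E_eps_def)

lemma finite_E_eps: "finite (E_eps E \<epsilon>)"
  by (rule finite_subset[OF E_eps_subset]) simp

lemma sym_E_eps: "(x, y) \<in> E_eps E \<epsilon> \<Longrightarrow> (y, x) \<in> E_eps E \<epsilon>"
  using graph by (auto simp: E_eps_def periodic_graph_def sym_def) blast

text \<open>A rescaled edge is the translate of an edge of \<open>EQ E\<close> by the residue of its
  first endpoint. Several pairs may yield the same edge, which is harmless for bounding the total
  flow from above.\<close>

lemma E_eps_subset_image:
  "E_eps E \<epsilon> \<subseteq> (\<lambda>(z, x, y). (T_eps \<epsilon> z x, T_eps \<epsilon> z y)) ` (Z_eps \<epsilon> \<times> EQ E)"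
proof
  fix p assume "p \<in> E_eps E \<epsilon>"
  then obtain x y where xy: "(x, y) \<in> E" "p = (T_eps \<epsilon> 0 x, T_eps \<epsilon> 0 y)" by (auto simp: E_eps_def)
  define z where "z = (\<chi> i. fst x $ i mod N)"
  have "T_eps \<epsilon> z (0, snd x) = T_eps \<epsilon> 0 x" "T_eps \<epsilon> z (fst y - fst x, snd y) = T_eps \<epsilon> 0 y"
    by (auto simp: T_eps_def z_def vec_eq_iff mod_add_left_eq split_beta)
  then have "p = (\<lambda>(z, x, y). (T_eps \<epsilon> z x, T_eps \<epsilon> z y)) (z, (0, snd x), (fst y - fst x, snd y))"
    using xy by simp
  moreover have "(z, (0, snd x), (fst y - fst x, snd y)) \<in> Z_eps \<epsilon> \<times> EQ E"
    using edge_from_EQ[OF graph xy(1)] mod_in_Z_eps by (simp add: z_def)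
  ultimately show "p \<in> (\<lambda>(z, x, y). (T_eps \<epsilon> z x, T_eps \<epsilon> z y)) ` (Z_eps \<epsilon> \<times> EQ E)" by (rule image_eqI)
qed

lemma card_Z_eps_le: "real (card (Z_eps \<epsilon> :: (int ^ 'd) set)) * \<epsilon> ^ CARD('d) \<le> 1"
proof -
  have "finite (PiE (UNIV :: 'd set) (\<lambda>_. {0..<N}))" by (intro finite_PiE) auto
  then have "card (Z_eps \<epsilon> :: (int ^ 'd) set) \<le> card (PiE (UNIV :: 'd set) (\<lambda>_. {0..<N}))"
    by (intro order_trans[OF card_mono[OF _ Z_eps_subset] card_image_le] finite_imageI)
  also have "\<dots> = nat N ^ CARD('d)" by (simp add: card_PiE)
  finally have "real (card (Z_eps \<epsilon> :: (int ^ 'd) set)) \<le> real (nat N ^ CARD('d))" by (simp only: of_nat_le_iff)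
  also have "\<dots> = real_of_int N ^ CARD('d)"
    by (simp only: of_nat_power of_nat_nat[OF less_imp_le[OF N_pos]])
  finally have "real (card (Z_eps \<epsilon> :: (int ^ 'd) set)) * \<epsilon> ^ CARD('d) \<le> real_of_int N ^ CARD('d) * \<epsilon> ^ CARD('d)"
    using eps_pos by (intro mult_right_mono) auto
  also have "\<dots> = (\<epsilon> * real_of_int N) ^ CARD('d)" by (simp add: power_mult_distrib mult.commute)
  finally show ?thesis by (simp add: eps_N)
qed

text \<open>For fixed x distinct residues z translate x to distinct vertices, so no mass is counted
  twice.\<close>

lemma sum_tau_mass_le:
  assumes "\<And>x. x \<in> X_eps \<epsilon> \<Longrightarrow> 0 \<le> m x"
  shows "(\<Sum>z\<in>Z_eps \<epsilon>. tau_mass \<epsilon> z m (x :: ('d, 'v) vertex)) \<le> (\<Sum>x\<in>X_eps \<epsilon>. m x)"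
proof -
  have inj: "inj_on (\<lambda>z. T_eps \<epsilon> z x) (Z_eps \<epsilon>)"
  proof (rule inj_onI)
    fix z z' assume z: "z \<in> Z_eps \<epsilon>" "z' \<in> Z_eps \<epsilon>" and eq: "T_eps \<epsilon> z x = T_eps \<epsilon> z' x"
    have "z $ i = z' $ i" for i
    proof -
      have "(z $ i + fst x $ i) mod N = (z' $ i + fst x $ i) mod N"
        using eq by (simp add: T_eps_def split_beta vec_eq_iff)
      then have "(z $ i + fst x $ i - fst x $ i) mod N = (z' $ i + fst x $ i - fst x $ i) mod N"
        by (rule mod_diff_cong) simp
      moreover have "z $ i \<in> {0..<N}" "z' $ i \<in> {0..<N}" using z by (simp_all add: Z_eps_def)
      ultimately show ?thesis by simp
    qed
    then show "z = z'" by (simp add: vec_eq_iff)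
  qed
  have "(\<Sum>z\<in>Z_eps \<epsilon>. tau_mass \<epsilon> z m x) = (\<Sum>y\<in>(\<lambda>z. T_eps \<epsilon> z x) ` Z_eps \<epsilon>. m y)"
    by (simp add: tau_mass_def sum.reindex[OF inj])
  also have "\<dots> \<le> (\<Sum>x\<in>X_eps \<epsilon>. m x)"
    by (intro sum_mono2 image_subsetI T_eps_in_X_eps) (simp_all add: assms)
  finally show ?thesis .
qed

text \<open>Makes the growth bounds, stated on \<open>states E\<close> only, applicable to each
  translate.\<close>

lemma tau_states:
  assumes m: "\<And>x. x \<in> X_eps \<epsilon> \<Longrightarrow> 0 \<le> m x" and J: "J \<in> flows (E_eps E \<epsilon>)"
  shows "(\<lambda>x. tau_mass \<epsilon> z m x / \<epsilon> ^ CARD('d), \<lambda>e. tau_flow E \<epsilon> z J e / \<epsilon> ^ (CARD('d) - 1)) \<in> states E"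
proof -
  have "sym E" using graph by (simp add: periodic_graph_def)
  then have symE: "(x, y) \<in> E \<longleftrightarrow> (y, x) \<in> E" for x y by (blast dest: symD)
  have anti: "J (y, x) = - J (x, y)" for x y using J unfolding flows_def by blast
  have tf: "tau_flow E \<epsilon> z J (y, x) = - tau_flow E \<epsilon> z J (x, y)" for x y
    using anti[of "T_eps \<epsilon> z y" "T_eps \<epsilon> z x"] symE[of x y] by (simp add: tau_flow_def)
  have "(\<lambda>e. tau_flow E \<epsilon> z J e / \<epsilon> ^ (CARD('d) - 1)) \<in> flows E"
    unfolding flows_def mem_Collect_eq
  proof (intro conjI allI impI)
    fix x y
    show "tau_flow E \<epsilon> z J (y, x) / \<epsilon> ^ (CARD('d) - 1) = - (tau_flow E \<epsilon> z J (x, y) / \<epsilon> ^ (CARD('d) - 1))"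
      unfolding tf[of y x] by simp
  next
    fix e assume "e \<notin> E"
    then show "tau_flow E \<epsilon> z J e / \<epsilon> ^ (CARD('d) - 1) = 0" by (simp add: tau_flow_def split_beta)
  qed
  moreover have "0 \<le> tau_mass \<epsilon> z m x / \<epsilon> ^ CARD('d)" for x
    using eps_pos m[OF T_eps_in_X_eps] by (simp add: tau_mass_def)
  ultimately show ?thesis by (simp add: states_def)
qed

text \<open>The powers of \<epsilon> cancel in the masses, where each vertex is counted at most once
  per vertex of the local window, and leave one factor \<epsilon> on the flow. The final 1 bounds
  the number of cells times their volume.\<close>

lemma F_eps_lower_bound:
  assumes m: "\<And>x. x \<in> X_eps \<epsilon> \<Longrightarrow> 0 \<le> m x" and J: "J \<in> flows (E_eps E \<epsilon>)"
    and K: "0 \<le> K" "0 \<le> C"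
    and growth: "\<And>m J. (m, J) \<in> states E \<Longrightarrow> ereal (K * local_flow E J - C * (local_mass R m + 1)) \<le> F (m, J)"
  shows "ereal (K * (\<epsilon> * (\<Sum>e\<in>E_eps E \<epsilon>. \<bar>J e\<bar>))
      - C * (real (card {x :: ('d, 'v) vertex. real_of_int (sup_norm (fst x)) \<le> R}) * (\<Sum>x\<in>X_eps \<epsilon>. m x) + 1)) \<le> F_eps E F \<epsilon> m J"
proof -
  let ?d = "CARD('d)" and ?S = "{x :: ('d, 'v) vertex. real_of_int (sup_norm (fst x)) \<le> R}"
  let ?m = "\<lambda>z x. tau_mass \<epsilon> z m x / \<epsilon> ^ ?d" and ?J = "\<lambda>z e. tau_flow E \<epsilon> z J e / \<epsilon> ^ (?d - 1)"
  let ?M = "\<Sum>x\<in>X_eps \<epsilon>. m x" and ?A = "\<Sum>e\<in>E_eps E \<epsilon>. \<bar>J e\<bar>"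
  have ed: "0 < \<epsilon> ^ ?d" using eps_pos by simp
  \<comment> \<open>The dimension is at least 1, so the truncated subtraction in the exponent is a
    true one.\<close>
  have esplit: "\<epsilon> ^ ?d = \<epsilon> * \<epsilon> ^ (?d - 1)" by (metis power_eq_if zero_less_card_finite less_numeral_extra(3))
  have mass: "(\<Sum>z\<in>Z_eps \<epsilon>. \<epsilon> ^ ?d * local_mass R (?m z)) \<le> real (card ?S) * ?M"
  proof -
    have "(\<Sum>z\<in>Z_eps \<epsilon>. \<epsilon> ^ ?d * local_mass R (?m z)) = (\<Sum>z\<in>Z_eps \<epsilon>. \<Sum>x\<in>?S. tau_mass \<epsilon> z m x)"
      using eps_pos by (simp add: local_mass_def sum_distrib_left)
    also have "\<dots> = (\<Sum>x\<in>?S. \<Sum>z\<in>Z_eps \<epsilon>. tau_mass \<epsilon> z m x)" by (rule sum.swap)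
    also have "\<dots> \<le> (\<Sum>x\<in>?S. ?M)" by (intro sum_mono sum_tau_mass_le m)
    finally show ?thesis by simp
  qed
  have flow: "\<epsilon> * ?A \<le> (\<Sum>z\<in>Z_eps \<epsilon>. \<epsilon> ^ ?d * local_flow E (?J z))"
  proof -
    let ?f = "\<lambda>(z, x, y). (T_eps \<epsilon> z x, T_eps \<epsilon> z y)"
    have fin: "finite (Z_eps \<epsilon> \<times> EQ E)" by (intro finite_cartesian_product finite_Z_eps finite_EQ graph)
    have "?A \<le> (\<Sum>e\<in>?f ` (Z_eps \<epsilon> \<times> EQ E). \<bar>J e\<bar>)"
      using fin E_eps_subset_image by (intro sum_mono2) auto
    also have "\<dots> \<le> (\<Sum>p\<in>Z_eps \<epsilon> \<times> EQ E. \<bar>J (?f p)\<bar>)"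
      using sum_image_le[OF fin, of "\<lambda>e. \<bar>J e\<bar>" ?f] by (simp add: comp_def)
    also have "\<dots> = (\<Sum>z\<in>Z_eps \<epsilon>. \<Sum>e\<in>EQ E. \<bar>J (?f (z, e))\<bar>)"
      unfolding sum.cartesian_product by (intro sum.cong refl) auto
    also have "\<dots> = (\<Sum>z\<in>Z_eps \<epsilon>. \<Sum>e\<in>EQ E. \<bar>tau_flow E \<epsilon> z J e\<bar>)"
      by (intro sum.cong refl) (auto simp: tau_flow_def EQ_def)
    finally have "\<epsilon> * ?A \<le> \<epsilon> * (\<Sum>z\<in>Z_eps \<epsilon>. \<Sum>e\<in>EQ E. \<bar>tau_flow E \<epsilon> z J e\<bar>)"
      using eps_pos by (intro mult_left_mono) auto
    also have "\<dots> = (\<Sum>z\<in>Z_eps \<epsilon>. \<epsilon> ^ ?d * local_flow E (?J z))"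
      unfolding local_flow_def esplit sum_distrib_left
      using eps_pos by (intro sum.cong refl) (simp add: abs_divide)
    finally show ?thesis .
  qed
  have "K * (\<epsilon> * ?A) - C * (real (card ?S) * ?M + 1)
    \<le> K * (\<Sum>z\<in>Z_eps \<epsilon>. \<epsilon> ^ ?d * local_flow E (?J z)) - C * ((\<Sum>z\<in>Z_eps \<epsilon>. \<epsilon> ^ ?d * local_mass R (?m z)) + real (card (Z_eps \<epsilon> :: (int ^ 'd) set)) * \<epsilon> ^ ?d)"
    using mass flow card_Z_eps_le K by (intro diff_mono mult_left_mono add_mono)
  also have "\<dots> = (\<Sum>z\<in>Z_eps \<epsilon>. \<epsilon> ^ ?d * (K * local_flow E (?J z) - C * (local_mass R (?m z) + 1)))"
    by (simp add: sum_distrib_left sum_subtractf sum.distrib algebra_simps)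
  finally have "ereal (K * (\<epsilon> * ?A) - C * (real (card ?S) * ?M + 1))
    \<le> ereal (\<Sum>z\<in>Z_eps \<epsilon>. \<epsilon> ^ ?d * (K * local_flow E (?J z) - C * (local_mass R (?m z) + 1)))" by simp
  also have "\<dots> = (\<Sum>z\<in>Z_eps \<epsilon>. ereal (\<epsilon> ^ ?d) * ereal (K * local_flow E (?J z) - C * (local_mass R (?m z) + 1)))"
    by (simp add: sum_ereal[symmetric] del: sum_ereal)
  also have "\<dots> \<le> F_eps E F \<epsilon> m J"
    unfolding F_eps_def using ed
    by (intro sum_mono ereal_mult_left_mono growth tau_states[OF m J]) auto
  finally show ?thesis .
qed

text \<open>Exchanging x and y and using antisymmetry turns twice the sum into a sum over
  differences of \<phi>. The factor 1/2 gained in this way is discarded.\<close>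

lemma summation_by_parts:
  assumes J: "J \<in> flows (E_eps E \<epsilon>)"
    and \<phi>: "\<And>x y. (x, y) \<in> E_eps E \<epsilon> \<Longrightarrow> \<bar>\<phi> x - \<phi> y\<bar> \<le> \<kappa>"
  shows "\<bar>\<Sum>x\<in>X_eps \<epsilon>. \<phi> x * divergence (E_eps E \<epsilon>) J x\<bar> \<le> \<kappa> * (\<Sum>e\<in>E_eps E \<epsilon>. \<bar>J e\<bar>)"
proof -
  let ?E = "E_eps E \<epsilon>"
  have fin: "finite {y. (x, y) \<in> ?E}" for x
    by (rule finite_subset[of _ "snd ` ?E"]) (force simp: finite_E_eps)+
  have "(\<Sum>x\<in>X_eps \<epsilon>. \<phi> x * divergence ?E J x) = (\<Sum>x\<in>X_eps \<epsilon>. \<Sum>y | (x, y) \<in> ?E. \<phi> x * J (x, y))"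
    by (simp add: divergence_def sum_distrib_left)
  also have "\<dots> = (\<Sum>(x, y)\<in>(SIGMA x:X_eps \<epsilon>. {y. (x, y) \<in> ?E}). \<phi> x * J (x, y))"
    using fin by (intro sum.Sigma) auto
  also have "(SIGMA x:X_eps \<epsilon>. {y. (x, y) \<in> ?E}) = ?E" using E_eps_subset by auto
  finally have 1: "(\<Sum>x\<in>X_eps \<epsilon>. \<phi> x * divergence ?E J x) = (\<Sum>(x, y)\<in>?E. \<phi> x * J (x, y))" .
  have "(\<Sum>(x, y)\<in>?E. \<phi> x * J (x, y)) = (\<Sum>(x, y)\<in>?E. \<phi> y * J (y, x))"
    by (rule sum.reindex_bij_witness[of _ prod.swap prod.swap]) (auto intro: sym_E_eps)
  also have "\<dots> = - (\<Sum>(x, y)\<in>?E. \<phi> y * J (x, y))"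
  proof -
    have "J (y, x) = - J (x, y)" for x y using J unfolding flows_def by blast
    then have "\<phi> (snd e) * J (snd e, fst e) = - (\<phi> (snd e) * J (fst e, snd e))" for e
      by (metis mult_minus_right)
    then show ?thesis unfolding split_beta sum_negf[symmetric] by (intro sum.cong refl)
  qed
  finally have "2 * (\<Sum>(x, y)\<in>?E. \<phi> x * J (x, y)) = (\<Sum>(x, y)\<in>?E. \<phi> x * J (x, y)) - (\<Sum>(x, y)\<in>?E. \<phi> y * J (x, y))" by simp
  also have "\<dots> = (\<Sum>(x, y)\<in>?E. (\<phi> x - \<phi> y) * J (x, y))"
    by (simp add: left_diff_distrib split_beta sum_subtractf)
  finally have "2 * \<bar>\<Sum>(x, y)\<in>?E. \<phi> x * J (x, y)\<bar> = \<bar>\<Sum>(x, y)\<in>?E. (\<phi> x - \<phi> y) * J (x, y)\<bar>" by linarith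
  also have "\<dots> \<le> (\<Sum>(x, y)\<in>?E. \<bar>(\<phi> x - \<phi> y) * J (x, y)\<bar>)"
    unfolding split_beta by (rule sum_abs)
  also have "\<dots> \<le> (\<Sum>(x, y)\<in>?E. \<kappa> * \<bar>J (x, y)\<bar>)"
    using \<phi> by (intro sum_mono) (auto simp: abs_mult intro!: mult_right_mono)
  also have "\<dots> = \<kappa> * (\<Sum>e\<in>?E. \<bar>J e\<bar>)" by (simp add: split_beta sum_distrib_left)
  finally have 2: "2 * \<bar>\<Sum>(x, y)\<in>?E. \<phi> x * J (x, y)\<bar> \<le> \<kappa> * (\<Sum>e\<in>?E. \<bar>J e\<bar>)" .
  have "\<bar>\<Sum>(x, y)\<in>?E. \<phi> x * J (x, y)\<bar> \<le> 2 * \<bar>\<Sum>(x, y)\<in>?E. \<phi> x * J (x, y)\<bar>" by simp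
  then show ?thesis using 1 2 by linarith
qed

text \<open>Reduction modulo N shifts the corner by \<epsilon> N = 1 times an integer
  vector.\<close>

lemma proj_corner_mod:
  "proj (corner \<epsilon> (\<chi> i. z $ i mod N) + w) = proj (corner \<epsilon> z + w)"
  unfolding proj_eq_iff torus_rel_def
proof
  fix i
  have "real_of_int (z $ i mod N) = real_of_int (z $ i) - real_of_int N * real_of_int (z $ i div N)"
    by (metis minus_mult_div_eq_mod of_int_diff of_int_mult)
  then have "\<epsilon> * real_of_int (z $ i mod N) = \<epsilon> * real_of_int (z $ i) - (\<epsilon> * real_of_int N) * real_of_int (z $ i div N)"
    by (simp only: right_diff_distrib mult.assoc)
  then show "(corner \<epsilon> (\<chi> i. z $ i mod N) + w) $ i - (corner \<epsilon> z + w) $ i \<in> \<int>"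
    by (simp add: corner_def eps_N)
qed

text \<open>The edge lifts to an edge of E, and reducing its endpoints does not change the projected
  points. The lifted corners differ by at most \<epsilon> R0 in each coordinate; the factor d comes
  from bounding the Euclidean norm by the sum of coordinates.\<close>

lemma cell_mean_edge:
  assumes \<psi>: "L-lipschitz_on UNIV \<psi>" and xy: "(x, y) \<in> E_eps E \<epsilon>"
  shows "\<bar>cell_mean \<epsilon> \<psi> (fst x) - cell_mean \<epsilon> \<psi> (fst y)\<bar> \<le> L * (\<epsilon> * (real CARD('d) * real_of_int (R0 E)))"
proof (rule cell_mean_diff[OF eps_pos \<psi>])
  fix w
  obtain x' y' where xy': "(x', y') \<in> E" "x = T_eps \<epsilon> 0 x'" "y = T_eps \<epsilon> 0 y'" using xy by (auto simp: E_eps_def)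
  have fst_T: "fst (T_eps \<epsilon> 0 u) = (\<chi> i. fst u $ i mod N)" for u :: "('d, 'v) vertex"
    by (simp add: T_eps_def split_beta)
  have "dist (proj (corner \<epsilon> (fst x) + w)) (proj (corner \<epsilon> (fst y) + w)) = dist (proj (corner \<epsilon> (fst x') + w)) (proj (corner \<epsilon> (fst y') + w))"
    by (simp add: xy' fst_T proj_corner_mod)
  also have "\<dots> \<le> dist (corner \<epsilon> (fst x') + w) (corner \<epsilon> (fst y') + w)" by (rule dist_torus_lower)
  also have "\<dots> = norm (corner \<epsilon> (fst x') - corner \<epsilon> (fst y'))" by (simp add: dist_norm)
  also have "\<dots> \<le> (\<Sum>i\<in>UNIV. \<bar>(corner \<epsilon> (fst x') - corner \<epsilon> (fst y')) $ i\<bar>)" by (rule norm_le_l1_cart)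
  also have "\<dots> \<le> (\<Sum>i\<in>(UNIV :: 'd set). \<epsilon> * real_of_int (R0 E))"
  proof (rule sum_mono)
    fix i
    have "\<bar>(fst x' - fst y') $ i\<bar> \<le> R0 E"
      using abs_component_le_sup_norm[of "fst x' - fst y'" i] sup_norm_edge_le_R0[OF graph xy'(1)] by linarith
    then have "real_of_int \<bar>(fst x' - fst y') $ i\<bar> \<le> real_of_int (R0 E)" by (simp only: of_int_le_iff)
    then have "\<epsilon> * \<bar>real_of_int (fst x' $ i) - real_of_int (fst y' $ i)\<bar> \<le> \<epsilon> * real_of_int (R0 E)"
      using eps_pos by (intro mult_left_mono) simp_all
    then show "\<bar>(corner \<epsilon> (fst x') - corner \<epsilon> (fst y')) $ i\<bar> \<le> \<epsilon> * real_of_int (R0 E)"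
      using eps_pos by (simp add: corner_def abs_mult flip: right_diff_distrib)
  qed
  finally show "dist (proj (corner \<epsilon> (fst x) + w)) (proj (corner \<epsilon> (fst y) + w)) \<le> \<epsilon> * (real CARD('d) * real_of_int (R0 E))"
    by (simp add: mult_ac)
qed

end

text \<open>\<theta> lies above the line K t - K T for some T, being at least K t beyond T and
  nonnegative before. In the perspective form of the growth condition this affine bound becomes one
  that is linear in flow and mass.\<close>

lemma superlinear_lower_bound:
  assumes F: "superlinear_growth E R1 F" and K: "0 \<le> K"
  obtains C where "0 \<le> C" "\<And>m J. (m, J) \<in> states E \<Longrightarrow>
    ereal (K * local_flow E J - C * (local_mass (max (real_of_int (R0 E)) R1) m + 1)) \<le> F (m, J)"
proof -
  let ?R = "max (real_of_int (R0 E)) R1"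
  obtain \<theta> C where *: "(\<forall>t\<ge>0. 0 \<le> \<theta> t) \<and> filterlim (\<lambda>t. \<theta> t / t) at_top at_top \<and>
      (\<forall>(m, J)\<in>states E. ereal ((local_mass ?R m + 1) * \<theta> (local_flow E J / (local_mass ?R m + 1)) - C * (local_mass ?R m + 1)) \<le> F (m, J))"
    using F unfolding superlinear_growth_def Let_def by (elim exE) (rule that)
  have \<theta>: "\<And>t. 0 \<le> t \<Longrightarrow> 0 \<le> \<theta> t" "filterlim (\<lambda>t. \<theta> t / t) at_top at_top"
    using * by auto
  have bound: "ereal ((local_mass ?R m + 1) * \<theta> (local_flow E J / (local_mass ?R m + 1)) - C * (local_mass ?R m + 1)) \<le> F (m, J)"
    if "(m, J) \<in> states E" for m J
    using *[THEN conjunct2, THEN conjunct2, THEN bspec, OF that] by simp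
  from \<theta>(2) have "\<forall>\<^sub>F t in at_top. K \<le> \<theta> t / t" by (simp add: filterlim_at_top)
  then obtain T0 where T0: "\<And>t. T0 \<le> t \<Longrightarrow> K \<le> \<theta> t / t" by (auto simp: eventually_at_top_linorder)
  \<comment> \<open>The lower bound 1 makes t positive for t >= T, and K T nonnegative.\<close>
  define T where "T = max 1 T0"
  have lin: "K * t - K * T \<le> \<theta> t" if "0 \<le> t" for t
  proof (cases "T \<le> t")
    case True
    then have "0 < t" "K \<le> \<theta> t / t" using T0[of t] by (auto simp: T_def)
    then have "K * t \<le> \<theta> t" by (simp add: pos_le_divide_eq)
    moreover have "0 \<le> K * T" using K by (simp add: T_def)
    ultimately show ?thesis by linarith
  next
    case False
    then have "K * t \<le> K * T" using K by (intro mult_left_mono) auto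
    then show ?thesis using \<theta>(1)[OF that] by linarith
  qed
  show thesis
  proof (rule that[of "K * T + \<bar>C\<bar>"])
    show "0 \<le> K * T + \<bar>C\<bar>" using K by (simp add: T_def)
    fix m J assume mJ: "(m, J) \<in> states E"
    define m0 where "m0 = local_mass ?R m + 1"
    have "0 \<le> m x" for x using mJ unfolding states_def by blast
    then have m0: "0 < m0" by (simp add: m0_def local_mass_def add_nonneg_pos sum_nonneg)
    have J0: "0 \<le> local_flow E J" by (simp add: local_flow_def sum_nonneg)
    have "K * local_flow E J - (K * T + \<bar>C\<bar>) * m0 = m0 * (K * (local_flow E J / m0) - K * T) - \<bar>C\<bar> * m0"
      using m0 by (simp add: field_simps)
    also have "\<dots> \<le> m0 * \<theta> (local_flow E J / m0) - C * m0"
      using m0 J0 by (intro diff_mono mult_left_mono lin mult_right_mono) auto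
    finally have "ereal (K * local_flow E J - (K * T + \<bar>C\<bar>) * m0) \<le> ereal (m0 * \<theta> (local_flow E J / m0) - C * m0)" by simp
    also have "\<dots> \<le> F (m, J)" using bound[OF mJ] by (simp only: m0_def)
    finally show "ereal (K * local_flow E J - (K * T + \<bar>C\<bar>) * (local_mass ?R m + 1)) \<le> F (m, J)"
      by (simp only: m0_def)
  qed
qed

section \<open>From energy bounds to equi-integrability\<close>

lemma borel_measurable_indicator_restrict:
  fixes f :: "real \<Rightarrow> real"
  assumes "f \<in> borel_measurable (restrict_space borel I)" "I \<in> sets borel"
  shows "(\<lambda>x. indicator I x * f x) \<in> borel_measurable borel"
  using assms borel_measurable_restrict_space_iff[of I borel f] by simp

text \<open>P is fixed before K, whereas D may depend on K. Dividing by a large K makes the first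
  term small, and the measure of S then controls the second; K = 1 gives the bound in L^1.\<close>

lemma equi_integrable_of_superlinear:
  fixes W :: "nat \<Rightarrow> real \<Rightarrow> real"
  assumes W: "\<And>n. W n \<in> borel_measurable borel" "\<And>n x. 0 \<le> W n x" and P: "0 \<le> P" and c: "0 \<le> c"
    and I: "emeasure lborel I = ennreal l" "0 \<le> l"
    and est: "\<And>K. 0 \<le> K \<Longrightarrow> \<exists>D\<ge>0. \<forall>n. \<forall>S\<in>sets borel.
      (\<integral>\<^sup>+x. ennreal (K * W n x) * indicator S x \<partial>lborel) \<le> ennreal P + ennreal D * emeasure lborel (S \<inter> I)"
  shows "\<exists>B. \<forall>n. integrable lborel (\<lambda>x. c * W n x) \<and> (\<integral>x. c * W n x \<partial>lborel) \<le> B"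
    and "0 < \<eta> \<Longrightarrow> \<exists>\<delta>>0. \<forall>n. \<forall>S\<in>sets borel. emeasure lborel S < ennreal \<delta> \<longrightarrow> (\<integral>x. indicator S x * (c * W n x) \<partial>lborel) \<le> \<eta>"
proof -
  obtain D1 where D1: "0 \<le> D1" "\<And>n S. S \<in> sets borel \<Longrightarrow>
    (\<integral>\<^sup>+x. ennreal (1 * W n x) * indicator S x \<partial>lborel) \<le> ennreal P + ennreal D1 * emeasure lborel (S \<inter> I)"
    using est[of 1] by (metis zero_le_one)
  have nn: "(\<integral>\<^sup>+x. ennreal (W n x) \<partial>lborel) \<le> ennreal (P + D1 * l)" for n
    using D1(2)[of UNIV n] I D1(1) P by (simp add: ennreal_mult ennreal_plus)
  have Wi: "integrable lborel (W n)" for n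
    using W nn[of n] by (intro integrableI_nonneg) (auto intro: le_less_trans)
  have Wb: "(\<integral>x. W n x \<partial>lborel) \<le> P + D1 * l" for n
  proof -
    have "ennreal (\<integral>x. W n x \<partial>lborel) \<le> ennreal (P + D1 * l)"
      using nn[of n] nn_integral_eq_integral[OF Wi[of n]] W(2) by simp
    then show ?thesis using P D1(1) I(2) by (subst (asm) ennreal_le_iff) auto
  qed
  show "\<exists>B. \<forall>n. integrable lborel (\<lambda>x. c * W n x) \<and> (\<integral>x. c * W n x \<partial>lborel) \<le> B"
    using Wi Wb c by (intro exI[of _ "c * (P + D1 * l)"]) (simp add: mult_left_mono)
  show "\<exists>\<delta>>0. \<forall>n. \<forall>S\<in>sets borel. emeasure lborel S < ennreal \<delta> \<longrightarrow> (\<integral>x. indicator S x * (c * W n x) \<partial>lborel) \<le> \<eta>"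
    if "0 < \<eta>"
  proof -
    \<comment> \<open>Makes c P/K at most \<eta>/2; the added 1 keeps K positive.\<close>
    define K where "K = 2 * c * P / \<eta> + 1"
    have "0 \<le> 2 * c * P / \<eta>" using c P that by simp
    then have K: "0 < K" "c * P \<le> K * (\<eta> / 2)" using that by (simp add: K_def, simp add: K_def field_simps)
    obtain D where D: "0 \<le> D" "\<And>n S. S \<in> sets borel \<Longrightarrow>
      (\<integral>\<^sup>+x. ennreal (K * W n x) * indicator S x \<partial>lborel) \<le> ennreal P + ennreal D * emeasure lborel (S \<inter> I)"
      using est[OF less_imp_le[OF K(1)]] by blast
    \<comment> \<open>Makes c D \<delta>/K at most \<eta>/2; the added 1 in the denominator admits c
      D = 0.\<close>
    define \<delta> where "\<delta> = K * (\<eta> / 2) / (c * D + 1)"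
    have cD: "0 < c * D + 1" using c D(1) by (simp add: add_nonneg_pos)
    have \<delta>: "0 < \<delta>" using K(1) cD that by (simp add: \<delta>_def)
    have "c * D * \<delta> \<le> (c * D + 1) * \<delta>" using \<delta> by (intro mult_right_mono) auto
    also have "\<dots> = K * (\<eta> / 2)"
      unfolding \<delta>_def times_divide_eq_right[of "c * D + 1"] using cD by (intro nonzero_mult_div_cancel_left) simp
    finally have \<delta>2: "c * D * \<delta> \<le> K * (\<eta> / 2)" .
    have "(\<integral>x. indicator S x * (c * W n x) \<partial>lborel) \<le> \<eta>" if S: "S \<in> sets borel" "emeasure lborel S < ennreal \<delta>" for n S
    proof -
      have iS: "integrable lborel (\<lambda>x. indicator S x * W n x)"
        using integrable_mult_indicator[OF _ Wi[of n], of S] S by simp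
      have "emeasure lborel (S \<inter> I) \<le> emeasure lborel S" using S by (intro emeasure_mono) auto
      then have le: "emeasure lborel (S \<inter> I) \<le> ennreal \<delta>" using S(2) by simp
      have "ennreal (K * (\<integral>x. indicator S x * W n x \<partial>lborel)) = ennreal (\<integral>x. K * (indicator S x * W n x) \<partial>lborel)" by simp
      also have "\<dots> = (\<integral>\<^sup>+x. ennreal (K * (indicator S x * W n x)) \<partial>lborel)"
        using iS W(2) K(1) by (intro nn_integral_eq_integral[symmetric]) auto
      also have "\<dots> = (\<integral>\<^sup>+x. ennreal (K * W n x) * indicator S x \<partial>lborel)"
        by (intro nn_integral_cong) (simp add: indicator_def)
      also have "\<dots> \<le> ennreal P + ennreal D * ennreal \<delta>"
        using D(2)[OF S(1), of n] le by (meson add_left_mono mult_left_mono order_trans zero_le)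
      also have "\<dots> = ennreal (P + D * \<delta>)" using P D(1) \<delta> by (simp add: ennreal_mult ennreal_plus)
      finally have "K * (\<integral>x. indicator S x * W n x \<partial>lborel) \<le> P + D * \<delta>"
        using P D(1) \<delta> by (subst (asm) ennreal_le_iff) auto
      then have "c * (K * (\<integral>x. indicator S x * W n x \<partial>lborel)) \<le> c * (P + D * \<delta>)" using c by (rule mult_left_mono)
      also have "\<dots> \<le> K * \<eta>" using K(2) \<delta>2 by (simp add: distrib_left mult.assoc)
      finally have "K * (c * (\<integral>x. indicator S x * W n x \<partial>lborel)) \<le> K * \<eta>" by (simp add: mult_ac)
      then have "c * (\<integral>x. indicator S x * W n x \<partial>lborel) \<le> \<eta>" using K(1) by simp
      then show ?thesis by (simp add: mult.left_commute)
    qed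
    then show ?thesis using \<delta> by blast
  qed
qed

text \<open>The lower bound limits the negative part to Q l, and the bound A on the difference then
  passes to the positive part.\<close>

lemma ereal_integral_positive_part_le:
  assumes I: "emeasure lborel I = ennreal l" "0 \<le> l" "I \<in> sets borel" and Q: "0 \<le> Q"
    and lower: "\<And>t. t \<in> I \<Longrightarrow> ereal (- Q) \<le> f t"
    and less: "ereal_integral (restrict_space lborel I) f < ereal A"
  shows "(\<integral>\<^sup>+t. e2ennreal (f t) \<partial>restrict_space lborel I) \<le> ennreal (\<bar>A\<bar> + Q * l)"
proof -
  let ?P = "\<integral>\<^sup>+t. e2ennreal (f t) \<partial>restrict_space lborel I" and ?N = "\<integral>\<^sup>+t. e2ennreal (- f t) \<partial>restrict_space lborel I"
  have "?N \<le> (\<integral>\<^sup>+t. ennreal Q \<partial>restrict_space lborel I)"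
  proof (intro nn_integral_mono)
    fix t assume "t \<in> space (restrict_space lborel I)"
    then have "ereal (- Q) \<le> f t" using lower by (simp add: space_restrict_space)
    then have "- f t \<le> ereal Q" by (simp add: ereal_uminus_le_reorder)
    then have "e2ennreal (- f t) \<le> e2ennreal (ereal Q)" by (rule e2ennreal_mono)
    then show "e2ennreal (- f t) \<le> ennreal Q" by simp
  qed
  also have "\<dots> = ennreal (Q * l)"
    using I Q by (simp add: space_restrict_space emeasure_restrict_space ennreal_mult)
  finally have N: "?N \<le> ennreal (Q * l)" .
  then have "enn2ereal ?N \<le> enn2ereal (ennreal (Q * l))" by (simp only: less_eq_ennreal.rep_eq)
  then have N': "enn2ereal ?N \<le> ereal (Q * l)" using Q I(2) by simp
  have "enn2ereal ?P - ereal (Q * l) \<le> enn2ereal ?P - enn2ereal ?N" using N' by (intro ereal_minus_mono) auto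
  also have "\<dots> < ereal A" using less by (simp add: ereal_integral_def)
  finally have "enn2ereal ?P < ereal A + ereal (Q * l)" by (simp add: ereal_minus_less_iff)
  then have "enn2ereal ?P \<le> ereal (\<bar>A\<bar> + Q * l)" by (auto intro: order_trans[OF less_imp_le])
  then have "e2ennreal (enn2ereal ?P) \<le> e2ennreal (ereal (\<bar>A\<bar> + Q * l))" by (rule e2ennreal_mono)
  then show ?thesis by simp
qed

section \<open>Flux and energy of curves on the rescaled graph\<close>

context rescaled_graph
begin

text \<open>The factor \<epsilon> is the order of the length of an edge, so this scales like a total
  momentum; both orientations of an edge are counted. Outside I the flow is not controlled and is
  replaced by zero.\<close>

definition flow_rate :: "real set \<Rightarrow> (real \<Rightarrow> ('d, 'v) vertex \<times> ('d, 'v) vertex \<Rightarrow> real) \<Rightarrow> real \<Rightarrow> real" where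
  "flow_rate I J t = indicator I t * (\<epsilon> * (\<Sum>e\<in>E_eps E \<epsilon>. \<bar>J t e\<bar>))"

lemma flow_rate_nonneg: "0 \<le> flow_rate I J t"
  using eps_pos by (simp add: flow_rate_def sum_nonneg)

lemma flow_rate_measurable:
  assumes "I \<in> sets borel" "\<And>e. (\<lambda>t. J t e) \<in> borel_measurable (restrict_space borel I)"
  shows "flow_rate I J \<in> borel_measurable borel"
proof -
  have "(\<lambda>t. \<epsilon> * (\<Sum>e\<in>E_eps E \<epsilon>. \<bar>J t e\<bar>)) \<in> borel_measurable (restrict_space borel I)"
    using assms(2) by (intro borel_measurable_times borel_measurable_const borel_measurable_sum borel_measurable_abs)
  from borel_measurable_indicator_restrict[OF this assms(1)] show ?thesis
    by (simp add: flow_rate_def[abs_def])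
qed

lemma discrete_flux:
  assumes I: "I = {a<..<b}" and CE: "continuity_equation E \<epsilon> I m J" and \<psi>: "L-lipschitz_on UNIV \<psi>"
  shows "\<exists>h\<in>borel_measurable borel. (\<forall>x. \<bar>h x\<bar> \<le> L * ((real CARD('d) * \<bar>real_of_int (R0 E)\<bar>) * flow_rate I J x)) \<and>
    (\<forall>s\<in>I. \<forall>t\<in>I. s \<le> t \<longrightarrow> (\<integral>p. \<psi> p \<partial>iota_eps \<epsilon> (m t)) - (\<integral>p. \<psi> p \<partial>iota_eps \<epsilon> (m s)) = (\<integral>x. indicator {s<..t} x * h x \<partial>lborel))"
proof -
  have Im: "I \<in> sets borel" using I by simp
  have mass: "mass_curve \<epsilon> I m" and flows: "\<And>t. t \<in> I \<Longrightarrow> J t \<in> flows (E_eps E \<epsilon>)"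
    and meas: "\<And>e. (\<lambda>t. J t e) \<in> borel_measurable (restrict_space borel I)"
    and wd: "\<And>x. x \<in> X_eps \<epsilon> \<Longrightarrow> weak_derivative I (\<lambda>t. m t x) (\<lambda>t. - divergence (E_eps E \<epsilon>) (J t) x)"
    using CE unfolding continuity_equation_def by blast+
  have m0: "0 \<le> m t x" if "t \<in> I" "x \<in> X_eps \<epsilon>" for t x using mass that unfolding mass_curve_def by blast
  have mc: "continuous_on I (\<lambda>t. m t x)" if "x \<in> X_eps \<epsilon>" for x using mass that unfolding mass_curve_def by blast
  have cont: "continuous_on UNIV \<psi>" by (rule lipschitz_on_continuous_on[OF \<psi>])
  have \<psi>m: "\<psi> \<in> borel_measurable borel" by (rule borel_measurable_continuous_onI[OF cont])
  obtain D where D: "\<And>p. \<bar>\<psi> p\<bar> \<le> D" using bounded_continuous_torus[OF cont] by (auto simp: bounded_iff)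
  have L: "0 \<le> L" by (rule lipschitz_on_nonneg[OF \<psi>])
  define w where "w x = cell_mean \<epsilon> \<psi> (fst x)" for x :: "('d, 'v) vertex"
  \<comment> \<open>The cut-off to I makes the flux bound hold at every real time.\<close>
  define h where "h t = indicator I t * (- (\<Sum>x\<in>X_eps \<epsilon>. w x * divergence (E_eps E \<epsilon>) (J t) x))" for t
  show ?thesis
  proof (intro bexI[of _ h] conjI allI ballI impI)
    have "(\<lambda>t. - (\<Sum>x\<in>X_eps \<epsilon>. w x * divergence (E_eps E \<epsilon>) (J t) x)) \<in> borel_measurable (restrict_space borel I)"
      unfolding divergence_def using meas
      by (intro borel_measurable_uminus borel_measurable_times borel_measurable_const borel_measurable_sum)
    from borel_measurable_indicator_restrict[OF this Im]
    show "h \<in> borel_measurable borel" by (simp add: h_def[abs_def])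
    fix t
    show "\<bar>h t\<bar> \<le> L * ((real CARD('d) * \<bar>real_of_int (R0 E)\<bar>) * flow_rate I J t)"
    proof (cases "t \<in> I")
      case True
      let ?A = "\<Sum>e\<in>E_eps E \<epsilon>. \<bar>J t e\<bar>"
      have "\<bar>\<Sum>x\<in>X_eps \<epsilon>. w x * divergence (E_eps E \<epsilon>) (J t) x\<bar> \<le> (L * (\<epsilon> * (real CARD('d) * real_of_int (R0 E)))) * ?A"
        unfolding w_def by (intro summation_by_parts flows True cell_mean_edge[OF \<psi>])
      \<comment> \<open>The absolute value makes the constant in front of the flow rate visibly
        nonnegative.\<close>
      also have "\<dots> \<le> (L * (\<epsilon> * (real CARD('d) * \<bar>real_of_int (R0 E)\<bar>))) * ?A"
        using L eps_pos by (intro mult_right_mono mult_left_mono sum_nonneg) auto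
      also have "\<dots> = L * ((real CARD('d) * \<bar>real_of_int (R0 E)\<bar>) * flow_rate I J t)"
        using True by (simp add: flow_rate_def mult_ac)
      finally show ?thesis using True by (simp add: h_def)
    qed (simp add: h_def flow_rate_def)
  next
    fix s t assume st: "s \<in> I" "t \<in> I" "s \<le> t"
    have sub: "{s..t} \<subseteq> I" using st I by auto
    \<comment> \<open>Integrability is given on compact subsets of I, so the half-open interval is
      reached through its closure.\<close>
    have int: "set_integrable lborel {s<..t} (\<lambda>r. - divergence (E_eps E \<epsilon>) (J r) x)" if "x \<in> X_eps \<epsilon>" for x
    proof (rule set_integrable_subset)
      show "set_integrable lborel {s..t} (\<lambda>r. - divergence (E_eps E \<epsilon>) (J r) x)"
        using wd[OF that] sub by (auto simp: weak_derivative_def locally_integrable_def)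
    qed auto
    have iota: "(\<integral>p. \<psi> p \<partial>iota_eps \<epsilon> (m r)) = (\<Sum>x\<in>X_eps \<epsilon>. m r x * w x)" if "r \<in> I" for r
      unfolding w_def by (rule integral_iota_eps[OF scale m0[OF that] \<psi>m D])
    have "(\<integral>p. \<psi> p \<partial>iota_eps \<epsilon> (m t)) - (\<integral>p. \<psi> p \<partial>iota_eps \<epsilon> (m s)) = (\<Sum>x\<in>X_eps \<epsilon>. w x * (m t x - m s x))"
      unfolding iota[OF st(1)] iota[OF st(2)] sum_subtractf[symmetric] by (intro sum.cong refl) (simp only: right_diff_distrib mult.commute)
    also have "\<dots> = (\<Sum>x\<in>X_eps \<epsilon>. w x * (LINT r:{s<..t}|lborel. - divergence (E_eps E \<epsilon>) (J r) x))"
      by (intro sum.cong refl arg_cong2[where f = "(*)"] weak_derivative_imp_integral[OF I mc wd st])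
    also have "\<dots> = (\<integral>r. (\<Sum>x\<in>X_eps \<epsilon>. w x * (indicator {s<..t} r * - divergence (E_eps E \<epsilon>) (J r) x)) \<partial>lborel)"
    proof -
      have "(\<integral>r. (\<Sum>x\<in>X_eps \<epsilon>. w x * (indicator {s<..t} r * - divergence (E_eps E \<epsilon>) (J r) x)) \<partial>lborel)
        = (\<Sum>x\<in>X_eps \<epsilon>. \<integral>r. w x * (indicator {s<..t} r * - divergence (E_eps E \<epsilon>) (J r) x) \<partial>lborel)"
        using int unfolding set_integrable_def real_scaleR_def
        by (intro Bochner_Integration.integral_sum integrable_mult_right) blast
      then show ?thesis
        unfolding set_lebesgue_integral_def real_scaleR_def Bochner_Integration.integral_mult_right_zero by (rule sym)
    qed
    also have "\<dots> = (\<integral>r. indicator {s<..t} r * h r \<partial>lborel)"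
    proof (rule Bochner_Integration.integral_cong[OF refl])
      fix r
      show "(\<Sum>x\<in>X_eps \<epsilon>. w x * (indicator {s<..t} r * - divergence (E_eps E \<epsilon>) (J r) x)) = indicator {s<..t} r * h r"
        using sub by (cases "r \<in> {s<..t}") (auto simp: h_def sum_negf subset_eq)
    qed
    finally show "(\<integral>p. \<psi> p \<partial>iota_eps \<epsilon> (m t)) - (\<integral>p. \<psi> p \<partial>iota_eps \<epsilon> (m s)) = (\<integral>x. indicator {s<..t} x * h x \<partial>lborel)" .
  qed
qed

lemma measure_iota_eps:
  fixes m :: "('d, 'v) vertex \<Rightarrow> real"
  assumes m: "\<And>x. x \<in> X_eps \<epsilon> \<Longrightarrow> 0 \<le> m x"
  shows "measure (iota_eps \<epsilon> m) UNIV = (\<Sum>x\<in>X_eps \<epsilon>. m x)"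
proof -
  have "(\<integral>p. 1 \<partial>iota_eps \<epsilon> m) = (\<Sum>x\<in>X_eps \<epsilon>. m x * cell_mean \<epsilon> (\<lambda>_. 1) (fst x))"
    by (rule integral_iota_eps[OF scale m, where D = 1]) auto
  moreover have "space (iota_eps \<epsilon> m) = UNIV" using sets_eq_imp_space_eq[OF sets_iota_eps[of \<epsilon> m]] by simp
  ultimately show ?thesis by (simp add: cell_mean_const[OF eps_pos])
qed

text \<open>For a constant test function L = 0, so the density of the increments vanishes
  identically.\<close>

lemma mass_conserved:
  assumes I: "I = {a<..<b}" and CE: "continuity_equation E \<epsilon> I m J" and st: "s \<in> I" "t \<in> I"
  shows "(\<Sum>x\<in>X_eps \<epsilon>. m t x) = (\<Sum>x\<in>X_eps \<epsilon>. m s x)"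
proof -
  have m0: "0 \<le> m t x" if "t \<in> I" "x \<in> X_eps \<epsilon>" for t x
    using CE that unfolding continuity_equation_def mass_curve_def by blast
  have sp: "space (iota_eps \<epsilon> (m t)) = UNIV" for t using sets_eq_imp_space_eq[OF sets_iota_eps[of \<epsilon> "m t"]] by simp
  have "0-lipschitz_on UNIV (\<lambda>_ :: 'd torus. 1 :: real)" by (intro lipschitz_onI) auto
  from discrete_flux[OF I CE this] obtain h :: "real \<Rightarrow> real" where h: "\<forall>x. \<bar>h x\<bar> \<le> 0 * ((real CARD('d) * \<bar>real_of_int (R0 E)\<bar>) * flow_rate I J x)"
    "\<forall>s\<in>I. \<forall>t\<in>I. s \<le> t \<longrightarrow> (\<integral>p. 1 \<partial>iota_eps \<epsilon> (m t)) - (\<integral>p. 1 \<partial>iota_eps \<epsilon> (m s)) = (\<integral>x. indicator {s<..t} x * h x \<partial>lborel)"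
    by blast
  have h0: "h = (\<lambda>x. 0)" using h(1) by (intro ext) simp
  have eq: "(\<Sum>x\<in>X_eps \<epsilon>. m t x) = (\<Sum>x\<in>X_eps \<epsilon>. m s x)" if st: "s \<in> I" "t \<in> I" "s \<le> t" for s t
  proof -
    have "(\<integral>p. 1 \<partial>iota_eps \<epsilon> (m t)) - (\<integral>p. 1 \<partial>iota_eps \<epsilon> (m s)) = (\<integral>x. indicator {s<..t} x * h x \<partial>lborel)"
      using h(2) st by blast
    then have "measure (iota_eps \<epsilon> (m t)) UNIV = measure (iota_eps \<epsilon> (m s)) UNIV"
      by (simp add: h0 sp)
    then show ?thesis using measure_iota_eps[OF m0[OF st(1)]] measure_iota_eps[OF m0[OF st(2)]] by simp
  qed
  show ?thesis using st by (cases "s \<le> t") (auto intro: eq eq[symmetric])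
qed

text \<open>The two lower bounds have different roles. The one of slope 0 limits the negative part
  of the energy, so that the action bound controls the positive part by a constant free of K; the
  one of slope K is then compared with that positive part.\<close>

lemma energy_estimate:
  assumes I: "I = {a<..<b}" "a < b" and CE: "continuity_equation E \<epsilon> I m J"
    and less: "ereal_integral (restrict_space lborel I) (\<lambda>t. F_eps E F \<epsilon> (m t) (J t)) < ereal A"
    and mass: "\<And>t. t \<in> I \<Longrightarrow> (\<Sum>x\<in>X_eps \<epsilon>. m t x) \<le> Mb"
    and C0: "0 \<le> C0" "\<And>m J. (m, J) \<in> states E \<Longrightarrow> ereal (0 * local_flow E J - C0 * (local_mass R m + 1)) \<le> F (m, J)"
    and C: "0 \<le> K" "0 \<le> C" "\<And>m J. (m, J) \<in> states E \<Longrightarrow> ereal (K * local_flow E J - C * (local_mass R m + 1)) \<le> F (m, J)"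
    and S: "S \<in> sets borel"
  defines "N0 \<equiv> real (card {x :: ('d, 'v) vertex. real_of_int (sup_norm (fst x)) \<le> R}) * Mb + 1"
  shows "(\<integral>\<^sup>+x. ennreal (K * flow_rate I J x) * indicator S x \<partial>lborel)
    \<le> ennreal (\<bar>A\<bar> + C0 * N0 * (b - a)) + ennreal (C * N0) * emeasure lborel (S \<inter> I)"
proof -
  have Im: "I \<in> sets borel" using I by simp
  have m0: "0 \<le> m t x" if "t \<in> I" "x \<in> X_eps \<epsilon>" for t x
    using CE that unfolding continuity_equation_def mass_curve_def by blast
  have flows: "J t \<in> flows (E_eps E \<epsilon>)" if "t \<in> I" for t using CE that by (simp add: continuity_equation_def)
  have meas: "flow_rate I J \<in> borel_measurable borel"
    using CE unfolding continuity_equation_def by (intro flow_rate_measurable Im) blast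
  have Mb0: "0 \<le> Mb"
  proof -
    have "(a + b) / 2 \<in> I" using I by auto
    then show ?thesis using mass[of "(a + b) / 2"] sum_nonneg[of "X_eps \<epsilon>" "m ((a + b) / 2)"] m0 by force
  qed
  then have N0: "0 \<le> N0" by (simp add: N0_def)
  have lower: "ereal (K' * flow_rate I J t - C' * N0) \<le> F_eps E F \<epsilon> (m t) (J t)"
    if t: "t \<in> I" and K': "0 \<le> K'" "0 \<le> C'" "\<And>m J. (m, J) \<in> states E \<Longrightarrow> ereal (K' * local_flow E J - C' * (local_mass R m + 1)) \<le> F (m, J)" for t K' C'
  proof -
    let ?n = "real (card {x :: ('d, 'v) vertex. real_of_int (sup_norm (fst x)) \<le> R})"
    have "C' * (?n * (\<Sum>x\<in>X_eps \<epsilon>. m t x) + 1) \<le> C' * N0"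
      unfolding N0_def using K'(2) mass[OF t] by (intro mult_left_mono add_right_mono) auto
    then have "K' * flow_rate I J t - C' * N0 \<le> K' * (\<epsilon> * (\<Sum>e\<in>E_eps E \<epsilon>. \<bar>J t e\<bar>)) - C' * (?n * (\<Sum>x\<in>X_eps \<epsilon>. m t x) + 1)"
      using t by (simp add: flow_rate_def)
    then show ?thesis
      using F_eps_lower_bound[OF m0[OF t] flows[OF t] K'] by (meson ereal_less_eq(3) order_trans)
  qed
  have pos: "(\<integral>\<^sup>+t. e2ennreal (F_eps E F \<epsilon> (m t) (J t)) \<partial>restrict_space lborel I) \<le> ennreal (\<bar>A\<bar> + C0 * N0 * (b - a))"
  proof (rule ereal_integral_positive_part_le[OF _ _ Im _ _ less])
    show "emeasure lborel I = ennreal (b - a)" using I by simp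
    show "ereal (- (C0 * N0)) \<le> F_eps E F \<epsilon> (m t) (J t)" if "t \<in> I" for t
      using lower[OF that _ C0] by simp
  qed (use I C0 N0 in auto)
  \<comment> \<open>On S the integrand is at most the positive part of K times the flow minus C N0,
    plus C N0. The former is bounded by the energy over all of I, so only the latter sees the
    measure of S.\<close>
  have "(\<integral>\<^sup>+x. ennreal (K * flow_rate I J x) * indicator S x \<partial>lborel)
    \<le> (\<integral>\<^sup>+x. ennreal (K * flow_rate I J x - C * N0) * indicator I x + ennreal (C * N0) * indicator (S \<inter> I) x \<partial>lborel)"
  proof (rule nn_integral_mono)
    fix x
    show "ennreal (K * flow_rate I J x) * indicator S x \<le> ennreal (K * flow_rate I J x - C * N0) * indicator I x + ennreal (C * N0) * indicator (S \<inter> I) x"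
    proof (cases "x \<in> S \<inter> I")
      case True
      have "ennreal (K * flow_rate I J x) = ennreal ((K * flow_rate I J x - C * N0) + C * N0)" by simp
      also have "\<dots> \<le> ennreal (K * flow_rate I J x - C * N0) + ennreal (C * N0)" 
        using C(2) N0 by (cases "0 \<le> K * flow_rate I J x - C * N0")
          (simp_all add: ennreal_plus[symmetric] ennreal_neg ennreal_leI del: ennreal_plus)
      finally show ?thesis using True by simp
    next
      case False
      then show ?thesis by (auto simp: flow_rate_def indicator_def)
    qed
  qed
  also have "\<dots> = (\<integral>\<^sup>+x. ennreal (K * flow_rate I J x - C * N0) * indicator I x \<partial>lborel) + ennreal (C * N0) * emeasure lborel (S \<inter> I)"
    using meas Im S by (subst nn_integral_add) (auto simp: nn_integral_cmult_indicator)
  also have "(\<integral>\<^sup>+x. ennreal (K * flow_rate I J x - C * N0) * indicator I x \<partial>lborel) = (\<integral>\<^sup>+x. ennreal (K * flow_rate I J x - C * N0) \<partial>restrict_space lborel I)"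
    using Im by (intro nn_integral_restrict_space[symmetric]) simp
  also have "\<dots> \<le> (\<integral>\<^sup>+t. e2ennreal (F_eps E F \<epsilon> (m t) (J t)) \<partial>restrict_space lborel I)"
  proof (rule nn_integral_mono)
    fix t assume "t \<in> space (restrict_space lborel I)"
    then have "e2ennreal (ereal (K * flow_rate I J t - C * N0)) \<le> e2ennreal (F_eps E F \<epsilon> (m t) (J t))"
      by (intro e2ennreal_mono lower C) (simp add: space_restrict_space)
    then show "ennreal (K * flow_rate I J t - C * N0) \<le> e2ennreal (F_eps E F \<epsilon> (m t) (J t))" by simp
  qed
  also note pos
  finally show ?thesis by simp
qed

end

section \<open>From the discrete curves to the limit\<close>

theorem theorem5p9:
  fixes E :: "(('d::finite, 'v::finite) vertex \<times> ('d, 'v) vertex) set"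
    and F :: "('d, 'v) cost"
    and R1 a b :: real
    and I :: "real set"
    and m :: "real \<Rightarrow> real \<Rightarrow> ('d, 'v) vertex \<Rightarrow> real"
    and e :: "nat \<Rightarrow> real"
  assumes graph: "periodic_graph E"
    and cost: "admissible_cost E R1 F" "superlinear_growth E R1 F"
    and interval: "a < b" "I = {a<..<b}"
    and curves: "\<And>\<epsilon>. \<epsilon> \<in> scales E \<Longrightarrow> mass_curve \<epsilon> I (m \<epsilon>)"
    and bounded_action: "(SUP \<epsilon>\<in>scales E. action E F \<epsilon> I (m \<epsilon>)) < \<infinity>"
    and bounded_mass: "(SUP \<epsilon>\<in>scales E. total_mass \<epsilon> I (m \<epsilon>)) < \<infinity>"
    and vanishing: "\<And>n. e n \<in> scales E" "e \<longlonglongrightarrow> 0"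
  shows "\<exists>\<mu> \<in> W11_KR I. \<exists>r :: nat \<Rightarrow> nat. strict_mono r \<and>
    weakly_converges_on (I \<times> UNIV)
      (\<lambda>n. spacetime_measure I (\<lambda>t. iota_eps (e (r n)) (m (e (r n)) t))) (spacetime_measure I \<mu>) \<and>
    uniform_limit I (\<lambda>n t. KR_dist (iota_eps (e (r n)) (m (e (r n)) t)) (\<mu> t)) (\<lambda>t. 0) sequentially \<and>
    (\<lambda>t. measure (\<mu> t) UNIV) constant_on I"
proof -
  have scale: "inverse_nat (e n)" for n using vanishing(1)[of n] by (simp add: scales_def inverse_nat_def)
  have rg: "rescaled_graph E (e n)" for n by (intro rescaled_graph.intro graph scale)
  note eps = scale[unfolded inverse_nat_def, THEN conjunct1]
  have Im: "I \<in> sets borel" using interval by simp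
  have mid: "(a + b) / 2 \<in> I" using interval by auto
  have m0: "0 \<le> m (e n) t x" if "t \<in> I" "x \<in> X_eps (e n)" for n t x
    using curves[OF vanishing(1)[of n]] that unfolding mass_curve_def by blast
  \<comment> \<open>A lies strictly above the supremum, so every infimum over flows is undercut by
    an actual flow, whether or not it is attained.\<close>
  obtain A where A: "(SUP \<epsilon>\<in>scales E. action E F \<epsilon> I (m \<epsilon>)) < ereal A"
    using ereal_dense2[OF bounded_action] by blast
  have "\<exists>J. continuity_equation E (e n) I (m (e n)) J \<and>
      ereal_integral (restrict_space lborel I) (\<lambda>t. F_eps E F (e n) (m (e n) t) (J t)) < ereal A" for n
  proof -
    have "action E F (e n) I (m (e n)) < ereal A"
      using le_less_trans[OF SUP_upper[OF vanishing(1)[of n]] A] .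
    then show ?thesis unfolding action_def INF_less_iff by blast
  qed
  then obtain J where CE: "\<And>n. continuity_equation E (e n) I (m (e n)) (J n)"
    and energy: "\<And>n. ereal_integral (restrict_space lborel I) (\<lambda>t. F_eps E F (e n) (m (e n) t) (J n t)) < ereal A"
    by metis
  define M1 where "M1 = enn2real (SUP \<epsilon>\<in>scales E. total_mass \<epsilon> I (m \<epsilon>))"
  have M1: "total_mass (e n) I (m (e n)) \<le> ennreal M1" for n
    using SUP_upper[OF vanishing(1)[of n], of "\<lambda>\<epsilon>. total_mass \<epsilon> I (m \<epsilon>)"] bounded_mass by (simp add: M1_def)
  \<comment> \<open>Mass is constant in time, so its time integral divided by the length of I is its
    value at each time.\<close>
  define M where "M = M1 / (b - a)"
  have massM: "(\<Sum>x\<in>X_eps (e n). m (e n) t x) \<le> M" if t: "t \<in> I" for n t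
  proof -
    let ?S = "\<Sum>x\<in>X_eps (e n). m (e n) t x"
    have S: "0 \<le> ?S" using m0[OF t] by (rule sum_nonneg)
    have "total_mass (e n) I (m (e n)) = (\<integral>\<^sup>+s. ennreal ?S \<partial>restrict_space lborel I)"
      unfolding total_mass_def
    proof (rule nn_integral_cong)
      fix s assume "s \<in> space (restrict_space lborel I)"
      then have "s \<in> I" by (simp add: space_restrict_space)
      from rescaled_graph.mass_conserved[OF rg interval(2) CE t this]
      show "ennreal (\<Sum>x\<in>X_eps (e n). m (e n) s x) = ennreal ?S" by (rule arg_cong)
    qed
    also have "\<dots> = ennreal (?S * (b - a))"
      using interval Im S by (simp add: space_restrict_space emeasure_restrict_space ennreal_mult)
    finally have "ennreal (?S * (b - a)) \<le> ennreal M1" using M1[of n] by simp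
    then have "?S * (b - a) \<le> M1" by (subst (asm) ennreal_le_iff) (simp_all add: M1_def)
    then show ?thesis using interval(1) by (simp add: M_def field_simps)
  qed
  define R where "R = max (real_of_int (R0 E)) R1"
  define N where "N = real (card {x :: ('d, 'v) vertex. real_of_int (sup_norm (fst x)) \<le> R}) * M + 1"
  define W where "W n = rescaled_graph.flow_rate E (e n) I (J n)" for n
  \<comment> \<open>The displacement constant of an edge, without its factor \<epsilon>, which the
    flow rate carries.\<close>
  define c where "c = real CARD('d) * \<bar>real_of_int (R0 E)\<bar>"
  have M0: "0 \<le> M" using massM[OF mid, of 0] sum_nonneg[of "X_eps (e 0)" "m (e 0) ((a + b) / 2)"] m0[OF mid] by force
  then have N0: "0 \<le> N" by (simp add: N_def)
  \<comment> \<open>Slope 0 is treated once, before any K, because this constant enters the part of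
    the estimate that must not depend on K.\<close>
  obtain C0 where C0: "0 \<le> C0" "\<And>m J. (m, J) \<in> states E \<Longrightarrow> ereal (0 * local_flow E J - C0 * (local_mass R m + 1)) \<le> F (m, J)"
    unfolding R_def using superlinear_lower_bound[OF cost(2), of 0] by blast
  have W_meas: "W n \<in> borel_measurable borel" for n
    unfolding W_def using CE[of n, unfolded continuity_equation_def] by (intro rescaled_graph.flow_rate_measurable[OF rg Im]) blast
  have W_nonneg: "0 \<le> W n x" for n x unfolding W_def by (rule rescaled_graph.flow_rate_nonneg[OF rg])
  have P0: "0 \<le> \<bar>A\<bar> + C0 * N * (b - a)" using C0(1) N0 interval(1) by simp
  have c0: "0 \<le> c" by (simp add: c_def)
  have l: "emeasure lborel I = ennreal (b - a)" "0 \<le> b - a" using interval by simp_all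
  have est: "\<exists>D\<ge>0. \<forall>n. \<forall>S\<in>sets borel.
      (\<integral>\<^sup>+x. ennreal (K * W n x) * indicator S x \<partial>lborel) \<le> ennreal (\<bar>A\<bar> + C0 * N * (b - a)) + ennreal D * emeasure lborel (S \<inter> I)"
    if K: "0 \<le> K" for K
  proof -
    obtain C where C: "0 \<le> C" "\<And>m J. (m, J) \<in> states E \<Longrightarrow> ereal (K * local_flow E J - C * (local_mass R m + 1)) \<le> F (m, J)"
      unfolding R_def using superlinear_lower_bound[OF cost(2) K] by blast
    have "0 \<le> C * N" using C(1) N0 by simp
    moreover have "(\<integral>\<^sup>+x. ennreal (K * W n x) * indicator S x \<partial>lborel)
        \<le> ennreal (\<bar>A\<bar> + C0 * N * (b - a)) + ennreal (C * N) * emeasure lborel (S \<inter> I)" if "S \<in> sets borel" for n S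
      unfolding W_def N_def
      by (rule rescaled_graph.energy_estimate[OF rg interval(2,1) CE energy massM C0 K C that])
    ultimately show ?thesis by blast
  qed
  obtain B where B: "\<And>n. integrable lborel (\<lambda>x. c * W n x)" "\<And>n. (\<integral>x. c * W n x \<partial>lborel) \<le> B"
    using equi_integrable_of_superlinear(1)[OF W_meas W_nonneg P0 c0 l est] by blast
  interpret flux_curves I a b M B "\<lambda>n t. iota_eps (e n) (m (e n) t)" "\<lambda>n x. c * W n x"
  proof (rule flux_curves.intro[OF interval(2,1)])
    show "measure (iota_eps (e n) (m (e n) t)) UNIV \<le> M" if "t \<in> I" for n t
      using massM[OF that, of n] rescaled_graph.measure_iota_eps[OF rg m0[OF that], of n] by simp
    show "\<exists>\<delta>>0. \<forall>n. \<forall>S\<in>sets borel. emeasure lborel S < ennreal \<delta> \<longrightarrow> (\<integral>x. indicator S x * (c * W n x) \<partial>lborel) \<le> \<eta>"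
      if "0 < \<eta>" for \<eta>
      by (rule equi_integrable_of_superlinear(2)[OF W_meas W_nonneg P0 c0 l est that])
    show "finite_measure (iota_eps (e n) (m (e n) t))" if "t \<in> I" for n t
      by (rule finite_iota_eps[OF eps m0[OF that]])
    show "\<exists>h\<in>borel_measurable borel. (\<forall>x. \<bar>h x\<bar> \<le> L * (c * W n x)) \<and> (\<forall>s\<in>I. \<forall>t\<in>I. s \<le> t \<longrightarrow>
        (\<integral>p. \<psi> p \<partial>iota_eps (e n) (m (e n) t)) - (\<integral>p. \<psi> p \<partial>iota_eps (e n) (m (e n) s)) = (\<integral>x. indicator {s<..t} x * h x \<partial>lborel))"
      if "L-lipschitz_on UNIV \<psi>" for n L and \<psi> :: "'d torus \<Rightarrow> real"
      unfolding c_def W_def by (rule rescaled_graph.discrete_flux[OF rg interval(2) CE that])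
    show "c * W n x = 0" if "x \<notin> I" for n x using that by (simp add: W_def rescaled_graph.flow_rate_def[OF rg])
    show "(\<lambda>x. c * W n x) \<in> borel_measurable borel" for n using W_meas by (intro borel_measurable_times borel_measurable_const)
    show "integrable lborel (\<lambda>x. c * W n x)" "(\<integral>x. c * W n x \<partial>lborel) \<le> B" for n by (fact B)+
  qed (simp_all add: c0 W_nonneg)
  obtain r :: "nat \<Rightarrow> nat" and v \<mu> where r: "strict_mono r"
    and lim: "flux_limit I a b M B (\<lambda>n t. iota_eps (e (r n)) (m (e (r n)) t)) (\<lambda>n x. c * W (r n) x) v \<mu>"
    by (rule exists_limit)
  show ?thesis
    using flux_limit.\<mu>_in_W11_KR[OF lim] r flux_limit.weak_convergence[OF lim] flux_limit.KR_uniform[OF lim]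
      flux_limit.mass_\<mu>_constant[OF lim] mid unfolding constant_on_def by blast
qed

end
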